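(* Let $G=(V,E)$ be an undirected graph with $m$ edges and maximum degree at most $16$, and let $0<\phi<1$. Given a set of source vertices $S\subseteq V$ and a set of sink vertices $T\subseteq V$ with $|S|\le|T|$, there is a parallel algorithm with work $\widetilde{O}(m/\phi^2)$ and span $\widetilde{O}(1/\phi^4)$ that finds a cut $C\subseteq V$ and a set $\mathcal{P}$ of $S$-$T$ paths embedding a (possibly non-perfect) matching $M$ between $S$ and $T$ such that: (1) every edge of $G$ appears on at most $\widetilde{O}(1/\phi)$ paths of $\mathcal{P}$; (2) $C$ contains all vertices of $S$ that are not the starting vertex of a path in $\mathcal{P}$; (3) $C$ does not contain any vertex of $T$ that is not the last vertex of a path in $\mathcal{P}$; (4) either $C=\emptyset$, or $|E_G(C,V\setminus C)|\le\phi\cdot\deg_G(C)+2\phi m$.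
   Context: For $X\subseteq V$, $\deg_G(X)=\sum_{v\in X}\deg_G(v)$, and $E_G(X,Y)$ is the set of edges with one endpoint in $X$ and the other in $Y$. An $S$-$T$ path starts at a vertex of $S$ and ends at a vertex of $T$; $\mathcal{P}$ embeds the matching $M$ consisting of the pairs (start, end) of its paths. $\widetilde{O}(\cdot)$ hides polylogarithmic factors in the graph size. Work is the total number of operations and span is the depth of the parallel computation.
   Formalization: The work bound is Õ(m/φ² + number of isolated vertices), and at least Õ(1), instead of Õ(m/φ²): with no edges, m = 0 but C and the paths may have to list every vertex of S; without isolated vertices and with m ≥ 1 the bound is Õ(m/φ²). *)

theory Defs
  imports Complex_Main
begin

section \<open>Graphs, cuts, paths and matchings\<close>

definition ugraph :: "'v set \<Rightarrow> 'v set set \<Rightarrow> bool" where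
  "ugraph V E \<longleftrightarrow> finite V \<and> (\<forall>e\<in>E. \<exists>u\<in>V. \<exists>v\<in>V. u \<noteq> v \<and> e = {u, v})"

definition deg :: "'v set set \<Rightarrow> 'v \<Rightarrow> nat" where
  "deg E v = card {e \<in> E. v \<in> e}"

definition deg_set :: "'v set set \<Rightarrow> 'v set \<Rightarrow> nat" where
  "deg_set E X = (\<Sum>v\<in>X. deg E v)"

definition edges_between :: "'v set set \<Rightarrow> 'v set \<Rightarrow> 'v set \<Rightarrow> 'v set set" where
  "edges_between E X Y = {e \<in> E. \<exists>x\<in>X. \<exists>y\<in>Y. e = {x, y}}"

definition isolated :: "'v set \<Rightarrow> 'v set set \<Rightarrow> 'v set" where
  "isolated V E = {v \<in> V. deg E v = 0}"

text \<open>Paths are simple and are given by their vertex sequences. A single vertex is a path;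
  it starts and ends at that vertex and has no edges.\<close>

definition is_path :: "'v set \<Rightarrow> 'v set set \<Rightarrow> 'v list \<Rightarrow> bool" where
  "is_path V E p \<longleftrightarrow>
     p \<noteq> [] \<and> distinct p \<and> set p \<subseteq> V \<and> successively (\<lambda>u v. {u, v} \<in> E) p"

definition path_between :: "'v set \<Rightarrow> 'v set set \<Rightarrow> 'v set \<Rightarrow> 'v set \<Rightarrow> 'v list \<Rightarrow> bool" where
  "path_between V E S T p \<longleftrightarrow> is_path V E p \<and> hd p \<in> S \<and> last p \<in> T"

definition path_edges :: "'v list \<Rightarrow> 'v set set" where
  "path_edges p = {{p ! i, p ! Suc i} | i. Suc i < length p}"

text \<open>The sets \<open>S\<close> and \<open>T\<close> may overlap. The pairs of a matching are vertex-disjoint; a pair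
  \<open>(v, v)\<close> with \<open>v\<close> in both sets is allowed.\<close>

definition matching_between :: "'v set \<Rightarrow> 'v set \<Rightarrow> ('v \<times> 'v) set \<Rightarrow> bool" where
  "matching_between S T M \<longleftrightarrow>
     M \<subseteq> S \<times> T \<and> pairwise (\<lambda>x y. disjnt {fst x, snd x} {fst y, snd y}) M"

definition embeds :: "'v list set \<Rightarrow> ('v \<times> 'v) set \<Rightarrow> bool" where
  "embeds P M \<longleftrightarrow> bij_betw (\<lambda>p. (hd p, last p)) P M"


section \<open>A work-span model of parallel computation\<close>

text \<open>Programs are written in a nested fork-join language over private variables and shared
  arrays of machine words. Word arithmetic is modulo \<open>B\<close>, apart from subtraction,
  which is truncated at 0. The real parameter \<open>\<phi>\<close> is not stored in a word: a program can only
  compare \<open>a\<close> with \<open>\<phi> * b\<close> for words \<open>a\<close> and \<open>b\<close>.\<close>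

datatype bop = Plus | Minus | Times | Div | Mod | Less | Equal

datatype exp =
    Num nat
  | Var string
  | Get string exp
  | Op bop exp exp
  | LePhi exp exp

datatype com =
    Skip
  | Assign string exp
  | Put string exp exp
  | Seq com com
  | Cond exp com com
  | While exp com
  | ParFor string exp com

type_synonym locals = "string \<Rightarrow> nat"
type_synonym loc = "string \<times> nat"
type_synonym heap = "loc \<Rightarrow> nat"

fun bop_val :: "bop \<Rightarrow> nat \<Rightarrow> nat \<Rightarrow> nat" where
  "bop_val Plus a b = a + b"
| "bop_val Minus a b = a - b"
| "bop_val Times a b = a * b"
| "bop_val Div a b = a div b"
| "bop_val Mod a b = a mod b"
| "bop_val Less a b = (if a < b then 1 else 0)"
| "bop_val Equal a b = (if a = b then 1 else 0)"

fun exp_val :: "real \<Rightarrow> nat \<Rightarrow> exp \<Rightarrow> locals \<Rightarrow> heap \<Rightarrow> nat" where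
  "exp_val \<phi> B (Num k) l h = k mod B"
| "exp_val \<phi> B (Var x) l h = l x"
| "exp_val \<phi> B (Get a e) l h = h (a, exp_val \<phi> B e l h)"
| "exp_val \<phi> B (Op f e1 e2) l h = bop_val f (exp_val \<phi> B e1 l h) (exp_val \<phi> B e2 l h) mod B"
| "exp_val \<phi> B (LePhi e1 e2) l h =
     (if real (exp_val \<phi> B e1 l h) \<le> \<phi> * real (exp_val \<phi> B e2 l h) then 1 else 0)"

fun exp_reads :: "real \<Rightarrow> nat \<Rightarrow> exp \<Rightarrow> locals \<Rightarrow> heap \<Rightarrow> loc set" where
  "exp_reads \<phi> B (Num k) l h = {}"
| "exp_reads \<phi> B (Var x) l h = {}"
| "exp_reads \<phi> B (Get a e) l h = insert (a, exp_val \<phi> B e l h) (exp_reads \<phi> B e l h)"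
| "exp_reads \<phi> B (Op f e1 e2) l h = exp_reads \<phi> B e1 l h \<union> exp_reads \<phi> B e2 l h"
| "exp_reads \<phi> B (LePhi e1 e2) l h = exp_reads \<phi> B e1 l h \<union> exp_reads \<phi> B e2 l h"

fun exp_cost :: "exp \<Rightarrow> nat" where
  "exp_cost (Num k) = 1"
| "exp_cost (Var x) = 1"
| "exp_cost (Get a e) = exp_cost e + 1"
| "exp_cost (Op f e1 e2) = exp_cost e1 + exp_cost e2 + 1"
| "exp_cost (LePhi e1 e2) = exp_cost e1 + exp_cost e2 + 1"

text \<open>\<open>exec \<phi> B c (l, h) (l', h') R W t d\<close>: started with variables \<open>l\<close> and arrays \<open>h\<close>,
  \<open>c\<close> terminates with \<open>l'\<close> and \<open>h'\<close>; it reads the array cells \<open>R\<close>, writes the cells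
  \<open>W\<close>, and has work \<open>t\<close> and span \<open>d\<close>.

  The branches of a parallel loop start with copies of the variables, which are dropped at the
  join. They must be free of data races: no branch writes a cell that another branch reads or
  writes. (Otherwise there is no derivation.) Hence running each branch on the arrays as they
  are at the fork agrees with every interleaving, and no concurrent-write convention is needed.\<close>

inductive exec ::
  "real \<Rightarrow> nat \<Rightarrow> com \<Rightarrow> locals \<times> heap \<Rightarrow> locals \<times> heap \<Rightarrow> loc set \<Rightarrow> loc set \<Rightarrow> nat \<Rightarrow> nat \<Rightarrow> bool"
  for \<phi> :: real and B :: nat where
  Skip: "exec \<phi> B Skip (l, h) (l, h) {} {} 1 1"
| Assign: "exec \<phi> B (Assign x e) (l, h) (l(x := exp_val \<phi> B e l h), h)
     (exp_reads \<phi> B e l h) {} (exp_cost e + 1) (exp_cost e + 1)"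
| Put: "exec \<phi> B (Put a e1 e2) (l, h)
     (l, h((a, exp_val \<phi> B e1 l h) := exp_val \<phi> B e2 l h))
     (exp_reads \<phi> B e1 l h \<union> exp_reads \<phi> B e2 l h) {(a, exp_val \<phi> B e1 l h)}
     (exp_cost e1 + exp_cost e2 + 1) (exp_cost e1 + exp_cost e2 + 1)"
| Seq: "exec \<phi> B c1 s1 s2 R1 W1 t1 d1 \<Longrightarrow> exec \<phi> B c2 s2 s3 R2 W2 t2 d2 \<Longrightarrow>
     exec \<phi> B (Seq c1 c2) s1 s3 (R1 \<union> R2) (W1 \<union> W2) (t1 + t2) (d1 + d2)"
| CondTrue: "exp_val \<phi> B e l h \<noteq> 0 \<Longrightarrow> exec \<phi> B c1 (l, h) s' R W t d \<Longrightarrow>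
     exec \<phi> B (Cond e c1 c2) (l, h) s' (exp_reads \<phi> B e l h \<union> R) W
       (exp_cost e + 1 + t) (exp_cost e + 1 + d)"
| CondFalse: "exp_val \<phi> B e l h = 0 \<Longrightarrow> exec \<phi> B c2 (l, h) s' R W t d \<Longrightarrow>
     exec \<phi> B (Cond e c1 c2) (l, h) s' (exp_reads \<phi> B e l h \<union> R) W
       (exp_cost e + 1 + t) (exp_cost e + 1 + d)"
| WhileFalse: "exp_val \<phi> B e l h = 0 \<Longrightarrow>
     exec \<phi> B (While e c) (l, h) (l, h) (exp_reads \<phi> B e l h) {}
       (exp_cost e + 1) (exp_cost e + 1)"
| WhileTrue: "exp_val \<phi> B e l h \<noteq> 0 \<Longrightarrow> exec \<phi> B c (l, h) s2 R1 W1 t1 d1 \<Longrightarrow>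
     exec \<phi> B (While e c) s2 s3 R2 W2 t2 d2 \<Longrightarrow>
     exec \<phi> B (While e c) (l, h) s3 (exp_reads \<phi> B e l h \<union> R1 \<union> R2) (W1 \<union> W2)
       (exp_cost e + 1 + t1 + t2) (exp_cost e + 1 + d1 + d2)"
| ParFor: "N = exp_val \<phi> B e l h \<Longrightarrow>
     (\<And>i. i < N \<Longrightarrow> exec \<phi> B c (l(x := i), h) (ls i, hs i) (R i) (W i) (t i) (d i)) \<Longrightarrow>
     (\<And>i j. i < N \<Longrightarrow> j < N \<Longrightarrow> i \<noteq> j \<Longrightarrow> disjnt (W i) (R j \<union> W j)) \<Longrightarrow>
     (\<And>i q. i < N \<Longrightarrow> q \<in> W i \<Longrightarrow> h' q = hs i q) \<Longrightarrow>
     (\<And>q. q \<notin> (\<Union>i<N. W i) \<Longrightarrow> h' q = h q) \<Longrightarrow>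
     exec \<phi> B (ParFor x e c) (l, h) (l, h')
       (exp_reads \<phi> B e l h \<union> (\<Union>i<N. R i)) (\<Union>i<N. W i)
       (exp_cost e + 1 + (\<Sum>i<N. t i + 1)) (exp_cost e + 1 + Max (insert 0 (d ` {..<N})))"

inductive_cases SkipE: "exec \<phi> B Skip s s' R W t d"
inductive_cases AssignE: "exec \<phi> B (Assign x e) s s' R W t d"
inductive_cases PutE: "exec \<phi> B (Put a e1 e2) s s' R W t d"
inductive_cases SeqE: "exec \<phi> B (Seq c1 c2) s s' R W t d"
inductive_cases CondE: "exec \<phi> B (Cond e c1 c2) s s' R W t d"
inductive_cases WhileE: "exec \<phi> B (While e c) s s' R W t d"
inductive_cases ParForE: "exec \<phi> B (ParFor x e c) s s' R W t d"

lemma exec_deterministic: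
  assumes "exec \<phi> B c s s1 R1 W1 t1 d1" and "exec \<phi> B c s sx Rx Wx tx dx"
  shows "s1 = sx \<and> R1 = Rx \<and> W1 = Wx \<and> t1 = tx \<and> d1 = dx"
  using assms
proof (induction arbitrary: sx Rx Wx tx dx rule: exec.induct)
  case (Skip l h)
  then show ?case by (auto elim: SkipE)
next
  case (Assign x e l h)
  then show ?case by (auto elim: AssignE)
next
  case (Put a e1 e2 l h)
  then show ?case by (auto elim: PutE)
next
  case (Seq c1 s1 s2 R1 W1 t1 d1 c2 s3 R2 W2 t2 d2)
  from Seq.prems show ?case
    by (elim SeqE) (use Seq.IH in blast)
next
  case (CondTrue e l h c1 s' R W t d c2)
  from CondTrue.prems CondTrue.hyps(1) show ?case by (elim CondE) (auto dest: CondTrue.IH)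
next
  case (CondFalse e l h c2 s' R W t d c1)
  from CondFalse.prems CondFalse.hyps(1) show ?case by (elim CondE) (auto dest: CondFalse.IH)
next
  case (WhileFalse e l h c)
  show ?case
    by (rule WhileE[OF WhileFalse.prems]) (use WhileFalse.hyps in auto)
next
  case (WhileTrue e l h c s2 R1 W1 t1 d1 s3 R2 W2 t2 d2)
  show ?case
  proof (rule WhileE[OF WhileTrue.prems], goal_cases)
    case (1 l' h')
    then have False using WhileTrue.hyps(1) by simp
    then show ?case ..
  next
    case (2 l' h' s2' R1' W1' t1' d1' R2' W2' t2' d2')
    then have lh: "l' = l" "h' = h" by simp_all
    have "s2 = s2' \<and> R1 = R1' \<and> W1 = W1' \<and> t1 = t1' \<and> d1 = d1'"
      using WhileTrue.IH(1) 2(7) unfolding lh by blast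
    moreover from this have "s3 = sx \<and> R2 = R2' \<and> W2 = W2' \<and> t2 = t2' \<and> d2 = d2'"
      using WhileTrue.IH(2) 2(8) by blast
    ultimately show ?case using 2(2-5) lh by simp
  qed
next
  case (ParFor N e l h c x ls hs R W t d h')
  show ?case
  proof (rule ParForE[OF ParFor.prems], goal_cases)
    case (1 l' h0 ls' hs' R' W' t' d' h'')
    then have lh: "l' = l" "h0 = h" by auto
    note 1 = 1[unfolded lh]
    have eq: "hs i = hs' i \<and> R i = R' i \<and> W i = W' i \<and> t i = t' i \<and> d i = d' i"
      if "i < N" for i
      using ParFor.IH[OF that 1(7)] ParFor.hyps(1) that by auto
    have U: "(\<Union>i<N. R' i) = (\<Union>i<N. R i)" "(\<Union>i<N. W' i) = (\<Union>i<N. W i)"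
      "(\<Sum>i<N. Suc (t' i)) = (\<Sum>i<N. Suc (t i))" "d' ` {..<N} = d ` {..<N}"
      using eq by (auto intro!: sum.cong image_cong)
    have "h' q = h'' q" for q
    proof (cases "q \<in> (\<Union>i<N. W i)")
      case True
      then obtain i where i: "i < N" "q \<in> W i" by auto
      then have "h'' q = hs' i q" using 1(9) ParFor.hyps(1) eq by simp
      then show ?thesis using ParFor.hyps(4)[OF i] eq[OF i(1)] by simp
    next
      case False
      then have "\<forall>i\<in>{..<exp_val \<phi> B e l h}. q \<notin> W' i"
        using eq ParFor.hyps(1) by auto
      then show ?thesis using 1(10) ParFor.hyps(5)[OF False] by simp
    qed
    then have "h' = h''" by auto
    then show ?thesis using 1(2-6) U ParFor.hyps(1) by simp
  qed
qed



section \<open>Input and output conventions\<close>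

text \<open>Words have \<open>O(log (n + m + 1/\<phi>))\<close> bits, with a factor \<open>b\<close> chosen with the algorithm.\<close>

definition word_bound :: "nat \<Rightarrow> nat \<Rightarrow> nat \<Rightarrow> real \<Rightarrow> nat" where
  "word_bound b n m \<phi> = 2 ^ (b * nat \<lceil>log 2 (real n + real m + 1 / \<phi>)\<rceil>)"

text \<open>The edges are given in an arbitrary order with arbitrary orientation.\<close>

definition edge_list :: "'v set set \<Rightarrow> ('v \<times> 'v) list \<Rightarrow> bool" where
  "edge_list E es \<longleftrightarrow> distinct (map (\<lambda>(u, v). {u, v}) es) \<and> (\<lambda>(u, v). {u, v}) ` set es = E"

definition input_locals :: "nat \<Rightarrow> (nat \<times> nat) list \<Rightarrow> locals" where
  "input_locals n es = (\<lambda>_. 0)(''n'' := n, ''m'' := length es)"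

definition input_heap :: "(nat \<times> nat) list \<Rightarrow> nat set \<Rightarrow> nat set \<Rightarrow> heap" where
  "input_heap es S T = (\<lambda>(a, i).
     if a = ''src'' \<and> i < length es then fst (es ! i)
     else if a = ''dst'' \<and> i < length es then snd (es ! i)
     else if a = ''S'' \<and> i \<in> S then 1
     else if a = ''T'' \<and> i \<in> T then 1
     else 0)"

definition output_cut :: "nat \<Rightarrow> heap \<Rightarrow> nat set" where
  "output_cut n h = {v. v < n \<and> h (''C'', v) \<noteq> 0}"

text \<open>The paths are stored consecutively in one array; the \<open>j\<close>th path occupies the cells from
  \<open>off j\<close> up to (excluding) \<open>off (j + 1)\<close>.\<close>

definition output_paths :: "locals \<Rightarrow> heap \<Rightarrow> nat list set" where
  "output_paths l h =
     (\<lambda>j. map (\<lambda>i. h (''path'', i)) [h (''off'', j)..<h (''off'', Suc j)]) ` {..<l ''num_paths''}"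

definition polylog :: "real \<Rightarrow> nat \<Rightarrow> nat \<Rightarrow> real" where
  "polylog K k N = K * log 2 (real N + 2) ^ k"

text \<open>The work bound \<open>m / \<phi>\<^sup>2\<close>. Even writing down the output can take work proportional to the
  number of isolated vertices (consider \<open>S = T = V\<close> and no edges), so these are
  counted too. For a nonempty graph without isolated vertices this is \<open>m / \<phi>\<^sup>2\<close> exactly; the
  maximum with 1 only matters for the empty graph.\<close>

definition work_bound :: "'v set \<Rightarrow> 'v set set \<Rightarrow> real \<Rightarrow> real" where
  "work_bound V E \<phi> = max 1 (real (card E) / \<phi>\<^sup>2 + real (card (isolated V E)))"

end

(* The paths come from I + 1 scales of unit-height push-relabel on vertex labels bounded by H = O(1/phi).
   Darts carry lengths, and a unit of flow pays a price that doubles with the congestion of its dart, so that after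
   a scale at most a 2^(-i) fraction of the edges is blocked by unmatched sources below the top label, while the
   total length grows by O(H M) / K per scale. Hence some level set of the final labels, together with the
   unmatched sources, is crossed by at most 2 phi m edges; unmatched sinks keep label 0 and stay outside.
   Vertices are processed through their at most 16 darts, which yields race-free parallel loops. *)
theory Submission
  imports Defs
begin

text \<open>The scales balance three costs. Scale \<open>i\<close> uses blocks of
  \<open>k = K / 2 ^ i\<close> units of equal price and has at most \<open>M / 2 ^ i\<close>
  sources. The growth of the total length, about \<open>H\<close> times the number of sources
  divided by \<open>k\<close>, is thus the same in every scale, whereas the congestion,
  \<open>k\<close> times a logarithm, forms a geometric series dominated by \<open>K\<close>.
  Smaller blocks also lower the initial potential, so one fixed number of rounds halves the
  surviving sources again. \<open>K\<close> is about \<open>(I + 1) / \<phi>\<close>, just large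
  enough for \<open>I + 1\<close> length increments to fit into the average over the levels. Units
  that reach no sink must not stay inside the network. Flow descends strictly in the labels, so they
  can be walked back in order of label within \<open>H + 1\<close> rounds; what remains is an
  acyclic flow, whose decomposition is local because numbering the units at each vertex determines
  the next dart of each unit. The machine shapes the rest: no two branches may write one cell, so
  units in transit are parked on darts until the head collects them, and words are bounded, so every
  stored value stays below a polynomial \<open>Z\<close>.\<close>

section \<open>Word arithmetic without overflow\<close>

text \<open>A growth bound: if all stored words are at most \<open>Z\<close>, then \<open>e\<close>
  evaluates below \<open>(Z + 2) ^ exp_deg e\<close>. A sum costs one degree because the base is at
  least 2. \<open>Get\<close> restarts at 1, since array contents are at most \<open>Z\<close>
  however large the index is.\<close>

fun exp_deg :: "exp \<Rightarrow> nat" where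
  "exp_deg (Num k) = 1"
| "exp_deg (Var x) = 1"
| "exp_deg (Get a e) = 1"
| "exp_deg (Op f e1 e2) = (case f of Plus \<Rightarrow> max (exp_deg e1) (exp_deg e2) + 1
     | Times \<Rightarrow> exp_deg e1 + exp_deg e2 | Less \<Rightarrow> 1 | Equal \<Rightarrow> 1 | _ \<Rightarrow> exp_deg e1)"
| "exp_deg (LePhi e1 e2) = 1"

text \<open>The limits 12 and 100 are matched to \<open>B_ge\<close> and \<open>Z_ge\<close> of the
  machine, under which reduction modulo \<open>B\<close> never acts on such an expression.\<close>

fun exp_ok :: "exp \<Rightarrow> bool" where
  "exp_ok (Num k) = (k \<le> 100)"
| "exp_ok (Var x) = True"
| "exp_ok (Get a e) = exp_ok e"
| "exp_ok (Op f e1 e2) = (exp_deg (Op f e1 e2) \<le> 12 \<and> exp_ok e1 \<and> exp_ok e2)"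
| "exp_ok (LePhi e1 e2) = (exp_ok e1 \<and> exp_ok e2)"

text \<open>Straight-line code, as used for the bodies of parallel loops: its work and its span
  coincide, and \<open>max_cost\<close> bounds both.\<close>

fun com_ok :: "com \<Rightarrow> bool" where
  "com_ok Skip = True"
| "com_ok (Assign x e) = exp_ok e"
| "com_ok (Put a e1 e2) = (exp_ok e1 \<and> exp_ok e2)"
| "com_ok (Seq c1 c2) = (com_ok c1 \<and> com_ok c2)"
| "com_ok (Cond e c1 c2) = (exp_ok e \<and> com_ok c1 \<and> com_ok c2)"
| "com_ok _ = False"

fun max_cost :: "com \<Rightarrow> nat" where
  "max_cost Skip = 1"
| "max_cost (Assign x e) = exp_cost e + 1"
| "max_cost (Put a e1 e2) = exp_cost e1 + exp_cost e2 + 1"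
| "max_cost (Seq c1 c2) = max_cost c1 + max_cost c2"
| "max_cost (Cond e c1 c2) = exp_cost e + 1 + max (max_cost c1) (max_cost c2)"
| "max_cost _ = 0"

text \<open>\<open>Z\<close> bounds what is stored in variables and cells, \<open>B\<close> is the
  modulus. Intermediate values, array indices in particular, may exceed \<open>Z\<close>; the
  twelfth power leaves room for them.\<close>

locale machine =
  fixes \<phi> :: real and B Z :: nat
  assumes Z_ge: "100 \<le> Z" and B_ge: "(Z + 2) ^ 12 \<le> B"
begin

fun val :: "exp \<Rightarrow> locals \<Rightarrow> heap \<Rightarrow> nat" where
  "val (Num k) l h = k"
| "val (Var x) l h = l x"
| "val (Get a e) l h = h (a, val e l h)"
| "val (Op f e1 e2) l h = bop_val f (val e1 l h) (val e2 l h)"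
| "val (LePhi e1 e2) l h = (if real (val e1 l h) \<le> \<phi> * real (val e2 l h) then 1 else 0)"

fun reads :: "exp \<Rightarrow> locals \<Rightarrow> heap \<Rightarrow> loc set" where
  "reads (Num k) l h = {}"
| "reads (Var x) l h = {}"
| "reads (Get a e) l h = insert (a, val e l h) (reads e l h)"
| "reads (Op f e1 e2) l h = reads e1 l h \<union> reads e2 l h"
| "reads (LePhi e1 e2) l h = reads e1 l h \<union> reads e2 l h"

definition small :: "locals \<Rightarrow> heap \<Rightarrow> bool" where
  "small l h \<longleftrightarrow> (\<forall>x. l x \<le> Z) \<and> (\<forall>q. h q \<le> Z)"

lemma smallD: "small l h \<Longrightarrow> l x \<le> Z" "small l h \<Longrightarrow> h q \<le> Z"
  by (simp_all only: small_def)

lemma pow_le_B: "i \<le> 12 \<Longrightarrow> (Z + 2) ^ i \<le> B"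
  using order_trans[OF power_increasing[of i 12 "Z + 2"] B_ge] by simp

text \<open>The degree bound belongs to the induction, because it is what turns every
  \<open>mod B\<close> into the identity; the cells read agree since the indices do.\<close>

lemma exp_val_eq:
  assumes "small l h" "exp_ok e"
  shows "exp_val \<phi> B e l h = val e l h \<and> exp_reads \<phi> B e l h = reads e l h
    \<and> val e l h < (Z + 2) ^ exp_deg e \<and> 1 \<le> exp_deg e"
  using assms(2)
proof (induction e)
  case (Num k)
  have "(Z + 2) ^ 1 \<le> B" by (rule pow_le_B) simp
  with Num show ?case using Z_ge by simp
next
  case (Var x)
  then show ?case using smallD(1)[OF assms(1), of x] by simp
next
  case (Get a e)
  then show ?case using smallD(2)[OF assms(1)] by (simp add: less_Suc_eq_le le_SucI)
next
  case (LePhi e1 e2)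
  then show ?case by simp
next
  case (Op f e1 e2)
  let ?Y = "Z + 2"
  let ?a = "val e1 l h" and ?b = "val e2 l h" and ?i = "exp_deg e1" and ?j = "exp_deg e2"
  have a: "?a < ?Y ^ ?i" "1 \<le> ?i" and b: "?b < ?Y ^ ?j" "1 \<le> ?j" and
    eq: "exp_val \<phi> B e1 l h = ?a" "exp_val \<phi> B e2 l h = ?b"
      "exp_reads \<phi> B e1 l h = reads e1 l h" "exp_reads \<phi> B e2 l h = reads e2 l h"
    using Op by auto
  have "bop_val f ?a ?b < ?Y ^ exp_deg (Op f e1 e2) \<and> 1 \<le> exp_deg (Op f e1 e2)"
  proof (cases f)
    case Plus
    have "?Y ^ ?i \<le> ?Y ^ max ?i ?j" "?Y ^ ?j \<le> ?Y ^ max ?i ?j"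
      by (auto intro!: power_increasing)
    then have "?a + ?b < 2 * ?Y ^ max ?i ?j" using a b by linarith
    also have "\<dots> \<le> ?Y ^ (max ?i ?j + 1)" by simp
    finally show ?thesis using Plus by simp
  next
    case Times
    have "?a * ?b < ?Y ^ ?i * ?Y ^ ?j" using a b by (intro mult_strict_mono) auto
    then show ?thesis using Times a b by (simp add: power_add)
  next
    case Div
    then show ?thesis using a by (simp add: le_less_trans[OF div_le_dividend])
  next
    case Mod
    then show ?thesis using a by (simp add: le_less_trans[OF mod_less_eq_dividend])
  qed (use a b in auto)
  moreover have "?Y ^ exp_deg (Op f e1 e2) \<le> B" using Op.prems by (intro pow_le_B) simp
  ultimately have "bop_val f ?a ?b < B" by linarith
  with \<open>bop_val f ?a ?b < _ \<and> _\<close> show ?case using eq by simp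
qed

section \<open>Weakest preconditions with footprints\<close>

text \<open>The postcondition also receives the cells read and written, so one symbolic execution
  yields both the result and the footprint required for race freedom. The conditions
  \<open>val e l h \<le> Z\<close> on stored values keep \<open>small\<close> invariant.\<close>

fun wp :: "com \<Rightarrow> locals \<Rightarrow> heap \<Rightarrow> (locals \<Rightarrow> heap \<Rightarrow> loc set \<Rightarrow> loc set \<Rightarrow> bool) \<Rightarrow> bool" where
  "wp Skip l h Q = Q l h {} {}"
| "wp (Assign x e) l h Q = (val e l h \<le> Z \<and> Q (l(x := val e l h)) h (reads e l h) {})"
| "wp (Put a e1 e2) l h Q = (val e2 l h \<le> Z \<and>
     Q l (h((a, val e1 l h) := val e2 l h)) (reads e1 l h \<union> reads e2 l h) {(a, val e1 l h)})"
| "wp (Seq c1 c2) l h Q =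
     wp c1 l h (\<lambda>l1 h1 R1 W1. wp c2 l1 h1 (\<lambda>l2 h2 R2 W2. Q l2 h2 (R1 \<union> R2) (W1 \<union> W2)))"
| "wp (Cond e c1 c2) l h Q =
     ((val e l h \<noteq> 0 \<longrightarrow> wp c1 l h (\<lambda>l1 h1 R W. Q l1 h1 (reads e l h \<union> R) W)) \<and>
      (val e l h = 0 \<longrightarrow> wp c2 l h (\<lambda>l1 h1 R W. Q l1 h1 (reads e l h \<union> R) W)))"
| "wp _ l h Q = False"

lemma wp_exec:
  assumes "wp c l h Q" "small l h" "com_ok c"
  shows "\<exists>l' h' R W t d. exec \<phi> B c (l, h) (l', h') R W t d \<and> small l' h' \<and>
    t \<le> max_cost c \<and> d \<le> max_cost c \<and> Q l' h' R W \<and> (\<forall>q. q \<notin> W \<longrightarrow> h' q = h q)"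
  using assms
proof (induction c arbitrary: l h Q)
  case Skip
  then show ?case using exec.Skip[of \<phi> B l h] by fastforce
next
  case (Assign x e)
  note v = exp_val_eq[OF Assign.prems(2), of e]
  have "small (l(x := val e l h)) h" using Assign.prems by (auto simp: small_def)
  then show ?case using Assign.prems v exec.Assign[of \<phi> B x e l h] by fastforce
next
  case (Put a e1 e2)
  note v = exp_val_eq[OF Put.prems(2), of e1] exp_val_eq[OF Put.prems(2), of e2]
  have s: "small l (h((a, val e1 l h) := val e2 l h))" using Put.prems by (auto simp: small_def)
  have ex: "exec \<phi> B (Put a e1 e2) (l, h) (l, h((a, val e1 l h) := val e2 l h))
    (reads e1 l h \<union> reads e2 l h) {(a, val e1 l h)} (exp_cost e1 + exp_cost e2 + 1) (exp_cost e1 + exp_cost e2 + 1)"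
    using Put.prems v exec.Put[of \<phi> B a e1 e2 l h] by simp
  have "\<forall>q. q \<notin> {(a, val e1 l h)} \<longrightarrow> (h((a, val e1 l h) := val e2 l h)) q = h q"
    by simp
  with ex show ?case
    by - (intro exI conjI, rule ex, use Put.prems s in \<open>simp_all del: fun_upd_apply\<close>)
next
  case (Seq c1 c2)
  from Seq.IH(1)[OF Seq.prems(1)[simplified] Seq.prems(2)] Seq.prems(3)
  obtain l1 h1 R1 W1 t1 d1 where 1: "exec \<phi> B c1 (l, h) (l1, h1) R1 W1 t1 d1" "small l1 h1"
    "t1 \<le> max_cost c1" "d1 \<le> max_cost c1" "\<forall>q. q \<notin> W1 \<longrightarrow> h1 q = h q"
    "wp c2 l1 h1 (\<lambda>l2 h2 R2 W2. Q l2 h2 (R1 \<union> R2) (W1 \<union> W2))" by auto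
  from Seq.IH(2)[OF 1(6) 1(2)] Seq.prems(3)
  obtain l2 h2 R2 W2 t2 d2 where 2: "exec \<phi> B c2 (l1, h1) (l2, h2) R2 W2 t2 d2" "small l2 h2"
    "t2 \<le> max_cost c2" "d2 \<le> max_cost c2" "\<forall>q. q \<notin> W2 \<longrightarrow> h2 q = h1 q"
    "Q l2 h2 (R1 \<union> R2) (W1 \<union> W2)" by auto
  show ?case
    by (intro exI conjI, rule exec.Seq[OF 1(1) 2(1)]) (use 1 2 in auto)
next
  case (Cond e c1 c2)
  note v = exp_val_eq[OF Cond.prems(2), of e]
  show ?case
  proof (cases "val e l h = 0")
    case True
    with Cond.IH(2)[of l h "\<lambda>l1 h1 R W. Q l1 h1 (reads e l h \<union> R) W"] Cond.prems
    obtain l2 h2 R2 W2 t2 d2 where 2: "exec \<phi> B c2 (l, h) (l2, h2) R2 W2 t2 d2" "small l2 h2"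
      "t2 \<le> max_cost c2" "d2 \<le> max_cost c2" "\<forall>q. q \<notin> W2 \<longrightarrow> h2 q = h q"
      "Q l2 h2 (reads e l h \<union> R2) W2" by auto
    show ?thesis
      by (intro exI conjI, rule exec.CondFalse[OF _ 2(1)]) (use 2 v True Cond.prems in auto)
  next
    case False
    with Cond.IH(1)[of l h "\<lambda>l1 h1 R W. Q l1 h1 (reads e l h \<union> R) W"] Cond.prems
    obtain l2 h2 R2 W2 t2 d2 where 2: "exec \<phi> B c1 (l, h) (l2, h2) R2 W2 t2 d2" "small l2 h2"
      "t2 \<le> max_cost c1" "d2 \<le> max_cost c1" "\<forall>q. q \<notin> W2 \<longrightarrow> h2 q = h q"
      "Q l2 h2 (reads e l h \<union> R2) W2" by auto
    show ?thesis
      by (intro exI conjI, rule exec.CondTrue[OF _ 2(1)]) (use 2 v False Cond.prems in auto)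
  qed
qed auto

section \<open>Triples with work and span bounds; rules for loops\<close>

text \<open>Smallness is a premise on the initial state and a conclusion on the final state of the
  triple itself, so triples compose without side conditions on word size.\<close>

definition run :: "com \<Rightarrow> locals \<Rightarrow> heap \<Rightarrow> nat \<Rightarrow> nat \<Rightarrow> (locals \<Rightarrow> heap \<Rightarrow> bool) \<Rightarrow> bool" where
  "run c l h T D Q \<longleftrightarrow> (small l h \<longrightarrow> (\<exists>l' h' R W t d. exec \<phi> B c (l, h) (l', h') R W t d \<and>
     small l' h' \<and> t \<le> T \<and> d \<le> D \<and> Q l' h'))"

lemma run_small: "(small l h \<Longrightarrow> run c l h T D Q) \<Longrightarrow> run c l h T D Q"
  by (auto simp: run_def)

lemma run_weaken:
  assumes "run c l h T D Q" "\<And>l' h'. Q l' h' \<Longrightarrow> small l' h' \<Longrightarrow> Q' l' h'" "T \<le> T'" "D \<le> D'"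
  shows "run c l h T' D' Q'"
  using assms unfolding run_def by (meson order_trans)

lemma run_wp:
  assumes "wp c l h (\<lambda>l' h' R W. Q l' h')" "com_ok c" "max_cost c \<le> T" "max_cost c \<le> D"
  shows "run c l h T D Q"
  unfolding run_def using wp_exec[OF assms(1)] assms(2-) by (meson order_trans)

lemma run_seq:
  assumes "run c1 l h T1 D1 Q1" "\<And>l1 h1. Q1 l1 h1 \<Longrightarrow> run c2 l1 h1 T2 D2 Q"
  shows "run (Seq c1 c2) l h (T1 + T2) (D1 + D2) Q"
  unfolding run_def
proof
  assume "small l h"
  with assms(1) obtain l1 h1 R1 W1 t1 d1 where 1: "exec \<phi> B c1 (l, h) (l1, h1) R1 W1 t1 d1"
    "small l1 h1" "t1 \<le> T1" "d1 \<le> D1" "Q1 l1 h1" unfolding run_def by blast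
  with assms(2) obtain l2 h2 R2 W2 t2 d2 where 2: "exec \<phi> B c2 (l1, h1) (l2, h2) R2 W2 t2 d2"
    "small l2 h2" "t2 \<le> T2" "d2 \<le> D2" "Q l2 h2" unfolding run_def by blast
  show "\<exists>l' h' R W t d. exec \<phi> B (Seq c1 c2) (l, h) (l', h') R W t d \<and>
     small l' h' \<and> t \<le> T1 + T2 \<and> d \<le> D1 + D2 \<and> Q l' h'"
    by (intro exI conjI, rule exec.Seq[OF 1(1) 2(1)]) (use 1 2 in auto)
qed

text \<open>The invariant carries the iteration number and the guard succeeds exactly
  \<open>J\<close> times, so termination and cost come from the same count. The last summand is the
  failing evaluation of the guard.\<close>

lemma run_while:
  assumes "Inv 0 l h" "exp_ok e"
    and step: "\<And>j l h. j < J \<Longrightarrow> Inv j l h \<Longrightarrow> val e l h \<noteq> 0 \<and> run c l h T D (Inv (Suc j))"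
    and fin: "\<And>l h. Inv J l h \<Longrightarrow> val e l h = 0"
  shows "run (While e c) l h (J * (T + exp_cost e + 1) + (exp_cost e + 1))
    (J * (D + exp_cost e + 1) + (exp_cost e + 1)) (Inv J)"
proof -
  have "run (While e c) l h ((J - j) * (T + exp_cost e + 1) + (exp_cost e + 1))
    ((J - j) * (D + exp_cost e + 1) + (exp_cost e + 1)) (Inv J)" if "Inv j l h" "j \<le> J" for j l h
    using that(2) that(1)
  proof (induction j arbitrary: l h rule: inc_induct)
    case base
    show ?case unfolding run_def
    proof
      assume "small l h"
      from exp_val_eq[OF this assms(2)] fin[OF base]
      have "exec \<phi> B (While e c) (l, h) (l, h) (reads e l h) {} (exp_cost e + 1) (exp_cost e + 1)"
        using exec.WhileFalse[of \<phi> B e l h c] by simp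
      then show "\<exists>l' h' R W t d. exec \<phi> B (While e c) (l, h) (l', h') R W t d \<and> small l' h' \<and>
        t \<le> (J - J) * (T + exp_cost e + 1) + (exp_cost e + 1) \<and>
        d \<le> (J - J) * (D + exp_cost e + 1) + (exp_cost e + 1) \<and> Inv J l' h'"
        using \<open>small l h\<close> base by (intro exI conjI) auto
    qed
  next
    case (step j)
    show ?case unfolding run_def
    proof
      assume s: "small l h"
      have e: "exp_val \<phi> B e l h \<noteq> 0"
        using exp_val_eq[OF s assms(2)] assms(3)[OF step.hyps(2) step.prems] by simp
      from assms(3)[OF step.hyps(2) step.prems] s obtain l1 h1 R1 W1 t1 d1 where
        1: "exec \<phi> B c (l, h) (l1, h1) R1 W1 t1 d1" "small l1 h1" "t1 \<le> T" "d1 \<le> D" "Inv (Suc j) l1 h1"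
        unfolding run_def by blast
      from step.IH[OF 1(5)] 1(2) obtain l2 h2 R2 W2 t2 d2 where
        2: "exec \<phi> B (While e c) (l1, h1) (l2, h2) R2 W2 t2 d2" "small l2 h2"
          "t2 \<le> (J - Suc j) * (T + exp_cost e + 1) + (exp_cost e + 1)"
          "d2 \<le> (J - Suc j) * (D + exp_cost e + 1) + (exp_cost e + 1)" "Inv J l2 h2"
        unfolding run_def by blast
      have J: "J - j = Suc (J - Suc j)" using step.hyps by simp
      show "\<exists>l' h' R W t d. exec \<phi> B (While e c) (l, h) (l', h') R W t d \<and> small l' h' \<and>
        t \<le> (J - j) * (T + exp_cost e + 1) + (exp_cost e + 1) \<and>
        d \<le> (J - j) * (D + exp_cost e + 1) + (exp_cost e + 1) \<and> Inv J l' h'"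
        by (intro exI conjI, rule exec.WhileTrue[OF e 1(1) 2(1)]) (use 1 2 J in auto)
    qed
  qed
  from this[of 0] assms(1) show ?thesis by simp
qed

end

definition For :: "string \<Rightarrow> exp \<Rightarrow> com \<Rightarrow> com" where
  "For x e c = Seq (Assign x (Num 0))
     (While (Op Less (Var x) e) (Seq c (Assign x (Op Plus (Var x) (Num 1)))))"

context machine
begin

lemma run_for:
  assumes "Inv 0 (l(x := 0)) h" "exp_ok e"
    and var: "\<And>j l h. j \<le> J \<Longrightarrow> Inv j l h \<Longrightarrow> l x = j \<and> val e l h = J"
    and step: "\<And>j l h. j < J \<Longrightarrow> Inv j l h \<Longrightarrow>
      run c l h T D (\<lambda>l' h'. l' x = j \<and> Inv (Suc j) (l'(x := Suc j)) h')"
    and J: "J \<le> Z"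
  shows "run (For x e c) l h (J * (T + exp_cost e + 7) + (exp_cost e + 5))
    (J * (D + exp_cost e + 7) + (exp_cost e + 5)) (Inv J)"
proof -
  have 1: "run (Assign x (Num 0)) l h 2 2 (\<lambda>l' h'. l' = l(x := 0) \<and> h' = h)"
    by (rule run_wp) auto
  have deg: "exp_deg (Op Less (Var x) e) = 1" by simp
  have 2: "run (While (Op Less (Var x) e) (Seq c (Assign x (Op Plus (Var x) (Num 1))))) l1 h1
     (J * ((T + 4) + exp_cost (Op Less (Var x) e) + 1) + (exp_cost (Op Less (Var x) e) + 1))
     (J * ((D + 4) + exp_cost (Op Less (Var x) e) + 1) + (exp_cost (Op Less (Var x) e) + 1)) (Inv J)"
    if "l1 = l(x := 0) \<and> h1 = h" for l1 h1
  proof (rule run_while)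
    show "Inv 0 l1 h1" using assms(1) that by simp
    show "exp_ok (Op Less (Var x) e)" using assms(2) by simp
    fix j l h assume j: "j < J" and I: "Inv j l h"
    show "val (Op Less (Var x) e) l h \<noteq> 0 \<and> run (Seq c (Assign x (Op Plus (Var x) (Num 1)))) l h (T + 4) (D + 4) (Inv (Suc j))"
    proof
      show "val (Op Less (Var x) e) l h \<noteq> 0" using var[of j l h] j I by simp
      show "run (Seq c (Assign x (Op Plus (Var x) (Num 1)))) l h (T + 4) (D + 4) (Inv (Suc j))"
        by (rule run_seq[OF step[OF j I]], rule run_wp) (use j J in auto)
    qed
  next
    fix l h assume "Inv J l h"
    then show "val (Op Less (Var x) e) l h = 0" using var[of J l h] by simp
  qed
  show ?thesis unfolding For_def
    by (rule run_weaken[OF run_seq[OF 1 2]]) (auto simp: algebra_simps)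
qed

text \<open>\<open>RS i\<close> and \<open>WS i\<close> over-approximate what branch
  \<open>i\<close> touches, whatever path its control flow takes. A branch has to establish the
  final value on all of \<open>WS i\<close>, also on cells that it leaves alone; this lets a single
  closed form \<open>h'\<close> describe the joined heap.\<close>

lemma run_par:
  assumes ok: "exp_ok e" "com_ok c" and N: "val e l h = N" "N \<le> Z"
    and body: "\<And>i. i < N \<Longrightarrow> small l h \<Longrightarrow> wp c (l(x := i)) h (\<lambda>l' h'' R W.
        R \<subseteq> RS i \<and> W \<subseteq> WS i \<and> (\<forall>q\<in>WS i. h'' q = h' q))"
    and disj: "\<And>i j q. i < N \<Longrightarrow> j < N \<Longrightarrow> i \<noteq> j \<Longrightarrow> q \<in> WS i \<Longrightarrow> q \<notin> RS j \<and> q \<notin> WS j"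
    and frame: "\<And>q. (\<And>i. i < N \<Longrightarrow> q \<notin> WS i) \<Longrightarrow> h' q = h q"
    and cost: "exp_cost e + max_cost c + 2 \<le> D"
  shows "run (ParFor x e c) l h (D * (N + 1)) D (\<lambda>l1 h1. l1 = l \<and> h1 = h')"
  unfolding run_def
proof
  assume s: "small l h"
  define P where "P = (\<lambda>i (l', h'', R, W, t, d). exec \<phi> B c (l(x := i), h) (l', h'') R W t d \<and> small l' h'' \<and>
      t \<le> max_cost c \<and> d \<le> max_cost c \<and> (R \<subseteq> RS i \<and> W \<subseteq> WS i \<and> (\<forall>q\<in>WS i. h'' q = h' q)) \<and>
      (\<forall>q. q \<notin> W \<longrightarrow> h'' q = h q))"
  have "\<exists>p. P i p" if "i < N" for i
  proof -
    have "small (l(x := i)) h" using s that N by (auto simp: small_def)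
    from wp_exec[OF body[OF that s] this ok(2)] show ?thesis unfolding P_def by auto
  qed
  then have "\<forall>i\<in>{..<N}. \<exists>p. P i p" by simp
  from bchoice[OF this] obtain f where f: "\<And>i. i < N \<Longrightarrow> P i (f i)" by auto
  define ls where "ls = (\<lambda>i. fst (f i))"
  define hs where "hs = (\<lambda>i. fst (snd (f i)))"
  define R where "R = (\<lambda>i. fst (snd (snd (f i))))"
  define W where "W = (\<lambda>i. fst (snd (snd (snd (f i)))))"
  define t where "t = (\<lambda>i. fst (snd (snd (snd (snd (f i))))))"
  define d where "d = (\<lambda>i. snd (snd (snd (snd (snd (f i))))))"
  note defs = P_def ls_def hs_def R_def W_def t_def d_def
  have b: "exec \<phi> B c (l(x := i), h) (ls i, hs i) (R i) (W i) (t i) (d i)"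
      "small (ls i) (hs i)" "t i \<le> max_cost c" "d i \<le> max_cost c"
      "R i \<subseteq> RS i" "W i \<subseteq> WS i" "\<And>q. q \<in> WS i \<Longrightarrow> hs i q = h' q"
      "\<And>q. q \<notin> W i \<Longrightarrow> hs i q = h q" if "i < N" for i
    using f[OF that] unfolding defs by (simp_all only: case_prod_beta prod.collapse) blast+
  have Ne: "N = exp_val \<phi> B e l h" using exp_val_eq[OF s ok(1)] N by simp
  have ex: "exec \<phi> B (ParFor x e c) (l, h) (l, h') (exp_reads \<phi> B e l h \<union> (\<Union>i<N. R i)) (\<Union>i<N. W i)
       (exp_cost e + 1 + (\<Sum>i<N. t i + 1)) (exp_cost e + 1 + Max (insert 0 (d ` {..<N})))"
  proof (rule exec.ParFor[OF Ne])
    fix i assume i: "i < N"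
    show "exec \<phi> B c (l(x := i), h) (ls i, hs i) (R i) (W i) (t i) (d i)" by (rule b(1)[OF i])
    fix q assume q: "q \<in> W i"
    have "q \<in> WS i" using b(6)[OF i] q by blast
    then show "h' q = hs i q" using b(7)[OF i] by metis
  next
    fix i j assume ij: "i < N" "j < N" "i \<noteq> j"
    show "disjnt (W i) (R j \<union> W j)"
      using disj[OF ij] b(5)[OF ij(2)] b(6)[OF ij(2)] b(6)[OF ij(1)] unfolding disjnt_def by blast
  next
    fix q assume q: "q \<notin> (\<Union>i<N. W i)"
    show "h' q = h q"
    proof (cases "\<exists>i<N. q \<in> WS i")
      case True
      then obtain i where "i < N" "q \<in> WS i" by blast
      then show ?thesis using b(7)[of i q] b(8)[of i q] q by auto
    next
      case False
      then show ?thesis using frame by blast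
    qed
  qed
  have "h' q \<le> Z" for q
  proof (cases "\<exists>i<N. q \<in> WS i")
    case True
    then obtain i where "i < N" "q \<in> WS i" by blast
    then show ?thesis using b(7)[of i q] smallD(2)[OF b(2)[of i]] by metis
  next
    case False
    then show ?thesis using frame[of q] smallD(2)[OF s] by metis
  qed
  then have s': "small l h'" using s by (auto simp: small_def)
  have "(\<Sum>i<N. t i + 1) \<le> (\<Sum>i<N. max_cost c + 1)"
    using b(3) by (intro sum_mono) auto
  also have "\<dots> = N * (max_cost c + 1)" by simp
  also have "\<dots> \<le> N * D" using cost by (intro mult_left_mono) auto
  finally have T: "exp_cost e + 1 + (\<Sum>i<N. t i + 1) \<le> D * (N + 1)"
    using cost by (simp add: algebra_simps)
  have "Max (insert 0 (d ` {..<N})) \<le> max_cost c" using b(4) by auto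
  then have D: "exp_cost e + 1 + Max (insert 0 (d ` {..<N})) \<le> D" using cost by linarith
  show "\<exists>l1 h1 R W t d. exec \<phi> B (ParFor x e c) (l, h) (l1, h1) R W t d \<and> small l1 h1 \<and>
    t \<le> D * (N + 1) \<and> d \<le> D \<and> l1 = l \<and> h1 = h'"
    using ex s' T D by blast
qed

text \<open>For loops whose write addresses are awkward to invert: only the values written by each
  branch are given, and the joined heap is recovered from them. Disjointness of the sets
  \<open>WS i\<close> makes the choice of the branch unambiguous.\<close>

lemma run_par_ex:
  assumes ok: "exp_ok e" "com_ok c" and N: "val e l h = N" "N \<le> Z"
    and body: "\<And>i. i < N \<Longrightarrow> small l h \<Longrightarrow> wp c (l(x := i)) h (\<lambda>l' h'' R W.
        R \<subseteq> RS i \<and> W \<subseteq> WS i \<and> (\<forall>q\<in>WS i. h'' q = v i q))"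
    and disj: "\<And>i j q. i < N \<Longrightarrow> j < N \<Longrightarrow> i \<noteq> j \<Longrightarrow> q \<in> WS i \<Longrightarrow> q \<notin> RS j \<and> q \<notin> WS j"
    and cost: "exp_cost e + max_cost c + 2 \<le> D"
  shows "run (ParFor x e c) l h (D * (N + 1)) D (\<lambda>l1 h1. l1 = l \<and>
    (\<forall>i<N. \<forall>q\<in>WS i. h1 q = v i q) \<and> (\<forall>q. (\<forall>i<N. q \<notin> WS i) \<longrightarrow> h1 q = h q))"
proof -
  define h' where "h' q = (if \<exists>i<N. q \<in> WS i then v (SOME i. i < N \<and> q \<in> WS i) q else h q)" for q
  have h': "h' q = v i q" if "i < N" "q \<in> WS i" for i q
  proof -
    have "(SOME i. i < N \<and> q \<in> WS i) = i"
      using that disj by (intro some_equality) blast+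
    then show ?thesis using that by (auto simp: h'_def)
  qed
  show ?thesis
  proof (rule run_weaken[OF run_par[OF ok N _ disj _ cost, where h' = h']])
    fix i assume i: "i < N" "small l h"
    have "(\<forall>q\<in>WS i. h'' q = v i q) = (\<forall>q\<in>WS i. h'' q = h' q)" for h'' :: heap
      using h'[OF i(1)] by (metis (no_types))
    then show "wp c (l(x := i)) h (\<lambda>l' h'' R W. R \<subseteq> RS i \<and> W \<subseteq> WS i \<and> (\<forall>q\<in>WS i. h'' q = h' q))"
      using body[OF i] by presburger
  next
    fix q assume "\<And>i. i < N \<Longrightarrow> q \<notin> WS i"
    then show "h' q = h q" by (auto simp: h'_def)
  next
    fix l' h1 assume "l' = l \<and> h1 = h'"
    then show "l' = l \<and> (\<forall>i<N. \<forall>q\<in>WS i. h1 q = v i q) \<and> (\<forall>q. (\<forall>i<N. q \<notin> WS i) \<longrightarrow> h1 q = h q)"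
      using h' h'_def by metis
  qed auto
qed

end

section \<open>Keyed prefix sums by doubling of blocks\<close>

definition upd :: "heap \<Rightarrow> string \<Rightarrow> (nat \<Rightarrow> nat) \<Rightarrow> heap" where
  "upd h a F = (\<lambda>(b, i). if b = a then F i else h (b, i))"

lemma upd_apply [simp]: "upd h a F (b, i) = (if b = a then F i else h (b, i))"
  by (simp add: upd_def)

abbreviation exp_add (infixl "\<oplus>" 65) where "a \<oplus> b \<equiv> Op Plus a b"
abbreviation exp_sub (infixl "\<ominus>" 65) where "a \<ominus> b \<equiv> Op Minus a b"
abbreviation exp_mult (infixl "\<otimes>" 70) where "a \<otimes> b \<equiv> Op Times a b"
abbreviation exp_div (infixl "\<oslash>" 70) where "a \<oslash> b \<equiv> Op Div a b"

text \<open>Address of the counter for the key of item \<open>i\<close> in block \<open>b\<close> at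
  block size \<open>s\<close>. Counters of different block sizes are disjoint, so a doubling step
  reads one level and writes the next without a race.\<close>

definition cell_exp :: "string \<Rightarrow> string \<Rightarrow> string \<Rightarrow> exp \<Rightarrow> exp \<Rightarrow> exp" where
  "cell_exp ky nv kv s b = (s \<otimes> (Var nv \<oplus> Num 1) \<oplus> b) \<otimes> Var kv \<oplus> Get ky (Var ''i'')"

definition prefix_init :: "string \<Rightarrow> string \<Rightarrow> string \<Rightarrow> string \<Rightarrow> string \<Rightarrow> string \<Rightarrow> com" where
  "prefix_init pre cnt wt ky nv kv = ParFor ''i'' (Var nv)
     (Seq (Put pre (Var ''i'') (Num 0))
       (Put cnt (cell_exp ky nv kv (Num 1) (Var ''i'')) (Get wt (Var ''i''))))"

definition prefix_add :: "string \<Rightarrow> string \<Rightarrow> string \<Rightarrow> string \<Rightarrow> string \<Rightarrow> com" where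
  "prefix_add pre cnt ky nv kv = ParFor ''i'' (Var nv)
     (Cond (Op Mod (Var ''i'' \<oslash> Var ''s'') (Num 2))
       (Put pre (Var ''i'') (Get pre (Var ''i'')
         \<oplus> Get cnt (cell_exp ky nv kv (Var ''s'') (Var ''i'' \<oslash> Var ''s'' \<ominus> Num 1)))) Skip)"

text \<open>In a merged block the counter of a key is written by the first item that has the key.
  Positive weights let this item recognise itself: its partial sum is 0, and no other item of that
  key in the block has partial sum 0.\<close>

definition prefix_merge :: "string \<Rightarrow> string \<Rightarrow> string \<Rightarrow> string \<Rightarrow> string \<Rightarrow> com" where
  "prefix_merge pre cnt ky nv kv = ParFor ''i'' (Var nv)
     (Cond (Op Equal (Get pre (Var ''i'')) (Num 0))
       (Put cnt (cell_exp ky nv kv (Var ''s'' \<oplus> Var ''s'') (Var ''i'' \<oslash> (Var ''s'' \<oplus> Var ''s'')))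
         (Get cnt (cell_exp ky nv kv (Var ''s'') (Num 2 \<otimes> (Var ''i'' \<oslash> (Var ''s'' \<oplus> Var ''s''))))
          \<oplus> Get cnt (cell_exp ky nv kv (Var ''s'')
              (Num 2 \<otimes> (Var ''i'' \<oslash> (Var ''s'' \<oplus> Var ''s'')) \<oplus> Num 1)))) Skip)"

text \<open>Item \<open>i\<close> receives the total weight of the earlier items with the same key.
  The counter addresses form a huge sparse table, so nothing is cleared beforehand; a counter is
  written only on behalf of an item that has its key.\<close>

definition prefix_sums :: "string \<Rightarrow> string \<Rightarrow> string \<Rightarrow> string \<Rightarrow> string \<Rightarrow> string \<Rightarrow> com" where
  "prefix_sums pre cnt wt ky nv kv =
     Seq (Assign ''s'' (Num 1))
    (Seq (prefix_init pre cnt wt ky nv kv)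
         (While (Op Less (Var ''s'') (Var nv))
            (Seq (prefix_add pre cnt ky nv kv)
            (Seq (prefix_merge pre cnt ky nv kv)
                 (Assign ''s'' (Var ''s'' \<oplus> Var ''s''))))))"

definition ceil_log2 :: "nat \<Rightarrow> nat" where
  "ceil_log2 N = (LEAST j. N \<le> 2 ^ j)"

lemma ceil_log2: "N \<le> 2 ^ ceil_log2 N" "j < ceil_log2 N \<Longrightarrow> 2 ^ j < N"
proof -
  have "N \<le> 2 ^ N" by (simp add: less_imp_le)
  then show "N \<le> 2 ^ ceil_log2 N" unfolding ceil_log2_def by (rule LeastI)
  show "2 ^ j < N" if "j < ceil_log2 N"
    using not_less_Least[of j "\<lambda>j. N \<le> 2 ^ j"] that unfolding ceil_log2_def by simp
qed

locale keyed_sums =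
  fixes N kap :: nat and w key :: "nat \<Rightarrow> nat"
  assumes key: "\<And>i. i < N \<Longrightarrow> key i < kap" and w: "\<And>i. i < N \<Longrightarrow> 0 < w i"
begin

definition psum :: "nat \<Rightarrow> nat \<Rightarrow> nat" where
  "psum s i = (\<Sum>i' | i' < i \<and> i' div s = i div s \<and> key i' = key i. w i')"

definition bsum :: "nat \<Rightarrow> nat \<Rightarrow> nat \<Rightarrow> nat" where
  "bsum s b k = (\<Sum>i' | i' < N \<and> i' div s = b \<and> key i' = k. w i')"

definition cell :: "nat \<Rightarrow> nat \<Rightarrow> nat \<Rightarrow> nat" where
  "cell s b k = (s * (N + 1) + b) * kap + k"

text \<open>Counters of absent keys are read but never written, so that they hold 0 has to be an
  invariant. It holds again afterwards, which allows the counter array to be used once more for the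
  same keys.\<close>

definition clean :: "(nat \<Rightarrow> nat) \<Rightarrow> bool" where
  "clean c \<longleftrightarrow> (\<forall>s b k. 0 < s \<longrightarrow> b \<le> N \<longrightarrow> k < kap \<longrightarrow> (\<forall>i<N. i div s = b \<longrightarrow> key i \<noteq> k) \<longrightarrow> c (cell s b k) = 0)"

lemma cell_inj:
  assumes "cell s b k = cell s' b' k'" "b \<le> N" "b' \<le> N" "k < kap" "k' < kap"
  shows "s = s' \<and> b = b' \<and> k = k'"
proof -
  have e: "(s * (N + 1) + b) * kap + k = (s' * (N + 1) + b') * kap + k'"
    using assms(1) unfolding cell_def .
  from arg_cong[OF e, of "\<lambda>x. x mod kap"] have k: "k = k'" using assms by simp
  with e have e2: "s * (N + 1) + b = s' * (N + 1) + b'" using assms by simp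
  from arg_cong[OF e2, of "\<lambda>x. x mod (N + 1)"] have b: "b = b'" using assms
    by (simp del: mult_Suc_right)
  with e2 have "s * (N + 1) = s' * (N + 1)" by linarith
  with k b show ?thesis by (metis mult_cancel2 add_is_0 one_neq_zero)
qed

text \<open>An item in an odd block gains the total of the left sibling block; for an item in an
  even block, merging adds only later items.\<close>

lemma psum_double:
  assumes i: "i < N" and s: "0 < s"
  shows "psum (2 * s) i = psum s i + (if odd (i div s) then bsum s (i div s - 1) (key i) else 0)"
proof -
  have d2: "x div (2 * s) = x div s div 2" for x
    by (metis div_mult2_eq mult.commute)
  have par: "odd b \<Longrightarrow> a div 2 = b div 2 \<longleftrightarrow> a = b \<or> a = b - 1"
    "even b \<Longrightarrow> a \<le> b \<Longrightarrow> a div 2 = b div 2 \<longleftrightarrow> a = b" for a b :: nat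
    by (erule oddE, simp, linarith) (erule evenE, simp, linarith)
  have mono: "x div s \<le> y div s" if "x < y" for x y
    using that by (simp add: div_le_mono)
  have lt: "x < y" if "x div s < y div s" for x y
    using that div_le_mono[of y x s] by (meson not_le)
  let ?A = "{i'. i' < i \<and> i' div s = i div s \<and> key i' = key i}"
  let ?B = "{i'. i' < N \<and> i' div s = i div s - 1 \<and> key i' = key i}"
  let ?C = "{i'. i' < i \<and> i' div (2 * s) = i div (2 * s) \<and> key i' = key i}"
  show ?thesis
  proof (cases "odd (i div s)")
    case True
    then have p: "0 < i div s" by (auto intro: Nat.gr0I)
    have "?C = ?A \<union> ?B"
    proof (intro equalityI subsetI)
      fix x assume "x \<in> ?C"
      then have x: "x < i" "x div s div 2 = i div s div 2" "key x = key i" by (auto simp: d2)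
      have "x div s = i div s \<or> x div s = i div s - 1" using x(2) par(1)[OF True, of "x div s"] by blast
      then show "x \<in> ?A \<union> ?B" using x i by auto
    next
      fix x assume "x \<in> ?A \<union> ?B"
      then consider "x \<in> ?A" | "x \<in> ?B" by blast
      then show "x \<in> ?C"
      proof cases
        case 2
        then have "x div s < i div s" using p by simp
        moreover have "x div s div 2 = i div s div 2" using 2 par(1)[OF True, of "x div s"] by blast
        ultimately show ?thesis using 2 lt[of x i] by (simp add: d2)
      qed (simp add: d2)
    qed
    moreover have "?A \<inter> ?B = {}" using p by auto
    ultimately show ?thesis using True unfolding psum_def bsum_def by (simp add: sum.union_disjoint)
  next
    case False
    have "?C = ?A"
    proof (intro equalityI subsetI)
      fix x assume "x \<in> ?C"
      then have x: "x < i" "x div s div 2 = i div s div 2" "key x = key i" by (auto simp: d2)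
      have "x div s = i div s" using x(2) par(2)[OF _ mono[OF x(1)]] False by blast
      then show "x \<in> ?A" using x by auto
    qed (simp add: d2)
    then show ?thesis using False unfolding psum_def by simp
  qed
qed

lemma bsum_double:
  assumes s: "0 < s"
  shows "bsum (2 * s) b k = bsum s (2 * b) k + bsum s (2 * b + 1) k"
proof -
  have d2: "x div (2 * s) = x div s div 2" for x
    by (metis div_mult2_eq mult.commute)
  have "{i'. i' < N \<and> i' div (2 * s) = b \<and> key i' = k} =
    {i'. i' < N \<and> i' div s = 2 * b \<and> key i' = k} \<union> {i'. i' < N \<and> i' div s = 2 * b + 1 \<and> key i' = k}"
    unfolding d2 by auto
  then show ?thesis unfolding bsum_def by (simp add: sum.union_disjoint disjoint_iff)
qed

lemma psum_eq_0: "i < N \<Longrightarrow> psum s i = 0 \<longleftrightarrow> (\<forall>i'<i. i' div s = i div s \<longrightarrow> key i' \<noteq> key i)"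
  unfolding psum_def using w by (auto simp: sum_nonneg_eq_0_iff) (metis less_trans not_gr0)

lemma psum_0_unique:
  assumes "i < N" "j < N" "psum s i = 0" "psum s j = 0" "i div s = j div s" "key i = key j"
  shows "i = j"
  using assms psum_eq_0[of i s] psum_eq_0[of j s] by (metis linorder_neqE_nat)

lemma psum_0_exists:
  assumes "i < N"
  shows "\<exists>j<N. psum s j = 0 \<and> j div s = i div s \<and> key j = key i"
proof -
  define j where "j = (LEAST j. j div s = i div s \<and> key j = key i)"
  have j: "j div s = i div s \<and> key j = key i" "j \<le> i"
    unfolding j_def by (rule LeastI[of _ i], simp) (rule Least_le, simp)
  have "\<forall>i'<j. i' div s = j div s \<longrightarrow> key i' \<noteq> key j"
    using j not_less_Least[of _ "\<lambda>j. j div s = i div s \<and> key j = key i"] unfolding j_def by metis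
  then have "psum s j = 0" using psum_eq_0[of j s] j assms by simp
  then show ?thesis using j assms by (metis le_less_trans)
qed

lemma psum_le: "i < N \<Longrightarrow> psum s i \<le> sum w {..<N}"
  unfolding psum_def by (rule sum_mono2) auto

lemma bsum_le: "bsum s b k \<le> sum w {..<N}"
  unfolding bsum_def by (rule sum_mono2) auto

lemma psum_total: "N \<le> s \<Longrightarrow> i < N \<Longrightarrow> psum s i = (\<Sum>i' | i' < i \<and> key i' = key i. w i')"
  unfolding psum_def by (rule sum.cong) auto

end

context machine
begin

text \<open>\<open>total\<close> bounds every partial sum and every block sum, and
  \<open>2 * N \<le> Z\<close> covers the last doubling of \<open>s\<close>, which starts from a
  value below \<open>N\<close>.\<close>

lemma run_prefix_sums:
  assumes names: "pre \<noteq> cnt" "pre \<noteq> wt" "pre \<noteq> ky" "cnt \<noteq> wt" "cnt \<noteq> ky"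
      "nv \<noteq> ''s''" "nv \<noteq> ''i''" "kv \<noteq> ''s''" "kv \<noteq> ''i''"
    and l: "l nv = N" "l kv = kap"
    and key: "\<And>i. i < N \<Longrightarrow> h (ky, i) < kap" and w: "\<And>i. i < N \<Longrightarrow> 0 < h (wt, i)"
    and total: "(\<Sum>i<N. h (wt, i)) \<le> Z" and N: "2 * N \<le> Z"
    and clean: "keyed_sums.clean N kap (\<lambda>i. h (ky, i)) (\<lambda>q. h (cnt, q))"
  shows "run (prefix_sums pre cnt wt ky nv kv) l h (300 * (N + 1) * (ceil_log2 N + 1)) (300 * (ceil_log2 N + 1))
    (\<lambda>l' h'. l' = l(''s'' := 2 ^ ceil_log2 N) \<and> (\<forall>a q. a \<noteq> pre \<longrightarrow> a \<noteq> cnt \<longrightarrow> h' (a, q) = h (a, q)) \<and>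
      (\<forall>q. N \<le> q \<longrightarrow> h' (pre, q) = h (pre, q)) \<and>
      keyed_sums.clean N kap (\<lambda>i. h (ky, i)) (\<lambda>q. h' (cnt, q)) \<and>
      (\<forall>i<N. h' (pre, i) = (\<Sum>i' | i' < i \<and> h (ky, i') = h (ky, i). h (wt, i'))))"
proof -
  define key where "key = (\<lambda>i. h (ky, i))"
  define w where "w = (\<lambda>i. h (wt, i))"
  interpret keyed_sums N kap w key
    using key w by unfold_locales (auto simp: key_def w_def)
  have cln: "clean (\<lambda>q. h (cnt, q))" using clean unfolding key_def .
  define Inv where "Inv = (\<lambda>j l' h'. l' = l(''s'' := 2 ^ j) \<and>
      (\<forall>a q. a \<noteq> pre \<longrightarrow> a \<noteq> cnt \<longrightarrow> h' (a, q) = h (a, q)) \<and>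
      (\<forall>q. N \<le> q \<longrightarrow> h' (pre, q) = h (pre, q)) \<and> clean (\<lambda>q. h' (cnt, q)) \<and>
      (\<forall>i<N. h' (pre, i) = psum (2 ^ j) i) \<and>
      (\<forall>b\<le>N. \<forall>k<kap. h' (cnt, cell (2 ^ j) b k) = bsum (2 ^ j) b k))"
  have tot: "psum s i \<le> Z" "bsum s b k \<le> Z" if "i < N" for s i b k
    using psum_le[OF that, of s] bsum_le[of s b k] total unfolding w_def by linarith+
  have ck: "cell_exp ky nv kv s b = (s \<otimes> (Var nv \<oplus> Num 1) \<oplus> b) \<otimes> Var kv \<oplus> Get ky (Var ''i'')" for s b
    by (rule cell_exp_def)
  have 1: "run (Assign ''s'' (Num 1)) l h 2 2 (\<lambda>l' h'. l' = l(''s'' := 1) \<and> h' = h)"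
    by (rule run_wp) (use Z_ge in auto)
  have 2: "run (prefix_init pre cnt wt ky nv kv) l1 h1 (30 * (N + 1)) 30 (Inv 0)"
    if "l1 = l(''s'' := 1) \<and> h1 = h" for l1 h1
  proof -
    define RS where "RS = (\<lambda>i::nat. {(a, q::nat). a \<noteq> pre \<and> a \<noteq> cnt})"
    define WS where "WS = (\<lambda>i. {(pre, i), (cnt, cell 1 i (key i))})"
    define v where "v = (\<lambda>i (a, q::nat). if a = pre then 0 else w i)"
    show ?thesis unfolding prefix_init_def
    proof (rule run_weaken[OF run_par_ex[where N = N and RS = RS and WS = WS and v = v]])
      show "val (Var nv) l1 h1 = N" using that l names by simp
      show "N \<le> Z" using N by simp
      fix i assume i: "i < N" and "small l1 h1"
      show "wp (Seq (Put pre (Var ''i'') (Num 0)) (Put cnt (cell_exp ky nv kv (Num 1) (Var ''i'')) (Get wt (Var ''i''))))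
            (l1(''i'' := i)) h1 (\<lambda>l' h'' R W. R \<subseteq> RS i \<and> W \<subseteq> WS i \<and> (\<forall>q\<in>WS i. h'' q = v i q))"
        using that names l smallD(2)[OF \<open>small l1 h1\<close>]
        by (auto simp: ck RS_def WS_def v_def cell_def key_def w_def)
    next
      fix i j q assume "i < N" "j < N" "i \<noteq> j" "q \<in> WS i"
      then show "q \<notin> RS j \<and> q \<notin> WS j"
        using cell_inj[of 1 i "key i" 1 j "key j"] keyed_sums_axioms names
        by (auto simp: RS_def WS_def keyed_sums_def)
    next
      fix l' h' assume A: "l' = l1 \<and> (\<forall>i<N. \<forall>q\<in>WS i. h' q = v i q) \<and> (\<forall>q. (\<forall>i<N. q \<notin> WS i) \<longrightarrow> h' q = h1 q)"
      have pre: "h' (pre, i) = 0" and c1: "h' (cnt, cell 1 i (key i)) = w i" if "i < N" for i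
        using A that names by (auto simp: WS_def v_def)
      have oth: "h' (a, q) = h (a, q)" if "\<And>i. i < N \<Longrightarrow> (a, q) \<notin> WS i" for a q
        using A \<open>l1 = _ \<and> h1 = h\<close> that by auto
      have z: "h' (cnt, cell s b k) = 0"
        if "0 < s" "b \<le> N" "k < kap" "\<forall>i<N. i div s = b \<longrightarrow> key i \<noteq> k" for s b k
      proof -
        have "(cnt, cell s b k) \<notin> WS i" if "i < N" for i
          using cell_inj[of s b k 1 i "key i"] keyed_sums.key[OF keyed_sums_axioms that] that
            \<open>\<forall>i<N. i div s = b \<longrightarrow> key i \<noteq> k\<close> \<open>b \<le> N\<close> \<open>k < kap\<close> names by (auto simp: WS_def)
        from oth[OF this] show ?thesis using cln that unfolding clean_def by metis
      qed
      have "h' (cnt, cell 1 b k) = bsum 1 b k" if "b \<le> N" "k < kap" for b k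
      proof (cases "b < N \<and> key b = k")
        case True
        then have "{i'. i' < N \<and> i' div 1 = b \<and> key i' = k} = {b}" by auto
        then show ?thesis using c1[of b] True unfolding bsum_def by (simp del: div_by_1)
      next
        case False
        then have e: "{i'. i' < N \<and> i' div 1 = b \<and> key i' = k} = {}" by auto
        have "h' (cnt, cell 1 b k) = 0" using False that by (intro z) auto
        then show ?thesis unfolding bsum_def e by simp
      qed
      moreover have "psum 1 i = 0" for i unfolding psum_def by simp
      moreover have "h' (a, q) = h (a, q)" if "a \<noteq> pre" "a \<noteq> cnt" for a q
        by (rule oth) (use that in \<open>simp add: WS_def\<close>)
      moreover have "h' (pre, q) = h (pre, q)" if "N \<le> q" for q
        by (rule oth) (use that names in \<open>auto simp: WS_def\<close>)
      ultimately show "Inv 0 l' h'" unfolding Inv_def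
        using A that pre z by (simp add: clean_def)
    qed (auto simp: ck)
  qed
  have 3: "run (While (Op Less (Var ''s'') (Var nv))
            (Seq (prefix_add pre cnt ky nv kv)
            (Seq (prefix_merge pre cnt ky nv kv)
                 (Assign ''s'' (Var ''s'' \<oplus> Var ''s''))))) l2 h2
    (ceil_log2 N * ((70 * (N + 1) + (100 * (N + 1) + 4)) + 3 + 1) + (3 + 1)) (ceil_log2 N * ((70 + (100 + 4)) + 3 + 1) + (3 + 1))
    (Inv (ceil_log2 N))" if "Inv 0 l2 h2" for l2 h2
  proof -
    have "run (While (Op Less (Var ''s'') (Var nv))
            (Seq (prefix_add pre cnt ky nv kv)
            (Seq (prefix_merge pre cnt ky nv kv)
                 (Assign ''s'' (Var ''s'' \<oplus> Var ''s''))))) l2 h2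
      (ceil_log2 N * ((70 * (N + 1) + (100 * (N + 1) + 4)) + exp_cost (Op Less (Var ''s'') (Var nv)) + 1) + (exp_cost (Op Less (Var ''s'') (Var nv)) + 1))
      (ceil_log2 N * ((70 + (100 + 4)) + exp_cost (Op Less (Var ''s'') (Var nv)) + 1) + (exp_cost (Op Less (Var ''s'') (Var nv)) + 1))
      (Inv (ceil_log2 N))"
    proof (rule run_while[where Inv = Inv, OF that])
      show "exp_ok (Op Less (Var ''s'') (Var nv))" by simp
      fix l' h' assume "Inv (ceil_log2 N) l' h'"
      then show "val (Op Less (Var ''s'') (Var nv)) l' h' = 0"
        using ceil_log2(1)[of N] l names by (auto simp: Inv_def)
    next
      fix j l' h' assume j: "j < ceil_log2 N" and I: "Inv j l' h'"
      define s where "s = (2::nat) ^ j"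
      have s: "0 < s" "s < N" using ceil_log2(2)[OF j] by (auto simp: s_def)
      have I': "l' ''s'' = s" "l' nv = N" "l' kv = kap"
        "\<And>a q. a \<noteq> pre \<Longrightarrow> a \<noteq> cnt \<Longrightarrow> h' (a, q) = h (a, q)"
        "\<And>q. N \<le> q \<Longrightarrow> h' (pre, q) = h (pre, q)" "clean (\<lambda>q. h' (cnt, q))"
        "\<And>i. i < N \<Longrightarrow> h' (pre, i) = psum s i"
        "\<And>b k. b \<le> N \<Longrightarrow> k < kap \<Longrightarrow> h' (cnt, cell s b k) = bsum s b k"
        using I l names unfolding Inv_def s_def by auto
      have hk: "h' (ky, i) = key i" for i using I'(4) names unfolding key_def by metis
      have A: "run (prefix_add pre cnt ky nv kv) l' h' (70 * (N + 1)) 70 (\<lambda>l1 h1. l1 = l' \<and>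
          (\<forall>a q. a \<noteq> pre \<longrightarrow> h1 (a, q) = h' (a, q)) \<and> (\<forall>q. N \<le> q \<longrightarrow> h1 (pre, q) = h' (pre, q)) \<and>
          (\<forall>i<N. h1 (pre, i) = psum (2 * s) i))"
      proof -
        define RS where "RS = (\<lambda>i. insert (pre, i) {(a, q::nat). a \<noteq> pre})"
        define WS where "WS = (\<lambda>i::nat. {(pre, i)})"
        define v where "v = (\<lambda>i (q::loc). psum (2 * s) i)"
        show ?thesis unfolding prefix_add_def
        proof (rule run_weaken[OF run_par_ex[where N = N and RS = RS and WS = WS and v = v]])
          show "val (Var nv) l' h' = N" using I' by simp
          show "N \<le> Z" using N by simp
          fix i assume i: "i < N" and sm: "small l' h'"
          have b: "i div s - 1 \<le> N" using i by (meson diff_le_self div_le_dividend le_trans less_imp_le)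
          have c: "h' (cnt, ((s + s * N) + (i div s - Suc 0)) * kap + key i) = bsum s (i div s - 1) (key i)"
            using I'(8)[OF b keyed_sums.key[OF keyed_sums_axioms i]] by (simp add: cell_def)
          show "wp (Cond (Op Mod (Var ''i'' \<oslash> Var ''s'') (Num 2))
             (Put pre (Var ''i'') (Get pre (Var ''i'')
             \<oplus> Get cnt (cell_exp ky nv kv (Var ''s'') (Var ''i'' \<oslash> Var ''s'' \<ominus> Num 1)))) Skip)
            (l'(''i'' := i)) h' (\<lambda>l' h'' R W. R \<subseteq> RS i \<and> W \<subseteq> WS i \<and> (\<forall>q\<in>WS i. h'' q = v i q))"
            using names I'(1-3) psum_double[OF i s(1)] tot(1)[OF i, of "2 * s"] c I'(7)[OF i]
            by (auto simp: ck RS_def WS_def v_def hk odd_iff_mod_2_eq_one even_iff_mod_2_eq_zero add.commute)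
        next
          fix l1 h1
          assume "l1 = l' \<and> (\<forall>i<N. \<forall>q\<in>WS i. h1 q = v i q) \<and> (\<forall>q. (\<forall>i<N. q \<notin> WS i) \<longrightarrow> h1 q = h' q)"
          then show "l1 = l' \<and> (\<forall>a q. a \<noteq> pre \<longrightarrow> h1 (a, q) = h' (a, q)) \<and> (\<forall>q. N \<le> q \<longrightarrow> h1 (pre, q) = h' (pre, q)) \<and>
            (\<forall>i<N. h1 (pre, i) = psum (2 * s) i)"
            by (auto simp: WS_def v_def)
        qed (auto simp: ck RS_def WS_def)
      qed
      have M: "run (prefix_merge pre cnt ky nv kv) l1 h1 (100 * (N + 1)) 100 (\<lambda>l2 h2. l2 = l1 \<and>
          (\<forall>a q. a \<noteq> cnt \<longrightarrow> h2 (a, q) = h1 (a, q)) \<and> clean (\<lambda>q. h2 (cnt, q)) \<and>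
          (\<forall>b\<le>N. \<forall>k<kap. h2 (cnt, cell (2 * s) b k) = bsum (2 * s) b k))"
        if h1: "l1 = l' \<and> (\<forall>a q. a \<noteq> pre \<longrightarrow> h1 (a, q) = h' (a, q)) \<and> (\<forall>q. N \<le> q \<longrightarrow> h1 (pre, q) = h' (pre, q)) \<and>
          (\<forall>i<N. h1 (pre, i) = psum (2 * s) i)" for l1 h1
      proof -
        \<comment> \<open>Counter reads stay at level \<open>s\<close> and counter writes at level
          \<open>2 * s\<close>; these differ because \<open>s\<close> is positive, and
          \<open>cell_inj\<close> separates the addresses.\<close>
        define RS where "RS = (\<lambda>i::nat. {(a, q::nat). a \<noteq> cnt} \<union> {(cnt, cell s b k) | b k. b \<le> N \<and> k < kap})"
        define WS where "WS = (\<lambda>i. if psum (2 * s) i = 0 then {(cnt, cell (2 * s) (i div (2 * s)) (key i))} else {})"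
        define v where "v = (\<lambda>i (q::loc). bsum (2 * s) (i div (2 * s)) (key i))"
        show ?thesis unfolding prefix_merge_def
        proof (rule run_weaken[OF run_par_ex[where N = N and RS = RS and WS = WS and v = v]])
          show "val (Var nv) l1 h1 = N" using I' h1 by simp
          show "N \<le> Z" using N by simp
          fix i assume i: "i < N" and sm: "small l1 h1"
          have "2 * (i div (2 * s)) \<le> i div s" 
            by (metis div_mult2_eq mult.commute div_times_less_eq_dividend)
          also have "\<dots> \<le> i" by simp
          \<comment> \<open>The right sibling may begin beyond the last item. Its index is still at
            most \<open>N\<close>, which is why block indices range up to and including
            \<open>N\<close>.\<close>
          finally have b: "2 * (i div (2 * s)) \<le> N" "2 * (i div (2 * s)) + 1 \<le> N" using i by linarith+
          have k: "key i < kap" by (rule keyed_sums.key[OF keyed_sums_axioms i])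
          have cs: "h1 (cnt, cell s b k) = bsum s b k" if "b \<le> N" "k < kap" for b k
            using that h1 I'(8) names by metis
          have c: "h1 (cnt, ((s + s * N) + (2 * (i div (2 * s)))) * kap + key i) = bsum s (2 * (i div (2 * s))) (key i)"
            "h1 (cnt, ((s + s * N) + Suc (2 * (i div (2 * s)))) * kap + key i) = bsum s (Suc (2 * (i div (2 * s)))) (key i)"
            using cs[OF b(1) k] cs[OF b(2) k] by (simp_all add: cell_def)
          have hk1: "h1 (ky, i) = key i" using h1 names hk by metis
          have in1: "(cnt, ((s + s * N) + (2 * (i div (2 * s)))) * kap + key i) \<in> RS i"
            "(cnt, ((s + s * N) + Suc (2 * (i div (2 * s)))) * kap + key i) \<in> RS i"
          proof -
            have "((s + s * N) + (2 * (i div (2 * s)))) * kap + key i = cell s (2 * (i div (2 * s))) (key i)"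
              "((s + s * N) + Suc (2 * (i div (2 * s)))) * kap + key i = cell s (2 * (i div (2 * s)) + 1) (key i)"
              by (simp_all add: cell_def)
            then show "(cnt, ((s + s * N) + (2 * (i div (2 * s)))) * kap + key i) \<in> RS i"
              "(cnt, ((s + s * N) + Suc (2 * (i div (2 * s)))) * kap + key i) \<in> RS i"
              unfolding RS_def using b k by blast+
          qed
          have s2: "s + s = 2 * s" by simp
          show "wp (Cond (Op Equal (Get pre (Var ''i'')) (Num 0))
           (Put cnt (cell_exp ky nv kv (Var ''s'' \<oplus> Var ''s'') (Var ''i'' \<oslash> (Var ''s'' \<oplus> Var ''s'')))
           (Get cnt (cell_exp ky nv kv (Var ''s'') (Num 2 \<otimes> (Var ''i'' \<oslash> (Var ''s'' \<oplus> Var ''s''))))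
            \<oplus> Get cnt (cell_exp ky nv kv (Var ''s'')
              (Num 2 \<otimes> (Var ''i'' \<oslash> (Var ''s'' \<oplus> Var ''s'')) \<oplus> Num 1)))) Skip)
            (l1(''i'' := i)) h1 (\<lambda>l' h'' R W. R \<subseteq> RS i \<and> W \<subseteq> WS i \<and> (\<forall>q\<in>WS i. h'' q = v i q))"
          proof (cases "psum (2 * s) i = 0")
            case True
            show ?thesis
              using names I'(1-3) h1 i bsum_double[OF s(1), of "i div (2 * s)" "key i"] tot(2)[OF i, of "2 * s" "i div (2 * s)" "key i"] c True
               in1 hk1 by (simp add: ck WS_def v_def s2 cell_def, simp add: RS_def mult.assoc)
          next
            case False
            then show ?thesis using names I'(1-3) h1 i by (simp add: ck WS_def v_def RS_def)
          qed
        next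
          fix i j q assume ij: "i < N" "j < N" "i \<noteq> j" "q \<in> WS i"
          note ks = keyed_sums.key[OF keyed_sums_axioms]
          have dl: "x div (2 * s) \<le> N" if "x < N" for x using that
            by (meson div_le_dividend le_trans less_imp_le)
          from ij have q: "psum (2 * s) i = 0" "q = (cnt, cell (2 * s) (i div (2 * s)) (key i))"
            by (auto simp: WS_def split: if_splits)
          have "q \<notin> RS j"
            using q(2) cell_inj[of "2 * s" "i div (2 * s)" "key i" s] ks[OF ij(1)] dl[OF ij(1)] s(1) by (auto simp: RS_def)
          moreover have "q \<notin> WS j"
          proof
            assume "q \<in> WS j"
            then have "psum (2 * s) j = 0" "q = (cnt, cell (2 * s) (j div (2 * s)) (key j))"
              by (auto simp: WS_def split: if_splits)
            then show False using q ij psum_0_unique[of i j "2 * s"]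
              cell_inj[of "2 * s" "i div (2 * s)" "key i" "2 * s" "j div (2 * s)" "key j"] ks dl by auto
          qed
          ultimately show "q \<notin> RS j \<and> q \<notin> WS j" ..
        next
          fix l2 h2
          assume A: "l2 = l1 \<and> (\<forall>i<N. \<forall>q\<in>WS i. h2 q = v i q) \<and> (\<forall>q. (\<forall>i<N. q \<notin> WS i) \<longrightarrow> h2 q = h1 q)"
          have oth: "h2 (a, q) = h1 (a, q)" if "a \<noteq> cnt" for a q
            using A that by (auto simp: WS_def)
          have cl1: "clean (\<lambda>q. h1 (cnt, q))" using I'(6) h1 names by simp
          have z: "h2 (cnt, cell s' b k) = 0"
            if "0 < s'" "b \<le> N" "k < kap" "\<forall>i<N. i div s' = b \<longrightarrow> key i \<noteq> k" for s' b k
          proof -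
            have "(cnt, cell s' b k) \<notin> WS i" if "i < N" for i
            proof
              assume "(cnt, cell s' b k) \<in> WS i"
              then have "cell s' b k = cell (2 * s) (i div (2 * s)) (key i)" by (auto simp: WS_def split: if_splits)
              moreover have "i div (2 * s) \<le> N" using \<open>i < N\<close>
                by (meson div_le_dividend le_trans less_imp_le)
              ultimately show False
                using cell_inj[of s' b k "2 * s" "i div (2 * s)" "key i"] keyed_sums.key[OF keyed_sums_axioms that] that
                \<open>\<forall>i<N. i div s' = b \<longrightarrow> key i \<noteq> k\<close> \<open>b \<le> N\<close> \<open>k < kap\<close> by auto
            qed
            then show ?thesis using A cl1 that unfolding clean_def by metis
          qed
          have "h2 (cnt, cell (2 * s) b k) = bsum (2 * s) b k" if "b \<le> N" "k < kap" for b k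
          proof (cases "\<exists>i<N. i div (2 * s) = b \<and> key i = k")
            case True
            then obtain i where i: "i < N" "i div (2 * s) = b" "key i = k" "psum (2 * s) i = 0"
              using psum_0_exists[of _ "2 * s"] by metis
            then show ?thesis using A by (auto simp: WS_def v_def)
          next
            case False
            then have e: "{i'. i' < N \<and> i' div (2 * s) = b \<and> key i' = k} = {}" by auto
            have "h2 (cnt, cell (2 * s) b k) = 0" using False that s by (intro z) auto
            then show ?thesis unfolding bsum_def e by simp
          qed
          then show "l2 = l1 \<and> (\<forall>a q. a \<noteq> cnt \<longrightarrow> h2 (a, q) = h1 (a, q)) \<and> clean (\<lambda>q. h2 (cnt, q)) \<and>
            (\<forall>b\<le>N. \<forall>k<kap. h2 (cnt, cell (2 * s) b k) = bsum (2 * s) b k)"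
            using A oth z by (simp add: clean_def)
        qed (auto simp: ck)
      qed
      show "val (Op Less (Var ''s'') (Var nv)) l' h' \<noteq> 0 \<and>
        run (Seq (prefix_add pre cnt ky nv kv) (Seq (prefix_merge pre cnt ky nv kv)
                 (Assign ''s'' (Var ''s'' \<oplus> Var ''s'')))) l' h' (70 * (N + 1) + (100 * (N + 1) + 4)) (70 + (100 + 4)) (Inv (Suc j))"
      proof
        show "val (Op Less (Var ''s'') (Var nv)) l' h' \<noteq> 0" using I' s by simp
        show "run (Seq (prefix_add pre cnt ky nv kv) (Seq (prefix_merge pre cnt ky nv kv)
                 (Assign ''s'' (Var ''s'' \<oplus> Var ''s'')))) l' h' (70 * (N + 1) + (100 * (N + 1) + 4)) (70 + (100 + 4)) (Inv (Suc j))"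
        proof (rule run_seq[OF A], rule run_seq[OF M], assumption)
          fix l1 h1 l2 h2
          assume h1: "l1 = l' \<and> (\<forall>a q. a \<noteq> pre \<longrightarrow> h1 (a, q) = h' (a, q)) \<and>
              (\<forall>q. N \<le> q \<longrightarrow> h1 (pre, q) = h' (pre, q)) \<and> (\<forall>i<N. h1 (pre, i) = psum (2 * s) i)"
            and h2: "l2 = l1 \<and> (\<forall>a q. a \<noteq> cnt \<longrightarrow> h2 (a, q) = h1 (a, q)) \<and> clean (\<lambda>q. h2 (cnt, q)) \<and>
            (\<forall>b\<le>N. \<forall>k<kap. h2 (cnt, cell (2 * s) b k) = bsum (2 * s) b k)"
          have "Inv (Suc j) (l2(''s'' := s + s)) h2"
            using I h1 h2 names unfolding Inv_def by (simp add: s_def mult_2)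
          then show "run (Assign ''s'' (Var ''s'' \<oplus> Var ''s'')) l2 h2 4 4 (Inv (Suc j))"
            using h1 h2 I' s N by (intro run_wp) auto
        qed
      qed
    qed
    then show ?thesis by (rule run_weaken) simp_all
  qed
  show ?thesis unfolding prefix_sums_def
  proof (rule run_weaken[OF run_seq[OF 1 run_seq[OF 2 3]]])
    fix l' h' assume I: "Inv (ceil_log2 N) l' h'"
    show "l' = l(''s'' := 2 ^ ceil_log2 N) \<and> (\<forall>a q. a \<noteq> pre \<longrightarrow> a \<noteq> cnt \<longrightarrow> h' (a, q) = h (a, q)) \<and>
      (\<forall>q. N \<le> q \<longrightarrow> h' (pre, q) = h (pre, q)) \<and>
      keyed_sums.clean N kap (\<lambda>i. h (ky, i)) (\<lambda>q. h' (cnt, q)) \<and>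
      (\<forall>i<N. h' (pre, i) = (\<Sum>i' | i' < i \<and> h (ky, i') = h (ky, i). h (wt, i')))"
      using I psum_total[OF ceil_log2(1)] unfolding Inv_def by (simp add: key_def w_def)
  qed (auto simp: algebra_simps)
qed

end

section \<open>Darts of a graph of bounded degree\<close>

text \<open>A dart is an oriented edge and \<open>mate\<close> reverses it. Ranks separate the darts
  with a common tail: darts of one rank have distinct tails, and the dart of rank 0 can act on
  behalf of its vertex. Fixing \<open>mate\<close> outside the range makes array updates through
  \<open>mate\<close> trivial there.\<close>

locale network =
  fixes M :: nat and tail head mate rank :: "nat \<Rightarrow> nat"
  assumes mate: "\<And>d. d < M \<Longrightarrow> mate d < M \<and> mate (mate d) = d \<and> tail (mate d) = head d"
    and mate_out: "\<And>d. M \<le> d \<Longrightarrow> mate d = d"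
    and rank_inj: "\<And>d e. d < M \<Longrightarrow> e < M \<Longrightarrow> tail d = tail e \<Longrightarrow> rank d = rank e \<Longrightarrow> d = e"
    and rank_0: "\<And>d. d < M \<Longrightarrow> \<exists>e<M. tail e = tail d \<and> rank e = 0"
    and rank_less: "\<And>d. d < M \<Longrightarrow> rank d < 16"
begin

definition outs :: "nat \<Rightarrow> nat set" where "outs v = {d \<in> {..<M}. tail d = v}"
definition ins :: "nat \<Rightarrow> nat set" where "ins v = {d \<in> {..<M}. head d = v}"
definition verts :: "nat set" where "verts = tail ` {..<M}"

lemma finite_sets [simp]: "finite (outs v)" "finite (ins v)" "finite verts"
  by (auto simp: outs_def ins_def verts_def)

lemma outsD: "d \<in> outs v \<longleftrightarrow> d < M \<and> tail d = v" and insD: "d \<in> ins v \<longleftrightarrow> d < M \<and> head d = v"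
  by (auto simp: outs_def ins_def)

lemma head_mate: "d < M \<Longrightarrow> head (mate d) = tail d"
  using mate by metis

lemma head_verts: "d < M \<Longrightarrow> head d \<in> verts" and tail_verts: "d < M \<Longrightarrow> tail d \<in> verts"
  using mate unfolding verts_def by (metis image_eqI lessThan_iff)+

lemma sum_ins: "(\<Sum>d\<in>ins v. F d) = (\<Sum>d\<in>outs v. F (mate d))"
  by (rule sum.reindex_bij_witness[of _ mate mate]) (auto simp: outsD insD mate head_mate)

lemma sum_outs: "(\<Sum>d\<in>outs v. F d) = (\<Sum>d\<in>ins v. F (mate d))"
  by (rule sum.reindex_bij_witness[of _ mate mate]) (auto simp: outsD insD mate head_mate)

lemma sum_mate: "(\<Sum>d<M. F (mate d)) = (\<Sum>d<M. F d)"
  by (rule sum.reindex_bij_witness[of _ mate mate]) (auto simp: mate)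

lemma sum_verts: "(\<Sum>v\<in>verts. \<Sum>d\<in>outs v. F d) = (\<Sum>d<M. F d)"
  unfolding outs_def verts_def by (rule sum.group) auto

lemma sum_verts_in: "(\<Sum>v\<in>verts. \<Sum>d\<in>ins v. F d) = (\<Sum>d<M. F d)"
  unfolding sum_ins sum_verts sum_mate ..

lemma outs_rank:
  fixes a :: "nat \<Rightarrow> nat"
  assumes "\<And>d. rank d \<noteq> j \<Longrightarrow> a d = 0" "d \<in> outs v" "rank d = j"
  shows "(\<Sum>d\<in>outs v. a d) = a d"
proof -
  have "a i = 0" if "i \<in> outs v - {d}" for i
    using that assms rank_inj[of i d] by (auto simp: outsD)
  then have "(\<Sum>d\<in>outs v. a d) = (\<Sum>d\<in>{d}. a d)"
    by (intro sum.mono_neutral_right) (use assms(2) in auto)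
  then show ?thesis by simp
qed

lemma outs_rank_none:
  fixes a :: "nat \<Rightarrow> nat"
  assumes "\<And>d. rank d \<noteq> j \<Longrightarrow> a d = 0" "\<And>d. d \<in> outs v \<Longrightarrow> rank d \<noteq> j"
  shows "(\<Sum>d\<in>outs v. a d) = 0"
  using assms by simp

lemma outs_rank_le:
  fixes a :: "nat \<Rightarrow> nat"
  assumes "\<And>d. rank d \<noteq> j \<Longrightarrow> a d = 0" "\<And>d. d < M \<Longrightarrow> a d \<le> X (tail d)"
  shows "(\<Sum>d\<in>outs v. a d) \<le> X v"
proof (cases "\<exists>d\<in>outs v. rank d = j")
  case True
  then obtain d where d: "d \<in> outs v" "rank d = j" by blast
  from outs_rank[of j a d v, OF assms(1) d] assms(2)[of d] d(1) show ?thesis by (simp add: outsD)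
next
  case False
  then show ?thesis using outs_rank_none[of j a v] assms(1) by force
qed

text \<open>During a pass over one rank this sum has at most one nonzero term per vertex; the form
  as a sum turns conservation into a rearrangement of finite sums.\<close>

definition sent :: "(nat \<Rightarrow> nat) \<Rightarrow> nat \<Rightarrow> nat" where
  "sent a v = (\<Sum>d\<in>outs v. a d)"

lemma sent_rank:
  assumes "\<And>e. rank e \<noteq> j \<Longrightarrow> a e = 0" "d < M" "rank d = j"
  shows "sent a (tail d) = a d"
  unfolding sent_def by (rule outs_rank[where j = j]) (use assms in \<open>auto simp: outsD\<close>)

lemma sent_none:
  assumes "\<And>d. d < M \<Longrightarrow> rank d = j \<Longrightarrow> tail d \<noteq> v" "\<And>e. rank e \<noteq> j \<Longrightarrow> a e = 0"
  shows "sent a v = 0"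
  unfolding sent_def by (rule outs_rank_none[where j = j]) (use assms in \<open>auto simp: outsD\<close>)

end

section \<open>Convex prices, slackness and the potential\<close>

text \<open>The marginal cost of the unit number \<open>f\<close> on a dart is \<open>len * 2 ^ (f div k)\<close>. The labels are
  a potential for these convex costs with complementary slackness up to one unit: this is an
  \<open>\<epsilon>\<close>-relaxation method in which each unit of flow moves by a push along a tight dart or by a
  return along a dart that carries flow.\<close>

locale flow_scale = network +
  fixes k H g :: nat and len sr fr :: "nat \<Rightarrow> nat"
  assumes k: "0 < k" and len: "\<And>d. d < M \<Longrightarrow> 2 \<le> len d" and H: "H = 2 ^ (g + 3)"
    and sr: "\<And>v. sr v \<le> 1" and fr: "\<And>v. fr v \<le> 1"
    and sr_verts: "\<And>v. v \<notin> verts \<Longrightarrow> sr v = 0"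
begin

definition cost :: "nat \<Rightarrow> nat \<Rightarrow> nat" where "cost d f = len d * 2 ^ (f div k)"

text \<open>\<open>x\<close> is the excess waiting at a vertex, \<open>ab\<close> the unit kept by a
  sink, and \<open>p d\<close> counts the units under way to \<open>head d\<close>. A dart cannot
  add to the excess at its head, since darts of equal rank may share a head. Units are therefore
  parked in \<open>p\<close> until the head collects them.\<close>

definition conserved :: "(nat \<Rightarrow> nat) \<Rightarrow> (nat \<Rightarrow> nat) \<Rightarrow> (nat \<Rightarrow> nat) \<Rightarrow> (nat \<Rightarrow> nat) \<Rightarrow> bool" where
  "conserved x f p ab \<longleftrightarrow> (\<forall>v. sr v + (\<Sum>d\<in>ins v. f d) = x v + ab v + (\<Sum>d\<in>outs v. f d) + (\<Sum>d\<in>ins v. p d))"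

text \<open>Complementary slackness for the marginal prices: the first clause concerns the next unit
  on the dart, the second the last unit. The slack of 1 in the second clause is what a lift by one
  level consumes.\<close>

definition feasible :: "(nat \<Rightarrow> nat) \<Rightarrow> (nat \<Rightarrow> nat) \<Rightarrow> bool" where
  "feasible f lab \<longleftrightarrow> (\<forall>d<M. lab (tail d) \<le> lab (head d) + cost d (f d) \<and>
     (0 < f d \<longrightarrow> lab (head d) + cost d (f d - 1) \<le> lab (tail d) + 1 \<and> lab (tail d) < H)) \<and> (\<forall>v. lab v \<le> H)"

text \<open>A free sink keeps the first unit that arrives, so while it is free it has no excess to
  be lifted for and its label stays 0. Once it has absorbed a unit it behaves like an ordinary
  vertex.\<close>

definition quiet :: "(nat \<Rightarrow> nat) \<Rightarrow> (nat \<Rightarrow> nat) \<Rightarrow> (nat \<Rightarrow> nat) \<Rightarrow> bool" where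
  "quiet x lab ab \<longleftrightarrow> (\<forall>v. ab v \<le> fr v \<and> (fr v = 1 \<longrightarrow> ab v = 0 \<longrightarrow> x v = 0 \<and> lab v = 0))"

definition tight :: "(nat \<Rightarrow> nat) \<Rightarrow> nat \<Rightarrow> nat \<Rightarrow> bool" where
  "tight lab d f \<longleftrightarrow> lab (tail d) = lab (head d) + cost d f"

definition rtight :: "(nat \<Rightarrow> nat) \<Rightarrow> nat \<Rightarrow> nat \<Rightarrow> bool" where
  "rtight lab d f \<longleftrightarrow> 0 < f \<and> lab (tail d) + 1 = lab (head d) + cost d (f - 1)"

text \<open>The number of units that can cross the dart, forward or back, at the current labels
  before the price changes.\<close>

definition moves :: "(nat \<Rightarrow> nat) \<Rightarrow> nat \<Rightarrow> nat \<Rightarrow> nat" where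
  "moves lab d f = (if tight lab d f then k - f mod k else if rtight lab d f then (f - 1) mod k + 1 else 0)"

definition fmax :: nat where "fmax = k * (g + 3)"

text \<open>A moved unit is paid by \<open>moves\<close>. The weight of a label step has two parts:
  \<open>2 * k\<close> covers the moves that a lift may open on the incident darts, and
  \<open>1 + fmax\<close> per out-dart covers the excess waiting at the lifted vertex.\<close>

definition pot :: "(nat \<Rightarrow> nat) \<Rightarrow> (nat \<Rightarrow> nat) \<Rightarrow> nat" where
  "pot f lab = (\<Sum>d<M. moves lab d (f d) + (2 * k + 1 + fmax) * (H - lab (tail d)))"

definition live :: "(nat \<Rightarrow> nat) \<Rightarrow> (nat \<Rightarrow> nat) \<Rightarrow> nat" where
  "live x lab = (\<Sum>v\<in>verts. if lab v < H then x v else 0)"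

lemma cost_ge: "d < M \<Longrightarrow> 2 \<le> cost d f"
  using mult_le_mono[OF len, of d 1 "2 ^ (f div k)"] by (simp add: cost_def)

lemma cost_mono: "f \<le> f' \<Longrightarrow> cost d f \<le> cost d f'"
  unfolding cost_def by (intro mult_le_mono2 power_increasing div_le_mono) auto

lemma moves_le: "moves lab d f \<le> k"
  using k by (auto simp: moves_def Suc_le_eq)

text \<open>A push or a return uses up the units of equal cost and never creates a new possible move, since
  the cost doubles from one block of \<open>k\<close> units to the next.\<close>

lemma push_block:
  assumes "d < M" "tight lab d f" "a \<le> k - f mod k"
  shows "moves lab d (f + a) + a \<le> moves lab d f" "0 < a \<Longrightarrow> cost d (f + a - 1) = cost d f"
    "a = k - f mod k \<Longrightarrow> \<not> tight lab d (f + a)"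
proof -
  let ?b = "f div k" and ?r = "f mod k"
  have f: "f = ?b * k + ?r" and r: "?r < k" using k by auto
  have "(f + i) div k = ?b" if "i < k - ?r" for i
  proof (rule div_nat_eqI)
    have f': "f = k * ?b + ?r" by simp
    show "k * ?b \<le> f + i" using f' by linarith
    show "f + i < k * Suc ?b" unfolding mult_Suc_right using f' that by linarith
  qed
  then have same: "cost d (f + i) = cost d f" if "i < k - ?r" for i
    using that unfolding cost_def by simp
  have mod: "(f + i) mod k = ?r + i" if "i < k - ?r" for i
  proof -
    have "?r + i < k" using that by simp
    then show ?thesis by (metis mod_add_left_eq mod_less)
  qed
  have "f = k * ?b + ?r" by simp
  moreover have e: "(?b + 1) * k = k * ?b + k" by simp
  ultimately have full: "(f + (k - ?r)) = (?b + 1) * k" unfolding e using r by linarith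
  then have dbl: "cost d (f + (k - ?r)) = 2 * cost d f" using k by (simp add: cost_def)
  show c: "cost d (f + a - 1) = cost d f" if "0 < a"
    using same[of "a - 1"] that assms(3) by simp
  show nt: "\<not> tight lab d (f + a)" if "a = k - ?r"
    using that dbl assms(2) cost_ge[OF assms(1), of f] by (simp add: tight_def)
  show "moves lab d (f + a) + a \<le> moves lab d f"
  proof (cases "a = k - ?r")
    case True
    have "0 < a" using True r by simp
    have "\<not> rtight lab d (f + a)"
      using c[OF \<open>0 < a\<close>] assms(2) by (simp add: tight_def rtight_def)
    then show ?thesis using nt[OF True] True assms(2) by (simp add: moves_def)
  next
    case False
    then have "a < k - ?r" using assms(3) by simp
    then have "tight lab d (f + a)" using same[of a] assms(2) by (simp add: tight_def)
    then show ?thesis using mod[OF \<open>a < _\<close>] assms by (simp add: moves_def)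
  qed
qed

lemma return_block:
  assumes "d < M" "rtight lab d f" "a \<le> (f - 1) mod k + 1"
  shows "moves lab d (f - a) + a \<le> moves lab d f" "0 < a \<Longrightarrow> \<not> tight lab d (f - a)"
    "cost d (f - a) \<ge> cost d (f - 1) \<or> a = 0" "a \<le> f"
    "a = (f - 1) mod k + 1 \<Longrightarrow> \<not> rtight lab d (f - a)"
proof -
  let ?b = "(f - 1) div k" and ?r = "(f - 1) mod k"
  have f0: "0 < f" using assms(2) by (simp add: rtight_def)
  have f: "f = ?b * k + ?r + 1" and r: "?r < k" using k f0 by auto
  show le: "a \<le> f" using assms(3) f by linarith
  have same: "cost d (f - 1 - i) = cost d (f - 1)" if "i \<le> ?r" for i
  proof -
    have "f - 1 - i = ?b * k + (?r - i)" using f that by linarith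
    then have "(f - 1 - i) div k = ?b" using k r by simp
    then show ?thesis unfolding cost_def by (rule arg_cong)
  qed
  have c: "cost d (f - a) = cost d (f - 1)" if "0 < a"
    using same[of "a - 1"] that assms(3) by simp
  then show "cost d (f - a) \<ge> cost d (f - 1) \<or> a = 0" by auto
  show nt: "\<not> tight lab d (f - a)" if "0 < a"
    using c[OF that] assms(2) by (simp add: tight_def rtight_def)
  show nr: "\<not> rtight lab d (f - a)" if a: "a = ?r + 1"
  proof
    assume rt: "rtight lab d (f - a)"
    have fa: "f - a = ?b * k" using a f by linarith
    with rt have b: "0 < ?b" by (auto simp: rtight_def intro: Nat.gr0I)
    obtain c where c: "?b = Suc c" using b gr0_implies_Suc by blast
    have "(f - a - 1) div k = c"
    proof (rule div_nat_eqI)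
      show "k * c \<le> f - a - 1" "f - a - 1 < k * Suc c"
        using fa k unfolding c by (simp_all add: algebra_simps)
    qed
    then have "(f - a - 1) div k = ?b - 1" using c by simp
    \<comment> \<open>The last remaining unit lies in the block below and has half the price; two
      different prices cannot both satisfy the equation of \<open>rtight\<close> for the same
      labels.\<close>
    then have "cost d (f - 1) = 2 * cost d (f - a - 1)"
      using b unfolding cost_def by (cases ?b) auto
    then show False using rt assms(2) cost_ge[OF assms(1), of "f - a - 1"] by (simp add: rtight_def)
  qed
  have nt0: "\<not> tight lab d f"
    using assms(2) cost_mono[of "f - 1" f d] by (simp add: tight_def rtight_def)
  show "moves lab d (f - a) + a \<le> moves lab d f"
  proof (cases "a = 0")
    case False
    then have a0: "0 < a" by simp
    show ?thesis
    proof (cases "a = ?r + 1")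
      case True
      then show ?thesis using nt[OF a0] nr[OF True] nt0 assms(2) by (simp add: moves_def)
    next
      case False
      then have a: "a \<le> ?r" using assms(3) by simp
      have "f - a - 1 = ?b * k + (?r - a)" using f a by linarith
      then have "(f - a - 1) mod k = ?r - a" using r by simp
      then show ?thesis using nt[OF a0] nt0 assms(2) a by (auto simp: moves_def)
    qed
  qed simp
qed

text \<open>The price of the last unit is at most the label range \<open>H = 2 ^ (g + 3)\<close>,
  while it starts at 2 or more and doubles with every \<open>k\<close> units; hence fewer than
  \<open>g + 3\<close> full blocks precede that unit.\<close>

lemma flow_le_fmax:
  assumes "feasible f lab" "d < M"
  shows "f d \<le> fmax"
proof (cases "f d = 0")
  case False
  with assms have "lab (head d) + cost d (f d - 1) \<le> lab (tail d) + 1" "lab (tail d) < H"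
    by (auto simp: feasible_def)
  then have "cost d (f d - 1) \<le> 2 ^ (g + 3)" using H by simp
  moreover have "2 * 2 ^ ((f d - 1) div k) \<le> cost d (f d - 1)"
    using len[OF assms(2)] unfolding cost_def by (intro mult_le_mono1)
  ultimately have "(2::nat) ^ Suc ((f d - 1) div k) \<le> 2 ^ (g + 3)" by simp
  then have "Suc ((f d - 1) div k) \<le> g + 3" by (rule power_le_imp_le_exp[rotated]) simp
  then have "(f d - 1) div k < g + 3" by simp
  then have "f d - 1 < k * (g + 3)" using k by (simp add: div_less_iff_less_mult mult.commute)
  then show ?thesis using False by (simp add: fmax_def)
qed simp

text \<open>Prices of at least 2 beat the slack of 1. In particular the flow is acyclic.\<close>

lemma flow_descends:
  assumes "feasible f lab" "d < M" "0 < f d"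
  shows "lab (head d) < lab (tail d)" "lab (tail d) < H"
proof -
  have "lab (head d) + cost d (f d - 1) \<le> lab (tail d) + 1 \<and> lab (tail d) < H"
    using assms unfolding feasible_def by blast
  then show "lab (head d) < lab (tail d)" "lab (tail d) < H"
    using cost_ge[OF assms(2), of "f d - 1"] by linarith+
qed

lemma x_le:
  assumes "conserved x f p ab"
  shows "x v + ab v + (\<Sum>d\<in>ins v. p d) \<le> 1 + (\<Sum>d\<in>ins v. f d)"
proof -
  have "sr v + (\<Sum>d\<in>ins v. f d) = x v + ab v + (\<Sum>d\<in>outs v. f d) + (\<Sum>d\<in>ins v. p d)"
    using assms unfolding conserved_def by blast
  then show ?thesis using sr[of v] by linarith
qed

section \<open>Pushes and returns, one rank at a time\<close>

definition push_amount :: "nat \<Rightarrow> (nat \<Rightarrow> nat) \<Rightarrow> (nat \<Rightarrow> nat) \<Rightarrow> (nat \<Rightarrow> nat) \<Rightarrow> nat \<Rightarrow> nat" where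
  "push_amount j x f lab d = (if d < M \<and> rank d = j \<and> lab (tail d) < H \<and> tight lab d (f d)
     then min (x (tail d)) (k - f d mod k) else 0)"

definition return_amount :: "nat \<Rightarrow> (nat \<Rightarrow> nat) \<Rightarrow> (nat \<Rightarrow> nat) \<Rightarrow> (nat \<Rightarrow> nat) \<Rightarrow> nat \<Rightarrow> nat" where
  "return_amount j x f lab d = (if d < M \<and> rank d = j \<and> rtight lab (mate d) (f (mate d))
     then min (x (tail d)) ((f (mate d) - 1) mod k + 1) else 0)"

definition drain_amount :: "nat \<Rightarrow> (nat \<Rightarrow> nat) \<Rightarrow> (nat \<Rightarrow> nat) \<Rightarrow> nat \<Rightarrow> nat" where
  "drain_amount j x f d = (if d < M \<and> rank d = j then min (x (tail d)) (f (mate d)) else 0)"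

lemma conserved_push:
  assumes "conserved x f p ab" "\<And>v. sent a v \<le> x v"
  shows "conserved (\<lambda>v. x v - sent a v) (\<lambda>d. f d + a d) (\<lambda>d. p d + a d) ab"
  unfolding conserved_def
proof
  fix v
  have "sr v + (\<Sum>d\<in>ins v. f d) = x v + ab v + (\<Sum>d\<in>outs v. f d) + (\<Sum>d\<in>ins v. p d)"
    using assms(1) by (simp add: conserved_def)
  then show "sr v + (\<Sum>d\<in>ins v. f d + a d) = x v - sent a v + ab v + (\<Sum>d\<in>outs v. f d + a d) + (\<Sum>d\<in>ins v. p d + a d)"
    using assms(2)[of v] by (simp add: sum.distrib sent_def)
qed

text \<open>A return along \<open>d\<close> cancels flow on \<open>mate d\<close>: the outflow of
  \<open>head d\<close> shrinks by the very units that are now under way to it.\<close>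

lemma conserved_return:
  assumes "conserved x f p ab" "\<And>v. sent a v \<le> x v" "\<And>d. d < M \<Longrightarrow> a d \<le> f (mate d)"
  shows "conserved (\<lambda>v. x v - sent a v) (\<lambda>d. f d - a (mate d)) (\<lambda>d. p d + a d) ab"
  unfolding conserved_def
proof
  fix v
  have "sr v + (\<Sum>d\<in>ins v. f d) = x v + ab v + (\<Sum>d\<in>outs v. f d) + (\<Sum>d\<in>ins v. p d)"
    using assms(1) by (simp add: conserved_def)
  moreover have "a (mate d) \<le> f d" if "d < M" for d using assms(3)[of "mate d"] mate[OF that] by simp
  then have "(\<Sum>d\<in>ins v. f d) = (\<Sum>d\<in>ins v. f d - a (mate d)) + sent a v"
    "(\<Sum>d\<in>outs v. f d) = (\<Sum>d\<in>outs v. f d - a (mate d)) + (\<Sum>d\<in>ins v. a d)"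
    unfolding sent_def sum_outs[of a] sum_ins[of a] sum.distrib[symmetric]
    by (auto intro!: sum.cong simp: insD outsD)
  ultimately show "sr v + (\<Sum>d\<in>ins v. f d - a (mate d)) =
      x v - sent a v + ab v + (\<Sum>d\<in>outs v. f d - a (mate d)) + (\<Sum>d\<in>ins v. p d + a d)"
    using assms(2)[of v] by (simp add: sum.distrib)
qed

lemma live_sent:
  assumes "\<And>v. sent a v \<le> x v" "\<And>d. d < M \<Longrightarrow> 0 < a d \<Longrightarrow> lab (tail d) < H"
  shows "live (\<lambda>v. x v - sent a v) lab + (\<Sum>d<M. a d) = live x lab"
proof -
  have "live (\<lambda>v. x v - sent a v) lab + (\<Sum>v\<in>verts. sent a v) = live x lab"
    unfolding live_def sum.distrib[symmetric]
  proof (rule sum.cong, simp)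
    fix v
    have "sent a v = 0" if "\<not> lab v < H"
      unfolding sent_def using assms(2) that by (intro sum.neutral) (metis outsD not_gr0)
    then show "(if lab v < H then x v - sent a v else 0) + sent a v = (if lab v < H then x v else 0)"
      using assms(1)[of v] by auto
  qed
  then show ?thesis by (simp add: sent_def sum_verts)
qed

lemma sent_push: "sent (push_amount j x f lab) v \<le> x v"
  unfolding sent_def by (rule outs_rank_le[where j = j]) (auto simp: push_amount_def)

lemma sent_return: "sent (return_amount j x f lab) v \<le> x v"
  unfolding sent_def by (rule outs_rank_le[where j = j]) (auto simp: return_amount_def)

lemma sent_drain: "sent (drain_amount j x f) v \<le> x v"
  unfolding sent_def by (rule outs_rank_le[where j = j]) (auto simp: drain_amount_def)

lemma return_amount_le: "d < M \<Longrightarrow> return_amount j x f lab d \<le> f (mate d)"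
  using return_block(4)[of "mate d" lab "f (mate d)"] mate[of d] by (auto simp: return_amount_def min_def)

text \<open>The state during a round; \<open>P0\<close> and \<open>L0\<close> are the potential and the number of live units at its start.\<close>

definition mid :: "nat \<Rightarrow> nat \<Rightarrow> (nat \<Rightarrow> nat) \<Rightarrow> (nat \<Rightarrow> nat) \<Rightarrow> (nat \<Rightarrow> nat) \<Rightarrow> (nat \<Rightarrow> nat) \<Rightarrow> (nat \<Rightarrow> nat) \<Rightarrow> bool" where
  "mid P0 L0 x f p lab ab \<longleftrightarrow> conserved x f p ab \<and> feasible f lab \<and> quiet x lab ab \<and>
     pot f lab + (\<Sum>d<M. p d) \<le> P0 \<and> live x lab + (\<Sum>d<M. p d) = L0"

definition pushed :: "nat \<Rightarrow> (nat \<Rightarrow> nat) \<Rightarrow> (nat \<Rightarrow> nat) \<Rightarrow> (nat \<Rightarrow> nat) \<Rightarrow> bool" where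
  "pushed j x f lab \<longleftrightarrow> (\<forall>d<M. rank d < j \<longrightarrow> 0 < x (tail d) \<longrightarrow> lab (tail d) < H \<longrightarrow> \<not> tight lab d (f d))"

definition returned :: "nat \<Rightarrow> (nat \<Rightarrow> nat) \<Rightarrow> (nat \<Rightarrow> nat) \<Rightarrow> (nat \<Rightarrow> nat) \<Rightarrow> bool" where
  "returned j x f lab \<longleftrightarrow> (\<forall>d<M. rank d < j \<longrightarrow> 0 < x (tail d) \<longrightarrow> \<not> rtight lab (mate d) (f (mate d)))"

lemma pot_change:
  assumes "\<And>d. d < M \<Longrightarrow> moves lab d (f' d) + a d \<le> moves lab d (f d)"
  shows "pot f' lab + (\<Sum>d<M. a d) \<le> pot f lab"
  unfolding pot_def sum.distrib[symmetric] using assms by (intro sum_mono) (simp add: add.commute add.left_commute)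

text \<open>A dart of rank \<open>j\<close> remains tight only if its tail has run out of excess;
  otherwise a whole block was moved and the price has doubled. Deliveries being postponed, excess
  does not grow during the pass, so finished ranks stay finished.\<close>

lemma push_step:
  assumes m: "mid P0 L0 x f p lab ab" and pu: "pushed j x f lab"
  defines "a \<equiv> push_amount j x f lab"
  shows "mid P0 L0 (\<lambda>v. x v - sent a v) (\<lambda>d. f d + a d) (\<lambda>d. p d + a d) lab ab"
    "pushed (Suc j) (\<lambda>v. x v - sent a v) (\<lambda>d. f d + a d) lab"
proof -
  have s: "sent a v \<le> x v" for v unfolding a_def by (rule sent_push)
  have a: "lab (tail d) < H \<and> tight lab d (f d) \<and> a d \<le> k - f d mod k \<and> d < M \<and> rank d = j" if "0 < a d" for d
    using that by (auto simp: a_def push_amount_def split: if_splits)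
  have mv: "moves lab d (f d + a d) + a d \<le> moves lab d (f d)" if "d < M" for d
    using a[of d] push_block(1)[OF that, of lab "f d" "a d"] by (cases "a d = 0") auto
  from m have fe: "feasible f lab" by (simp add: mid_def)
  have "feasible (\<lambda>d. f d + a d) lab" unfolding feasible_def
  proof (intro conjI allI impI)
    fix v show "lab v \<le> H" using fe by (simp add: feasible_def)
  next
    fix d assume d: "d < M"
    show "lab (tail d) \<le> lab (head d) + cost d (f d + a d)"
      using fe d cost_mono[of "f d" "f d + a d" d] unfolding feasible_def by (meson add_le_mono le_add1 le_refl le_trans)
    assume fa: "0 < f d + a d"
    show "lab (head d) + cost d (f d + a d - 1) \<le> lab (tail d) + 1"
    proof (cases "a d = 0")
      case True then show ?thesis using fe d fa by (simp add: feasible_def)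
    next
      case False
      then show ?thesis using push_block(2)[OF d, of lab "f d" "a d"] a[of d] by (simp add: tight_def)
    qed
    show "lab (tail d) < H"
      using a[of d] fe d fa by (cases "a d = 0") (auto simp: feasible_def)
  qed
  moreover have "pot (\<lambda>d. f d + a d) lab + (\<Sum>d<M. p d + a d) \<le> P0"
    using pot_change[of lab "\<lambda>d. f d + a d" a f, OF mv] m by (simp add: mid_def sum.distrib)
  moreover have "live (\<lambda>v. x v - sent a v) lab + (\<Sum>d<M. p d + a d) = L0"
    using live_sent[of a x lab, OF s] a m by (simp add: mid_def sum.distrib)
  moreover have "quiet (\<lambda>v. x v - sent a v) lab ab" using m by (auto simp: mid_def quiet_def)
  ultimately show "mid P0 L0 (\<lambda>v. x v - sent a v) (\<lambda>d. f d + a d) (\<lambda>d. p d + a d) lab ab"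
    using conserved_push[of x f p ab a, OF _ s] m by (simp add: mid_def)
  show "pushed (Suc j) (\<lambda>v. x v - sent a v) (\<lambda>d. f d + a d) lab"
    unfolding pushed_def
  proof (intro allI impI)
    fix d assume d: "d < M" "rank d < Suc j" "0 < x (tail d) - sent a (tail d)" "lab (tail d) < H"
    show "\<not> tight lab d (f d + a d)"
    proof (cases "rank d = j")
      case False
      then have "a d = 0" using a[of d] by auto
      then show ?thesis using pu d False by (auto simp: pushed_def)
    next
      case True
      have "sent a (tail d) = a d" unfolding sent_def
        by (rule outs_rank[where j = j]) (use True d in \<open>auto simp: a_def push_amount_def outsD\<close>)
      then have "a d < x (tail d)" using d(3) by simp
      then have "tight lab d (f d) \<Longrightarrow> a d = k - f d mod k" using d True by (auto simp: a_def push_amount_def)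
      moreover have "\<not> tight lab d (f d) \<Longrightarrow> a d = 0" by (simp add: a_def push_amount_def)
      ultimately show ?thesis using push_block(3)[OF d(1), of lab "f d" "a d"]
        by (cases "tight lab d (f d)") auto
    qed
  qed
qed

text \<open>Returns do not undo the pushes: a dart from which a unit has been taken back is one
  short of being tight, so \<open>pushed 16\<close> survives.\<close>

lemma return_step:
  assumes m: "mid P0 L0 x f p lab ab" and pu: "pushed 16 x f lab" and re: "returned j x f lab"
  defines "a \<equiv> return_amount j x f lab"
  shows "mid P0 L0 (\<lambda>v. x v - sent a v) (\<lambda>d. f d - a (mate d)) (\<lambda>d. p d + a d) lab ab"
    "pushed 16 (\<lambda>v. x v - sent a v) (\<lambda>d. f d - a (mate d)) lab"
    "returned (Suc j) (\<lambda>v. x v - sent a v) (\<lambda>d. f d - a (mate d)) lab"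
proof -
  have s: "sent a v \<le> x v" for v unfolding a_def by (rule sent_return)
  have a: "rtight lab (mate d) (f (mate d)) \<and> a d \<le> (f (mate d) - 1) mod k + 1 \<and> d < M \<and> rank d = j" if "0 < a d" for d
    using that by (auto simp: a_def return_amount_def split: if_splits)
  have am: "rtight lab d (f d) \<and> a (mate d) \<le> (f d - 1) mod k + 1" if "0 < a (mate d)" "d < M" for d
    using a[OF that(1)] mate[OF that(2)] by simp
  have al: "a d \<le> f (mate d)" if "d < M" for d unfolding a_def by (rule return_amount_le[OF that])
  have mv: "moves lab d (f d - a (mate d)) + a (mate d) \<le> moves lab d (f d)" if "d < M" for d
    using am[OF _ that] return_block(1)[OF that, of lab "f d" "a (mate d)"] by (cases "a (mate d) = 0") auto
  from m have fe: "feasible f lab" by (simp add: mid_def)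
  have "feasible (\<lambda>d. f d - a (mate d)) lab" unfolding feasible_def
  proof (intro conjI allI impI)
    fix v show "lab v \<le> H" using fe by (simp add: feasible_def)
  next
    fix d assume d: "d < M"
    show "lab (tail d) \<le> lab (head d) + cost d (f d - a (mate d))"
    proof (cases "a (mate d) = 0")
      case True
      then show ?thesis using fe d by (simp add: feasible_def)
    next
      case False
      with am d have r: "rtight lab d (f d)" "a (mate d) \<le> (f d - 1) mod k + 1" by auto
      from return_block(3)[OF d r] False r(1) show ?thesis by (simp add: rtight_def)
    qed
    assume fa: "0 < f d - a (mate d)"
    show "lab (head d) + cost d (f d - a (mate d) - 1) \<le> lab (tail d) + 1"
      using fe d fa cost_mono[of "f d - a (mate d) - 1" "f d - 1" d] by (fastforce simp: feasible_def)
    show "lab (tail d) < H" using fe d fa by (auto simp: feasible_def)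
  qed
  moreover have "pot (\<lambda>d. f d - a (mate d)) lab + (\<Sum>d<M. p d + a d) \<le> P0"
    using pot_change[of lab "\<lambda>d. f d - a (mate d)" "\<lambda>d. a (mate d)" f, OF mv] m
    by (simp add: mid_def sum.distrib sum_mate)
  \<comment> \<open>A vertex that returns a unit receives flow, and flow descends from a vertex
    below \<open>H\<close>; so the moved units were live.\<close>
  moreover have "lab (tail d) < H" if d: "d < M" "0 < a d" for d
  proof -
    have "0 < f (mate d)" using a[OF d(2)] by (auto simp: rtight_def)
    from flow_descends[OF fe _ this] mate[OF d(1)] head_mate[OF d(1)] show ?thesis by auto
  qed
  then have "live (\<lambda>v. x v - sent a v) lab + (\<Sum>d<M. p d + a d) = L0"
    using live_sent[of a x lab, OF s] m by (simp add: mid_def sum.distrib)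
  moreover have "quiet (\<lambda>v. x v - sent a v) lab ab" using m by (auto simp: mid_def quiet_def)
  ultimately show "mid P0 L0 (\<lambda>v. x v - sent a v) (\<lambda>d. f d - a (mate d)) (\<lambda>d. p d + a d) lab ab"
    using conserved_return[of x f p ab a, OF _ s al] m by (simp add: mid_def)
  show "pushed 16 (\<lambda>v. x v - sent a v) (\<lambda>d. f d - a (mate d)) lab"
    unfolding pushed_def
  proof (intro allI impI)
    fix d assume d: "d < M" "rank d < 16" "0 < x (tail d) - sent a (tail d)" "lab (tail d) < H"
    show "\<not> tight lab d (f d - a (mate d))"
    proof (cases "a (mate d) = 0")
      case True
      then show ?thesis using pu d by (simp add: pushed_def)
    next
      case False
      then show ?thesis using return_block(2)[OF d(1), of lab "f d" "a (mate d)"] am[OF _ d(1)] by auto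
    qed
  qed
  show "returned (Suc j) (\<lambda>v. x v - sent a v) (\<lambda>d. f d - a (mate d)) lab"
    unfolding returned_def
  proof (intro allI impI)
    fix d assume d: "d < M" "rank d < Suc j" "0 < x (tail d) - sent a (tail d)"
    have mm: "mate (mate d) = d" "mate d < M" using mate[OF d(1)] by auto
    show "\<not> rtight lab (mate d) (f (mate d) - a (mate (mate d)))"
    proof (cases "rank d = j")
      case False
      then have "a d = 0" using a[of d] by auto
      then show ?thesis using re d False mm by (auto simp: returned_def)
    next
      case True
      have "sent a (tail d) = a d" unfolding sent_def
        by (rule outs_rank[where j = j]) (use True d in \<open>auto simp: a_def return_amount_def outsD\<close>)
      then have "a d < x (tail d)" using d(3) by simp
      then have "rtight lab (mate d) (f (mate d)) \<Longrightarrow> a d = (f (mate d) - 1) mod k + 1"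
        using d True by (auto simp: a_def return_amount_def)
      moreover have "\<not> rtight lab (mate d) (f (mate d)) \<Longrightarrow> a d = 0" by (simp add: a_def return_amount_def)
      ultimately show ?thesis using return_block(5)[OF mm(2), of lab "f (mate d)" "a d"] mm
        by (cases "rtight lab (mate d) (f (mate d))") auto
    qed
  qed
qed

end

section \<open>Lifting of labels and the charging of live units\<close>

context flow_scale
begin

definition lift :: "(nat \<Rightarrow> nat) \<Rightarrow> (nat \<Rightarrow> nat) \<Rightarrow> nat \<Rightarrow> nat" where
  "lift x lab v = (if v \<in> verts \<and> 0 < x v \<and> lab v < H then lab v + 1 else lab v)"

definition calm :: "(nat \<Rightarrow> nat) \<Rightarrow> (nat \<Rightarrow> nat) \<Rightarrow> bool" where
  "calm lab ab \<longleftrightarrow> (\<forall>v. ab v \<le> fr v \<and> (fr v = 1 \<longrightarrow> ab v = 0 \<longrightarrow> lab v = 0))"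

text \<open>At this stage all \<open>L0\<close> live units of the round have been charged to the
  potential. Deliveries may reach free sinks before these absorb, hence \<open>calm\<close> in place
  of \<open>quiet\<close>.\<close>

definition late :: "nat \<Rightarrow> nat \<Rightarrow> (nat \<Rightarrow> nat) \<Rightarrow> (nat \<Rightarrow> nat) \<Rightarrow> (nat \<Rightarrow> nat) \<Rightarrow> (nat \<Rightarrow> nat) \<Rightarrow> (nat \<Rightarrow> nat) \<Rightarrow> bool" where
  "late P0 L0 x f p lab ab \<longleftrightarrow> conserved x f p ab \<and> feasible f lab \<and> calm lab ab \<and>
     pot f lab + L0 \<le> P0 \<and> live x lab + (\<Sum>d<M. p d) \<le> L0"

text \<open>The charging argument of a round: every live unit either was moved, which consumed a
  possible move, or waits at a vertex that is lifted now. Lifting by 1 keeps slackness, because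
  after complete passes no dart at a vertex with excess is tight in the direction that the lift
  would violate.\<close>

lemma lift_step:
  assumes m: "mid P0 L0 x f p lab ab" and pu: "pushed 16 x f lab" and re: "returned 16 x f lab"
  shows "late P0 L0 x f p (lift x lab) ab"
proof -
  define up where "up v = (if v \<in> verts \<and> 0 < x v \<and> lab v < H then 1 else 0::nat)" for v
  have l: "lift x lab v = lab v + up v" for v by (simp add: lift_def up_def)
  from m have fe: "feasible f lab" and co: "conserved x f p ab" by (auto simp: mid_def)
  have I1: "lab (tail d) \<le> lab (head d) + cost d (f d)" if "d < M" for d using fe that by (simp add: feasible_def)
  have I2: "lab (head d) + cost d (f d - 1) \<le> lab (tail d) + 1" if "d < M" "0 < f d" for d
    using fe that by (simp add: feasible_def)
  have strict1: "lab (tail d) < lab (head d) + cost d (f d)" if "d < M" "up (tail d) = 1" for d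
    using I1[OF that(1)] pu that rank_less[OF that(1)] by (auto simp: pushed_def tight_def up_def split: if_splits)
  have strict2: "lab (head d) + cost d (f d - 1) \<le> lab (tail d)" if d: "d < M" "0 < f d" "up (head d) = 1" for d
  proof -
    have "mate d < M" "tail (mate d) = head d" "mate (mate d) = d" using mate[OF d(1)] by auto
    with re d rank_less[of "mate d"] have "\<not> rtight lab d (f d)" by (fastforce simp: returned_def up_def split: if_splits)
    then show ?thesis using I2[OF d(1,2)] d(2) by (auto simp: rtight_def)
  qed
  \<comment> \<open>A vertex about to reach \<open>H\<close> has no inflow, which would have to come
    from a label above \<open>H\<close>. Its whole supply is one source unit of its own; this unit
    is still waiting, so nothing flows out either.\<close>
  have blocked: "lab (tail d) + up (tail d) < H" if d: "d < M" "0 < f d" for d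
  proof (rule ccontr)
    assume n: "\<not> ?thesis"
    let ?v = "tail d"
    from flow_descends(2)[OF fe d] n have u: "up ?v = 1" "lab ?v + 1 = H" by (auto simp: up_def split: if_splits)
    have "f e = 0" if "e \<in> ins ?v" for e
    proof (rule ccontr)
      assume "f e \<noteq> 0"
      then have e: "e < M" "0 < f e" "head e = ?v" using that by (auto simp: insD)
      from strict2[OF e(1,2)] e(3) u flow_descends(2)[OF fe e(1,2)] cost_ge[OF e(1), of "f e - 1"] show False by simp
    qed
    then have "sr ?v = x ?v + ab ?v + (\<Sum>d\<in>outs ?v. f d) + (\<Sum>d\<in>ins ?v. p d)"
      using co unfolding conserved_def by (metis (no_types, lifting) add.right_neutral sum.neutral)
    moreover have "f d \<le> (\<Sum>d\<in>outs ?v. f d)" using d(1) by (intro member_le_sum) (auto simp: outsD)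
    moreover have "0 < x ?v" using u(1) by (auto simp: up_def split: if_splits)
    ultimately show False using sr[of ?v] d(2) by linarith
  qed
  have "feasible f (lift x lab)" unfolding feasible_def
  proof (intro conjI allI impI)
    fix v show "lift x lab v \<le> H" using fe by (simp add: l up_def feasible_def)
  next
    fix d assume d: "d < M"
    show "lift x lab (tail d) \<le> lift x lab (head d) + cost d (f d)"
      using I1[OF d] strict1[OF d] by (cases "up (tail d) = 1") (auto simp: l up_def)
    assume f: "0 < f d"
    show "lift x lab (head d) + cost d (f d - 1) \<le> lift x lab (tail d) + 1"
      using I2[OF d f] strict2[OF d f] by (cases "up (head d) = 1") (auto simp: l up_def)
    show "lift x lab (tail d) < H" using blocked[OF d f] by (simp add: l)
  qed
  moreover have "calm (lift x lab) ab" using m by (auto simp: mid_def quiet_def calm_def lift_def)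
  moreover have "pot f (lift x lab) + live x lab \<le> pot f lab"
  proof -
    \<comment> \<open>A dart with unlifted ends keeps its \<open>moves\<close>; otherwise they are
      at most \<open>k\<close>, which is charged to a lifted end. Summed with the mates, this costs
      \<open>2 * k\<close> per dart at a lifted tail.\<close>
    have per: "moves (lift x lab) d (f d) + (2 * k + 1 + fmax) * (H - lift x lab (tail d)) + (2 * k + 1 + fmax) * up (tail d)
        \<le> moves lab d (f d) + (2 * k + 1 + fmax) * (H - lab (tail d)) + k * up (tail d) + k * up (head d)" if d: "d < M" for d
    proof -
      have "lift x lab (tail d) \<le> H" using fe by (simp add: l up_def feasible_def)
      then have "H - lift x lab (tail d) + up (tail d) = H - lab (tail d)" by (auto simp: l)
      then have e: "(2 * k + 1 + fmax) * (H - lift x lab (tail d)) + (2 * k + 1 + fmax) * up (tail d)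
         = (2 * k + 1 + fmax) * (H - lab (tail d))" by (metis distrib_left)
      have "moves (lift x lab) d (f d) \<le> moves lab d (f d) + k * up (tail d) + k * up (head d)"
      proof (cases "up (tail d) = 0 \<and> up (head d) = 0")
        case True
        then show ?thesis by (simp add: moves_def tight_def rtight_def l)
      next
        case False
        then have "1 \<le> up (tail d) + up (head d)" by linarith
        then have "k * 1 \<le> k * (up (tail d) + up (head d))" by (rule mult_le_mono2)
        then show ?thesis using moves_le[of "lift x lab" d "f d"] by (simp add: distrib_left)
      qed
      with e show ?thesis by linarith
    qed
    have "pot f (lift x lab) + (\<Sum>d<M. (2 * k + 1 + fmax) * up (tail d)) \<le>
       pot f lab + (\<Sum>d<M. k * up (tail d)) + (\<Sum>d<M. k * up (head d))"
      unfolding pot_def sum.distrib[symmetric] by (rule sum_mono) (use per in auto)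
    also have "(\<Sum>d<M. k * up (head d)) = (\<Sum>d<M. k * up (tail d))"
      using sum_mate[of "\<lambda>d. k * up (tail d)"] mate by (metis (no_types, lifting) lessThan_iff sum.cong)
    finally have A: "pot f (lift x lab) + (\<Sum>d<M. (1 + fmax) * up (tail d)) \<le> pot f lab"
      unfolding sum_distrib_left[symmetric] by (simp add: algebra_simps)
    have "live x lab \<le> (\<Sum>v\<in>verts. \<Sum>d\<in>outs v. (1 + fmax) * up (tail d))"
      unfolding live_def
    proof (rule sum_mono)
      fix v assume v: "v \<in> verts"
      show "(if lab v < H then x v else 0) \<le> (\<Sum>d\<in>outs v. (1 + fmax) * up (tail d))"
      proof (cases "up v = 0")
        case True
        then show ?thesis using v by (auto simp: up_def split: if_splits)
      next
        case False
        then have u: "up v = 1" by (simp add: up_def split: if_splits)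
        from v obtain d where d: "d \<in> outs v" by (auto simp: verts_def outsD)
        \<comment> \<open>The excess consists of at most one source unit and \<open>fmax\<close>
          units per incident dart. Since \<open>v\<close> has some out-dart, this is at most
          \<open>1 + fmax\<close> per out-dart.\<close>
        have "x v \<le> 1 + (\<Sum>d\<in>ins v. f d)" using x_le[OF co, of v] by linarith
        also have "(\<Sum>d\<in>ins v. f d) = (\<Sum>d\<in>outs v. f (mate d))" by (rule sum_ins)
        also have "\<dots> \<le> (\<Sum>d\<in>outs v. fmax)"
          using flow_le_fmax[OF fe] mate by (intro sum_mono) (auto simp: outsD)
        also have "1 + \<dots> \<le> (\<Sum>d\<in>outs v. 1) + (\<Sum>d\<in>outs v. fmax)"
        proof -
          have "(\<Sum>d\<in>{d}. 1) \<le> (\<Sum>d\<in>outs v. 1::nat)" using d by (intro sum_mono2) auto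
          then show ?thesis by simp
        qed
        also have "\<dots> = (\<Sum>d\<in>outs v. (1 + fmax) * up (tail d))"
          unfolding sum.distrib[symmetric] using u by (intro sum.cong) (auto simp: outsD)
        finally show ?thesis by auto
      qed
    qed
    also have "\<dots> = (\<Sum>d<M. (1 + fmax) * up (tail d))" by (rule sum_verts)
    finally show ?thesis using A by linarith
  qed
  moreover have "live x (lift x lab) \<le> live x lab"
    unfolding live_def by (intro sum_mono) (auto simp: l)
  ultimately show ?thesis using m unfolding mid_def late_def by linarith
qed

section \<open>Delivery of units in transit and absorption\<close>

definition gather_amount :: "nat \<Rightarrow> (nat \<Rightarrow> nat) \<Rightarrow> nat \<Rightarrow> nat" where
  "gather_amount j p d = (if d < M \<and> rank d = j then p (mate d) else 0)"

definition gathered :: "nat \<Rightarrow> (nat \<Rightarrow> nat) \<Rightarrow> bool" where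
  "gathered j p \<longleftrightarrow> (\<forall>d<M. rank d < j \<longrightarrow> p (mate d) = 0)"

text \<open>Shared by flow rounds and draining rounds. A delivery to a vertex at label
  \<open>H\<close> leaves the count of live units, hence an inequality.\<close>

lemma gather_basic:
  assumes co: "conserved x f p ab" and ga: "gathered j p"
  defines "b \<equiv> gather_amount j p"
  shows "conserved (\<lambda>v. x v + sent b v) f (\<lambda>d. p d - b (mate d)) ab"
    "live (\<lambda>v. x v + sent b v) lab + (\<Sum>d<M. p d - b (mate d)) \<le> live x lab + (\<Sum>d<M. p d)"
    "gathered (Suc j) (\<lambda>d. p d - b (mate d))"
proof -
  have b: "b (mate d) \<le> p d" if "d < M" for d
    using mate[OF that] by (auto simp: b_def gather_amount_def)
  show "conserved (\<lambda>v. x v + sent b v) f (\<lambda>d. p d - b (mate d)) ab"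
    unfolding conserved_def
  proof
    fix v
    have "(\<Sum>d\<in>ins v. p d) = (\<Sum>d\<in>ins v. p d - b (mate d)) + sent b v"
      unfolding sent_def sum_outs[of b] sum.distrib[symmetric] using b by (auto intro!: sum.cong simp: insD)
    then show "sr v + (\<Sum>d\<in>ins v. f d) = x v + sent b v + ab v + (\<Sum>d\<in>outs v. f d) + (\<Sum>d\<in>ins v. p d - b (mate d))"
      using co unfolding conserved_def by (metis add.commute add.left_commute)
  qed
  have "(\<Sum>d<M. p d) = (\<Sum>d<M. p d - b (mate d)) + (\<Sum>d<M. b d)"
    unfolding sum_mate[of b, symmetric] sum.distrib[symmetric] using b by (auto intro!: sum.cong)
  moreover have "live (\<lambda>v. x v + sent b v) lab \<le> live x lab + (\<Sum>v\<in>verts. sent b v)"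
    unfolding live_def sum.distrib[symmetric] by (intro sum_mono) auto
  then have "live (\<lambda>v. x v + sent b v) lab \<le> live x lab + (\<Sum>d<M. b d)"
    by (simp add: sent_def sum_verts)
  ultimately show "live (\<lambda>v. x v + sent b v) lab + (\<Sum>d<M. p d - b (mate d)) \<le> live x lab + (\<Sum>d<M. p d)" by linarith
  show "gathered (Suc j) (\<lambda>d. p d - b (mate d))"
    using ga mate unfolding gathered_def b_def gather_amount_def by (auto simp: less_Suc_eq)
qed

lemma gather_step:
  assumes "late P0 L0 x f p lab ab" "gathered j p"
  defines "b \<equiv> gather_amount j p"
  shows "late P0 L0 (\<lambda>v. x v + sent b v) f (\<lambda>d. p d - b (mate d)) lab ab"
    "gathered (Suc j) (\<lambda>d. p d - b (mate d))"
  using gather_basic[of x f p ab j] assms unfolding late_def by (auto intro: order_trans)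

lemma gathered_all: "gathered 16 p \<Longrightarrow> d < M \<Longrightarrow> p d = 0"
  using mate[of d] rank_less[of "mate d"] unfolding gathered_def by metis

definition absorbing :: "(nat \<Rightarrow> nat) \<Rightarrow> (nat \<Rightarrow> nat) \<Rightarrow> nat \<Rightarrow> bool" where
  "absorbing x ab v \<longleftrightarrow> v \<in> verts \<and> fr v = 1 \<and> ab v = 0 \<and> 0 < x v"

text \<open>The number of live units never increases, and a round lowers \<open>pot\<close> by at
  least the number at its start. So \<open>pot + r * live\<close> stays below its initial value when
  \<open>r\<close> counts the rounds.\<close>

definition round_inv :: "nat \<Rightarrow> nat \<Rightarrow> (nat \<Rightarrow> nat) \<Rightarrow> (nat \<Rightarrow> nat) \<Rightarrow> (nat \<Rightarrow> nat) \<Rightarrow> (nat \<Rightarrow> nat) \<Rightarrow> (nat \<Rightarrow> nat) \<Rightarrow> bool" where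
  "round_inv POT r x f p lab ab \<longleftrightarrow> conserved x f p ab \<and> feasible f lab \<and> quiet x lab ab \<and>
     (\<forall>d<M. p d = 0) \<and> pot f lab + r * live x lab \<le> POT"

lemma round_start:
  assumes "round_inv POT r x f p lab ab"
  shows "mid (pot f lab) (live x lab) x f p lab ab" "pushed 0 x f lab"
  using assms by (auto simp: round_inv_def mid_def pushed_def)

lemma returned_0: "returned 0 x f lab" by (simp add: returned_def)
lemma gathered_0: "gathered 0 p" by (simp add: gathered_def)

lemma absorb_step:
  assumes la: "late P0 L0 x f p lab ab" and p: "gathered 16 p" and P0: "P0 + r * L0 \<le> POT"
  shows "round_inv POT (Suc r) (\<lambda>v. if absorbing x ab v then x v - 1 else x v) f p lab
    (\<lambda>v. if absorbing x ab v then 1 else ab v)"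
proof -
  let ?x = "\<lambda>v. if absorbing x ab v then x v - 1 else x v"
  let ?ab = "\<lambda>v. if absorbing x ab v then 1 else ab v"
  have s: "?x v + ?ab v = x v + ab v" for v by (auto simp: absorbing_def)
  from la have co: "conserved x f p ab" by (simp add: late_def)
  have "conserved ?x f p ?ab" unfolding conserved_def
  proof
    fix v show "sr v + (\<Sum>d\<in>ins v. f d) = ?x v + ?ab v + (\<Sum>d\<in>outs v. f d) + (\<Sum>d\<in>ins v. p d)"
      unfolding s using co by (simp add: conserved_def)
  qed
  moreover have "quiet ?x lab ?ab" unfolding quiet_def
  proof (intro allI conjI impI)
    fix v
    show "?ab v \<le> fr v" using la by (auto simp: late_def calm_def absorbing_def)
    assume v: "fr v = 1" "?ab v = 0"
    then have n: "\<not> absorbing x ab v" "ab v = 0" by (auto split: if_splits)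
    then show "lab v = 0" using la v by (simp add: late_def calm_def)
    show "?x v = 0"
    proof (cases "v \<in> verts")
      case True
      then show ?thesis using n v by (auto simp: absorbing_def)
    next
      case False
      then have "ins v = {}" using head_verts by (auto simp: insD)
      then have "sr v = x v + ab v + (\<Sum>d\<in>outs v. f d)"
        using co unfolding conserved_def by (metis add.right_neutral sum.empty)
      then show ?thesis using sr_verts[OF False] n by simp
    qed
  qed
  moreover have "live ?x lab \<le> L0"
  proof -
    have "live ?x lab \<le> live x lab" unfolding live_def by (intro sum_mono) auto
    then show ?thesis using la by (simp add: late_def)
  qed
  then have "pot f lab + Suc r * live ?x lab \<le> POT"
  proof -
    assume "live ?x lab \<le> L0"
    then have "Suc r * live ?x lab \<le> Suc r * L0" by (rule mult_le_mono2)
    moreover have "pot f lab + L0 \<le> P0" using la by (simp add: late_def)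
    ultimately show ?thesis using P0 by simp
  qed
  ultimately show ?thesis using la gathered_all[OF p] unfolding round_inv_def late_def by auto
qed

text \<open>The weight \<open>2 * k + 1 + k * (g + 3)\<close> is at most \<open>k * (g + 6)\<close>,
  and one more \<open>k * H\<close> absorbs the moves.\<close>

lemma pot_le:
  shows "pot f lab \<le> M * (k * H * (g + 7))"
proof -
  have "pot f lab \<le> (\<Sum>d<M. k * H * (g + 7))" unfolding pot_def
  proof (rule sum_mono)
    fix d
    have "1 \<le> H" using H by simp
    have "moves lab d (f d) \<le> k * H" using le_trans[OF moves_le[of lab d "f d"], of "k * H"] mult_le_mono2[OF \<open>1 \<le> H\<close>, of k] by simp
    moreover have "2 * k + 1 + fmax \<le> k * (g + 6)"
      unfolding fmax_def using k by (simp add: algebra_simps)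
    then have "(2 * k + 1 + fmax) * (H - lab (tail d)) \<le> k * (g + 6) * H" by (intro mult_le_mono) auto
    moreover have "k * H * (g + 7) = k * H + k * (g + 6) * H" by (simp add: algebra_simps)
    ultimately show "moves lab d (f d) + (2 * k + 1 + fmax) * (H - lab (tail d)) \<le> k * H * (g + 7)"
      by linarith
  qed
  then show ?thesis by simp
qed

text \<open>The origin of the number of rounds. With \<open>K = c * k\<close> the same
  \<open>2 * K * H * (g + 7)\<close> rounds serve every scale, because the initial potential shrinks
  with \<open>k\<close> by the same factor as the target for the live units.\<close>

lemma live_after:
  assumes "round_inv (M * (k * H * (g + 7))) (2 * K * H * (g + 7)) x f p lab ab" "K = c * k"
  shows "2 * c * live x lab \<le> M"
proof -
  have "(2 * K * H * (g + 7)) * live x lab \<le> M * (k * H * (g + 7))"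
    using assms(1) unfolding round_inv_def by linarith
  then have "(k * H * (g + 7)) * (2 * c * live x lab) \<le> (k * H * (g + 7)) * M"
    unfolding assms(2) by (simp add: algebra_simps)
  moreover have "0 < k * H * (g + 7)" using k H by simp
  ultimately show ?thesis by simp
qed

section \<open>Draining undelivered units back to their sources\<close>

text \<open>What is kept of feasibility while flow is cancelled: draining ignores prices and may
  break slackness.\<close>

definition descends :: "(nat \<Rightarrow> nat) \<Rightarrow> (nat \<Rightarrow> nat) \<Rightarrow> bool" where
  "descends f lab \<longleftrightarrow> (\<forall>d<M. f d \<le> fmax \<and> (0 < f d \<longrightarrow> lab (head d) < lab (tail d) \<and> lab (tail d) < H))"

text \<open>Draining goes by increasing label. A drained unit moves against the flow, hence to a
  strictly higher label, so a level that has been cleared is never disturbed again.\<close>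

definition settled :: "nat \<Rightarrow> (nat \<Rightarrow> nat) \<Rightarrow> (nat \<Rightarrow> nat) \<Rightarrow> (nat \<Rightarrow> nat) \<Rightarrow> bool" where
  "settled r x f lab \<longleftrightarrow> (\<forall>v. lab v < r \<longrightarrow> x v = 0 \<or> (\<forall>d\<in>ins v. f d = 0))"

definition upward :: "nat \<Rightarrow> (nat \<Rightarrow> nat) \<Rightarrow> (nat \<Rightarrow> nat) \<Rightarrow> bool" where
  "upward r p lab \<longleftrightarrow> (\<forall>d<M. 0 < p d \<longrightarrow> r \<le> lab (tail d) \<and> lab (tail d) < lab (head d))"

definition draining :: "nat \<Rightarrow> nat \<Rightarrow> (nat \<Rightarrow> nat) \<Rightarrow> (nat \<Rightarrow> nat) \<Rightarrow> (nat \<Rightarrow> nat) \<Rightarrow> (nat \<Rightarrow> nat) \<Rightarrow> (nat \<Rightarrow> nat) \<Rightarrow> bool" where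
  "draining r L x f p lab ab \<longleftrightarrow> conserved x f p ab \<and> descends f lab \<and> settled r x f lab \<and> live x lab + (\<Sum>d<M. p d) \<le> L"

definition drained :: "nat \<Rightarrow> (nat \<Rightarrow> nat) \<Rightarrow> (nat \<Rightarrow> nat) \<Rightarrow> bool" where
  "drained j x f \<longleftrightarrow> (\<forall>d<M. rank d < j \<longrightarrow> x (tail d) = 0 \<or> f (mate d) = 0)"

lemma drain_start:
  assumes "round_inv POT r x f p lab ab"
  shows "draining 0 (live x lab) x f p lab ab"
  using assms flow_descends flow_le_fmax by (auto simp: round_inv_def draining_def descends_def settled_def)

lemma drain_step:
  assumes m: "draining r L x f p lab ab" and up: "upward r p lab" and re: "drained j x f"
  defines "a \<equiv> drain_amount j x f"
  shows "draining r L (\<lambda>v. x v - sent a v) (\<lambda>d. f d - a (mate d)) (\<lambda>d. p d + a d) lab ab"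
    "upward r (\<lambda>d. p d + a d) lab"
    "drained (Suc j) (\<lambda>v. x v - sent a v) (\<lambda>d. f d - a (mate d))"
proof -
  have s: "sent a v \<le> x v" for v unfolding a_def by (rule sent_drain)
  have al: "a d \<le> f (mate d)" for d unfolding a_def drain_amount_def by auto
  have a: "0 < x (tail d) \<and> 0 < f (mate d) \<and> d < M" if "0 < a d" for d
    using that by (auto simp: a_def drain_amount_def split: if_splits)
  have de: "lab (head (mate d)) < lab (tail (mate d)) \<and> lab (tail (mate d)) < H" if "0 < a d" for d
    using m a[OF that] mate[of d] by (auto simp: draining_def descends_def)
  have ad: "lab (tail d) < lab (head d) \<and> lab (head d) < H" if "0 < a d" for d
    using de[OF that] mate[of d] head_mate[of d] a[OF that] by auto
  have st: "settled r x f lab" using m by (simp add: draining_def)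
  have "live (\<lambda>v. x v - sent a v) lab + (\<Sum>d<M. p d + a d) \<le> L"
  proof -
    have "lab (tail d) < H" if "0 < a d" for d using ad[OF that] by simp
    then show ?thesis using live_sent[of a x lab, OF s] m by (simp add: draining_def sum.distrib)
  qed
  moreover have "descends (\<lambda>d. f d - a (mate d)) lab"
    using m by (auto simp: draining_def descends_def intro: le_trans[OF diff_le_self])
  moreover have "settled r (\<lambda>v. x v - sent a v) (\<lambda>d. f d - a (mate d)) lab"
    using st by (auto simp: settled_def)
  ultimately show "draining r L (\<lambda>v. x v - sent a v) (\<lambda>d. f d - a (mate d)) (\<lambda>d. p d + a d) lab ab"
    using conserved_return[of x f p ab a, OF _ s al] m by (simp add: draining_def)
  \<comment> \<open>Below level \<open>r\<close> a vertex with excess has no inflow left to cancel,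
    so it sends nothing.\<close>
  have "r \<le> lab (tail d)" if "0 < a d" for d
  proof (rule ccontr)
    assume "\<not> ?thesis"
    then have "x (tail d) = 0 \<or> (\<forall>e\<in>ins (tail d). f e = 0)" using st by (simp add: settled_def)
    then show False using a[OF that] mate[of d] head_mate[of d] by (auto simp: insD)
  qed
  then show "upward r (\<lambda>d. p d + a d) lab" using up ad by (auto simp: upward_def)
  show "drained (Suc j) (\<lambda>v. x v - sent a v) (\<lambda>d. f d - a (mate d))"
    unfolding drained_def
  proof (intro allI impI)
    fix d assume d: "d < M" "rank d < Suc j"
    show "x (tail d) - sent a (tail d) = 0 \<or> f (mate d) - a (mate (mate d)) = 0"
    proof (cases "rank d = j")
      case False
      then show ?thesis using re d by (auto simp: drained_def)
    next
      case True
      have "sent a (tail d) = a d" unfolding sent_def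
        by (rule outs_rank[where j = j]) (use True d in \<open>auto simp: a_def drain_amount_def outsD\<close>)
      then show ?thesis using mate[OF d(1)] d True by (auto simp: a_def drain_amount_def)
    qed
  qed
qed

text \<open>Right after the pass every vertex, at whatever level, is out of excess or out of inflow.
  Only the deliveries still to come can spoil this, and they all arrive above level
  \<open>r\<close>.\<close>

lemma drained_all:
  assumes "draining r L x f p lab ab" "drained 16 x f"
  shows "draining (Suc r) L x f p lab ab"
proof -
  have "x v = 0 \<or> (\<forall>d\<in>ins v. f d = 0)" for v
  proof (cases "x v = 0")
    case False
    have "f d = 0" if "d \<in> ins v" for d
      using assms(2) mate[of d] that rank_less[of "mate d"] False unfolding drained_def insD by metis
    then show ?thesis by blast
  qed simp
  then show ?thesis using assms(1) by (simp add: draining_def settled_def)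
qed

lemma drain_gather:
  assumes dr: "draining (Suc r) L x f p lab ab" and up: "upward r p lab" and ga: "gathered j p"
  defines "b \<equiv> gather_amount j p"
  shows "draining (Suc r) L (\<lambda>v. x v + sent b v) f (\<lambda>d. p d - b (mate d)) lab ab"
    "upward r (\<lambda>d. p d - b (mate d)) lab" "gathered (Suc j) (\<lambda>d. p d - b (mate d))"
proof -
  have co: "conserved x f p ab" using dr by (simp add: draining_def)
  note gb = gather_basic[OF co ga, folded b_def]
  show "gathered (Suc j) (\<lambda>d. p d - b (mate d))" by (rule gb(3))
  show "upward r (\<lambda>d. p d - b (mate d)) lab" using up by (simp add: upward_def)
  have "sent b v = 0" if "lab v < Suc r" for v
    unfolding sent_def
  proof (rule sum.neutral, rule ballI)
    fix d assume d: "d \<in> outs v"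
    show "b d = 0"
    proof (rule ccontr)
      assume "b d \<noteq> 0"
      then have "0 < p (mate d)" "d < M" by (auto simp: b_def gather_amount_def split: if_splits)
      then have "r \<le> lab (tail (mate d)) \<and> lab (tail (mate d)) < lab (head (mate d))"
        using up mate[of d] unfolding upward_def by blast
      then show False using d that head_mate[OF \<open>d < M\<close>] by (simp add: outsD)
    qed
  qed
  then have "settled (Suc r) (\<lambda>v. x v + sent b v) f lab"
    using dr by (simp add: draining_def settled_def)
  then show "draining (Suc r) L (\<lambda>v. x v + sent b v) f (\<lambda>d. p d - b (mate d)) lab ab"
    using gb dr unfolding draining_def by (meson le_trans)
qed

section \<open>Growth of the total length\<close>

lemma cost_Suc: "cost d (Suc f) \<le> 2 * cost d f"
proof -
  have "Suc f div k \<le> f div k + 1" using k by (simp add: div_Suc)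
  then have "(2::nat) ^ (Suc f div k) \<le> 2 ^ (f div k + 1)" by (intro power_increasing) auto
  then show ?thesis unfolding cost_def by (simp add: mult.left_commute)
qed

text \<open>A full block pays for the doubling that follows it: \<open>k\<close> units at price
  \<open>c\<close> pay \<open>k * c\<close>, which is \<open>k\<close> times the increase of the
  price. The term \<open>f mod k\<close> records what the current block has paid so far and carries
  the induction.\<close>

lemma cost_block_sum: "(k + f mod k) * cost d f \<le> k * len d + (\<Sum>i<f. cost d i)"
proof (induction f)
  case 0
  then show ?case by (simp add: cost_def)
next
  case (Suc f)
  show ?case
  proof (cases "Suc (f mod k) = k")
    case True
    then have "Suc f mod k = 0" by (simp add: mod_Suc)
    moreover have "k * cost d (Suc f) \<le> (k + f mod k) * cost d f + cost d f"
    proof -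
      have "k * cost d (Suc f) \<le> k * (2 * cost d f)" by (rule mult_le_mono2[OF cost_Suc])
      also have "\<dots> = (k + Suc (f mod k)) * cost d f" using True by simp
      finally show ?thesis by simp
    qed
    ultimately show ?thesis using Suc.IH by simp
  next
    case False
    then have "Suc f mod k = Suc (f mod k)" "Suc f div k = f div k"
      using k by (auto simp: mod_Suc div_Suc)
    then show ?thesis using Suc.IH by (simp add: cost_def)
  qed
qed

text \<open>The increase of \<open>k\<close> times the price of a dart is paid by the units on it.
  Each unit pays at most twice its label drop, and label drops telescope along the flow to at most
  \<open>H\<close> per source unit.\<close>

lemma total_cost:
  assumes "conserved x f p ab" "feasible f lab"
  shows "k * (\<Sum>d<M. cost d (f d)) \<le> k * (\<Sum>d<M. len d) + 2 * H * (\<Sum>v\<in>verts. sr v)"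
proof -
  have per: "k * cost d (f d) + 2 * (f d * lab (head d)) \<le> k * len d + 2 * (f d * lab (tail d))" if d: "d < M" for d
  proof (cases "f d = 0")
    case False
    have "k * cost d (f d) \<le> (k + f d mod k) * cost d (f d)" by simp
    also have "\<dots> \<le> k * len d + (\<Sum>i<f d. cost d i)" by (rule cost_block_sum)
    also have "(\<Sum>i<f d. cost d i) \<le> (\<Sum>i<f d. cost d (f d - 1))" by (intro sum_mono cost_mono) auto
    also have "\<dots> = f d * cost d (f d - 1)" by simp
    finally have A: "k * cost d (f d) \<le> k * len d + f d * cost d (f d - 1)" by simp
    have "lab (head d) + cost d (f d - 1) \<le> lab (tail d) + 1" using assms(2) d False by (simp add: feasible_def)
    \<comment> \<open>The price is at most the drop plus 1 and at least 2, so it is at most twice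
      the drop; this is the factor 2 of the bound.\<close>
    with cost_ge[OF d, of "f d - 1"] have "cost d (f d - 1) + 2 * lab (head d) \<le> 2 * lab (tail d)" by linarith
    then have "f d * (cost d (f d - 1) + 2 * lab (head d)) \<le> f d * (2 * lab (tail d))" by (rule mult_le_mono2)
    with A show ?thesis by (simp add: algebra_simps)
  qed (simp add: cost_def)
  have "k * (\<Sum>d<M. cost d (f d)) + 2 * (\<Sum>d<M. f d * lab (head d)) \<le> k * (\<Sum>d<M. len d) + 2 * (\<Sum>d<M. f d * lab (tail d))"
    unfolding sum_distrib_left sum.distrib[symmetric] by (rule sum_mono) (use per in auto)
  \<comment> \<open>Summation by parts: regrouped by vertices, outflow is at most supply plus
    inflow, and labels are at most \<open>H\<close> on the supply.\<close>
  moreover have "(\<Sum>d<M. f d * lab (tail d)) \<le> H * (\<Sum>v\<in>verts. sr v) + (\<Sum>d<M. f d * lab (head d))"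
  proof -
    have "(\<Sum>d<M. f d * lab (tail d)) = (\<Sum>v\<in>verts. \<Sum>d\<in>outs v. f d * lab (tail d))" by (rule sum_verts[symmetric])
    also have "\<dots> = (\<Sum>v\<in>verts. lab v * (\<Sum>d\<in>outs v. f d))"
      unfolding sum_distrib_left by (intro sum.cong) (auto simp: outsD)
    also have "\<dots> \<le> (\<Sum>v\<in>verts. H * sr v + lab v * (\<Sum>d\<in>ins v. f d))"
    proof (rule sum_mono)
      fix v
      have "sr v + (\<Sum>d\<in>ins v. f d) = x v + ab v + (\<Sum>d\<in>outs v. f d) + (\<Sum>d\<in>ins v. p d)"
        using assms(1) unfolding conserved_def by blast
      then have "(\<Sum>d\<in>outs v. f d) \<le> sr v + (\<Sum>d\<in>ins v. f d)" by linarith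
      then have "lab v * (\<Sum>d\<in>outs v. f d) \<le> lab v * (sr v + (\<Sum>d\<in>ins v. f d))" by (rule mult_le_mono2)
      moreover have "lab v * sr v \<le> H * sr v" using assms(2) by (intro mult_le_mono1) (simp add: feasible_def)
      ultimately show "lab v * (\<Sum>d\<in>outs v. f d) \<le> H * sr v + lab v * (\<Sum>d\<in>ins v. f d)"
        unfolding distrib_left by linarith
    qed
    also have "\<dots> = H * (\<Sum>v\<in>verts. sr v) + (\<Sum>v\<in>verts. lab v * (\<Sum>d\<in>ins v. f d))"
      by (simp add: sum.distrib sum_distrib_left)
    also have "(\<Sum>v\<in>verts. lab v * (\<Sum>d\<in>ins v. f d)) = (\<Sum>v\<in>verts. \<Sum>d\<in>ins v. f d * lab (head d))"
      unfolding sum_distrib_left by (intro sum.cong) (auto simp: insD)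
    also have "\<dots> = (\<Sum>d<M. f d * lab (head d))" by (rule sum_verts_in)
    finally show ?thesis .
  qed
  ultimately show ?thesis by simp
qed

text \<open>One further unit at most doubles the price, and the price of the last unit is bounded by
  the label range. Lengths therefore stay at most \<open>2 * H\<close> in all scales.\<close>

lemma cost_le:
  assumes "feasible f lab" "d < M" "len d \<le> 2 * H"
  shows "cost d (f d) \<le> 2 * H"
proof (cases "f d = 0")
  case True
  then show ?thesis using assms(3) by (simp add: cost_def)
next
  case False
  with assms(1,2) have "lab (head d) + cost d (f d - 1) \<le> lab (tail d) + 1" "lab (tail d) < H"
    by (auto simp: feasible_def)
  then have "cost d (f d - 1) \<le> H" by simp
  then show ?thesis using cost_Suc[of d "f d - 1"] False by simp
qed

end

section \<open>Race-free loops over the darts of one rank\<close>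

abbreviation exp_min :: "exp \<Rightarrow> exp \<Rightarrow> exp" where "exp_min a b \<equiv> a \<ominus> (a \<ominus> b)"
abbreviation "vd \<equiv> Var ''d''"
abbreviation "vv \<equiv> Var ''v''"
abbreviation "ve \<equiv> Var ''e''"
abbreviation "va \<equiv> Var ''a''"

text \<open>Scans all darts and keeps those of rank \<open>J\<close>. For \<open>J = 0\<close> this
  is a loop over the vertices that have darts, with work proportional to the number of darts;
  isolated vertices cost nothing.\<close>

definition dart_loop :: "exp \<Rightarrow> com \<Rightarrow> com" where
  "dart_loop J c = ParFor ''d'' (Var ''M'') (Cond (Op Equal (Get ''rk'' vd) J)
     (Seq (Assign ''v'' (Get ''tl'' vd)) c) Skip)"

definition pass :: "com \<Rightarrow> com" where
  "pass c = For ''j'' (Num 16) (dart_loop (Var ''j'') c)"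

abbreviation leaders :: "com \<Rightarrow> com" where
  "leaders c \<equiv> dart_loop (Num 0) c"

definition same :: "string set \<Rightarrow> heap \<Rightarrow> heap \<Rightarrow> bool" where
  "same A h h' \<longleftrightarrow> (\<forall>a q. a \<notin> A \<longrightarrow> h' (a, q) = h (a, q))"

definition same_locals :: "string set \<Rightarrow> locals \<Rightarrow> locals \<Rightarrow> bool" where
  "same_locals A l l' \<longleftrightarrow> (\<forall>x. x \<notin> A \<longrightarrow> l' x = l x)"

lemma same_trans: "same A h h' \<Longrightarrow> same A h' h'' \<Longrightarrow> same A h h''"
  and same_mono: "same A h h' \<Longrightarrow> A \<subseteq> A' \<Longrightarrow> same A' h h'"
  and same_refl [simp]: "same A h h"
  by (auto simp: same_def)

lemma same_locals_trans: "same_locals A l l' \<Longrightarrow> same_locals A l' l'' \<Longrightarrow> same_locals A l l''"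
  and same_locals_mono: "same_locals A l l' \<Longrightarrow> A \<subseteq> A' \<Longrightarrow> same_locals A' l l'"
  and same_locals_refl [simp]: "same_locals A l l"
  by (auto simp: same_locals_def)

locale net_machine = network M tail head mate rank + machine \<phi> B Z
  for M tail head mate rank \<phi> B Z +
  assumes M_le: "M \<le> Z"
begin

definition wired :: "heap \<Rightarrow> bool" where
  "wired h \<longleftrightarrow> (\<forall>d<M. h (''tl'', d) = tail d \<and> h (''hd'', d) = head d \<and> h (''rv'', d) = mate d \<and> h (''rk'', d) = rank d)"

text \<open>The cells that belong to a dart: one per array at its tail, itself or its mate. The last
  alternative serves arrays in which every vertex owns \<open>W\<close> consecutive cells.\<close>

definition own :: "string set \<Rightarrow> string set \<Rightarrow> string set \<Rightarrow> string set \<Rightarrow> nat \<Rightarrow> nat \<Rightarrow> loc set" where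
  "own AT AD AM AB W d = {(a, q). a \<in> AT \<and> q = tail d \<or> a \<in> AD \<and> q = d \<or> a \<in> AM \<and> q = mate d \<or> a \<in> AB \<and> q div W = tail d}"

lemma mate_inj: "d < M \<Longrightarrow> e < M \<Longrightarrow> mate d = mate e \<Longrightarrow> d = e"
  using mate by metis

text \<open>Darts of equal rank differ in tail, index and mate, so their own cells are disjoint;
  every other read must go to arrays that the loop does not write. A body of cost 80 leaves enough
  of the budget 100 for the test of the rank and the lookup of the tail.\<close>

lemma run_dart_loop:
  assumes c: "com_ok c" "max_cost c \<le> 80" and J: "exp_ok J" "exp_cost J = 1" "\<And>d. val J (l(''d'' := d)) h = j" "\<And>d. reads J (l(''d'' := d)) h = {}"
    and l: "l ''M'' = M" and h: "wired h"
    and names: "''rk'' \<notin> AT \<union> AD \<union> AM \<union> AB" "''tl'' \<notin> AT \<union> AD \<union> AM \<union> AB"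
      "AT \<inter> (AD \<union> AM \<union> AB) = {}" "AD \<inter> (AM \<union> AB) = {}" "AM \<inter> AB = {}"
    and body: "\<And>d. d < M \<Longrightarrow> rank d = j \<Longrightarrow> small l h \<Longrightarrow> wp c (l(''d'' := d, ''v'' := tail d)) h (\<lambda>l' h'' R W.
        R \<subseteq> {(a, q). a \<notin> AT \<union> AD \<union> AM \<union> AB} \<union> own AT AD AM AB Wd d \<and> W \<subseteq> own AT AD AM AB Wd d \<and>
        (\<forall>q\<in>own AT AD AM AB Wd d. h'' q = h' q))"
    and frame: "\<And>q. (\<And>d. d < M \<Longrightarrow> rank d = j \<Longrightarrow> q \<notin> own AT AD AM AB Wd d) \<Longrightarrow> h' q = h q"
  shows "run (dart_loop J c) l h (100 * (M + 1)) 100 (\<lambda>l1 h1. l1 = l \<and> h1 = h')"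
proof -
  let ?own = "own AT AD AM AB Wd"
  let ?RO = "{(a, q::nat). a \<notin> AT \<union> AD \<union> AM \<union> AB}"
  let ?WS = "\<lambda>d. if rank d = j then ?own d else {}"
  let ?RS = "\<lambda>d. if rank d = j then ?RO \<union> ?own d else ?RO"
  show ?thesis unfolding dart_loop_def
  proof (rule run_par[where N = M and RS = ?RS and WS = ?WS])
    show "exp_ok (Var ''M'')" by simp
    show "com_ok (Cond (Op Equal (Get ''rk'' vd) J) (Seq (Assign ''v'' (Get ''tl'' vd)) c) Skip)"
      using c J by simp
    show "val (Var ''M'') l h = M" using l by simp
    show "M \<le> Z" by (rule M_le)
    show "exp_cost (Var ''M'') + max_cost (Cond (Op Equal (Get ''rk'' vd) J) (Seq (Assign ''v'' (Get ''tl'' vd)) c) Skip) + 2 \<le> 100"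
      using c J by simp
  next
    fix d assume d: "d < M" and sm: "small l h"
    have hv: "h (''rk'', d) = rank d" "h (''tl'', d) = tail d" using h d by (auto simp: wired_def)
    have tz: "tail d \<le> Z" using smallD(2)[OF sm, of "(''tl'', d)"] hv by simp
    show "wp (Cond (Op Equal (Get ''rk'' vd) J) (Seq (Assign ''v'' (Get ''tl'' vd)) c) Skip) (l(''d'' := d)) h
        (\<lambda>l' h'' R W. R \<subseteq> ?RS d \<and> W \<subseteq> ?WS d \<and> (\<forall>q\<in>?WS d. h'' q = h' q))"
    proof (cases "rank d = j")
      case True
      have "wp c (l(''d'' := d, ''v'' := tail d)) h (\<lambda>l' h'' R W. {(''rk'', d), (''tl'', d)} \<union> R \<subseteq> ?RS d \<and> W \<subseteq> ?WS d \<and> (\<forall>q\<in>?WS d. h'' q = h' q))"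
        using body[OF d True sm] names True by simp
      then show ?thesis using True J hv tz by (simp add: insert_absorb)
    next
      case False
      then show ?thesis using J hv names by simp
    qed
  next
    fix d e q assume de: "d < M" "e < M" "d \<noteq> e" "q \<in> ?WS d"
    then have q: "q \<in> ?own d" "rank d = j" by (auto split: if_splits)
    obtain a y where ay: "q = (a, y)" by (cases q)
    have "q \<notin> ?own e" if "rank e = j"
      using q ay names(3-5) de rank_inj[of d e] mate_inj[of d e] that unfolding own_def by auto
    moreover have "q \<notin> ?RO" using q ay by (auto simp: own_def)
    ultimately show "q \<notin> ?RS e \<and> q \<notin> ?WS e" by auto
  next
    fix q assume "\<And>d. d < M \<Longrightarrow> q \<notin> ?WS d"
    then show "h' q = h q" by (intro frame) (metis (no_types))
  qed
qed

lemma run_for16: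
  assumes I: "I 0 h" and step: "\<And>j l' h'. j < 16 \<Longrightarrow> same_locals {''j''} l l' \<Longrightarrow> l' ''j'' = j \<Longrightarrow> I j h' \<Longrightarrow>
      run c l' h' (100 * (M + 1)) 100 (\<lambda>l1 h1. l1 = l' \<and> I (Suc j) h1)"
  shows "run (For ''j'' (Num 16) c) l h (1800 * (M + 1)) 1800 (\<lambda>l' h'. same_locals {''j''} l l' \<and> I 16 h')"
proof -
  define Inv where "Inv = (\<lambda>j l' h'. same_locals {''j''} l l' \<and> l' ''j'' = j \<and> I j h')"
  have "run (For ''j'' (Num 16) c) l h (16 * (100 * (M + 1) + exp_cost (Num 16) + 7) + (exp_cost (Num 16) + 5))
    (16 * (100 + exp_cost (Num 16) + 7) + (exp_cost (Num 16) + 5)) (Inv 16)"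
  proof (rule run_for)
    show "Inv 0 (l(''j'' := 0)) h" using I by (simp add: Inv_def same_locals_def)
    show "exp_ok (Num 16)" by simp
    show "16 \<le> Z" using Z_ge by simp
  next
    fix j l' h' assume "Inv j l' h'"
    then show "l' ''j'' = j \<and> val (Num 16) l' h' = 16" by (simp add: Inv_def)
  next
    fix j l' h' assume j: "j < 16" and "Inv j l' h'"
    then have i: "same_locals {''j''} l l'" "l' ''j'' = j" "I j h'" by (auto simp: Inv_def)
    show "run c l' h' (100 * (M + 1)) 100 (\<lambda>l'' h''. l'' ''j'' = j \<and> Inv (Suc j) (l''(''j'' := Suc j)) h'')"
      by (rule run_weaken[OF step[OF j i]]) (use i in \<open>auto simp: Inv_def same_locals_def\<close>)
  qed
  then show ?thesis by (rule run_weaken) (auto simp: Inv_def)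
qed

lemmas run_pass = run_for16[where c = "dart_loop (Var ''j'') c" for c, folded pass_def]

end

section \<open>Programs for rounds of flow and of draining\<close>

text \<open>Powers of two come from the table \<open>pw\<close>, whose entries up to
  \<open>g + 3\<close> suffice by the bound \<open>fmax\<close> on the flow.\<close>

definition cost_exp :: "exp \<Rightarrow> exp \<Rightarrow> exp" where
  "cost_exp d f = Get ''len'' d \<otimes> Get ''pw'' (f \<oslash> Var ''k'')"

definition move_units :: "exp \<Rightarrow> exp \<Rightarrow> com" where
  "move_units e fe = Seq (Put ''p'' vd (Get ''p'' vd \<oplus> va)) (Seq (Put ''f'' e fe)
     (Put ''x'' vv (Get ''x'' vv \<ominus> va)))"

definition push_body :: com where
  "push_body = Seq (Cond (Op Less (Get ''lab'' vv) (Var ''H'')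
        \<otimes> Op Equal (Get ''lab'' vv) (Get ''lab'' (Get ''hd'' vd) \<oplus> cost_exp vd (Get ''f'' vd)))
      (Assign ''a'' (exp_min (Get ''x'' vv) (Var ''k'' \<ominus> Op Mod (Get ''f'' vd) (Var ''k''))))
      (Assign ''a'' (Num 0)))
    (move_units vd (Get ''f'' vd \<oplus> va))"

definition return_body :: com where
  "return_body = Seq (Assign ''e'' (Get ''rv'' vd)) (Seq
     (Cond (Op Less (Num 0) (Get ''f'' ve)
        \<otimes> Op Equal (Get ''lab'' (Get ''hd'' vd) \<oplus> Num 1) (Get ''lab'' vv \<oplus> cost_exp ve (Get ''f'' ve \<ominus> Num 1)))
      (Assign ''a'' (exp_min (Get ''x'' vv) (Op Mod (Get ''f'' ve \<ominus> Num 1) (Var ''k'') \<oplus> Num 1)))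
      (Assign ''a'' (Num 0)))
    (move_units ve (Get ''f'' ve \<ominus> va)))"

definition drain_body :: com where
  "drain_body = Seq (Assign ''e'' (Get ''rv'' vd)) (Seq
      (Assign ''a'' (exp_min (Get ''x'' vv) (Get ''f'' ve)))
    (move_units ve (Get ''f'' ve \<ominus> va)))"

text \<open>The receiving vertex collects through its own out-dart what was sent along the mate, so
  that excess is only ever written at the tail.\<close>

definition gather_body :: com where
  "gather_body = Seq (Assign ''e'' (Get ''rv'' vd)) (Seq
      (Put ''x'' vv (Get ''x'' vv \<oplus> Get ''p'' ve)) (Put ''p'' ve (Num 0)))"

definition lift_body :: com where
  "lift_body = Cond (Op Less (Num 0) (Get ''x'' vv) \<otimes> Op Less (Get ''lab'' vv) (Var ''H''))
     (Put ''lab'' vv (Get ''lab'' vv \<oplus> Num 1)) Skip"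

definition absorb_body :: com where
  "absorb_body = Cond (Op Equal (Get ''fr'' vv) (Num 1) \<otimes> (Op Equal (Get ''ab'' vv) (Num 0)
       \<otimes> Op Less (Num 0) (Get ''x'' vv)))
     (Seq (Put ''ab'' vv (Num 1)) (Put ''x'' vv (Get ''x'' vv \<ominus> Num 1))) Skip"

definition flow_round :: com where
  "flow_round = Seq (pass push_body) (Seq (pass return_body) (Seq (leaders lift_body)
     (Seq (pass gather_body) (leaders absorb_body))))"

definition drain_round :: com where
  "drain_round = Seq (pass drain_body) (pass gather_body)"

lemma min_nat_diff: "(a::nat) - (a - b) = min a b"
  by auto

locale scale_machine = flow_scale M tail head mate rank k H g len sr fr + net_machine M tail head mate rank \<phi> B Z
  for M tail head mate rank k H g len sr fr \<phi> B Z +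
  assumes big: "M * (k * H * (g + 7)) + 2 * M * fmax + 2 * H + 3 \<le> Z" and k_le: "k \<le> Z"
begin

definition ready :: "heap \<Rightarrow> bool" where
  "ready h \<longleftrightarrow> wired h \<and> (\<forall>d<M. h (''len'', d) = len d) \<and> (\<forall>b\<le>g + 3. h (''pw'', b) = 2 ^ b) \<and> (\<forall>v. h (''fr'', v) = fr v)"

definition params :: "locals \<Rightarrow> bool" where
  "params l \<longleftrightarrow> l ''M'' = M \<and> l ''k'' = k \<and> l ''H'' = H"

abbreviation "X h \<equiv> \<lambda>v. h (''x'', v)"
abbreviation "F h \<equiv> \<lambda>d. h (''f'', d)"
abbreviation "P h \<equiv> \<lambda>d. h (''p'', d)"
abbreviation "L h \<equiv> \<lambda>v. h (''lab'', v)"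
abbreviation "A h \<equiv> \<lambda>v. h (''ab'', v)"

abbreviation "dyn \<equiv> {''x'', ''f'', ''p'', ''lab'', ''ab''}"

lemma ready_same: "ready h \<Longrightarrow> same dyn h h' \<Longrightarrow> ready h'"
  by (simp add: ready_def same_def wired_def)

lemma wired_ready: "ready h \<Longrightarrow> wired h" by (simp add: ready_def)

text \<open>A closed form of the whole heap after a pass over one rank. The amounts vanish on
  inactive darts, so the updates act as the identity there.\<close>

definition after_push :: "heap \<Rightarrow> (nat \<Rightarrow> nat) \<Rightarrow> heap" where
  "after_push h a = upd (upd (upd h ''x'' (\<lambda>v. X h v - sent a v)) ''f'' (\<lambda>d. F h d + a d)) ''p'' (\<lambda>d. P h d + a d)"

definition after_return :: "heap \<Rightarrow> (nat \<Rightarrow> nat) \<Rightarrow> heap" where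
  "after_return h a = upd (upd (upd h ''x'' (\<lambda>v. X h v - sent a v)) ''f'' (\<lambda>d. F h d - a (mate d))) ''p'' (\<lambda>d. P h d + a d)"

definition after_gather :: "heap \<Rightarrow> (nat \<Rightarrow> nat) \<Rightarrow> heap" where
  "after_gather h b = upd (upd h ''x'' (\<lambda>v. X h v + sent b v)) ''p'' (\<lambda>d. P h d - b (mate d))"

lemma div_fmax: "f \<le> fmax \<Longrightarrow> f div k \<le> g + 3"
  using k div_le_mono[of f fmax k] by (simp add: fmax_def)

lemma own_push: "own {''x''} {''f'', ''p''} {} {} W d = {(''x'', tail d), (''f'', d), (''p'', d)}"
  and own_return: "own {''x''} {''p''} {''f''} {} W d = {(''x'', tail d), (''p'', d), (''f'', mate d)}"
  and own_gather: "own {''x''} {} {''p''} {} W d = {(''x'', tail d), (''p'', mate d)}"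
  unfolding own_def by blast+

lemma run_push:
  assumes l: "params l" "l ''j'' = j" and h: "ready h" and fe: "feasible (F h) (L h)"
    and a: "a = push_amount j (X h) (F h) (L h)"
    and bd: "\<And>d. d < M \<Longrightarrow> F h d + a d \<le> Z \<and> P h d + a d \<le> Z"
  shows "run (dart_loop (Var ''j'') push_body) l h (100 * (M + 1)) 100 (\<lambda>l1 h1. l1 = l \<and> h1 = after_push h a)"
proof (rule run_dart_loop[where j = j and AT = "{''x''}" and AD = "{''f'', ''p''}" and AM = "{}" and AB = "{}" and Wd = 0])
  have a0: "a e = 0" if "rank e \<noteq> j" for e using that by (simp add: a push_amount_def)
  fix d assume d: "d < M" "rank d = j" and sm: "small l h"
  have hd: "h (''hd'', d) = head d" "h (''len'', d) = len d" using h d by (auto simp: ready_def wired_def)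
  have pw: "h (''pw'', F h d div k) = 2 ^ (F h d div k)"
    using h div_fmax[OF flow_le_fmax[OF fe d(1)]] by (simp add: ready_def)
  have sd: "sent a (tail d) = a d" using sent_rank[OF a0 d] .
  have ad: "a d = (if L h (tail d) < H \<and> L h (tail d) = L h (head d) + len d * 2 ^ (F h d div k) then min (X h (tail d)) (k - F h d mod k) else 0)"
    unfolding a push_amount_def using d by (simp add: tight_def cost_def)
  have z: "X h (tail d) \<le> Z" "F h d + a d \<le> Z" "P h d + a d \<le> Z" using smallD(2)[OF sm] bd[OF d(1)] by auto
  show "wp push_body (l(''d'' := d, ''v'' := tail d)) h (\<lambda>l' h'' R W.
        R \<subseteq> {(a, q). a \<notin> {''x''} \<union> {''f'', ''p''} \<union> {} \<union> {}} \<union> own {''x''} {''f'', ''p''} {} {} 0 d \<and> W \<subseteq> own {''x''} {''f'', ''p''} {} {} 0 d \<and>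
        (\<forall>q\<in>own {''x''} {''f'', ''p''} {} {} 0 d. h'' q = after_push h a q))"
  proof -
    have z': "a d \<le> Z" "X h (tail d) - a d \<le> Z" using z by auto
    consider "\<not> L h (tail d) < H" | "L h (tail d) < H" "L h (tail d) \<noteq> L h (head d) + len d * 2 ^ (F h d div k)"
      | "L h (tail d) < H" "L h (tail d) = L h (head d) + len d * 2 ^ (F h d div k)" by blast
    then show ?thesis
    proof cases
      case 3
      then have ad: "min (X h (tail d)) (k - F h d mod k) = a d" using ad by simp
      show ?thesis
        using l z z' 3(1) 3(2)[symmetric]
        by (simp add: push_body_def move_units_def cost_exp_def params_def min_nat_diff own_push after_push_def ad hd pw sd)
    next
      case 2
      then have "a d = 0" using ad by simp
      then show ?thesis
        using l z z' 2
        by (simp add: push_body_def move_units_def cost_exp_def params_def own_push after_push_def hd pw sd)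
    next
      case 1
      then have "a d = 0" using ad by simp
      then show ?thesis
        using l z z' 1
        by (simp add: push_body_def move_units_def cost_exp_def params_def own_push after_push_def hd pw sd)
    qed
  qed
next
  fix q assume q: "\<And>d. d < M \<Longrightarrow> rank d = j \<Longrightarrow> q \<notin> own {''x''} {''f'', ''p''} {} {} 0 d"
  have a0: "a e = 0" if "rank e \<noteq> j" for e using that by (simp add: a push_amount_def)
  obtain b y where qe: "q = (b, y)" by (cases q)
  consider "b = ''x''" | "b = ''f'' \<or> b = ''p''" | "b \<noteq> ''x''" "b \<noteq> ''f''" "b \<noteq> ''p''" by blast
  then show "after_push h a q = h q"
  proof cases
    case 1
    then have "sent a y = 0" using q by (intro sent_none[of j, OF _ a0]) (auto simp: own_push qe)
    then show ?thesis using 1 by (simp add: after_push_def qe)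
  next
    case 2
    then have "a y = 0" using q[of y] by (auto simp: own_push qe a push_amount_def)
    then show ?thesis using 2 by (auto simp: after_push_def qe)
  next
    case 3
    then show ?thesis by (simp add: after_push_def qe)
  qed
qed (use l h in \<open>auto simp: params_def ready_def push_body_def move_units_def cost_exp_def\<close>)

lemma return_frame:
  assumes a0: "\<And>e. rank e \<noteq> j \<or> M \<le> e \<Longrightarrow> a e = 0"
    and q: "\<And>d. d < M \<Longrightarrow> rank d = j \<Longrightarrow> q \<notin> own {''x''} {''p''} {''f''} {} 0 d"
  shows "after_return h a q = h q"
proof -
  obtain b y where qe: "q = (b, y)" by (cases q)
  consider "b = ''x''" | "b = ''p''" | "b = ''f''" | "b \<noteq> ''x''" "b \<noteq> ''f''" "b \<noteq> ''p''" by blast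
  then show ?thesis
  proof cases
    case 1
    then have "sent a y = 0" using q a0 by (intro sent_none[of j]) (auto simp: own_return qe)
    then show ?thesis using 1 by (simp add: after_return_def qe)
  next
    case 2
    have "a y = 0" using q[of y] a0[of y] 2 by (cases "y < M") (auto simp: own_return qe)
    then show ?thesis using 2 by (simp add: after_return_def qe)
  next
    case 3
    have "a (mate y) = 0"
    proof (cases "y < M")
      case True
      then show ?thesis using q[of "mate y"] a0[of "mate y"] 3 mate[OF True] by (auto simp: own_return qe)
    next
      case False
      then show ?thesis using a0[of y] mate_out[of y] by simp
    qed
    then show ?thesis using 3 by (simp add: after_return_def qe)
  next
    case 4
    then show ?thesis by (simp add: after_return_def qe)
  qed
qed

lemma run_return:
  assumes l: "params l" "l ''j'' = j" and h: "ready h" and fe: "feasible (F h) (L h)"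
    and a: "a = return_amount j (X h) (F h) (L h)"
    and bd: "\<And>d. d < M \<Longrightarrow> P h d + a d \<le> Z"
  shows "run (dart_loop (Var ''j'') return_body) l h (100 * (M + 1)) 100 (\<lambda>l1 h1. l1 = l \<and> h1 = after_return h a)"
proof (rule run_dart_loop[where j = j and AT = "{''x''}" and AD = "{''p''}" and AM = "{''f''}" and AB = "{}" and Wd = 0])
  have a0: "a e = 0" if "rank e \<noteq> j \<or> M \<le> e" for e using that by (auto simp: a return_amount_def)
  fix d assume d: "d < M" "rank d = j" and sm: "small l h"
  let ?e = "mate d"
  have e: "?e < M" "mate ?e = d" "tail ?e = head d" "head ?e = tail d" using mate[OF d(1)] head_mate[OF d(1)] by auto
  have hd: "h (''hd'', d) = head d" "h (''rv'', d) = ?e" "h (''len'', ?e) = len ?e" using h d e by (auto simp: ready_def wired_def)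
  have "(F h ?e - 1) div k \<le> g + 3" using flow_le_fmax[OF fe e(1)] by (intro div_fmax) simp
  then have pw: "h (''pw'', (F h ?e - 1) div k) = 2 ^ ((F h ?e - 1) div k)"
    using h by (simp add: ready_def)
  have sd: "sent a (tail d) = a d" using sent_rank[of j a d] a0 d by blast
  have ad: "a d = (if 0 < F h ?e \<and> L h (head d) + 1 = L h (tail d) + len ?e * 2 ^ ((F h ?e - 1) div k) then min (X h (tail d)) ((F h ?e - 1) mod k + 1) else 0)"
    unfolding a return_amount_def using d e by (simp add: rtight_def cost_def)
  have ez: "?e \<le> Z" using smallD(2)[OF sm, of "(''rv'', d)"] hd by simp
  have z: "X h (tail d) \<le> Z" "F h ?e \<le> Z" "P h d + a d \<le> Z" using smallD(2)[OF sm] bd[OF d(1)] by auto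
  show "wp return_body (l(''d'' := d, ''v'' := tail d)) h (\<lambda>l' h'' R W.
        R \<subseteq> {(a, q). a \<notin> {''x''} \<union> {''p''} \<union> {''f''} \<union> {}} \<union> own {''x''} {''p''} {''f''} {} 0 d \<and> W \<subseteq> own {''x''} {''p''} {''f''} {} 0 d \<and>
        (\<forall>q\<in>own {''x''} {''p''} {''f''} {} 0 d. h'' q = after_return h a q))"
  proof -
    have z': "a d \<le> Z" "X h (tail d) - a d \<le> Z" "F h ?e - a d \<le> Z" using z by auto
    consider "F h ?e = 0" | "0 < F h ?e" "L h (head d) + 1 \<noteq> L h (tail d) + len ?e * 2 ^ ((F h ?e - 1) div k)"
      | "0 < F h ?e" "L h (head d) + 1 = L h (tail d) + len ?e * 2 ^ ((F h ?e - 1) div k)" by blast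
    then show ?thesis
    proof cases
      case 3
      then have ad: "min (X h (tail d)) (Suc ((F h ?e - Suc 0) mod k)) = a d" using ad by simp
      show ?thesis
        using l z z' ez 3
        by (simp add: return_body_def move_units_def cost_exp_def params_def min_nat_diff own_return after_return_def ad hd pw[simplified] sd e)
    next
      case 2
      then have "a d = 0" using ad by simp
      then show ?thesis
        using l z z' ez 2
        by (simp add: return_body_def move_units_def cost_exp_def params_def own_return after_return_def hd pw[simplified] sd e)
    next
      case 1
      then have "a d = 0" using ad by simp
      then show ?thesis
        using l z z' ez 1
        by (simp add: return_body_def move_units_def cost_exp_def params_def own_return after_return_def hd pw[simplified] sd e)
    qed
  qed
next
  fix q assume q: "\<And>d. d < M \<Longrightarrow> rank d = j \<Longrightarrow> q \<notin> own {''x''} {''p''} {''f''} {} 0 d"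
  show "after_return h a q = h q" by (rule return_frame[OF _ q]) (auto simp: a return_amount_def)
qed (use l h in \<open>auto simp: params_def ready_def return_body_def move_units_def cost_exp_def\<close>)

lemma run_drain:
  assumes l: "params l" "l ''j'' = j" and h: "ready h"
    and a: "a = drain_amount j (X h) (F h)"
    and bd: "\<And>d. d < M \<Longrightarrow> P h d + a d \<le> Z"
  shows "run (dart_loop (Var ''j'') drain_body) l h (100 * (M + 1)) 100 (\<lambda>l1 h1. l1 = l \<and> h1 = after_return h a)"
proof (rule run_dart_loop[where j = j and AT = "{''x''}" and AD = "{''p''}" and AM = "{''f''}" and AB = "{}" and Wd = 0])
  have a0: "a e = 0" if "rank e \<noteq> j \<or> M \<le> e" for e using that by (auto simp: a drain_amount_def)
  fix d assume d: "d < M" "rank d = j" and sm: "small l h"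
  let ?e = "mate d"
  have e: "?e < M" "mate ?e = d" "tail ?e = head d" "head ?e = tail d" using mate[OF d(1)] head_mate[OF d(1)] by auto
  have hd: "h (''rv'', d) = ?e" using h d e by (auto simp: ready_def wired_def)
  have sd: "sent a (tail d) = a d" using sent_rank[of j a d] a0 d by blast
  have ad: "a d = min (X h (tail d)) (F h ?e)"
    unfolding a drain_amount_def using d e by simp
  have ez: "?e \<le> Z" using smallD(2)[OF sm, of "(''rv'', d)"] hd by simp
  have z: "X h (tail d) \<le> Z" "F h ?e \<le> Z" "P h d + a d \<le> Z" using smallD(2)[OF sm] bd[OF d(1)] by auto
  show "wp drain_body (l(''d'' := d, ''v'' := tail d)) h (\<lambda>l' h'' R W.
        R \<subseteq> {(a, q). a \<notin> {''x''} \<union> {''p''} \<union> {''f''} \<union> {}} \<union> own {''x''} {''p''} {''f''} {} 0 d \<and> W \<subseteq> own {''x''} {''p''} {''f''} {} 0 d \<and>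
        (\<forall>q\<in>own {''x''} {''p''} {''f''} {} 0 d. h'' q = after_return h a q))"
  proof -
    have z': "a d \<le> Z" "X h (tail d) - a d \<le> Z" "F h ?e - a d \<le> Z" using z by auto
    show ?thesis
      using l z z' ez
      by (simp add: drain_body_def move_units_def params_def min_nat_diff own_return after_return_def ad[symmetric] hd sd e)
  qed
next
  fix q assume q: "\<And>d. d < M \<Longrightarrow> rank d = j \<Longrightarrow> q \<notin> own {''x''} {''p''} {''f''} {} 0 d"
  show "after_return h a q = h q" by (rule return_frame[OF _ q]) (auto simp: a drain_amount_def)
qed (use l h in \<open>auto simp: params_def ready_def drain_body_def move_units_def\<close>)

lemma run_gather:
  assumes l: "params l" "l ''j'' = j" and h: "ready h"
    and b: "b = gather_amount j (P h)"
    and bd: "\<And>d. d < M \<Longrightarrow> X h (tail d) + b d \<le> Z"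
  shows "run (dart_loop (Var ''j'') gather_body) l h (100 * (M + 1)) 100 (\<lambda>l1 h1. l1 = l \<and> h1 = after_gather h b)"
proof (rule run_dart_loop[where j = j and AT = "{''x''}" and AD = "{}" and AM = "{''p''}" and AB = "{}" and Wd = 0])
  have b0: "b e = 0" if "rank e \<noteq> j \<or> M \<le> e" for e using that by (auto simp: b gather_amount_def)
  {
    fix d assume d: "d < M" "rank d = j" and sm: "small l h"
    let ?e = "mate d"
    have e: "?e < M" "mate ?e = d" "tail ?e = head d" "head ?e = tail d" using mate[OF d(1)] head_mate[OF d(1)] by auto
    have hd: "h (''rv'', d) = ?e" using h d e by (auto simp: ready_def wired_def)
    have sd: "sent b (tail d) = b d" using sent_rank[of j b d] b0 d by blast
    have ad: "b d = P h ?e" unfolding b gather_amount_def using d e by simp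
    have ez: "?e \<le> Z" using smallD(2)[OF sm, of "(''rv'', d)"] hd by simp
    have z: "X h (tail d) + b d \<le> Z" using bd[OF d(1)] by auto
    show "wp gather_body (l(''d'' := d, ''v'' := tail d)) h (\<lambda>l' h'' R W.
        R \<subseteq> {(a, q). a \<notin> {''x''} \<union> {} \<union> {''p''} \<union> {}} \<union> own {''x''} {} {''p''} {} 0 d \<and> W \<subseteq> own {''x''} {} {''p''} {} 0 d \<and>
        (\<forall>q\<in>own {''x''} {} {''p''} {} 0 d. h'' q = after_gather h b q))"
      using l hd sd z e ez
      by (simp add: gather_body_def params_def own_gather after_gather_def ad)
  next
    fix q assume q: "\<And>d. d < M \<Longrightarrow> rank d = j \<Longrightarrow> q \<notin> own {''x''} {} {''p''} {} 0 d"
    obtain c y where qe: "q = (c, y)" by (cases q)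
    consider "c = ''x''" | "c = ''p''" | "c \<noteq> ''x''" "c \<noteq> ''p''" by blast
    then show "after_gather h b q = h q"
    proof cases
      case 1
      then have "sent b y = 0" using q b0 by (intro sent_none[of j]) (auto simp: own_gather qe)
      then show ?thesis using 1 by (simp add: after_gather_def qe)
    next
      case 2
      have "b (mate y) = 0"
      proof (cases "y < M")
        case True
        then show ?thesis using q[of "mate y"] b0[of "mate y"] 2 mate[OF True] by (auto simp: own_gather qe)
      next
        case False
        then show ?thesis using b0[of y] mate_out[of y] by simp
      qed
      then show ?thesis using 2 by (simp add: after_gather_def qe)
    next
      case 3
      then show ?thesis by (simp add: after_gather_def qe)
    qed
  }
qed (use l h in \<open>auto simp: params_def ready_def gather_body_def\<close>)

end

context scale_machine
begin

lemma verts_leader: "v \<in> verts \<longleftrightarrow> (\<exists>d<M. rank d = 0 \<and> tail d = v)"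
proof
  assume "v \<in> verts"
  then obtain d where "d < M" "tail d = v" by (auto simp: verts_def)
  then show "\<exists>d<M. rank d = 0 \<and> tail d = v" using rank_0[of d] by auto
qed (auto simp: verts_def)

lemma own_tail: "own AT {} {} {} W d = AT \<times> {tail d}"
  by (auto simp: own_def)

lemma run_lift:
  assumes l: "params l" and h: "ready h"
  shows "run (leaders lift_body) l h (100 * (M + 1)) 100
    (\<lambda>l1 h1. l1 = l \<and> h1 = upd h ''lab'' (lift (X h) (L h)))"
proof (rule run_dart_loop[where j = 0 and AT = "{''lab''}" and AD = "{}" and AM = "{}" and AB = "{}" and Wd = 0])
  fix d assume d: "d < M" "rank d = 0" and sm: "small l h"
  have v: "tail d \<in> verts" using d verts_leader by blast
  show "wp lift_body (l(''d'' := d, ''v'' := tail d)) h (\<lambda>l' h'' R W.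
        R \<subseteq> {(a, q). a \<notin> {''lab''} \<union> {} \<union> {} \<union> {}} \<union> own {''lab''} {} {} {} 0 d \<and> W \<subseteq> own {''lab''} {} {} {} 0 d \<and>
        (\<forall>q\<in>own {''lab''} {} {} {} 0 d. h'' q = upd h ''lab'' (lift (X h) (L h)) q))"
    using l v big by (auto simp: lift_body_def params_def own_tail lift_def)
next
  fix q assume q: "\<And>d. d < M \<Longrightarrow> rank d = 0 \<Longrightarrow> q \<notin> own {''lab''} {} {} {} 0 d"
  obtain b y where qe: "q = (b, y)" by (cases q)
  have "b = ''lab'' \<Longrightarrow> y \<notin> verts" using q unfolding verts_leader qe own_tail by blast
  then show "upd h ''lab'' (lift (X h) (L h)) q = h q" by (simp add: qe lift_def)
qed (use l h in \<open>auto simp: params_def ready_def lift_body_def\<close>)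

definition after_absorb :: "heap \<Rightarrow> heap" where
  "after_absorb h = upd (upd h ''x'' (\<lambda>v. if absorbing (X h) (A h) v then X h v - 1 else X h v))
     ''ab'' (\<lambda>v. if absorbing (X h) (A h) v then 1 else A h v)"

lemma run_absorb:
  assumes l: "params l" and h: "ready h"
  shows "run (leaders absorb_body) l h (100 * (M + 1)) 100 (\<lambda>l1 h1. l1 = l \<and> h1 = after_absorb h)"
proof (rule run_dart_loop[where j = 0 and AT = "{''x'', ''ab''}" and AD = "{}" and AM = "{}" and AB = "{}" and Wd = 0])
  fix d assume d: "d < M" "rank d = 0" and sm: "small l h"
  have v: "tail d \<in> verts" using d verts_leader by blast
  have z: "X h (tail d) \<le> Z" using smallD(2)[OF sm] by auto
  have f: "h (''fr'', tail d) = fr (tail d)" using h by (simp add: ready_def)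
  show "wp absorb_body (l(''d'' := d, ''v'' := tail d)) h (\<lambda>l' h'' R W.
        R \<subseteq> {(a, q). a \<notin> {''x'', ''ab''} \<union> {} \<union> {} \<union> {}} \<union> own {''x'', ''ab''} {} {} {} 0 d \<and> W \<subseteq> own {''x'', ''ab''} {} {} {} 0 d \<and>
        (\<forall>q\<in>own {''x'', ''ab''} {} {} {} 0 d. h'' q = after_absorb h q))"
    using l v big z by (auto simp: absorb_body_def params_def own_tail after_absorb_def absorbing_def f)
next
  fix q assume q: "\<And>d. d < M \<Longrightarrow> rank d = 0 \<Longrightarrow> q \<notin> own {''x'', ''ab''} {} {} {} 0 d"
  obtain b y where qe: "q = (b, y)" by (cases q)
  have "b = ''x'' \<or> b = ''ab'' \<Longrightarrow> y \<notin> verts" using q unfolding verts_leader qe own_tail by blast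
  then show "after_absorb h q = h q" by (auto simp: qe after_absorb_def absorbing_def)
qed (use l h in \<open>auto simp: params_def ready_def absorb_body_def\<close>)

text \<open>Conservation bounds waiting and travelling units by supply plus inflow; smallness of
  these arrays thus needs no invariant of its own.\<close>

lemma unit_bounds:
  assumes "conserved x f p ab" "\<And>d. d < M \<Longrightarrow> f d \<le> fmax"
  shows "x v \<le> Z" "d < M \<Longrightarrow> p d \<le> Z" "d < M \<Longrightarrow> f d \<le> Z"
proof -
  have s: "(\<Sum>d\<in>ins v. f d) \<le> M * fmax" for v
  proof -
    have "(\<Sum>d\<in>ins v. f d) \<le> (\<Sum>d\<in>ins v. fmax)" using assms(2) by (intro sum_mono) (simp add: insD)
    also have "\<dots> \<le> (\<Sum>d<M. fmax)" by (intro sum_mono2) (auto simp: insD)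
    finally show ?thesis by simp
  qed
  show "x v \<le> Z" using x_le[OF assms(1), of v] s[of v] big by linarith
  show "p d \<le> Z" if "d < M"
  proof -
    have "p d \<le> (\<Sum>e\<in>ins (head d). p e)" using that by (intro member_le_sum) (auto simp: insD)
    then show ?thesis using x_le[OF assms(1), of "head d"] s[of "head d"] big by linarith
  qed
  show "f d \<le> Z" if "d < M"
  proof -
    have "f d \<le> fmax" using assms(2) that by simp
    also have "fmax \<le> M * fmax" using that by simp
    finally show ?thesis using big by linarith
  qed
qed

lemma params_same: "params l \<Longrightarrow> same_locals V l l' \<Longrightarrow> ''M'' \<notin> V \<Longrightarrow> ''k'' \<notin> V \<Longrightarrow> ''H'' \<notin> V \<Longrightarrow> params l'"
  by (simp add: params_def same_locals_def)

lemma same_after: "same dyn h (after_push h a)" "same dyn h (after_return h a)" "same dyn h (after_gather h a)"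
  "same dyn h (upd h ''lab'' u)" "same dyn h (after_absorb h)"
  by (simp_all add: same_def after_push_def after_return_def after_gather_def after_absorb_def)

lemma after_simps:
  "X (after_push h a) = (\<lambda>v. X h v - sent a v)" "F (after_push h a) = (\<lambda>d. F h d + a d)"
  "P (after_push h a) = (\<lambda>d. P h d + a d)" "L (after_push h a) = L h" "A (after_push h a) = A h"
  "X (after_return h a) = (\<lambda>v. X h v - sent a v)" "F (after_return h a) = (\<lambda>d. F h d - a (mate d))"
  "P (after_return h a) = (\<lambda>d. P h d + a d)" "L (after_return h a) = L h" "A (after_return h a) = A h"
  "X (after_gather h a) = (\<lambda>v. X h v + sent a v)" "F (after_gather h a) = F h"
  "P (after_gather h a) = (\<lambda>d. P h d - a (mate d))" "L (after_gather h a) = L h" "A (after_gather h a) = A h"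
  by (simp_all add: after_push_def after_return_def after_gather_def)

text \<open>That labels only rise is recorded for the end of the scale: a vertex that ends below
  \<open>H\<close> must have begun below \<open>H\<close>, hence have been offered as a source if
  unmatched.\<close>

lemma run_flow_round:
  assumes l: "params l" and h: "ready h" and inv: "round_inv POT r (X h) (F h) (P h) (L h) (A h)"
  shows "run flow_round l h (5600 * (M + 1)) 5600 (\<lambda>l' h'. same_locals {''j''} l l' \<and> same dyn h h' \<and>
    round_inv POT (Suc r) (X h') (F h') (P h') (L h') (A h') \<and> (\<forall>v. L h v \<le> L h' v))"
proof -
  define P0 L0 where "P0 = pot (F h) (L h)" and "L0 = live (X h) (L h)"
  have pl: "params l'" if "same_locals {''j''} l l'" for l'
    using params_same[OF l that] by simp
  have P0: "P0 + r * L0 \<le> POT" using inv by (simp add: round_inv_def P0_def L0_def)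
  define I1 where "I1 = (\<lambda>j h'. same dyn h h' \<and> L h' = L h \<and> mid P0 L0 (X h') (F h') (P h') (L h') (A h') \<and> pushed j (X h') (F h') (L h'))"
  define I2 where "I2 = (\<lambda>j h'. same dyn h h' \<and> L h' = L h \<and> mid P0 L0 (X h') (F h') (P h') (L h') (A h') \<and> pushed 16 (X h') (F h') (L h') \<and> returned j (X h') (F h') (L h'))"
  define I3 where "I3 = (\<lambda>j h'. same dyn h h' \<and> (\<forall>v. L h v \<le> L h' v) \<and> late P0 L0 (X h') (F h') (P h') (L h') (A h') \<and> gathered j (P h'))"
  have r1: "run (pass push_body) l h (1800 * (M + 1)) 1800 (\<lambda>l' h'. same_locals {''j''} l l' \<and> I1 16 h')"
  proof (rule run_pass)
    show "I1 0 h" using round_start[OF inv] by (simp add: I1_def P0_def L0_def)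
    fix j l' h' assume j: "j < 16" "same_locals {''j''} l l'" "l' ''j'' = j" and I: "I1 j h'"
    let ?a = "push_amount j (X h') (F h') (L h')"
    have m: "mid P0 L0 (X h') (F h') (P h') (L h') (A h')" "pushed j (X h') (F h') (L h')" using I by (auto simp: I1_def)
    note st = push_step[OF m]
    then have fe: "feasible (F h') (L h')" and co': "conserved (\<lambda>v. X h' v - sent ?a v) (\<lambda>d. F h' d + ?a d) (\<lambda>d. P h' d + ?a d) (A h')"
      and fe': "feasible (\<lambda>d. F h' d + ?a d) (L h')" using m by (auto simp: mid_def)
    \<comment> \<open>The bounds on the values about to be written come from conservation and
      feasibility in the state after the step.\<close>
    have bd: "F h' d + ?a d \<le> Z \<and> P h' d + ?a d \<le> Z" if "d < M" for d
      using unit_bounds(2,3)[OF co' flow_le_fmax[OF fe'] that] by blast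
    have rh: "ready h'" using ready_same[OF h] I by (simp add: I1_def)
    show "run (dart_loop (Var ''j'') push_body) l' h' (100 * (M + 1)) 100 (\<lambda>l1 h1. l1 = l' \<and> I1 (Suc j) h1)"
      by (rule run_weaken[OF run_push[OF pl[OF j(2)] j(3) rh fe refl bd]])
        (use st I same_trans[OF _ same_after(1)] in \<open>auto simp: I1_def after_simps\<close>)
  qed
  have r2: "run (pass return_body) l1 h1 (1800 * (M + 1)) 1800 (\<lambda>l' h'. same_locals {''j''} l1 l' \<and> I2 16 h')"
    if A: "same_locals {''j''} l l1 \<and> I1 16 h1" for l1 h1
  proof (rule run_pass)
    show "I2 0 h1" using A returned_0 unfolding I1_def I2_def by blast
    fix j l' h' assume j: "j < 16" "same_locals {''j''} l1 l'" "l' ''j'' = j" and I: "I2 j h'"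
    have sl: "same_locals {''j''} l l'" using A j(2) same_locals_trans by blast
    let ?a = "return_amount j (X h') (F h') (L h')"
    have m: "mid P0 L0 (X h') (F h') (P h') (L h') (A h')" "pushed 16 (X h') (F h') (L h')" "returned j (X h') (F h') (L h')" using I by (auto simp: I2_def)
    note st = return_step[OF m]
    then have fe: "feasible (F h') (L h')" and co': "conserved (\<lambda>v. X h' v - sent ?a v) (\<lambda>d. F h' d - ?a (mate d)) (\<lambda>d. P h' d + ?a d) (A h')"
      and fe': "feasible (\<lambda>d. F h' d - ?a (mate d)) (L h')" using m by (auto simp: mid_def)
    have bd: "P h' d + ?a d \<le> Z" if "d < M" for d
      using unit_bounds(2)[OF co' flow_le_fmax[OF fe'] that] by blast
    have rh: "ready h'" using ready_same[OF h] I by (simp add: I2_def)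
    show "run (dart_loop (Var ''j'') return_body) l' h' (100 * (M + 1)) 100 (\<lambda>l1 h1. l1 = l' \<and> I2 (Suc j) h1)"
      by (rule run_weaken[OF run_return[OF pl[OF sl] j(3) rh fe refl bd]])
        (use st I same_trans[OF _ same_after(2)] in \<open>auto simp: I2_def after_simps\<close>)
  qed
  have r3: "run (leaders lift_body) l1 h1 (100 * (M + 1)) 100 (\<lambda>l' h'. l' = l1 \<and> I3 0 h')"
    if A: "same_locals {''j''} l l1" "I2 16 h1" for l1 h1
  proof (rule run_weaken[OF run_lift[OF pl[OF A(1)]]])
    show "ready h1" using ready_same[OF h] A by (simp add: I2_def)
    fix l' h' assume "l' = l1 \<and> h' = upd h1 ''lab'' (lift (X h1) (L h1))"
    then have h': "l' = l1" "h' = upd h1 ''lab'' (lift (X h1) (L h1))" by auto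
    have i: "same dyn h h1" "L h1 = L h" "mid P0 L0 (X h1) (F h1) (P h1) (L h1) (A h1)"
      "pushed 16 (X h1) (F h1) (L h1)" "returned 16 (X h1) (F h1) (L h1)"
      using A(2) unfolding I2_def by blast+
    have "late P0 L0 (X h') (F h') (P h') (L h') (A h')"
      using lift_step[OF i(3-5)] by (simp add: h')
    moreover have "\<forall>v. L h v \<le> L h' v" using fun_cong[OF i(2)] by (simp add: h' lift_def)
    moreover have "same dyn h h'" unfolding h' by (rule same_trans[OF i(1) same_after(4)])
    ultimately show "l' = l1 \<and> I3 0 h'" using h'(1) gathered_0 unfolding I3_def by blast
  qed auto
  have r4: "run (pass gather_body) l1 h1 (1800 * (M + 1)) 1800 (\<lambda>l' h'. same_locals {''j''} l1 l' \<and> I3 16 h')"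
    if A: "same_locals {''j''} l l1" "I3 0 h1" for l1 h1
  proof (rule run_pass)
    show "I3 0 h1" by (rule A(2))
    fix j l' h' assume j: "j < 16" "same_locals {''j''} l1 l'" "l' ''j'' = j" and I: "I3 j h'"
    have sl: "same_locals {''j''} l l'" using A j(2) same_locals_trans by blast
    let ?b = "gather_amount j (P h')"
    have m: "late P0 L0 (X h') (F h') (P h') (L h') (A h')" "gathered j (P h')" using I by (auto simp: I3_def)
    note st = gather_step[OF m]
    then have co': "conserved (\<lambda>v. X h' v + sent ?b v) (F h') (\<lambda>d. P h' d - ?b (mate d)) (A h')"
      and fe': "feasible (F h') (L h')" by (auto simp: late_def)
    have bd: "X h' (tail d) + ?b d \<le> Z" if "d < M" for d
    proof -
      have "?b d \<le> sent ?b (tail d)" unfolding sent_def using that by (intro member_le_sum) (auto simp: outsD)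
      then show ?thesis using unit_bounds(1)[OF co' flow_le_fmax[OF fe'], of "tail d"] by linarith
    qed
    have lb: "\<forall>v. L h v \<le> after_gather h' ?b (''lab'', v)" using I by (simp add: after_gather_def I3_def)
    have rh: "ready h'" using ready_same[OF h] I by (simp add: I3_def)
    show "run (dart_loop (Var ''j'') gather_body) l' h' (100 * (M + 1)) 100 (\<lambda>l1 h1. l1 = l' \<and> I3 (Suc j) h1)"
      by (rule run_weaken[OF run_gather[OF pl[OF sl] j(3) rh refl bd]])
        (use st I lb same_trans[OF _ same_after(3)] in \<open>auto simp: I3_def after_simps\<close>)
  qed
  have r5: "run (leaders absorb_body) l1 h1 (100 * (M + 1)) 100 (\<lambda>l' h'. l' = l1 \<and> same dyn h h' \<and>
      round_inv POT (Suc r) (X h') (F h') (P h') (L h') (A h') \<and> (\<forall>v. L h v \<le> L h' v))"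
    if A: "same_locals {''j''} l l1" "I3 16 h1" for l1 h1
  proof (rule run_weaken[OF run_absorb[OF pl[OF A(1)]]])
    show "ready h1" using ready_same[OF h] A by (simp add: I3_def)
    fix l' h' assume "l' = l1 \<and> h' = after_absorb h1"
    then show "l' = l1 \<and> same dyn h h' \<and> round_inv POT (Suc r) (X h') (F h') (P h') (L h') (A h') \<and> (\<forall>v. L h v \<le> L h' v)"
      using absorb_step[of P0 L0 "X h1" "F h1" "P h1" "L h1" "A h1" r POT] P0 A same_trans[OF _ same_after(5)]
      by (simp add: I3_def after_absorb_def)
  qed auto
  show ?thesis unfolding flow_round_def
  proof (rule run_weaken)
    show "run (Seq (pass push_body) (Seq (pass return_body) (Seq (leaders lift_body)
       (Seq (pass gather_body) (leaders absorb_body))))) l h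
       (1800 * (M + 1) + (1800 * (M + 1) + (100 * (M + 1) + (1800 * (M + 1) + 100 * (M + 1)))))
       (1800 + (1800 + (100 + (1800 + 100))))
       (\<lambda>l' h'. same_locals {''j''} l l' \<and> same dyn h h' \<and>
          round_inv POT (Suc r) (X h') (F h') (P h') (L h') (A h') \<and> (\<forall>v. L h v \<le> L h' v))"
    proof (rule run_seq[OF r1], rule run_seq[OF r2], assumption, rule run_seq[OF r3])
      fix l1 h1 l2 h2 assume 1: "same_locals {''j''} l l1 \<and> I1 16 h1" and 2: "same_locals {''j''} l1 l2 \<and> I2 16 h2"
      show s2: "same_locals {''j''} l l2" "I2 16 h2" using 1 2 same_locals_trans by blast+
      fix l3 h3 assume 3: "l3 = l2 \<and> I3 0 h3"
      show "run (Seq (pass gather_body) (leaders absorb_body)) l3 h3 (1800 * (M + 1) + 100 * (M + 1)) (1800 + 100)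
         (\<lambda>l' h'. same_locals {''j''} l l' \<and> same dyn h h' \<and> round_inv POT (Suc r) (X h') (F h') (P h') (L h') (A h') \<and> (\<forall>v. L h v \<le> L h' v))"
      proof (rule run_seq[OF r4])
        show "same_locals {''j''} l l3" "I3 0 h3" using s2 3 by auto
        fix l4 h4 assume 4: "same_locals {''j''} l3 l4 \<and> I3 16 h4"
        then have "same_locals {''j''} l l4" using s2 3 same_locals_trans by blast
        with 4 show "run (leaders absorb_body) l4 h4 (100 * (M + 1)) 100
          (\<lambda>l' h'. same_locals {''j''} l l' \<and> same dyn h h' \<and> round_inv POT (Suc r) (X h') (F h') (P h') (L h') (A h') \<and> (\<forall>v. L h v \<le> L h' v))"
          by (intro run_weaken[OF r5]) auto
      qed
    qed
  qed auto
qed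

lemma run_drain_round:
  assumes l: "params l" and h: "ready h" and inv: "draining r N (X h) (F h) (P h) (L h) (A h)" and p: "\<And>d. d < M \<Longrightarrow> P h d = 0"
  shows "run drain_round l h (3600 * (M + 1)) 3600 (\<lambda>l' h'. same_locals {''j''} l l' \<and> same {''x'', ''f'', ''p''} h h' \<and>
    draining (Suc r) N (X h') (F h') (P h') (L h') (A h') \<and> (\<forall>d<M. P h' d = 0) \<and> (\<forall>d<M. F h' d \<le> F h d))"
proof -
  let ?S = "{''x'', ''f'', ''p''}"
  have pl: "params l'" if "same_locals {''j''} l l'" for l'
    using params_same[OF l that] by simp
  have rd: "ready h'" if "same ?S h h'" for h' using that by (intro ready_same[OF h]) (auto simp: same_def)
  define I1 where "I1 = (\<lambda>j h'. same ?S h h' \<and> draining r N (X h') (F h') (P h') (L h') (A h') \<and> upward r (P h') (L h') \<and>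
    drained j (X h') (F h') \<and> (\<forall>d<M. F h' d \<le> F h d))"
  define I2 where "I2 = (\<lambda>j h'. same ?S h h' \<and> draining (Suc r) N (X h') (F h') (P h') (L h') (A h') \<and> upward r (P h') (L h') \<and>
    gathered j (P h') \<and> (\<forall>d<M. F h' d \<le> F h d))"
  have ss: "same ?S h1 (after_return h1 a)" "same ?S h1 (after_gather h1 a)" for h1 a
    by (simp_all add: same_def after_return_def after_gather_def)
  have r1: "run (pass drain_body) l h (1800 * (M + 1)) 1800 (\<lambda>l' h'. same_locals {''j''} l l' \<and> I1 16 h')"
  proof (rule run_pass)
    show "I1 0 h" using inv p by (simp add: I1_def upward_def drained_def)
    fix j l' h' assume j: "j < 16" "same_locals {''j''} l l'" "l' ''j'' = j" and I: "I1 j h'"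
    let ?a = "drain_amount j (X h') (F h')"
    have m: "draining r N (X h') (F h') (P h') (L h') (A h')" "upward r (P h') (L h')" "drained j (X h') (F h')" using I by (auto simp: I1_def)
    note st = drain_step[OF m]
    then have co': "conserved (\<lambda>v. X h' v - sent ?a v) (\<lambda>d. F h' d - ?a (mate d)) (\<lambda>d. P h' d + ?a d) (A h')"
      and fe': "\<And>d. d < M \<Longrightarrow> F h' d - ?a (mate d) \<le> fmax" by (auto simp: draining_def descends_def)
    have bd: "P h' d + ?a d \<le> Z" if "d < M" for d
      using unit_bounds(2)[OF co' fe' that] by blast
    have fl: "\<forall>d<M. after_return h' ?a (''f'', d) \<le> F h d"
      using I by (auto simp: after_return_def I1_def intro: le_trans[OF diff_le_self])
    have rh: "ready h'" using I by (intro rd) (simp add: I1_def)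
    show "run (dart_loop (Var ''j'') drain_body) l' h' (100 * (M + 1)) 100 (\<lambda>l1 h1. l1 = l' \<and> I1 (Suc j) h1)"
      by (rule run_weaken[OF run_drain[OF pl[OF j(2)] j(3) rh refl bd]])
        (use st I fl same_trans[OF _ ss(1)] in \<open>auto simp: I1_def after_simps\<close>)
  qed
  have r2: "run (pass gather_body) l1 h1 (1800 * (M + 1)) 1800 (\<lambda>l' h'. same_locals {''j''} l1 l' \<and> I2 16 h')"
    if A: "same_locals {''j''} l l1 \<and> I1 16 h1" for l1 h1
  proof (rule run_pass)
    show "I2 0 h1" using A drained_all by (auto simp: I1_def I2_def gathered_0)
    fix j l' h' assume j: "j < 16" "same_locals {''j''} l1 l'" "l' ''j'' = j" and I: "I2 j h'"
    have sl: "same_locals {''j''} l l'" using A j(2) same_locals_trans by blast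
    let ?b = "gather_amount j (P h')"
    have m: "draining (Suc r) N (X h') (F h') (P h') (L h') (A h')" "upward r (P h') (L h')" "gathered j (P h')" using I by (auto simp: I2_def)
    note st = drain_gather[OF m]
    then have co': "conserved (\<lambda>v. X h' v + sent ?b v) (F h') (\<lambda>d. P h' d - ?b (mate d)) (A h')"
      and fe': "\<And>d. d < M \<Longrightarrow> F h' d \<le> fmax" by (auto simp: draining_def descends_def)
    have bd: "X h' (tail d) + ?b d \<le> Z" if "d < M" for d
    proof -
      have "?b d \<le> sent ?b (tail d)" unfolding sent_def using that by (intro member_le_sum) (auto simp: outsD)
      then show ?thesis using unit_bounds(1)[OF co' fe', of "tail d"] by linarith
    qed
    have fl: "\<forall>d<M. after_gather h' ?b (''f'', d) \<le> F h d"
      using I by (simp add: after_gather_def I2_def)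
    have rh: "ready h'" using I by (intro rd) (simp add: I2_def)
    show "run (dart_loop (Var ''j'') gather_body) l' h' (100 * (M + 1)) 100 (\<lambda>l1 h1. l1 = l' \<and> I2 (Suc j) h1)"
      by (rule run_weaken[OF run_gather[OF pl[OF sl] j(3) rh refl bd]])
        (use st I fl same_trans[OF _ ss(2)] in \<open>auto simp: I2_def after_simps\<close>)
  qed
  show ?thesis unfolding drain_round_def
  proof (rule run_weaken)
    show "run (Seq (pass drain_body) (pass gather_body)) l h (1800 * (M + 1) + 1800 * (M + 1)) (1800 + 1800)
      (\<lambda>l' h'. same_locals {''j''} l l' \<and> I2 16 h')"
    proof (rule run_seq[OF r1])
      fix l1 h1 assume 1: "same_locals {''j''} l l1 \<and> I1 16 h1"
      show "run (pass gather_body) l1 h1 (1800 * (M + 1)) 1800 (\<lambda>l' h'. same_locals {''j''} l l' \<and> I2 16 h')"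
        by (rule run_weaken[OF r2[OF 1]]) (use 1 same_locals_trans in auto)
    qed
  next
    fix l' h' assume "same_locals {''j''} l l' \<and> I2 16 h'"
    then show "same_locals {''j''} l l' \<and> same ?S h h' \<and> draining (Suc r) N (X h') (F h') (P h') (L h') (A h') \<and>
        (\<forall>d<M. P h' d = 0) \<and> (\<forall>d<M. F h' d \<le> F h d)"
      using gathered_all[of "P h'"] by (auto simp: I2_def)
  qed simp_all
qed

end

section \<open>Decomposition of a descending flow into routes\<close>

text \<open>Items stacked in the order of their ranks occupy consecutive intervals of lengths
  \<open>w\<close>, so no number lies in two of them. Together with existence, the intervals tile
  the numbers below the total.\<close>

lemma rank_interval_unique:
  fixes w r :: "nat \<Rightarrow> nat"
  assumes "finite A" "inj_on r A" "d \<in> A" "e \<in> A"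
    and "(\<Sum>x | x \<in> A \<and> r x < r d. w x) \<le> g" "g < (\<Sum>x | x \<in> A \<and> r x < r d. w x) + w d"
    and "(\<Sum>x | x \<in> A \<and> r x < r e. w x) \<le> g" "g < (\<Sum>x | x \<in> A \<and> r x < r e. w x) + w e"
  shows "d = e"
proof -
  have *: "(\<Sum>x | x \<in> A \<and> r x < r d. w x) + w d \<le> (\<Sum>x | x \<in> A \<and> r x < r e. w x)"
    if "d \<in> A" "r d < r e" for d e
  proof -
    have "(\<Sum>x | x \<in> A \<and> r x < r d. w x) + w d = (\<Sum>x\<in>insert d {x \<in> A. r x < r d}. w x)"
      using assms(1) by (simp add: add.commute)
    also have "\<dots> \<le> (\<Sum>x | x \<in> A \<and> r x < r e. w x)"
      using assms(1) that by (intro sum_mono2) auto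
    finally show ?thesis .
  qed
  have "r d = r e" using *[of d e] *[of e d] assms(3-) by (cases "r d" "r e" rule: linorder_cases) auto
  then show ?thesis using assms(2-4) by (auto dest: inj_onD)
qed

lemma rank_interval_exists:
  fixes w r :: "nat \<Rightarrow> nat"
  assumes "finite A" "inj_on r A" "g < (\<Sum>x\<in>A. w x)" "\<And>x. x \<in> A \<Longrightarrow> r x < R"
  shows "\<exists>d\<in>A. (\<Sum>x | x \<in> A \<and> r x < r d. w x) \<le> g \<and> g < (\<Sum>x | x \<in> A \<and> r x < r d. w x) + w d"
proof -
  define P where "P j = (\<Sum>x | x \<in> A \<and> r x < j. w x)" for j
  define j where "j = (LEAST j. g < P j)"
  have "{x. x \<in> A \<and> r x < R} = A" using assms(4) by auto
  then have "g < P R" using assms(3) by (simp add: P_def)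
  then have j: "g < P j" unfolding j_def by (rule LeastI)
  then obtain i where i: "j = Suc i" by (cases j) (auto simp: P_def)
  have Pi: "P i \<le> g" using not_less_Least[of i "\<lambda>j. g < P j"] i unfolding j_def by simp
  have split: "{x. x \<in> A \<and> r x < Suc i} = {x. x \<in> A \<and> r x < i} \<union> {x \<in> A. r x = i}" by auto
  have Pj: "P j = P i + (\<Sum>x | x \<in> A \<and> r x = i. w x)"
    unfolding P_def i split using assms(1) by (subst sum.union_disjoint) auto
  have "{x \<in> A. r x = i} \<noteq> {}"
  proof
    assume "{x \<in> A. r x = i} = {}"
    then show False using Pj Pi j by (simp only: sum.empty)
  qed
  then obtain d where d: "d \<in> A" "r d = i" by auto
  have "{x \<in> A. r x = i} = {d}" using d assms(2) by (auto dest: inj_onD)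
  then have "P j = P i + w d" using Pj by simp
  then show ?thesis using d Pi j unfolding P_def by auto
qed

text \<open>\<open>rest\<close> is the outcome of draining: leftover units sit where nothing flows
  in, that is, at their own sources.\<close>

locale routed = network +
  fixes x f ab sr lab :: "nat \<Rightarrow> nat"
  assumes balance: "\<And>v. sr v + (\<Sum>d\<in>ins v. f d) = x v + ab v + (\<Sum>d\<in>outs v. f d)"
    and rest: "\<And>v. x v = 0 \<or> (\<forall>d\<in>ins v. f d = 0)"
    and desc: "\<And>d. d < M \<Longrightarrow> 0 < f d \<Longrightarrow> lab (head d) < lab (tail d)"
    and sr_le: "\<And>v. sr v \<le> 1" and ab_le: "\<And>v. ab v \<le> 1" and ab_sr: "\<And>v. ab v = 1 \<Longrightarrow> sr v = 0"
    and srv: "\<And>v. v \<notin> verts \<Longrightarrow> sr v = 0"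
begin

text \<open>At every vertex the incoming units are numbered, first the source unit and then the units on
  the darts in the order of their ranks, and so are the outgoing units. The number of an incoming
  unit is its number as an outgoing unit.\<close>

definition out_off :: "nat \<Rightarrow> nat" where
  "out_off d = ab (tail d) + (\<Sum>e | e \<in> outs (tail d) \<and> rank e < rank d. f e)"

definition in_off :: "nat \<Rightarrow> nat" where
  "in_off d = sr (head d) + (\<Sum>e | e \<in> ins (head d) \<and> rank (mate e) < rank (mate d). f e)"

definition carries :: "nat \<Rightarrow> nat \<Rightarrow> bool" where
  "carries d g \<longleftrightarrow> d < M \<and> out_off d \<le> g \<and> g < out_off d + f d"

definition unit_dart :: "nat \<times> nat \<Rightarrow> nat" where
  "unit_dart = (\<lambda>(v, g). THE d. tail d = v \<and> carries d g)"

definition hop :: "nat \<times> nat \<Rightarrow> nat \<times> nat" where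
  "hop = (\<lambda>(v, g). let d = unit_dart (v, g) in (head d, in_off d + (g - out_off d)))"

text \<open>Outgoing numbers begin with the absorbed unit, which therefore has number 0 and leaves
  on no dart.\<close>

definition stopped :: "nat \<times> nat \<Rightarrow> bool" where
  "stopped = (\<lambda>(v, g). g < ab v)"

text \<open>Where \<open>x v = 0\<close>, incoming and outgoing units are equally many, so the two
  numberings match. A vertex with leftover excess has no inflow and is never entered.\<close>

definition unit :: "nat \<times> nat \<Rightarrow> bool" where
  "unit = (\<lambda>(v, g). x v = 0 \<and> g < sr v + (\<Sum>d\<in>ins v. f d))"

definition sources :: "nat set" where
  "sources = {v. sr v = 1 \<and> x v = 0}"

lemma carries_unique: "carries d g \<Longrightarrow> carries e g \<Longrightarrow> tail d = tail e \<Longrightarrow> d = e"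
  using rank_interval_unique[of "outs (tail d)" rank d e f "g - ab (tail d)"] rank_inj
  by (auto simp: carries_def out_off_def outsD inj_on_def)

lemma unit_dart_eq: "carries d g \<Longrightarrow> unit_dart (tail d, g) = d"
  unfolding unit_dart_def by (auto intro!: the_equality carries_unique)

lemma unit_dart:
  assumes "unit (v, g)" "\<not> stopped (v, g)"
  shows "carries (unit_dart (v, g)) g" "tail (unit_dart (v, g)) = v"
proof -
  have "g - ab v < (\<Sum>d\<in>outs v. f d)" using assms balance[of v] by (auto simp: unit_def stopped_def)
  from rank_interval_exists[OF _ _ this, of rank 16] obtain d where d: "d \<in> outs v"
    "(\<Sum>x | x \<in> outs v \<and> rank x < rank d. f x) \<le> g - ab v"
    "g - ab v < (\<Sum>x | x \<in> outs v \<and> rank x < rank d. f x) + f d"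
    using rank_inj rank_less by (auto simp: inj_on_def outsD)
  then have "carries d g" "tail d = v"
    using assms(2) by (auto simp: carries_def out_off_def outsD stopped_def)
  then show "carries (unit_dart (v, g)) g" "tail (unit_dart (v, g)) = v" using unit_dart_eq by auto
qed

lemma unit_hop:
  assumes "unit s" "\<not> stopped s"
  shows "unit (hop s)" "lab (fst (hop s)) < lab (fst s)"
proof -
  obtain v g where s: "s = (v, g)" by (cases s)
  define d where "d = unit_dart (v, g)"
  have d: "d < M" "out_off d \<le> g" "g < out_off d + f d" "tail d = v"
    using unit_dart[of v g] assms s unfolding d_def by (auto simp: carries_def)
  have fd: "0 < f d" using d by linarith
  have hin: "d \<in> ins (head d)" using d by (simp add: insD)
  have "in_off d + f d \<le> sr (head d) + (\<Sum>e\<in>ins (head d). f e)"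
  proof -
    have "(\<Sum>e | e \<in> ins (head d) \<and> rank (mate e) < rank (mate d). f e) + f d =
       (\<Sum>e\<in>insert d {e \<in> ins (head d). rank (mate e) < rank (mate d)}. f e)" by (simp add: add.commute)
    also have "\<dots> \<le> (\<Sum>e\<in>ins (head d). f e)" using hin by (intro sum_mono2) auto
    finally show ?thesis by (simp add: in_off_def)
  qed
  moreover have "x (head d) = 0" using rest[of "head d"] hin fd by auto
  ultimately show "unit (hop s)" using d by (auto simp: unit_def hop_def s Let_def d_def[symmetric])
  show "lab (fst (hop s)) < lab (fst s)" using desc[OF d(1) fd] d(4) by (simp add: hop_def s Let_def d_def[symmetric])
qed

text \<open>The number of a unit at the head determines the dart of arrival, because the darts into
  a vertex tile the numbers from \<open>sr\<close> on, and then its position on that dart.\<close>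

lemma hop_inj:
  assumes "unit s" "\<not> stopped s" "unit s'" "\<not> stopped s'" "hop s = hop s'"
  shows "s = s'"
proof -
  obtain v g v' g' where s: "s = (v, g)" "s' = (v', g')" by (cases s, cases s')
  define d d' where "d = unit_dart (v, g)" and "d' = unit_dart (v', g')"
  have d: "d < M" "out_off d \<le> g" "g < out_off d + f d" "tail d = v"
    using unit_dart[of v g] assms s unfolding d_def by (auto simp: carries_def)
  have d': "d' < M" "out_off d' \<le> g'" "g' < out_off d' + f d'" "tail d' = v'"
    using unit_dart[of v' g'] assms s unfolding d'_def by (auto simp: carries_def)
  have h: "head d = head d'" "in_off d + (g - out_off d) = in_off d' + (g' - out_off d')"
  proof -
    have "hop s = (head d, in_off d + (g - out_off d))" unfolding s(1) d_def by (simp add: hop_def Let_def)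
    moreover have "hop s' = (head d', in_off d' + (g' - out_off d'))" unfolding s(2) d'_def by (simp add: hop_def Let_def)
    ultimately show "head d = head d'" "in_off d + (g - out_off d) = in_off d' + (g' - out_off d')"
      using assms(5) by simp_all
  qed
  have inj: "inj_on (\<lambda>e. rank (mate e)) (ins (head d))"
  proof (rule inj_onI)
    fix a b assume ab: "a \<in> ins (head d)" "b \<in> ins (head d)" "rank (mate a) = rank (mate b)"
    have m: "a < M" "b < M" "head a = head d" "head b = head d" using ab(1,2) by (simp_all only: insD)
    have "mate a = mate b"
    proof (rule rank_inj)
      show "mate a < M" "mate b < M" using mate m by blast+
      show "tail (mate a) = tail (mate b)" using mate[OF m(1)] mate[OF m(2)] m(3,4) by presburger
    qed (rule ab(3))
    moreover have "mate (mate a) = a" "mate (mate b) = b" using mate m by blast+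
    ultimately show "a = b" by metis
  qed
  have "d = d'"
  proof (rule rank_interval_unique[OF _ inj, where w = f and g = "in_off d + (g - out_off d) - sr (head d)"])
    let ?P = "\<lambda>d. \<Sum>x | x \<in> ins (head d) \<and> rank (mate x) < rank (mate d). f x"
    have i: "in_off d = sr (head d) + ?P d" "in_off d' = sr (head d') + ?P d'" by (simp_all only: in_off_def)
    show "?P d \<le> in_off d + (g - out_off d) - sr (head d)" "in_off d + (g - out_off d) - sr (head d) < ?P d + f d"
      using d(2,3) i(1) by linarith+
    have "?P d' \<le> in_off d' + (g' - out_off d') - sr (head d')" "in_off d' + (g' - out_off d') - sr (head d') < ?P d' + f d'"
      using d'(2,3) i(2) by linarith+
    then show "(\<Sum>x | x \<in> ins (head d) \<and> rank (mate x) < rank (mate d'). f x) \<le> in_off d + (g - out_off d) - sr (head d)"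
      "in_off d + (g - out_off d) - sr (head d) < (\<Sum>x | x \<in> ins (head d) \<and> rank (mate x) < rank (mate d'). f x) + f d'"
      unfolding h by blast+
    show "finite (ins (head d))" by simp
    show "d \<in> ins (head d)" "d' \<in> ins (head d)" using d(1) d'(1) h(1) by (simp_all only: insD)
  qed
  then show ?thesis using d d' h(2) s by auto
qed

primrec walk :: "nat \<Rightarrow> nat \<Rightarrow> nat \<times> nat" where
  "walk s 0 = (s, 0)"
| "walk s (Suc n) = (if stopped (walk s n) then walk s n else hop (walk s n))"

definition hops :: "nat \<Rightarrow> nat" where "hops s = (LEAST n. stopped (walk s n))"

definition terminus :: "nat \<Rightarrow> nat" where "terminus s = fst (walk s (hops s))"

definition route :: "nat \<Rightarrow> nat list" where
  "route s = map (\<lambda>n. fst (walk s n)) [0..<Suc (hops s)]"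

context
  fixes s assumes s: "s \<in> sources"
begin

lemma unit_walk: "unit (walk s n)"
  by (induction n) (use s unit_hop in \<open>auto simp: sources_def unit_def[of]\<close>)

text \<open>Each hop drops the label by at least 1; this bounds the length of a walk by the label of
  its start and forces the walk to stop.\<close>

lemma walk_lab: "(\<And>i. i < n \<Longrightarrow> \<not> stopped (walk s i)) \<Longrightarrow> lab (fst (walk s n)) + n \<le> lab s"
proof (induction n)
  case (Suc n)
  have "\<not> stopped (walk s n)" using Suc.prems by simp
  with unit_hop(2)[OF unit_walk this] Suc show ?case by (simp add: less_Suc_eq)
qed simp

lemma stopped_hops: "stopped (walk s (hops s))" and before_hops: "n < hops s \<Longrightarrow> \<not> stopped (walk s n)"
proof -
  have "\<exists>n. stopped (walk s n)" using walk_lab[of "Suc (lab s)"] by fastforce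
  then show "stopped (walk s (hops s))" unfolding hops_def by (rule LeastI_ex)
  show "\<not> stopped (walk s n)" if "n < hops s" using not_less_Least that unfolding hops_def .
qed

lemma walk_Suc: "n < hops s \<Longrightarrow> walk s (Suc n) = hop (walk s n)"
  using before_hops by simp

lemma hops_le: "hops s \<le> lab s"
  using walk_lab[of "hops s"] before_hops by simp

lemma walk_desc: "n < n' \<Longrightarrow> n' \<le> hops s \<Longrightarrow> lab (fst (walk s n')) < lab (fst (walk s n))"
proof (induction n')
  case (Suc n')
  have 1: "lab (fst (walk s (Suc n'))) < lab (fst (walk s n'))"
    unfolding walk_Suc[OF Suc_le_lessD[OF Suc.prems(2)]]
    using Suc.prems before_hops by (intro unit_hop(2) unit_walk) auto
  show ?case
  proof (cases "n = n'")
    case False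
    then show ?thesis using Suc 1 by auto
  qed (use 1 in simp)
qed simp

lemma walk_dart:
  assumes "n < hops s"
  defines "d \<equiv> unit_dart (walk s n)"
  shows "carries d (snd (walk s n))" "tail d = fst (walk s n)" "head d = fst (walk s (Suc n))"
    "walk s (Suc n) = (head d, in_off d + (snd (walk s n) - out_off d))"
proof -
  obtain v g where vg: "walk s n = (v, g)" by (cases "walk s n")
  have "unit (v, g)" "\<not> stopped (v, g)" using unit_walk[of n] before_hops[OF assms(1)] vg by auto
  from unit_dart[OF this] show "carries d (snd (walk s n))" "tail d = fst (walk s n)" by (simp_all add: d_def vg)
  show "walk s (Suc n) = (head d, in_off d + (snd (walk s n) - out_off d))"
    unfolding walk_Suc[OF assms(1)] by (simp add: hop_def vg d_def Let_def)
  then show "head d = fst (walk s (Suc n))" by simp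
qed

lemma terminus_absorbs: "ab (terminus s) = 1" "walk s (hops s) = (terminus s, 0)"
proof -
  obtain v g where vg: "walk s (hops s) = (v, g)" by (cases "walk s (hops s)")
  then have "g < ab v" using stopped_hops by (simp add: stopped_def)
  then show "ab (terminus s) = 1" "walk s (hops s) = (terminus s, 0)"
    using ab_le[of v] by (auto simp: terminus_def vg)
qed

lemma route_distinct: "distinct (route s)"
proof -
  have "inj_on (\<lambda>n. fst (walk s n)) {0..<Suc (hops s)}"
  proof (rule inj_onI)
    fix n n' assume "n \<in> {0..<Suc (hops s)}" "n' \<in> {0..<Suc (hops s)}" "fst (walk s n) = fst (walk s n')"
    then show "n = n'" using walk_desc[of n n'] walk_desc[of n' n] by (cases n n' rule: linorder_cases) auto
  qed
  then show ?thesis by (simp only: route_def distinct_map set_upt distinct_upt simp_thms)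
qed

end

text \<open>At a source vertex the number 0 is reserved for its own unit; arriving units have
  numbers from 1 on.\<close>

lemma hop_not_source: "s \<in> sources \<Longrightarrow> hop p \<noteq> (s, 0)"
  by (auto simp: hop_def in_off_def sources_def Let_def split: prod.splits)

text \<open>Walks can be traced backwards, since \<open>hop\<close> is injective and a start has no
  predecessor. Hence walks from different sources never share a unit.\<close>

lemma walk_inj:
  assumes "s \<in> sources" "s' \<in> sources"
  shows "n \<le> hops s \<Longrightarrow> n' \<le> hops s' \<Longrightarrow> walk s n = walk s' n' \<Longrightarrow> s = s' \<and> n = n'"
proof (induction n arbitrary: n')
  case 0
  then have "n' = 0"
    using hop_not_source[OF assms(1), of "walk s' (n' - 1)"] walk_Suc[OF assms(2), of "n' - 1"] by (cases n') auto
  then show ?case using 0 by simp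
next
  case (Suc n)
  have S: "walk s (Suc n) = hop (walk s n)" using Suc.prems walk_Suc[OF assms(1)] by simp
  obtain i where i: "n' = Suc i"
    using Suc.prems S hop_not_source[OF assms(2), of "walk s n"] by (cases n') auto
  have S': "walk s' (Suc i) = hop (walk s' i)" using Suc.prems i walk_Suc[OF assms(2)] by simp
  have "walk s n = walk s' i"
    using hop_inj[of "walk s n" "walk s' i"] unit_walk assms before_hops[OF assms(1)] before_hops[OF assms(2)] Suc.prems i S S'
    by (metis Suc_le_lessD)
  then show ?case using Suc.IH[of i] Suc.prems i by simp
qed

lemma terminus_inj: "inj_on terminus sources"
  using walk_inj terminus_absorbs(2) by (intro inj_onI) (metis order_refl)

lemma x_le_sr: "x v \<le> sr v"
  using balance[of v] rest[of v] by (cases "x v = 0") auto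

lemma outside: "v \<notin> verts \<Longrightarrow> ab v = 0 \<and> x v = 0"
proof -
  assume v: "v \<notin> verts"
  then have "ins v = {}" using head_verts by (auto simp: insD)
  then show ?thesis using balance[of v] srv[OF v] by simp
qed

lemma total_units: "(\<Sum>v\<in>verts. sr v) = (\<Sum>v\<in>verts. x v) + (\<Sum>v\<in>verts. ab v)"
proof -
  have "(\<Sum>v\<in>verts. sr v + (\<Sum>d\<in>ins v. f d)) = (\<Sum>v\<in>verts. x v + ab v + (\<Sum>d\<in>outs v. f d))"
    using balance by (intro sum.cong) auto
  then show ?thesis by (simp add: sum.distrib sum_verts sum_verts_in)
qed

lemma sources_verts: "sources \<subseteq> verts"
proof
  fix v assume "v \<in> sources"
  then show "v \<in> verts" using srv[of v] by (cases "v \<in> verts") (auto simp: sources_def)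
qed

text \<open>By counting: there are as many termini as routed sources by injectivity, and as many
  absorbed units as routed sources by conservation. So every sink marked as absorbing ends a
  route.\<close>

lemma terminus_image: "terminus ` sources = {t. ab t = 1}"
proof (rule card_subset_eq)
  have T: "{t. ab t = 1} \<subseteq> verts" using outside by force
  then show "finite {t. ab t = 1}" by (rule finite_subset) simp
  show "terminus ` sources \<subseteq> {t. ab t = 1}" using terminus_absorbs by auto
  have "card (terminus ` sources) = card sources" by (rule card_image[OF terminus_inj])
  also have "card sources = (\<Sum>v\<in>verts. if v \<in> sources then 1 else 0)"
    using sources_verts by (simp add: sum.If_cases Int_absorb1)
  also have "\<dots> = (\<Sum>v\<in>verts. sr v - x v)"
  proof (rule sum.cong[OF refl])
    fix v show "(if v \<in> sources then 1 else 0) = sr v - x v"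
      using x_le_sr[of v] sr_le[of v] by (auto simp: sources_def)
  qed
  also have "\<dots> = (\<Sum>v\<in>verts. sr v) - (\<Sum>v\<in>verts. x v)" using x_le_sr by (intro sum_subtractf_nat) auto
  also have "\<dots> = (\<Sum>v\<in>verts. ab v)" using total_units by simp
  also have "\<dots> = (\<Sum>v\<in>verts. if v \<in> {t. ab t = 1} then 1 else 0)"
  proof (rule sum.cong[OF refl])
    fix v show "ab v = (if v \<in> {t. ab t = 1} then 1 else 0)" using ab_le[of v] by (cases "ab v") auto
  qed
  also have "\<dots> = card {t. ab t = 1}" using T by (simp add: sum.If_cases Int_absorb1)
  finally show "card (terminus ` sources) = card {t. ab t = 1}" .
qed

text \<open>Walks that cross \<open>d\<close> occupy different unit numbers there, and
  \<open>d\<close> carries only \<open>f d\<close> numbers.\<close>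

lemma route_congestion:
  assumes "d < M"
  shows "card {s \<in> sources. \<exists>n<hops s. unit_dart (walk s n) = d} \<le> f d"
proof -
  let ?S = "{s \<in> sources. \<exists>n<hops s. unit_dart (walk s n) = d}"
  define n where "n s = (SOME n. n < hops s \<and> unit_dart (walk s n) = d)" for s
  have n: "n s < hops s \<and> unit_dart (walk s (n s)) = d" if "s \<in> ?S" for s
    unfolding n_def by (rule someI_ex) (use that in auto)
  have w: "fst (walk s (n s)) = tail d" "out_off d \<le> snd (walk s (n s))" "snd (walk s (n s)) < out_off d + f d"
    if "s \<in> ?S" for s
    using walk_dart(1,2)[of s "n s"] n[OF that] that by (auto simp: carries_def)
  have "inj_on (\<lambda>s. snd (walk s (n s)) - out_off d) ?S"
  proof (rule inj_onI)
    fix s s' assume A: "s \<in> ?S" "s' \<in> ?S" "snd (walk s (n s)) - out_off d = snd (walk s' (n s')) - out_off d"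
    then have "walk s (n s) = walk s' (n s')" using w[OF A(1)] w[OF A(2)] by (intro prod_eqI) auto
    then show "s = s'" using walk_inj[of s s' "n s" "n s'"] A n[OF A(1)] n[OF A(2)] by auto
  qed
  moreover have "(\<lambda>s. snd (walk s (n s)) - out_off d) ` ?S \<subseteq> {..<f d}"
  proof (rule image_subsetI)
    fix s assume "s \<in> ?S" from w[OF this] show "snd (walk s (n s)) - out_off d \<in> {..<f d}" by auto
  qed
  ultimately have "card ?S \<le> card {..<f d}" by (intro card_inj_on_le) auto
  then show ?thesis by simp
qed

end

section \<open>Tracing the routes in parallel\<close>

definition trace_init :: com where
  "trace_init = Seq (Put ''ao'' vv (Get ''ab'' vv)) (Seq (Put ''ai'' vv (Get ''sr'' vv))
     (Seq (Put ''cu'' vv vv) (Seq (Put ''gg'' vv (Num 0)) (Put ''hp'' vv (Num 0)))))"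

text \<open>\<open>ao\<close> and \<open>ai\<close> are running totals at a vertex. Visiting the
  ranks in increasing order makes them equal to \<open>out_off\<close> of the dart and
  \<open>in_off\<close> of its mate at the moment of the visit.\<close>

definition offsets_body :: com where
  "offsets_body = Seq (Assign ''e'' (Get ''rv'' vd))
     (Seq (Put ''po'' vd (Get ''ao'' vv)) (Seq (Put ''ao'' vv (Get ''ao'' vv \<oplus> Get ''f'' vd))
     (Seq (Put ''pi'' ve (Get ''ai'' vv)) (Put ''ai'' vv (Get ''ai'' vv \<oplus> Get ''f'' ve)))))"

text \<open>\<open>adj\<close> holds the dart number plus 1, so 0 means that there is no dart of
  this rank; the test with \<open>+ 1\<close> expresses \<open>po \<le> gg\<close>. A walker writes
  only cells of its own source and merely reads offsets and flow, so many walkers may stand at one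
  vertex.\<close>

definition hop_body :: com where
  "hop_body = Cond (Op Less (Get ''x'' vv) (Get ''sr'' vv))
     (Seq (Assign ''w'' (Get ''adj'' (Num 16 \<otimes> Get ''cu'' vv \<oplus> Var ''j'')))
       (Cond (Var ''w'') (Seq (Assign ''e'' (Var ''w'' \<ominus> Num 1))
         (Cond (Op Less (Get ''po'' ve) (Get ''gg'' vv \<oplus> Num 1) \<otimes> Op Less (Get ''gg'' vv) (Get ''po'' ve \<oplus> Get ''f'' ve))
           (Seq (Put ''hp'' vv (Get ''hp'' vv \<oplus> Num 1))
           (Seq (Put ''pth'' (vv \<otimes> Var ''W'' \<oplus> Get ''hp'' vv) (Get ''hd'' ve))
           (Seq (Put ''gg'' vv (Get ''pi'' ve \<oplus> (Get ''gg'' vv \<ominus> Get ''po'' ve)))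
                (Put ''cu'' vv (Get ''hd'' ve))))) Skip)) Skip)) Skip"

definition trace :: com where
  "trace = Seq (leaders trace_init) (Seq (pass offsets_body)
     (For ''r'' (Var ''H'') (For ''j'' (Num 16) (leaders hop_body))))"

abbreviation "trace_arrays \<equiv> {''ao'', ''ai'', ''po'', ''pi'', ''cu'', ''gg'', ''hp'', ''pth''}"

context net_machine
begin

definition adjacent :: "heap \<Rightarrow> bool" where
  "adjacent h \<longleftrightarrow> (\<forall>d<M. h (''adj'', 16 * tail d + rank d) = d + 1) \<and>
     (\<forall>v j. j < 16 \<longrightarrow> (\<forall>d<M. tail d = v \<longrightarrow> rank d \<noteq> j) \<longrightarrow> h (''adj'', 16 * v + j) = 0)"

lemma verts_lead: "v \<in> verts \<longleftrightarrow> (\<exists>d<M. rank d = 0 \<and> tail d = v)"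
proof
  assume "v \<in> verts"
  then obtain d where "d < M" "tail d = v" by (auto simp: verts_def)
  then show "\<exists>d<M. rank d = 0 \<and> tail d = v" using rank_0[of d] by auto
qed (auto simp: verts_def)

lemma own_tails: "own AT {} {} {} W' d = AT \<times> {tail d}"
  by (auto simp: own_def)

end

locale trace_machine = routed M tail head mate rank x f ab sr lab + net_machine M tail head mate rank \<phi> B Z
  for M tail head mate rank x f ab sr lab \<phi> B Z +
  fixes H W :: nat
  assumes lab_le: "\<And>v. lab v \<le> H" and W: "W = H + 1" and WZ: "W \<le> Z"
    and flow_le: "\<And>v. sr v + (\<Sum>d\<in>ins v. f d) \<le> Z"
begin

definition loaded :: "heap \<Rightarrow> bool" where
  "loaded h \<longleftrightarrow> wired h \<and> adjacent h \<and> (\<forall>d<M. h (''f'', d) = f d) \<and>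
     (\<forall>v. h (''x'', v) = x v \<and> h (''sr'', v) = sr v \<and> h (''ab'', v) = ab v)"

lemma loaded_same: "loaded h \<Longrightarrow> same trace_arrays h h' \<Longrightarrow> loaded h'"
  by (simp add: loaded_def wired_def adjacent_def same_def)

definition after_init :: "heap \<Rightarrow> heap" where
  "after_init h = upd (upd (upd (upd (upd h ''ao'' (\<lambda>v. if v \<in> verts then ab v else h (''ao'', v)))
     ''ai'' (\<lambda>v. if v \<in> verts then sr v else h (''ai'', v)))
     ''cu'' (\<lambda>v. if v \<in> verts then v else h (''cu'', v)))
     ''gg'' (\<lambda>v. if v \<in> verts then 0 else h (''gg'', v)))
     ''hp'' (\<lambda>v. if v \<in> verts then 0 else h (''hp'', v))"

lemma run_trace_init:
  assumes l: "l ''M'' = M" and h: "loaded h"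
  shows "run (leaders trace_init) l h (100 * (M + 1)) 100 (\<lambda>l1 h1. l1 = l \<and> h1 = after_init h)"
proof (rule run_dart_loop[where j = 0 and AT = "{''ao'', ''ai'', ''cu'', ''gg'', ''hp''}" and AD = "{}" and AM = "{}" and AB = "{}" and Wd = 0])
  let ?N = "{''ao'', ''ai'', ''cu'', ''gg'', ''hp''}"
  fix d assume d: "d < M" "rank d = 0" and sm: "small l h"
  have v: "tail d \<in> verts" using d verts_lead by blast
  have f: "h (''ab'', tail d) = ab (tail d)" "h (''sr'', tail d) = sr (tail d)" "h (''tl'', d) = tail d"
    using h d by (auto simp: loaded_def wired_def)
  have z: "ab (tail d) \<le> Z" "sr (tail d) \<le> Z" "tail d \<le> Z"
    using f smallD(2)[OF sm, of "(''ab'', tail d)"] smallD(2)[OF sm, of "(''sr'', tail d)"] smallD(2)[OF sm, of "(''tl'', d)"] by auto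
  show "wp trace_init (l(''d'' := d, ''v'' := tail d)) h (\<lambda>l' h'' R W.
        R \<subseteq> {(a, q). a \<notin> ?N \<union> {} \<union> {} \<union> {}} \<union> own ?N {} {} {} 0 d \<and> W \<subseteq> own ?N {} {} {} 0 d \<and>
        (\<forall>q\<in>own ?N {} {} {} 0 d. h'' q = after_init h q))"
    using l v z by (simp add: trace_init_def own_tails after_init_def f)
next
  let ?N = "{''ao'', ''ai'', ''cu'', ''gg'', ''hp''}"
  fix q assume q: "\<And>d. d < M \<Longrightarrow> rank d = 0 \<Longrightarrow> q \<notin> own ?N {} {} {} 0 d"
  obtain b y where qe: "q = (b, y)" by (cases q)
  have "b \<in> ?N \<Longrightarrow> y \<notin> verts" using q unfolding verts_lead qe own_tails by blast
  then show "after_init h q = h q" by (auto simp: qe after_init_def)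
qed (use l h in \<open>auto simp: loaded_def trace_init_def\<close>)

definition out_part :: "nat \<Rightarrow> nat \<Rightarrow> nat" where
  "out_part j v = ab v + (\<Sum>e | e \<in> outs v \<and> rank e < j. f e)"

definition in_part :: "nat \<Rightarrow> nat \<Rightarrow> nat" where
  "in_part j v = sr v + (\<Sum>e | e \<in> ins v \<and> rank (mate e) < j. f e)"

lemma part_le: "out_part j v \<le> Z" "in_part j v \<le> Z"
proof -
  have "(\<Sum>e | e \<in> outs v \<and> rank e < j. f e) \<le> (\<Sum>e\<in>outs v. f e)" by (intro sum_mono2) auto
  then show "out_part j v \<le> Z" using balance[of v] flow_le[of v] by (simp add: out_part_def)
  have "(\<Sum>e | e \<in> ins v \<and> rank (mate e) < j. f e) \<le> (\<Sum>e\<in>ins v. f e)" by (intro sum_mono2) auto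
  then show "in_part j v \<le> Z" using flow_le[of v] by (simp add: in_part_def)
qed

lemma part_Suc:
  assumes "d < M"
  shows "out_part (Suc (rank d)) (tail d) = out_part (rank d) (tail d) + f d"
    "in_part (Suc (rank d)) (tail d) = in_part (rank d) (tail d) + f (mate d)"
proof -
  have "{e. e \<in> outs (tail d) \<and> rank e < Suc (rank d)} = insert d {e. e \<in> outs (tail d) \<and> rank e < rank d}"
    using assms rank_inj[of _ d] by (auto simp: outsD less_Suc_eq)
  then show "out_part (Suc (rank d)) (tail d) = out_part (rank d) (tail d) + f d"
    unfolding out_part_def by simp
  have m: "mate d < M" "mate (mate d) = d" "head (mate d) = tail d" using mate[OF assms] head_mate[OF assms] by auto
  have eq: "e \<in> ins (tail d) \<and> rank (mate e) = rank d \<longleftrightarrow> e = mate d" for e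
  proof
    assume e: "e \<in> ins (tail d) \<and> rank (mate e) = rank d"
    then have em: "e < M" "head e = tail d" by (auto simp: insD)
    have "mate e = d" by (rule rank_inj) (use e em(2) mate[OF em(1)] assms in auto)
    then show "e = mate d" using mate[OF em(1)] by auto
  qed (use m in \<open>simp add: insD\<close>)
  have "{e. e \<in> ins (tail d) \<and> rank (mate e) < Suc (rank d)} =
      {e. e \<in> ins (tail d) \<and> rank (mate e) = rank d} \<union> {e. e \<in> ins (tail d) \<and> rank (mate e) < rank d}"
    by (auto simp: less_Suc_eq)
  then have "{e. e \<in> ins (tail d) \<and> rank (mate e) < Suc (rank d)} = insert (mate d) {e. e \<in> ins (tail d) \<and> rank (mate e) < rank d}"
    unfolding eq by simp
  then show "in_part (Suc (rank d)) (tail d) = in_part (rank d) (tail d) + f (mate d)"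
    unfolding in_part_def using m by simp
qed

lemma part_none:
  assumes "\<And>d. d < M \<Longrightarrow> rank d = j \<Longrightarrow> tail d \<noteq> v"
  shows "out_part (Suc j) v = out_part j v" "in_part (Suc j) v = in_part j v"
proof -
  have "{e. e \<in> outs v \<and> rank e < Suc j} = {e. e \<in> outs v \<and> rank e < j}"
    using assms by (auto simp: outsD less_Suc_eq)
  then show "out_part (Suc j) v = out_part j v" unfolding out_part_def by simp
  have "rank (mate e) \<noteq> j" if "e \<in> ins v" for e
    using assms[of "mate e"] mate[of e] that unfolding insD by metis
  then have "{e. e \<in> ins v \<and> rank (mate e) < Suc j} = {e. e \<in> ins v \<and> rank (mate e) < j}"
    by (auto simp: less_Suc_eq)
  then show "in_part (Suc j) v = in_part j v" unfolding in_part_def by simp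
qed

definition offsets_upto :: "nat \<Rightarrow> heap \<Rightarrow> bool" where
  "offsets_upto j h \<longleftrightarrow> (\<forall>v\<in>verts. h (''ao'', v) = out_part j v \<and> h (''ai'', v) = in_part j v) \<and>
     (\<forall>d<M. (rank d < j \<longrightarrow> h (''po'', d) = out_off d) \<and> (rank (mate d) < j \<longrightarrow> h (''pi'', d) = in_off d))"

definition after_offsets :: "nat \<Rightarrow> heap \<Rightarrow> heap" where
  "after_offsets j h = upd (upd (upd (upd h
     ''ao'' (\<lambda>v. if v \<in> verts then out_part (Suc j) v else h (''ao'', v)))
     ''ai'' (\<lambda>v. if v \<in> verts then in_part (Suc j) v else h (''ai'', v)))
     ''po'' (\<lambda>d. if d < M \<and> rank d = j then out_off d else h (''po'', d)))
     ''pi'' (\<lambda>d. if d < M \<and> rank (mate d) = j then in_off d else h (''pi'', d))"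

lemma run_offsets_step:
  assumes l: "l ''M'' = M" "l ''j'' = j" and h: "loaded h" and off: "offsets_upto j h"
  shows "run (dart_loop (Var ''j'') offsets_body) l h (100 * (M + 1)) 100 (\<lambda>l1 h1. l1 = l \<and> h1 = after_offsets j h)"
proof (rule run_dart_loop[where j = j and AT = "{''ao'', ''ai''}" and AD = "{''po''}" and AM = "{''pi''}" and AB = "{}" and Wd = 0])
  have own: "own {''ao'', ''ai''} {''po''} {''pi''} {} 0 d = {(''ao'', tail d), (''ai'', tail d), (''po'', d), (''pi'', mate d)}" for d
    unfolding own_def by blast
  {
    fix d assume d: "d < M" "rank d = j" and sm: "small l h"
    have m: "mate d < M" "mate (mate d) = d" "head (mate d) = tail d" using mate[OF d(1)] head_mate[OF d(1)] by auto
    have v: "tail d \<in> verts" using d(1) by (rule tail_verts)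
    have f: "h (''rv'', d) = mate d" "h (''f'', d) = f d" "h (''f'', mate d) = f (mate d)"
      "h (''ao'', tail d) = out_part j (tail d)" "h (''ai'', tail d) = in_part j (tail d)"
      using h d m v off by (auto simp: loaded_def wired_def offsets_upto_def)
    have o: "out_off d = out_part j (tail d)" "in_off (mate d) = in_part j (tail d)"
      unfolding out_off_def in_off_def out_part_def in_part_def using d m by auto
    have p: "out_part (Suc j) (tail d) = out_part j (tail d) + f d" "in_part (Suc j) (tail d) = in_part j (tail d) + f (mate d)"
      using part_Suc[OF d(1)] d(2) by auto
    have z: "mate d \<le> Z" using smallD(2)[OF sm, of "(''rv'', d)"] f by simp
    have zz: "out_part j (tail d) + f d \<le> Z" "in_part j (tail d) + f (mate d) \<le> Z"
       "out_part j (tail d) \<le> Z" "in_part j (tail d) \<le> Z"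
      using part_le p by metis+
    show "wp offsets_body (l(''d'' := d, ''v'' := tail d)) h (\<lambda>l' h'' R W.
        R \<subseteq> {(a, q). a \<notin> {''ao'', ''ai''} \<union> {''po''} \<union> {''pi''} \<union> {}} \<union> own {''ao'', ''ai''} {''po''} {''pi''} {} 0 d \<and> W \<subseteq> own {''ao'', ''ai''} {''po''} {''pi''} {} 0 d \<and>
        (\<forall>q\<in>own {''ao'', ''ai''} {''po''} {''pi''} {} 0 d. h'' q = after_offsets j h q))"
      using l v d m z zz by (simp add: offsets_body_def own after_offsets_def f o p)
  next
    fix q assume q: "\<And>d. d < M \<Longrightarrow> rank d = j \<Longrightarrow> q \<notin> own {''ao'', ''ai''} {''po''} {''pi''} {} 0 d"
    obtain c y where qe: "q = (c, y)" by (cases q)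
    consider "c = ''ao'' \<or> c = ''ai''" | "c = ''po''" | "c = ''pi''" | "c \<notin> {''ao'', ''ai'', ''po'', ''pi''}" by blast
    then show "after_offsets j h q = h q"
    proof cases
      case 1
      then have "tail d \<noteq> y" if "d < M" "rank d = j" for d using q[OF that] by (auto simp: own qe)
      from part_none[of j y, OF this] 1 show ?thesis
        using off by (auto simp: after_offsets_def qe offsets_upto_def)
    next
      case 2
      then show ?thesis using q[of y] by (auto simp: after_offsets_def own qe)
    next
      case 3
      then show ?thesis using q[of "mate y"] mate[of y] by (auto simp: after_offsets_def own qe)
    next
      case 4
      then show ?thesis by (simp add: after_offsets_def qe)
    qed
  }
qed (use l h in \<open>auto simp: loaded_def offsets_body_def\<close>)

definition offsets_done :: "heap \<Rightarrow> bool" where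
  "offsets_done h \<longleftrightarrow> (\<forall>d<M. h (''po'', d) = out_off d \<and> h (''pi'', d) = in_off d)"

lemma run_offsets:
  assumes l: "l ''M'' = M" and h: "loaded h" and off: "offsets_upto 0 h"
  shows "run (pass offsets_body) l h (1800 * (M + 1)) 1800 (\<lambda>l' h'. same_locals {''j''} l l' \<and>
    same {''ao'', ''ai'', ''po'', ''pi''} h h' \<and> offsets_done h')"
proof -
  let ?S = "{''ao'', ''ai'', ''po'', ''pi''}"
  have ss: "same ?S h' (after_offsets j h')" for j h' by (simp add: same_def after_offsets_def)
  have "run (pass offsets_body) l h (1800 * (M + 1)) 1800 (\<lambda>l' h'. same_locals {''j''} l l' \<and> (same ?S h h' \<and> offsets_upto 16 h'))"
  proof (rule run_pass)
    show "same ?S h h \<and> offsets_upto 0 h" using off by simp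
    fix j l' h' assume j: "j < 16" "same_locals {''j''} l l'" "l' ''j'' = j" and I: "same ?S h h' \<and> offsets_upto j h'"
    have lm: "l' ''M'' = M" using j(2) l by (simp add: same_locals_def)
    have lh: "loaded h'" by (rule loaded_same[OF h]) (use I in \<open>auto simp: same_def\<close>)
    have "offsets_upto (Suc j) (after_offsets j h')"
      using I by (auto simp: offsets_upto_def after_offsets_def less_Suc_eq)
    then show "run (dart_loop (Var ''j'') offsets_body) l' h' (100 * (M + 1)) 100
        (\<lambda>l1 h1. l1 = l' \<and> (same ?S h h1 \<and> offsets_upto (Suc j) h1))"
      by (intro run_weaken[OF run_offsets_step[OF lm j(3) lh]]) (use I same_trans[OF _ ss] in auto)
  qed
  then show ?thesis
  proof (rule run_weaken)
    fix l' h' assume I: "same_locals {''j''} l l' \<and> same ?S h h' \<and> offsets_upto 16 h'"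
    have "rank (mate d) < 16" if "d < M" for d using rank_less mate[OF that] by blast
    then have "offsets_done h'" using I rank_less unfolding offsets_upto_def offsets_done_def by blast
    then show "same_locals {''j''} l l' \<and> same ?S h h' \<and> offsets_done h'" using I by blast
  qed auto
qed

definition moving :: "nat \<Rightarrow> heap \<Rightarrow> nat \<Rightarrow> bool" where
  "moving j h v \<longleftrightarrow> v \<in> sources \<and> h (''hp'', v) < hops v \<and> rank (unit_dart (walk v (h (''hp'', v)))) = j"

definition after_hop :: "nat \<Rightarrow> heap \<Rightarrow> heap" where
  "after_hop j h = upd (upd (upd (upd h
     ''hp'' (\<lambda>v. if moving j h v then h (''hp'', v) + 1 else h (''hp'', v)))
     ''cu'' (\<lambda>v. if moving j h v then fst (walk v (h (''hp'', v) + 1)) else h (''cu'', v)))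
     ''gg'' (\<lambda>v. if moving j h v then snd (walk v (h (''hp'', v) + 1)) else h (''gg'', v)))
     ''pth'' (\<lambda>q. if moving j h (q div W) \<and> q mod W = h (''hp'', q div W) + 1
        then fst (walk (q div W) (q mod W)) else h (''pth'', q))"

definition tracking :: "heap \<Rightarrow> bool" where
  "tracking h \<longleftrightarrow> (\<forall>s\<in>sources. h (''hp'', s) \<le> hops s \<and> (h (''cu'', s), h (''gg'', s)) = walk s (h (''hp'', s)))"

lemma sources_less: "s \<in> sources \<longleftrightarrow> x s < sr s"
  using sr_le[of s] by (auto simp: sources_def)

lemma hops_H: "s \<in> sources \<Longrightarrow> hops s \<le> H"
  using hops_le lab_le le_trans by blast

lemma walk_unit_le: "s \<in> sources \<Longrightarrow> snd (walk s n) \<le> Z"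
  using unit_walk[of s n] flow_le[of "fst (walk s n)"] by (cases "walk s n") (auto simp: unit_def)

lemma run_hop:
  assumes l: "l ''M'' = M" "l ''j'' = j" "l ''W'' = W" and j: "j < 16"
    and h: "loaded h" and off: "offsets_done h" and tr: "tracking h"
  shows "run (leaders hop_body) l h (100 * (M + 1)) 100 (\<lambda>l1 h1. l1 = l \<and> h1 = after_hop j h)"
proof (rule run_dart_loop[where j = 0 and AT = "{''cu'', ''gg'', ''hp''}" and AD = "{}" and AM = "{}" and AB = "{''pth''}" and Wd = W])
  let ?N = "{''cu'', ''gg'', ''hp''}"
  have W0: "0 < W" using W by simp
  fix d assume d: "d < M" "rank d = 0" and sm: "small l h"
  define v where "v = tail d"
  have own: "own ?N {} {} {''pth''} W d = ?N \<times> {v} \<union> {''pth''} \<times> {q. q div W = v}"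
    by (auto simp: own_def v_def)
  have hv: "h (''x'', v) = x v" "h (''sr'', v) = sr v" using h by (auto simp: loaded_def)
  have stay: "wp hop_body (l(''d'' := d, ''v'' := v)) h (\<lambda>l' h'' R W'.
        R \<subseteq> {(a, q). a \<notin> ?N \<union> {} \<union> {} \<union> {''pth''}} \<union> own ?N {} {} {''pth''} W d \<and> W' \<subseteq> own ?N {} {} {''pth''} W d \<and>
        (\<forall>q\<in>own ?N {} {} {''pth''} W d. h'' q = h q))" if "v \<notin> sources"
    using that l hv unfolding sources_less by (simp add: hop_body_def own)
  show "wp hop_body (l(''d'' := d, ''v'' := tail d)) h (\<lambda>l' h'' R W'.
        R \<subseteq> {(a, q). a \<notin> ?N \<union> {} \<union> {} \<union> {''pth''}} \<union> own ?N {} {} {''pth''} W d \<and> W' \<subseteq> own ?N {} {} {''pth''} W d \<and>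
        (\<forall>q\<in>own ?N {} {} {''pth''} W d. h'' q = after_hop j h q))"
  proof (cases "v \<in> sources")
    case False
    then have "\<not> moving j h v" by (simp add: moving_def)
    then have "\<forall>q\<in>own ?N {} {} {''pth''} W d. after_hop j h q = h q"
      by (auto simp: own after_hop_def)
    then show ?thesis using stay[OF False] unfolding v_def[symmetric] by simp
  next
    case True
    obtain n c g where n: "h (''hp'', v) = n" "h (''cu'', v) = c" "h (''gg'', v) = g" by blast
    have tv: "n \<le> hops v" "walk v n = (c, g)" using tr True n by (auto simp: tracking_def)
    have xs: "x v < sr v" using True sources_less by simp
    have zw: "h (''adj'', 16 * c + j) \<le> Z" using smallD(2)[OF sm] by simp
    consider "\<And>e. e < M \<Longrightarrow> tail e = c \<Longrightarrow> rank e \<noteq> j" | e where "e < M" "tail e = c" "rank e = j" by blast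
    then show ?thesis
    proof cases
      case 1
      have w: "h (''adj'', 16 * c + j) = 0" using h j 1 by (auto simp: loaded_def adjacent_def)
      have "\<not> moving j h v"
      proof
        assume m: "moving j h v"
        then have "n < hops v" "rank (unit_dart (c, g)) = j" using n tv by (auto simp: moving_def)
        with walk_dart(1,2)[OF True, of n] tv 1[of "unit_dart (c, g)"] show False by (auto simp: carries_def)
      qed
      then have "\<forall>q\<in>own ?N {} {} {''pth''} W d. after_hop j h q = h q"
        by (auto simp: own after_hop_def)
      then show ?thesis unfolding v_def[symmetric] using l hv xs w n
        by (simp add: hop_body_def own)
    next
      case 2
      have w: "h (''adj'', 16 * c + j) = Suc e" using h 2 by (auto simp: loaded_def adjacent_def)
      have he: "h (''po'', e) = out_off e" "h (''pi'', e) = in_off e" "h (''f'', e) = f e" "h (''hd'', e) = head e"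
        using h off 2 by (auto simp: loaded_def wired_def offsets_done_def)
      show ?thesis
      proof (cases "out_off e \<le> g \<and> g < out_off e + f e")
        case True
        then have ca: "carries e g" using 2 by (simp add: carries_def)
        have ud: "unit_dart (c, g) = e" using unit_dart_eq[OF ca] 2 by simp
        \<comment> \<open>A stopped unit has a number below every \<open>out_off\<close> at its
          vertex, so a walker that has arrived never matches a dart.\<close>
        have ns: "\<not> stopped (walk v n)" using True 2 tv by (simp add: stopped_def out_off_def)
        then have lt: "n < hops v" using stopped_hops[OF \<open>v \<in> sources\<close>] tv by (cases "n = hops v") auto
        have mv: "moving j h v" using \<open>v \<in> sources\<close> lt ud tv n 2 by (simp add: moving_def)
        have nx: "walk v (Suc n) = (head e, in_off e + (g - out_off e))"
          using walk_dart(4)[OF \<open>v \<in> sources\<close> lt] tv ud by simp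
        have z: "Suc n \<le> Z" "head e \<le> Z" "in_off e + (g - out_off e) \<le> Z" "e \<le> Z" "Suc e \<le> Z"
          using lt hops_H[OF \<open>v \<in> sources\<close>] W WZ smallD(2)[OF sm, of "(''hd'', e)"] he walk_unit_le[OF \<open>v \<in> sources\<close>, of "Suc n"] nx zw w
          by auto
        have nW: "Suc n < W" using lt hops_H[OF \<open>v \<in> sources\<close>] W by simp
        have "(v * W + r) div W = v \<and> (v * W + r) mod W = r" if "r < W" for r using that by simp
        from this[OF nW] have dv: "(v * W + Suc n) div W = v" "(v * W + Suc n) mod W = Suc n" by blast+
        have cell: "after_hop j h (''pth'', q) = (if q = v * W + Suc n then head e else h (''pth'', q))" if "q div W = v" for q
        proof -
          have "q = v * W + q mod W" using that by (metis div_mult_mod_eq)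
          then have iff: "q mod W = Suc n \<longleftrightarrow> q = v * W + Suc n" using dv by metis
          have "after_hop j h (''pth'', q) = (if moving j h (q div W) \<and> q mod W = h (''hp'', q div W) + 1
            then fst (walk (q div W) (q mod W)) else h (''pth'', q))" by (simp add: after_hop_def)
          also have "\<dots> = (if q mod W = Suc n then fst (walk v (q mod W)) else h (''pth'', q))"
            unfolding that n(1) using mv by simp
          also have "\<dots> = (if q mod W = Suc n then head e else h (''pth'', q))" using nx by (cases "q mod W = Suc n") simp_all
          finally show ?thesis unfolding iff .
        qed
        have other: "after_hop j h (''hp'', v) = Suc n" "after_hop j h (''cu'', v) = head e"
          "after_hop j h (''gg'', v) = in_off e + (g - out_off e)"
          using mv nx n by (simp_all add: after_hop_def)
        show ?thesis unfolding v_def[symmetric] own using l hv xs w n z he True dv W0 other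
          by (simp add: hop_body_def ball_Un cell)
      next
        case False
        have "\<not> moving j h v"
        proof
          assume m: "moving j h v"
          then have lt: "n < hops v" "rank (unit_dart (c, g)) = j" using n tv by (auto simp: moving_def)
          with walk_dart(1,2)[OF \<open>v \<in> sources\<close> lt(1)] tv have "unit_dart (c, g) < M" "tail (unit_dart (c, g)) = c" "carries (unit_dart (c, g)) g"
            by (auto simp: carries_def)
          with lt 2 rank_inj[of "unit_dart (c, g)" e] False show False by (auto simp: carries_def)
        qed
        then have st: "\<forall>q\<in>own ?N {} {} {''pth''} W d. after_hop j h q = h q"
          by (auto simp: own after_hop_def)
        have "Suc e \<le> Z" using zw w by simp
        then show ?thesis unfolding v_def[symmetric] using l hv xs w n he False st
          by (auto simp: hop_body_def own)
      qed
    qed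
  qed
next
  let ?N = "{''cu'', ''gg'', ''hp''}"
  fix q assume q: "\<And>d. d < M \<Longrightarrow> rank d = 0 \<Longrightarrow> q \<notin> own ?N {} {} {''pth''} W d"
  obtain b y where qe: "q = (b, y)" by (cases q)
  have mvv: "moving j h v \<Longrightarrow> \<exists>d<M. rank d = 0 \<and> tail d = v" for v
    using sources_verts verts_lead by (auto simp: moving_def)
  have "\<not> moving j h y" if "b \<in> ?N"
  proof
    assume "moving j h y"
    from mvv[OF this] obtain d where "d < M" "rank d = 0" "tail d = y" by blast
    with q[of d] that show False by (simp add: own_def qe)
  qed
  moreover have "\<not> moving j h (y div W)" if "b = ''pth''"
  proof
    assume "moving j h (y div W)"
    from mvv[OF this] obtain d where "d < M" "rank d = 0" "tail d = y div W" by blast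
    with q[of d] that show False by (simp add: own_def qe)
  qed
  ultimately show "after_hop j h q = h q" by (auto simp: qe after_hop_def)
qed (use l h in \<open>auto simp: loaded_def hop_body_def\<close>)

text \<open>Progress is lexicographic: a walker is finished, or ahead of sweep \<open>r\<close>, or
  exactly \<open>r\<close> hops along with a next dart of rank at least \<open>j\<close>. It can be
  ahead because one sweep over the ranks may contain several hops of the same walker.\<close>

definition traced :: "heap \<Rightarrow> nat \<Rightarrow> nat \<Rightarrow> heap \<Rightarrow> bool" where
  "traced h0 r j h \<longleftrightarrow> tracking h \<and>
     (\<forall>s\<in>sources. (\<forall>n. 1 \<le> n \<longrightarrow> n \<le> h (''hp'', s) \<longrightarrow> h (''pth'', s * W + n) = fst (walk s n)) \<and>
        (hops s \<le> h (''hp'', s) \<or> r < h (''hp'', s) \<or>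
         r = h (''hp'', s) \<and> j \<le> rank (unit_dart (walk s (h (''hp'', s)))))) \<and>
     (\<forall>q. q div W \<notin> sources \<longrightarrow> h (''pth'', q) = h0 (''pth'', q))"

lemma traced_hop:
  assumes t: "traced h0 r j h"
  shows "traced h0 r (Suc j) (after_hop j h)"
proof -
  have W0: "0 < W" using W by simp
  have tr: "tracking h" using t by (simp add: traced_def)
  have nth: "(s * W + n) div W = s \<and> (s * W + n) mod W = n" if "s \<in> sources" "n \<le> hops s" for s n
  proof -
    have "n < W" using that hops_H[of s] W by simp
    then show ?thesis by simp
  qed
  have "tracking (after_hop j h)"
    unfolding tracking_def
  proof (intro ballI conjI)
    fix s assume s: "s \<in> sources"
    show "after_hop j h (''hp'', s) \<le> hops s"
      using tr s by (auto simp: tracking_def after_hop_def moving_def)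
    show "(after_hop j h (''cu'', s), after_hop j h (''gg'', s)) = walk s (after_hop j h (''hp'', s))"
      using tr s by (cases "moving j h s") (auto simp: tracking_def after_hop_def)
  qed
  moreover have "after_hop j h (''pth'', s * W + n) = fst (walk s n)"
    if s: "s \<in> sources" and n: "1 \<le> n" "n \<le> after_hop j h (''hp'', s)" for s n
  proof -
    have n': "n \<le> hops s" using n tr s by (auto simp: tracking_def after_hop_def moving_def split: if_splits)
    have e: "after_hop j h (''pth'', s * W + n) = (if moving j h s \<and> n = h (''hp'', s) + 1 then fst (walk s n) else h (''pth'', s * W + n))"
    proof -
      have "after_hop j h (''pth'', q) = (if moving j h (q div W) \<and> q mod W = h (''hp'', q div W) + 1
        then fst (walk (q div W) (q mod W)) else h (''pth'', q))" for q by (simp add: after_hop_def)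
      note this[of "s * W + n"]
      then show ?thesis unfolding conjunct1[OF nth[OF s n']] conjunct2[OF nth[OF s n']] .
    qed
    show ?thesis
    proof (cases "moving j h s \<and> n = h (''hp'', s) + 1")
      case True
      then show ?thesis using e by simp
    next
      case False
      then have "n \<le> h (''hp'', s)" using n(2) by (auto simp: after_hop_def split: if_splits)
      then show ?thesis using e False t s n(1) by (auto simp: traced_def)
    qed
  qed
  moreover have "hops s \<le> after_hop j h (''hp'', s) \<or> r < after_hop j h (''hp'', s) \<or>
         r = after_hop j h (''hp'', s) \<and> Suc j \<le> rank (unit_dart (walk s (after_hop j h (''hp'', s))))"
    if s: "s \<in> sources" for s
  proof (cases "moving j h s")
    case True
    then show ?thesis using t s by (auto simp: traced_def after_hop_def)
  next
    case False
    then have "after_hop j h (''hp'', s) = h (''hp'', s)" by (simp add: after_hop_def)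
    moreover have "h (''hp'', s) < hops s \<Longrightarrow> rank (unit_dart (walk s (h (''hp'', s)))) \<noteq> j"
      using False s by (simp add: moving_def)
    moreover have "hops s \<le> h (''hp'', s) \<or> r < h (''hp'', s) \<or>
         r = h (''hp'', s) \<and> j \<le> rank (unit_dart (walk s (h (''hp'', s))))"
      using t s by (simp add: traced_def)
    ultimately show ?thesis by fastforce
  qed
  moreover have "after_hop j h (''pth'', q) = h0 (''pth'', q)" if "q div W \<notin> sources" for q
    using t that by (simp add: traced_def after_hop_def moving_def)
  ultimately show ?thesis unfolding traced_def by blast
qed

text \<open>All ranks are below 16, so after a full sweep no unfinished walker is still waiting for
  its dart.\<close>

lemma traced_next:
  assumes "traced h0 r 16 h"
  shows "traced h0 (Suc r) 0 h"
proof -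
  have "hops s \<le> h (''hp'', s) \<or> Suc r < h (''hp'', s) \<or> Suc r = h (''hp'', s)" if s: "s \<in> sources" for s
  proof (rule ccontr)
    assume n: "\<not> ?thesis"
    then have "r = h (''hp'', s)" "16 \<le> rank (unit_dart (walk s (h (''hp'', s))))" "h (''hp'', s) < hops s"
      using assms s by (auto simp: traced_def)
    with walk_dart(1)[OF s this(3)] rank_less[of "unit_dart (walk s (h (''hp'', s)))"] show False
      by (simp add: carries_def)
  qed
  then show ?thesis using assms by (simp add: traced_def)
qed

lemma run_trace:
  assumes l: "l ''M'' = M" "l ''W'' = W" "l ''H'' = H" and h: "loaded h"
  shows "run trace l h (4000 * (H + 1) * (M + 1)) (4000 * (H + 1)) (\<lambda>l' h'. same_locals {''j'', ''r''} l l' \<and>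
    same trace_arrays h h' \<and> (\<forall>s\<in>sources. h' (''hp'', s) = hops s \<and>
       (\<forall>n. 1 \<le> n \<longrightarrow> n \<le> hops s \<longrightarrow> h' (''pth'', s * W + n) = fst (walk s n))) \<and>
    (\<forall>q. q div W \<notin> sources \<longrightarrow> h' (''pth'', q) = h (''pth'', q)))"
proof -
  have 1: "run (leaders trace_init) l h (100 * (M + 1)) 100 (\<lambda>l1 h1. l1 = l \<and> h1 = after_init h)"
    by (rule run_trace_init) (rule l(1), rule h)
  have i: "same trace_arrays h (after_init h)" by (simp add: same_def after_init_def)
  have li: "loaded (after_init h)" by (rule loaded_same[OF h i])
  have "offsets_upto 0 (after_init h)"
    by (simp add: offsets_upto_def after_init_def out_part_def in_part_def)
  from run_offsets[OF _ li this] have 2: "run (pass offsets_body) l1 h1 (1800 * (M + 1)) 1800 (\<lambda>l' h'. same_locals {''j''} l l' \<and>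
    same {''ao'', ''ai'', ''po'', ''pi''} (after_init h) h' \<and> offsets_done h')" if "l1 = l \<and> h1 = after_init h" for l1 h1
    using that l by simp
  define Q where "Q = (\<lambda>r j h'. same trace_arrays h h' \<and> offsets_done h' \<and> traced h r j h')"
  have 3: "run (For ''r'' (Var ''H'') (For ''j'' (Num 16) (leaders hop_body))) l1 h1
      (H * (1800 * (M + 1) + exp_cost (Var ''H'') + 7) + (exp_cost (Var ''H'') + 5))
      (H * (1800 + exp_cost (Var ''H'') + 7) + (exp_cost (Var ''H'') + 5))
      (\<lambda>l' h'. same_locals {''j'', ''r''} l l' \<and> l' ''r'' = H \<and> Q H 0 h')"
    if A: "same_locals {''j''} l l1 \<and> same {''ao'', ''ai'', ''po'', ''pi''} (after_init h) h1 \<and> offsets_done h1" for l1 h1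
  proof (rule run_for[where Inv = "\<lambda>r l' h'. same_locals {''j'', ''r''} l l' \<and> l' ''r'' = r \<and> Q r 0 h'"])
    have s1: "same trace_arrays h h1" using A i by (auto simp: same_def)
    have init: "h1 (''hp'', v) = 0" "h1 (''cu'', v) = v" "h1 (''gg'', v) = 0" if "v \<in> verts" for v
      using A that by (auto simp: same_def after_init_def)
    have pth: "h1 (''pth'', q) = h (''pth'', q)" for q
      using A by (auto simp: same_def after_init_def)
    have "tracking h1" using init sources_verts by (auto simp: tracking_def)
    then have "traced h 0 0 h1" using init sources_verts pth by (auto simp: traced_def)
    then show "same_locals {''j'', ''r''} l (l1(''r'' := 0)) \<and> (l1(''r'' := 0)) ''r'' = 0 \<and> Q 0 0 h1"
      using A s1 by (auto simp: Q_def same_locals_def)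
    show "exp_ok (Var ''H'')" by simp
    show "H \<le> Z" using W WZ by simp
  next
    fix r l' h' assume "same_locals {''j'', ''r''} l l' \<and> l' ''r'' = r \<and> Q r 0 h'"
    then show "l' ''r'' = r \<and> val (Var ''H'') l' h' = H" using l by (simp add: same_locals_def)
  next
    fix r l' h' assume r: "r < H" and I: "same_locals {''j'', ''r''} l l' \<and> l' ''r'' = r \<and> Q r 0 h'"
    have "run (For ''j'' (Num 16) (leaders hop_body)) l' h' (1800 * (M + 1)) 1800 (\<lambda>l2 h2. same_locals {''j''} l' l2 \<and> Q r 16 h2)"
    proof (rule run_for16)
      show "Q r 0 h'" using I by simp
      fix j l2 h2 assume j: "j < 16" "same_locals {''j''} l' l2" "l2 ''j'' = j" and q: "Q r j h2"
      have l2: "l2 ''M'' = M" "l2 ''W'' = W" using l I j by (auto simp: same_locals_def)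
      have h2: "loaded h2" "offsets_done h2" "tracking h2"
        using q loaded_same[OF h] by (auto simp: Q_def traced_def)
      show "run (leaders hop_body) l2 h2 (100 * (M + 1)) 100 (\<lambda>l3 h3. l3 = l2 \<and> Q r (Suc j) h3)"
      proof (rule run_weaken[OF run_hop[OF l2(1) j(3) l2(2) j(1) h2]])
        fix l3 h3 assume A: "l3 = l2 \<and> h3 = after_hop j h2"
        have "same trace_arrays h2 (after_hop j h2)" by (simp add: same_def after_hop_def)
        moreover have "offsets_done (after_hop j h2)" using h2(2) by (simp add: offsets_done_def after_hop_def)
        ultimately show "l3 = l2 \<and> Q r (Suc j) h3"
          using A q traced_hop[of h r j h2] same_trans[of trace_arrays h h2 "after_hop j h2"] by (simp add: Q_def)
      qed auto
    qed
    then show "run (For ''j'' (Num 16) (leaders hop_body)) l' h' (1800 * (M + 1)) 1800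
      (\<lambda>l2 h2. l2 ''r'' = r \<and> same_locals {''j'', ''r''} l (l2(''r'' := Suc r)) \<and> (l2(''r'' := Suc r)) ''r'' = Suc r \<and> Q (Suc r) 0 h2)"
      by (rule run_weaken) (use I traced_next in \<open>auto simp: Q_def same_locals_def\<close>)
  qed
  show ?thesis unfolding trace_def
  proof (rule run_weaken)
    show "run (Seq (leaders trace_init) (Seq (pass offsets_body) (For ''r'' (Var ''H'') (For ''j'' (Num 16) (leaders hop_body))))) l h
      (100 * (M + 1) + (1800 * (M + 1) + (H * (1800 * (M + 1) + exp_cost (Var ''H'') + 7) + (exp_cost (Var ''H'') + 5))))
      (100 + (1800 + (H * (1800 + exp_cost (Var ''H'') + 7) + (exp_cost (Var ''H'') + 5))))
      (\<lambda>l' h'. same_locals {''j'', ''r''} l l' \<and> l' ''r'' = H \<and> Q H 0 h')"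
      by (rule run_seq[OF 1], rule run_seq[OF 2], assumption, rule 3)
  next
    fix l' h' assume A: "same_locals {''j'', ''r''} l l' \<and> l' ''r'' = H \<and> Q H 0 h'"
    \<comment> \<open>No walk has more than \<open>H\<close> hops, so \<open>H\<close> sweeps finish
      every walker.\<close>
    have hp: "h' (''hp'', s) = hops s" if s: "s \<in> sources" for s
      using A s hops_H[OF s] by (force simp: Q_def traced_def tracking_def)
    then show "same_locals {''j'', ''r''} l l' \<and> same trace_arrays h h' \<and> (\<forall>s\<in>sources. h' (''hp'', s) = hops s \<and>
       (\<forall>n. 1 \<le> n \<longrightarrow> n \<le> hops s \<longrightarrow> h' (''pth'', s * W + n) = fst (walk s n))) \<and>
      (\<forall>q. q div W \<notin> sources \<longrightarrow> h' (''pth'', q) = h (''pth'', q))"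
      using A by (auto simp: Q_def traced_def)
  qed (auto simp: algebra_simps)
qed

end

section \<open>One scale: flow, draining, tracing, update\<close>

text \<open>Only unmatched sources below the top label take part. Labels never fall, so a source
  that has reached \<open>H\<close> stays unmatched and ends up inside the cut.\<close>

definition scale_init :: com where
  "scale_init = Seq (Put ''x'' vv (Get ''un'' vv \<otimes> Op Less (Get ''lab'' vv) (Var ''H'')))
     (Seq (Put ''sr'' vv (Get ''x'' vv)) (Put ''ab'' vv (Num 0)))"

definition clear_flow :: com where
  "clear_flow = ParFor ''d'' (Var ''M'') (Put ''f'' vd (Num 0))"

text \<open>The prices are saved before draining: the labels are feasible for that flow, so with
  these prices as lengths they are feasible for zero flow, where the next scale starts.\<close>

definition next_len :: com where
  "next_len = ParFor ''d'' (Var ''M'') (Put ''nl'' vd (cost_exp vd (Get ''f'' vd)))"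

definition commit_body :: com where
  "commit_body = Seq (Cond (Op Less (Get ''x'' vv) (Get ''sr'' vv))
       (Seq (Put ''un'' vv (Num 0)) (Put ''pl'' vv (Get ''hp'' vv \<oplus> Num 1))) Skip)
     (Cond (Get ''ab'' vv) (Put ''fr'' vv (Num 0)) Skip)"

definition commit_len :: com where
  "commit_len = ParFor ''d'' (Var ''M'') (Put ''len'' vd (Get ''nl'' vd))"

definition scale :: com where
  "scale = Seq (leaders scale_init) (Seq clear_flow (Seq (For ''r'' (Var ''R'') flow_round)
     (Seq next_len (Seq (For ''r'' (Var ''W'') drain_round) (Seq trace
     (Seq (leaders commit_body) (Seq commit_len (Assign ''k'' (Var ''k'' \<oslash> Num 2)))))))))"

text \<open>\<open>simple\<close> makes a vertex sequence determine its darts, so the congestion of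
  darts can be counted on stored vertex sequences.\<close>

locale algorithm = net_machine M tail head mate rank \<phi> B Z
  for M tail head mate rank \<phi> B Z +
  fixes S T :: "nat set" and g I :: nat
  assumes finite_S: "finite S"
    and simple: "\<And>d e. d < M \<Longrightarrow> e < M \<Longrightarrow> tail d = tail e \<Longrightarrow> head d = head e \<Longrightarrow> d = e"
    and Z_big: "M * (2 ^ I * 2 ^ (g + 3) * (g + 7)) + 2 * M * (2 ^ I * (g + 3)) + 2 * 2 ^ (g + 3) + 3 \<le> Z"
      "2 * 2 ^ I * 2 ^ (g + 3) * (g + 7) \<le> Z" 
begin

definition H :: nat where "H = 2 ^ (g + 3)"
definition K :: nat where "K = 2 ^ I"
definition W :: nat where "W = H + 1"
definition R :: nat where "R = 2 * K * H * (g + 7)"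

definition path_of :: "heap \<Rightarrow> nat \<Rightarrow> nat list" where
  "path_of h v = v # map (\<lambda>n. h (''pth'', v * W + n)) [1..<h (''pl'', v)]"

definition linked :: "nat list \<Rightarrow> bool" where
  "linked p \<longleftrightarrow> (\<forall>i. Suc i < length p \<longrightarrow> (\<exists>d<M. tail d = p ! i \<and> head d = p ! Suc i))"

definition uses :: "nat \<Rightarrow> nat list \<Rightarrow> bool" where
  "uses d p \<longleftrightarrow> (\<exists>i. Suc i < length p \<and> tail d = p ! i \<and> head d = p ! Suc i)"

definition matched :: "heap \<Rightarrow> nat set" where
  "matched h = {v \<in> S - T. h (''un'', v) = 0}"

text \<open>Vertices in both \<open>S\<close> and \<open>T\<close> are paired with themselves by a
  path of one vertex, recorded as \<open>pl = 1\<close>, and are kept out of the flow. So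
  \<open>matched\<close>, \<open>fr\<close> and the routes only concern \<open>S - T\<close> and
  \<open>T - S\<close>.\<close>

definition routes_ok :: "heap \<Rightarrow> bool" where
  "routes_ok h \<longleftrightarrow>
     (\<forall>v\<in>matched h. 1 \<le> h (''pl'', v) \<and> h (''pl'', v) \<le> W \<and> distinct (path_of h v) \<and> linked (path_of h v) \<and>
        last (path_of h v) \<in> T - S \<and> h (''fr'', last (path_of h v)) = 0) \<and>
     inj_on (\<lambda>v. last (path_of h v)) (matched h) \<and>
     (\<forall>t\<in>T - S. h (''fr'', t) = 0 \<longrightarrow> t \<in> (\<lambda>v. last (path_of h v)) ` matched h) \<and>
     (\<forall>v. v \<notin> matched h \<longrightarrow> h (''pl'', v) = (if v \<in> S \<inter> T then 1 else 0))"

definition tables :: "heap \<Rightarrow> bool" where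
  "tables h \<longleftrightarrow> wired h \<and> adjacent h \<and> (\<forall>b\<le>g + 3. h (''pw'', b) = 2 ^ b)"

text \<open>The last three clauses are budgets, with \<open>k = K div 2 ^ i\<close>. Congestion:
  scale \<open>i\<close> adds at most \<open>k * (g + 3)\<close> routes per dart, and the halving
  series is covered by the reserve \<open>2 * k * (g + 3)\<close>. Length: \<open>M / 2 ^ i\<close>
  sources at block size \<open>K / 2 ^ i\<close> add at most \<open>2 * H * M / K\<close> in every
  scale. Live sources: their number is at most \<open>M / 2 ^ i\<close>.\<close>

definition state_inv :: "nat \<Rightarrow> heap \<Rightarrow> bool" where
  "state_inv i h \<longleftrightarrow> tables h \<and>
     (\<forall>d<M. 2 \<le> h (''len'', d) \<and> h (''len'', d) \<le> 2 * H \<and> h (''p'', d) = 0 \<and>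
        h (''lab'', tail d) \<le> h (''lab'', head d) + h (''len'', d)) \<and>
     (\<forall>v. h (''lab'', v) \<le> H \<and> h (''un'', v) \<le> 1 \<and> h (''fr'', v) \<le> 1 \<and>
        (h (''un'', v) = 1 \<longrightarrow> v \<in> S - T) \<and> (h (''fr'', v) = 1 \<longrightarrow> v \<in> T - S \<and> h (''lab'', v) = 0)) \<and>
     (\<forall>v. v \<notin> verts \<longrightarrow> h (''x'', v) = 0 \<and> h (''sr'', v) = 0 \<and> h (''ab'', v) = 0) \<and>
     routes_ok h \<and>
     (\<forall>d<M. card {v \<in> matched h. uses d (path_of h v)} + 2 * (K div 2 ^ i) * (g + 3) \<le> 2 * K * (g + 3)) \<and>
     K * (\<Sum>d<M. h (''len'', d)) \<le> K * (2 * M) + i * (2 * H * M) \<and>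
     2 ^ i * card {v \<in> verts. h (''un'', v) = 1 \<and> h (''lab'', v) < H} \<le> M"

definition scale_params :: "nat \<Rightarrow> locals \<Rightarrow> bool" where
  "scale_params i l \<longleftrightarrow> l ''M'' = M \<and> l ''H'' = H \<and> l ''W'' = W \<and> l ''R'' = R \<and> l ''k'' = K div 2 ^ i"

lemma run_flat:
  assumes l: "l ''M'' = M" and e: "exp_ok e" "exp_cost e \<le> 90"
    and val: "\<And>d. d < M \<Longrightarrow> val e (l(''d'' := d)) h = u d \<and> u d \<le> Z"
    and rd: "\<And>d. d < M \<Longrightarrow> reads e (l(''d'' := d)) h \<subseteq> {(b, q). b \<noteq> a}"
  shows "run (ParFor ''d'' (Var ''M'') (Put a vd e)) l h (100 * (M + 1)) 100
    (\<lambda>l1 h1. l1 = l \<and> h1 = upd h a (\<lambda>d. if d < M then u d else h (a, d)))"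
proof (rule run_par[where N = M and RS = "\<lambda>d. {(b, q). b \<noteq> a}" and WS = "\<lambda>d. {(a, d)}"])
  fix d assume "d < M" "small l h"
  then show "wp (Put a vd e) (l(''d'' := d)) h (\<lambda>l' h'' R Wr. R \<subseteq> {(b, q). b \<noteq> a} \<and> Wr \<subseteq> {(a, d)} \<and>
     (\<forall>q\<in>{(a, d)}. h'' q = upd h a (\<lambda>d. if d < M then u d else h (a, d)) q))"
    using val[of d] rd[of d] by simp
next
  fix q assume q: "\<And>i. i < M \<Longrightarrow> q \<notin> {(a, i)}"
  obtain b y where qe: "q = (b, y)" by (cases q)
  show "upd h a (\<lambda>d. if d < M then u d else h (a, d)) q = h q" using q[of y] by (auto simp: qe)
qed (use l e M_le in auto)

lemma run_scale_init:
  assumes l: "scale_params i l" and h: "state_inv i h"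
  defines "s0 \<equiv> \<lambda>v. if h (''lab'', v) < H then h (''un'', v) else 0"
  shows "run (leaders scale_init) l h (100 * (M + 1)) 100 (\<lambda>l1 h1. l1 = l \<and>
    h1 = upd (upd (upd h ''x'' (\<lambda>v. if v \<in> verts then s0 v else h (''x'', v)))
      ''sr'' (\<lambda>v. if v \<in> verts then s0 v else h (''sr'', v)))
      ''ab'' (\<lambda>v. if v \<in> verts then 0 else h (''ab'', v)))" (is "run _ _ _ _ _ (\<lambda>l1 h1. _ \<and> h1 = ?h')")
proof (rule run_dart_loop[where j = 0 and AT = "{''x'', ''sr'', ''ab''}" and AD = "{}" and AM = "{}" and AB = "{}" and Wd = 0])
  let ?N = "{''x'', ''sr'', ''ab''}"
  fix d assume d: "d < M" "rank d = 0" and sm: "small l h"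
  have v: "tail d \<in> verts" using d(1) by (rule tail_verts)
  have z: "s0 (tail d) \<le> Z" using smallD(2)[OF sm] by (auto simp: s0_def)
  have s: "h (''un'', tail d) * (if h (''lab'', tail d) < H then 1 else 0) = s0 (tail d)" by (simp add: s0_def)
  show "wp scale_init (l(''d'' := d, ''v'' := tail d)) h (\<lambda>l' h'' R W.
        R \<subseteq> {(a, q). a \<notin> ?N \<union> {} \<union> {} \<union> {}} \<union> own ?N {} {} {} 0 d \<and> W \<subseteq> own ?N {} {} {} 0 d \<and>
        (\<forall>q\<in>own ?N {} {} {} 0 d. h'' q = ?h' q))"
    using l v z by (simp add: scale_init_def own_tails scale_params_def s del: mult_eq_if)
next
  let ?N = "{''x'', ''sr'', ''ab''}"
  fix q assume q: "\<And>d. d < M \<Longrightarrow> rank d = 0 \<Longrightarrow> q \<notin> own ?N {} {} {} 0 d"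
  obtain b y where qe: "q = (b, y)" by (cases q)
  have "b \<in> ?N \<Longrightarrow> y \<notin> verts" using q unfolding verts_lead qe own_tails by blast
  then show "?h' q = h q" by (auto simp: qe)
qed (use l h in \<open>auto simp: scale_params_def state_inv_def tables_def scale_init_def\<close>)


lemma run_commit:
  assumes l: "l ''M'' = M" and h: "wired h"
    and hp: "\<And>v. v \<in> verts \<Longrightarrow> h (''x'', v) < h (''sr'', v) \<Longrightarrow> h (''hp'', v) + 1 \<le> Z"
  shows "run (leaders commit_body) l h (100 * (M + 1)) 100 (\<lambda>l1 h1. l1 = l \<and>
    h1 = upd (upd (upd h ''un'' (\<lambda>v. if v \<in> verts \<and> h (''x'', v) < h (''sr'', v) then 0 else h (''un'', v)))
      ''pl'' (\<lambda>v. if v \<in> verts \<and> h (''x'', v) < h (''sr'', v) then h (''hp'', v) + 1 else h (''pl'', v)))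
      ''fr'' (\<lambda>v. if v \<in> verts \<and> h (''ab'', v) \<noteq> 0 then 0 else h (''fr'', v)))" (is "run _ _ _ _ _ (\<lambda>l1 h1. _ \<and> h1 = ?h')")
proof (rule run_dart_loop[where j = 0 and AT = "{''un'', ''pl'', ''fr''}" and AD = "{}" and AM = "{}" and AB = "{}" and Wd = 0])
  let ?N = "{''un'', ''pl'', ''fr''}"
  fix d assume d: "d < M" "rank d = 0" and sm: "small l h"
  have v: "tail d \<in> verts" using d(1) by (rule tail_verts)
  show "wp commit_body (l(''d'' := d, ''v'' := tail d)) h (\<lambda>l' h'' R W.
        R \<subseteq> {(a, q). a \<notin> ?N \<union> {} \<union> {} \<union> {}} \<union> own ?N {} {} {} 0 d \<and> W \<subseteq> own ?N {} {} {} 0 d \<and>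
        (\<forall>q\<in>own ?N {} {} {} 0 d. h'' q = ?h' q))"
    using l v hp[OF v] by (simp add: commit_body_def own_tails)
next
  let ?N = "{''un'', ''pl'', ''fr''}"
  fix q assume q: "\<And>d. d < M \<Longrightarrow> rank d = 0 \<Longrightarrow> q \<notin> own ?N {} {} {} 0 d"
  obtain b y where qe: "q = (b, y)" by (cases q)
  have "b \<in> ?N \<Longrightarrow> y \<notin> verts" using q unfolding verts_lead qe own_tails by blast
  then show "?h' q = h q" by (auto simp: qe)
qed (use l h in \<open>auto simp: commit_body_def\<close>)

abbreviation "scale_arrays \<equiv> {''x'', ''sr'', ''ab'', ''f'', ''p'', ''lab'', ''nl'', ''un'', ''pl'', ''fr'', ''len''} \<union> trace_arrays"

lemma path_of_cong:
  assumes "h' (''pl'', v) = h (''pl'', v)" "\<And>n. n < h (''pl'', v) \<Longrightarrow> h' (''pth'', v * W + n) = h (''pth'', v * W + n)"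
  shows "path_of h' v = path_of h v"
  using assms by (auto simp: path_of_def)

lemma run_scale:
  assumes i: "i \<le> I" and l: "scale_params i l" and h: "state_inv i h"
  shows "run scale l h (6000 * (R + 2 * W + 1) * (M + 1)) (6000 * (R + 2 * W + 1)) (\<lambda>l' h'.
    same_locals {''j'', ''r'', ''k''} l l' \<and> scale_params (Suc i) l' \<and> state_inv (Suc i) h' \<and> same scale_arrays h h')"
proof -
  define k where "k = K div 2 ^ i"
  \<comment> \<open>The division is exact because \<open>i \<le> I\<close>; even the last scale has
    blocks of at least one unit.\<close>
  have Kk: "K = 2 ^ i * k" and k0: "0 < k"
    using i by (auto simp: k_def K_def power_diff[symmetric] power_add[symmetric])
  have kK: "k \<le> K" unfolding k_def by simp
  define len where "len = (\<lambda>d. h (''len'', d))"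
  define fr where "fr = (\<lambda>v. h (''fr'', v))"
  define sr where "sr = (\<lambda>v. if v \<in> verts \<and> h (''lab'', v) < H then h (''un'', v) else 0)"
  have hI: "tables h" "\<And>d. d < M \<Longrightarrow> 2 \<le> len d \<and> len d \<le> 2 * H \<and> h (''p'', d) = 0 \<and> h (''lab'', tail d) \<le> h (''lab'', head d) + len d"
    "\<And>v. h (''lab'', v) \<le> H" "\<And>v. h (''un'', v) \<le> 1" "\<And>v. fr v \<le> 1"
    "\<And>v. h (''un'', v) = 1 \<Longrightarrow> v \<in> S - T" "\<And>v. fr v = 1 \<Longrightarrow> v \<in> T - S \<and> h (''lab'', v) = 0"
    "\<And>v. v \<notin> verts \<Longrightarrow> h (''x'', v) = 0 \<and> h (''sr'', v) = 0 \<and> h (''ab'', v) = 0"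
    "routes_ok h" "\<And>d. d < M \<Longrightarrow> card {v \<in> matched h. uses d (path_of h v)} + 2 * k * (g + 3) \<le> 2 * K * (g + 3)"
    "K * (\<Sum>d<M. len d) \<le> K * (2 * M) + i * (2 * H * M)"
    "2 ^ i * card {v \<in> verts. h (''un'', v) = 1 \<and> h (''lab'', v) < H} \<le> M"
    using h unfolding state_inv_def len_def fr_def k_def by blast+
  have lp: "l ''M'' = M" "l ''H'' = H" "l ''W'' = W" "l ''R'' = R" "l ''k'' = k"
    using l by (auto simp: scale_params_def k_def)
  interpret fs: flow_scale M tail head mate rank k H g len sr fr
    using k0 hI by unfold_locales (auto simp: H_def sr_def)
  interpret sm: scale_machine M tail head mate rank k H g len sr fr \<phi> B Z
  proof unfold_locales
    have "M * (k * H * (g + 7)) \<le> M * (K * H * (g + 7))" using kK by (intro mult_le_mono) auto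
    moreover have "2 * M * fs.fmax \<le> 2 * M * (K * (g + 3))" unfolding fs.fmax_def using kK by (intro mult_le_mono) auto
    ultimately show "M * (k * H * (g + 7)) + 2 * M * fs.fmax + 2 * H + 3 \<le> Z"
      using Z_big(1) unfolding H_def K_def by linarith
    have "k * 1 \<le> k * (2 * H * (g + 7))" by (intro mult_le_mono2) (simp add: H_def)
    also have "\<dots> \<le> K * (2 * H * (g + 7))" using kK by (intro mult_le_mono1)
    also have "\<dots> = 2 * K * H * (g + 7)" by simp
    also have "\<dots> \<le> Z" using Z_big(2) unfolding H_def K_def .
    finally show "k \<le> Z" by simp
  qed
  have WZ: "W + 1 \<le> Z" and RZ: "R \<le> Z" using Z_big unfolding W_def R_def H_def K_def by linarith+
  define POT where "POT = M * (k * H * (g + 7))"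
  define h1 where "h1 = upd (upd (upd h ''x'' (\<lambda>v. if v \<in> verts then (if h (''lab'', v) < H then h (''un'', v) else 0) else h (''x'', v)))
      ''sr'' (\<lambda>v. if v \<in> verts then (if h (''lab'', v) < H then h (''un'', v) else 0) else h (''sr'', v)))
      ''ab'' (\<lambda>v. if v \<in> verts then 0 else h (''ab'', v))"
  define h2 where "h2 = upd h1 ''f'' (\<lambda>d. if d < M then 0 else h1 (''f'', d))"
  have 1: "run (leaders scale_init) l h (100 * (M + 1)) 100 (\<lambda>l' h'. l' = l \<and> h' = h1)"
    unfolding h1_def by (rule run_scale_init[OF l h])
  have 2: "run clear_flow l h1 (100 * (M + 1)) 100 (\<lambda>l' h'. l' = l \<and> h' = h2)"
    unfolding clear_flow_def h2_def by (rule run_flat) (use lp in auto)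
  have h2v: "h2 (''x'', v) = sr v" "h2 (''sr'', v) = sr v" "h2 (''ab'', v) = 0" for v
    using hI(8)[of v] by (auto simp: h2_def h1_def sr_def)
  have h2d: "d < M \<Longrightarrow> h2 (''f'', d) = 0" "h2 (''p'', d) = h (''p'', d)" "h2 (''lab'', d) = h (''lab'', d)" for d
    by (auto simp: h2_def h1_def)
  have s2: "same {''x'', ''sr'', ''ab'', ''f''} h h2" by (auto simp: same_def h2_def h1_def)
  have ready2: "sm.ready h2"
    using hI(1) unfolding sm.ready_def by (simp add: tables_def wired_def h2_def h1_def len_def fr_def)
  \<comment> \<open>Zero flow is feasible for the inherited labels, because the inherited lengths
    are the final prices of the previous scale, or 2 with all labels 0 at the beginning.\<close>
  have inv2: "fs.round_inv POT 0 (\<lambda>v. h2 (''x'', v)) (\<lambda>d. h2 (''f'', d)) (\<lambda>d. h2 (''p'', d)) (\<lambda>v. h2 (''lab'', v)) (\<lambda>v. h2 (''ab'', v))"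
    unfolding fs.round_inv_def
  proof (intro conjI allI impI)
    have "sum (\<lambda>d. h2 (''f'', d)) (ins v) = 0" "sum (\<lambda>d. h2 (''f'', d)) (outs v) = 0" "sum (\<lambda>d. h2 (''p'', d)) (ins v) = 0" for v
      using h2d hI(2) by (auto simp: insD outsD)
    then show "fs.conserved (\<lambda>v. h2 (''x'', v)) (\<lambda>d. h2 (''f'', d)) (\<lambda>d. h2 (''p'', d)) (\<lambda>v. h2 (''ab'', v))"
      by (simp add: fs.conserved_def h2v)
    show "fs.feasible (\<lambda>d. h2 (''f'', d)) (\<lambda>v. h2 (''lab'', v))"
      using hI(2,3) h2d by (simp add: fs.feasible_def fs.cost_def)
    show "fs.quiet (\<lambda>v. h2 (''x'', v)) (\<lambda>v. h2 (''lab'', v)) (\<lambda>v. h2 (''ab'', v))"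
      unfolding fs.quiet_def
    proof (intro allI conjI impI)
      fix v assume f: "fr v = 1"
      then have "h (''un'', v) = 0" using hI(4)[of v] hI(6)[of v] hI(7)[OF f] by force
      then show "h2 (''x'', v) = 0" by (simp add: h2v sr_def)
      show "h2 (''lab'', v) = 0" using hI(7)[OF f] h2d by simp
    qed (simp add: h2v)
    show "fs.pot (\<lambda>d. h2 (''f'', d)) (\<lambda>v. h2 (''lab'', v)) + 0 * fs.live (\<lambda>v. h2 (''x'', v)) (\<lambda>v. h2 (''lab'', v)) \<le> POT"
      using fs.pot_le unfolding POT_def by simp
    show "h2 (''p'', d) = 0" if "d < M" for d using h2d hI(2)[OF that] by simp
  qed
  let ?RI = "\<lambda>r h'. fs.round_inv POT r (\<lambda>v. h' (''x'', v)) (\<lambda>d. h' (''f'', d)) (\<lambda>d. h' (''p'', d)) (\<lambda>v. h' (''lab'', v)) (\<lambda>v. h' (''ab'', v))"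
  let ?dyn = "{''x'', ''f'', ''p'', ''lab'', ''ab''}"
  define Q3 where "Q3 = (\<lambda>r l' h'. same_locals {''j'', ''r''} l l' \<and> l' ''r'' = r \<and> same ?dyn h2 h' \<and> ?RI r h' \<and>
      (\<forall>v. h2 (''lab'', v) \<le> h' (''lab'', v)))"
  have pa: "sm.params l'" if "same_locals {''j'', ''r''} l l'" for l'
    using that lp by (simp add: sm.params_def same_locals_def)
  have 3: "run (For ''r'' (Var ''R'') flow_round) l h2 (R * (5600 * (M + 1) + exp_cost (Var ''R'') + 7) + (exp_cost (Var ''R'') + 5))
     (R * (5600 + exp_cost (Var ''R'') + 7) + (exp_cost (Var ''R'') + 5)) (Q3 R)"
  proof (rule run_for)
    show "Q3 0 (l(''r'' := 0)) h2" using inv2 by (simp add: Q3_def same_locals_def)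
    show "exp_ok (Var ''R'')" by simp
    show "R \<le> Z" by (rule RZ)
  next
    fix r l' h' assume "Q3 r l' h'"
    then show "l' ''r'' = r \<and> val (Var ''R'') l' h' = R" using lp by (simp add: Q3_def same_locals_def)
  next
    fix r l' h' assume r: "r < R" and q: "Q3 r l' h'"
    have sl: "same_locals {''j'', ''r''} l l'" and sd: "same ?dyn h2 h'" and ri: "?RI r h'" using q by (auto simp: Q3_def)
    have rd: "sm.ready h'" by (rule sm.ready_same[OF ready2 sd])
    show "run flow_round l' h' (5600 * (M + 1)) 5600 (\<lambda>l1 h1. l1 ''r'' = r \<and> Q3 (Suc r) (l1(''r'' := Suc r)) h1)"
    proof (rule run_weaken[OF sm.run_flow_round[OF pa[OF sl] rd ri]])
      fix l1 h1 assume A: "same_locals {''j''} l' l1 \<and> same ?dyn h' h1 \<and> ?RI (Suc r) h1 \<and> (\<forall>v. h' (''lab'', v) \<le> h1 (''lab'', v))"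
      have "same ?dyn h2 h1" using A sd same_trans by blast
      moreover have "\<forall>v. h2 (''lab'', v) \<le> h1 (''lab'', v)" using A q le_trans unfolding Q3_def by blast
      ultimately show "l1 ''r'' = r \<and> Q3 (Suc r) (l1(''r'' := Suc r)) h1"
        using A q by (simp add: Q3_def same_locals_def)
    qed auto
  qed
  define h4 where "h4 = (\<lambda>h3. upd h3 ''nl'' (\<lambda>d. if d < M then fs.cost d (h3 (''f'', d)) else h3 (''nl'', d)))"
  have 4: "run next_len l3 h3 (100 * (M + 1)) 100 (\<lambda>l' h'. l' = l3 \<and> h' = h4 h3)" if q: "Q3 R l3 h3" for l3 h3
    unfolding next_len_def h4_def
  proof (rule run_flat)
    have sl: "same_locals {''j'', ''r''} l l3" and sd: "same ?dyn h2 h3" and ri: "?RI R h3" using q by (auto simp: Q3_def)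
    have rd: "sm.ready h3" by (rule sm.ready_same[OF ready2 sd])
    have fe: "fs.feasible (\<lambda>d. h3 (''f'', d)) (\<lambda>v. h3 (''lab'', v))" using ri by (simp add: fs.round_inv_def)
    show "l3 ''M'' = M" using sl lp by (simp add: same_locals_def)
    show "exp_ok (cost_exp vd (Get ''f'' vd))" "exp_cost (cost_exp vd (Get ''f'' vd)) \<le> 90" by (simp_all add: cost_exp_def)
    fix d assume d: "d < M"
    have "h3 (''pw'', h3 (''f'', d) div k) = 2 ^ (h3 (''f'', d) div k)"
      using rd sm.div_fmax[OF fs.flow_le_fmax[OF fe d]] by (simp add: sm.ready_def)
    moreover have "h3 (''len'', d) = len d" using rd d by (simp add: sm.ready_def)
    moreover have "fs.cost d (h3 (''f'', d)) \<le> Z"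
      using fs.cost_le[OF fe d] hI(2)[OF d] WZ Z_big(1) unfolding H_def by linarith
    ultimately show "val (cost_exp vd (Get ''f'' vd)) (l3(''d'' := d)) h3 = fs.cost d (h3 (''f'', d)) \<and> fs.cost d (h3 (''f'', d)) \<le> Z"
      using sl lp by (simp add: cost_exp_def same_locals_def fs.cost_def)
    show "reads (cost_exp vd (Get ''f'' vd)) (l3(''d'' := d)) h3 \<subseteq> {(b, q). b \<noteq> ''nl''}" by (simp add: cost_exp_def)
  qed
  define N where "N = (\<lambda>h3 :: heap. fs.live (\<lambda>v. h3 (''x'', v)) (\<lambda>v. h3 (''lab'', v)))"
  let ?DR = "\<lambda>r n h'. fs.draining r n (\<lambda>v. h' (''x'', v)) (\<lambda>d. h' (''f'', d)) (\<lambda>d. h' (''p'', d)) (\<lambda>v. h' (''lab'', v)) (\<lambda>v. h' (''ab'', v))"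
  define Q5 where "Q5 = (\<lambda>h3 r l' h'. same_locals {''j'', ''r''} l l' \<and> l' ''r'' = r \<and> same {''x'', ''f'', ''p''} (h4 h3) h' \<and>
     ?DR r (N h3) h' \<and> (\<forall>d<M. h' (''p'', d) = 0))"
  have ready4: "sm.ready (h4 h3)" if q: "Q3 R l3 h3" for l3 h3
  proof -
    have "sm.ready h3" using q sm.ready_same[OF ready2] by (simp add: Q3_def)
    then show ?thesis by (simp add: sm.ready_def wired_def h4_def)
  qed
  have 5: "run (For ''r'' (Var ''W'') drain_round) l4 h' (W * (3600 * (M + 1) + exp_cost (Var ''W'') + 7) + (exp_cost (Var ''W'') + 5))
     (W * (3600 + exp_cost (Var ''W'') + 7) + (exp_cost (Var ''W'') + 5)) (Q5 h3 W)"
    if q: "Q3 R l3 h3" and lh: "l4 = l3 \<and> h' = h4 h3" for l3 h3 l4 h'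
  proof (rule run_for)
    have sl: "same_locals {''j'', ''r''} l l3" and ri: "?RI R h3" using q by (auto simp: Q3_def)
    have "?DR 0 (N h3) h'" unfolding N_def using fs.drain_start[OF ri] lh by (simp add: h4_def)
    then show "Q5 h3 0 (l4(''r'' := 0)) h'" using sl ri lh by (simp add: Q5_def same_locals_def fs.round_inv_def h4_def)
    show "exp_ok (Var ''W'')" by simp
    show "W \<le> Z" using WZ by simp
  next
    fix r l' h' assume "Q5 h3 r l' h'"
    then show "l' ''r'' = r \<and> val (Var ''W'') l' h' = W" using lp by (simp add: Q5_def same_locals_def)
  next
    fix r l' h' assume r: "r < W" and q5: "Q5 h3 r l' h'"
    have sl: "same_locals {''j'', ''r''} l l'" and sd: "same {''x'', ''f'', ''p''} (h4 h3) h'" and dr: "?DR r (N h3) h'"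
      and p0: "\<And>d. d < M \<Longrightarrow> h' (''p'', d) = 0" using q5 by (auto simp: Q5_def)
    have rd: "sm.ready h'" by (rule sm.ready_same[OF ready4[OF q] same_mono[OF sd]]) auto
    show "run drain_round l' h' (3600 * (M + 1)) 3600 (\<lambda>l1 h1. l1 ''r'' = r \<and> Q5 h3 (Suc r) (l1(''r'' := Suc r)) h1)"
    proof (rule run_weaken[OF sm.run_drain_round[OF pa[OF sl] rd dr p0]])
      fix l1 h1 assume A: "same_locals {''j''} l' l1 \<and> same {''x'', ''f'', ''p''} h' h1 \<and> ?DR (Suc r) (N h3) h1 \<and>
        (\<forall>d<M. h1 (''p'', d) = 0) \<and> (\<forall>d<M. h1 (''f'', d) \<le> h' (''f'', d))"
      have "same {''x'', ''f'', ''p''} (h4 h3) h1" using A sd same_trans by blast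
      then show "l1 ''r'' = r \<and> Q5 h3 (Suc r) (l1(''r'' := Suc r)) h1"
        using A q5 by (simp add: Q5_def same_locals_def)
    qed auto
  qed
  define Post where "Post = (\<lambda>l' h'. same_locals {''j'', ''r'', ''k''} l l' \<and> scale_params (Suc i) l' \<and> state_inv (Suc i) h' \<and> same scale_arrays h h')"
  have 6: "run (Seq trace (Seq (leaders commit_body) (Seq commit_len (Assign ''k'' (Var ''k'' \<oslash> Num 2))))) l5 h5
     (4000 * (H + 1) * (M + 1) + (100 * (M + 1) + (100 * (M + 1) + 4))) (4000 * (H + 1) + (100 + (100 + 4))) Post"
    if q: "Q3 R l3 h3" and q5: "Q5 h3 W l5 h5" for l3 h3 l5 h5
  proof -
    have sl3: "same_locals {''j'', ''r''} l l3" and sd3: "same ?dyn h2 h3" and ri3: "?RI R h3"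
      and mono3: "\<And>v. h2 (''lab'', v) \<le> h3 (''lab'', v)" using q by (auto simp: Q3_def)
    have sl5: "same_locals {''j'', ''r''} l l5" and sd5: "same {''x'', ''f'', ''p''} (h4 h3) h5" and dr5: "?DR W (N h3) h5"
      and p5: "\<And>d. d < M \<Longrightarrow> h5 (''p'', d) = 0" using q5 by (auto simp: Q5_def)
    have l5: "l5 ''M'' = M" "l5 ''W'' = W" "l5 ''H'' = H" "l5 ''k'' = k" "l5 ''R'' = R" using sl5 lp by (auto simp: same_locals_def)
    define x where "x = (\<lambda>v. h5 (''x'', v))"
    define f where "f = (\<lambda>d. h5 (''f'', d))"
    define ab where "ab = (\<lambda>v. h3 (''ab'', v))"
    define lab where "lab = (\<lambda>v. h3 (''lab'', v))"
    define c where "c = (\<lambda>d. fs.cost d (h3 (''f'', d)))"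
    have from3: "h5 (a, q) = h3 (a, q)" if "a \<notin> {''x'', ''f'', ''p'', ''nl''}" for a q
      using sd5 that by (simp add: same_def h4_def)
    have h5: "(\<lambda>v. h5 (''ab'', v)) = ab" "(\<lambda>v. h5 (''lab'', v)) = lab"
      using from3 by (auto simp: ab_def lab_def)
    have from0: "h3 (a, q) = h (a, q)" if "a \<notin> ?dyn \<union> {''sr''}" for a q
      using sd3 that by (simp add: same_def h2_def h1_def)
    have sr5: "h5 (''sr'', v) = sr v" for v using from3[of "''sr''" v] sd3 h2v by (simp add: same_def)
    have nl5: "d < M \<Longrightarrow> h5 (''nl'', d) = c d" for d using sd5 by (simp add: same_def h4_def c_def)
    have fe3: "fs.feasible (\<lambda>d. h3 (''f'', d)) lab" and qu3: "fs.quiet (\<lambda>v. h3 (''x'', v)) lab ab"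
      and co3: "fs.conserved (\<lambda>v. h3 (''x'', v)) (\<lambda>d. h3 (''f'', d)) (\<lambda>d. h3 (''p'', d)) ab"
      using ri3 unfolding fs.round_inv_def lab_def ab_def by blast+
    have labH: "lab v \<le> H" for v using fe3 by (simp add: fs.feasible_def)
    have dr: "fs.draining W (N h3) x f (\<lambda>d. h5 (''p'', d)) lab ab"
      using dr5 unfolding h5 x_def f_def .
    have co: "sr v + (\<Sum>d\<in>ins v. f d) = x v + ab v + (\<Sum>d\<in>outs v. f d)" for v
    proof -
      have "(\<Sum>d\<in>ins v. h5 (''p'', d)) = 0" using p5 by (auto simp: insD)
      then show ?thesis using dr by (simp add: fs.draining_def fs.conserved_def)
    qed
    have de: "f d \<le> fs.fmax" "0 < f d \<Longrightarrow> lab (head d) < lab (tail d)" if "d < M" for d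
      using dr that by (auto simp: fs.draining_def fs.descends_def)
    have ab1: "ab v \<le> 1" "ab v = 1 \<Longrightarrow> fr v = 1" for v
    proof -
      have "ab v \<le> fr v" using qu3 by (simp add: fs.quiet_def)
      then show "ab v \<le> 1" "ab v = 1 \<Longrightarrow> fr v = 1" using fs.fr[of v] by linarith+
    qed
    have fr_sr: "fr v = 1 \<Longrightarrow> sr v = 0" for v
    proof -
      assume a: "fr v = 1"
      then have "h (''un'', v) \<noteq> 1" using hI(6)[of v] hI(7)[OF a] by blast
      then have "h (''un'', v) = 0" using hI(4)[of v] by linarith
      then show "sr v = 0" by (simp add: sr_def)
    qed
    interpret ro: routed M tail head mate rank x f ab sr lab
    proof unfold_locales
      \<comment> \<open>\<open>W = H + 1\<close> draining rounds settle all labels up to and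
        including \<open>H\<close>.\<close>
      fix v show "x v = 0 \<or> (\<forall>d\<in>ins v. f d = 0)"
        using dr labH[of v] by (simp add: fs.draining_def fs.settled_def W_def)
    qed (use co de ab1 fr_sr fs.sr fs.sr_verts in auto)
    interpret tm: trace_machine M tail head mate rank x f ab sr lab \<phi> B Z H W
    proof unfold_locales
      fix v
      have "(\<Sum>d\<in>ins v. f d) \<le> (\<Sum>d\<in>ins v. fs.fmax)" using de(1) by (intro sum_mono) (simp add: insD)
      also have "\<dots> \<le> (\<Sum>d<M. fs.fmax)" by (intro sum_mono2) (auto simp: insD)
      finally show "sr v + (\<Sum>d\<in>ins v. f d) \<le> Z" using fs.sr[of v] sm.big by simp
    qed (use labH WZ in \<open>auto simp: W_def\<close>)
    have tab5: "tables h5"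
      using hI(1) from3 from0 by (simp add: tables_def wired_def adjacent_def)
    have lo5: "tm.loaded h5"
      unfolding tm.loaded_def using tab5 sr5 fun_cong[OF h5(1)] by (simp add: tables_def x_def f_def)
    define Q6 where "Q6 = (\<lambda>l6 h6. same_locals {''j'', ''r''} l5 l6 \<and> same trace_arrays h5 h6 \<and>
       (\<forall>s\<in>ro.sources. h6 (''hp'', s) = ro.hops s \<and> (\<forall>n. 1 \<le> n \<longrightarrow> n \<le> ro.hops s \<longrightarrow> h6 (''pth'', s * W + n) = fst (ro.walk s n))) \<and>
       (\<forall>q. q div W \<notin> ro.sources \<longrightarrow> h6 (''pth'', q) = h5 (''pth'', q)))"
    have r7: "run trace l5 h5 (4000 * (H + 1) * (M + 1)) (4000 * (H + 1)) Q6"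
      unfolding Q6_def by (rule tm.run_trace[OF l5(1,2,3) lo5])
    define h7 where "h7 = (\<lambda>h6 :: heap. upd (upd (upd h6 ''un'' (\<lambda>v. if v \<in> verts \<and> h6 (''x'', v) < h6 (''sr'', v) then 0 else h6 (''un'', v)))
      ''pl'' (\<lambda>v. if v \<in> verts \<and> h6 (''x'', v) < h6 (''sr'', v) then h6 (''hp'', v) + 1 else h6 (''pl'', v)))
      ''fr'' (\<lambda>v. if v \<in> verts \<and> h6 (''ab'', v) \<noteq> 0 then 0 else h6 (''fr'', v)))"
    have from5: "h6 (a, q) = h5 (a, q)" if "Q6 l6 h6" "a \<notin> trace_arrays" for l6 h6 a q
      using that by (simp add: Q6_def same_def)
    have src: "v \<in> ro.sources \<longleftrightarrow> x v < sr v" for v by (rule tm.sources_less)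
    have src6: "h6 (''x'', v) < h6 (''sr'', v) \<longleftrightarrow> v \<in> ro.sources" if "Q6 l6 h6" for l6 h6 v
      unfolding src using from5[OF that, of "''x''"] from5[OF that, of "''sr''"] sr5 by (simp add: x_def)
    have r8: "run (leaders commit_body) l6 h6 (100 * (M + 1)) 100 (\<lambda>l' h'. l' = l6 \<and> h' = h7 h6)" if q6: "Q6 l6 h6" for l6 h6
      unfolding h7_def
    proof (rule run_commit)
      show "l6 ''M'' = M" using q6 l5 by (simp add: Q6_def same_locals_def)
      show "wired h6" using tab5 from5[OF q6] by (simp add: tables_def wired_def)
      fix v assume "h6 (''x'', v) < h6 (''sr'', v)"
      then have "v \<in> ro.sources" using src6[OF q6] by simp
      then show "h6 (''hp'', v) + 1 \<le> Z" using q6 tm.hops_H[of v] WZ by (auto simp: Q6_def W_def)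
    qed
    define h8 where "h8 = (\<lambda>h6. upd (h7 h6) ''len'' (\<lambda>d. if d < M then h7 h6 (''nl'', d) else h7 h6 (''len'', d)))"
    have r9: "run commit_len l7 h' (100 * (M + 1)) 100 (\<lambda>l' h'. l' = l7 \<and> h' = h8 h6)"
      if q6: "Q6 l6 h6" and e: "l7 = l6 \<and> h' = h7 h6" for l6 h6 l7 h'
    proof (rule run_small)
      assume sm: "small l7 h'"
      show "run commit_len l7 h' (100 * (M + 1)) 100 (\<lambda>l' h'. l' = l7 \<and> h' = h8 h6)"
        unfolding commit_len_def h8_def e[THEN conjunct2, symmetric]
      proof (rule run_flat)
        show "l7 ''M'' = M" using q6 l5 e by (simp add: Q6_def same_locals_def)
      qed (use smallD(2)[OF sm] in auto)
    qed
    have post: "Post (l6(''k'' := k div 2)) (h8 h6)" if q6: "Q6 l6 h6" for l6 h6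
    proof -
      let ?h = "h8 h6"
      have g6: "h6 (a, q) = h (a, q)" if "a \<notin> ?dyn \<union> {''sr'', ''nl''} \<union> trace_arrays" for a q
        using that from5[OF q6, of a] from3[of a] from0[of a] by auto
      have un: "?h (''un'', v) = (if v \<in> ro.sources then 0 else h (''un'', v))" for v
        using src6[OF q6, of v] ro.sources_verts g6[of "''un''"] by (auto simp: h8_def h7_def)
      have pl: "?h (''pl'', v) = (if v \<in> ro.sources then ro.hops v + 1 else h (''pl'', v))" for v
        using src6[OF q6, of v] ro.sources_verts g6[of "''pl''"] q6 by (auto simp: h8_def h7_def Q6_def)
      have ab6: "h6 (''ab'', v) = ab v" for v using from5[OF q6, of "''ab''"] fun_cong[OF h5(1)] by simp
      have abv: "ab v \<noteq> 0 \<Longrightarrow> v \<in> verts" for v using ro.outside[of v] by (cases "v \<in> verts") auto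
      have frn: "?h (''fr'', v) = (if ab v = 1 then 0 else fr v)" for v
        using ab6[of v] abv[of v] ab1(1)[of v] g6[of "''fr''" v] by (auto simp: h8_def h7_def fr_def)
      have lenn: "d < M \<Longrightarrow> ?h (''len'', d) = c d" for d
        using from5[OF q6, of "''nl''"] nl5 by (simp add: h8_def h7_def)
      have other: "?h (a, q) = h6 (a, q)" if "a \<notin> {''un'', ''pl'', ''fr'', ''len''}" for a q
        using that by (simp add: h8_def h7_def)
      have labn: "?h (''lab'', v) = lab v" for v using other from5[OF q6, of "''lab''"] fun_cong[OF h5(2)] by simp
      have pth_new: "?h (''pth'', s * W + n) = fst (ro.walk s n)" if "s \<in> ro.sources" "1 \<le> n" "n \<le> ro.hops s" for s n
      proof -
        have "?h (''pth'', s * W + n) = h6 (''pth'', s * W + n)" by (rule other) simp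
        also have "\<dots> = fst (ro.walk s n)" using that q6 unfolding Q6_def by blast
        finally show ?thesis .
      qed
      have pth_old: "?h (''pth'', q) = h (''pth'', q)" if "q div W \<notin> ro.sources" for q
      proof -
        have "?h (''pth'', q) = h6 (''pth'', q)" by (rule other) simp
        also have "\<dots> = h5 (''pth'', q)" using that q6 unfolding Q6_def by blast
        also have "\<dots> = h (''pth'', q)" using from3[of "''pth''" q] from0[of "''pth''" q] by simp
        finally show ?thesis .
      qed
      have src_un: "v \<in> ro.sources \<Longrightarrow> h (''un'', v) = 1" for v
      proof -
        assume "v \<in> ro.sources"
        then have "0 < sr v" unfolding src by linarith
        then show "h (''un'', v) = 1" using hI(4)[of v] unfolding sr_def by (simp split: if_splits)
      qed
      have mat: "matched ?h = matched h \<union> ro.sources"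
      proof (intro set_eqI iffI)
        fix v assume "v \<in> matched ?h"
        then show "v \<in> matched h \<union> ro.sources" using un[of v] by (auto simp: matched_def split: if_splits)
      next
        fix v assume "v \<in> matched h \<union> ro.sources"
        then show "v \<in> matched ?h" using un[of v] src_un[of v] hI(6)[of v] by (auto simp: matched_def)
      qed
      have disj: "v \<notin> ro.sources" if "v \<in> matched h" for v using that src_un[of v] by (auto simp: matched_def)
      have rk: "\<forall>v\<in>matched h. 1 \<le> h (''pl'', v) \<and> h (''pl'', v) \<le> W \<and> distinct (path_of h v) \<and> linked (path_of h v) \<and>
        last (path_of h v) \<in> T - S \<and> fr (last (path_of h v)) = 0"
        "inj_on (\<lambda>v. last (path_of h v)) (matched h)"
        "\<forall>t\<in>T - S. fr t = 0 \<longrightarrow> t \<in> (\<lambda>v. last (path_of h v)) ` matched h"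
        "\<forall>v. v \<notin> matched h \<longrightarrow> h (''pl'', v) = (if v \<in> S \<inter> T then 1 else 0)"
        using hI(9) unfolding routes_ok_def fr_def by blast+
      \<comment> \<open>Tracing writes only into the blocks of its own sources, and a source already
        matched is not offered again.\<close>
      have old: "path_of ?h v = path_of h v" if v: "v \<in> matched h" for v
      proof (rule path_of_cong)
        show "?h (''pl'', v) = h (''pl'', v)" using pl disj[OF v] by simp
        fix n assume "n < h (''pl'', v)"
        then have "n < W" using rk(1) v by fastforce
        then have "(v * W + n) div W = v" by simp
        then show "?h (''pth'', v * W + n) = h (''pth'', v * W + n)" using pth_old disj[OF v] by simp
      qed
      have new: "path_of ?h s = ro.route s" if s: "s \<in> ro.sources" for s
      proof -
        have "ro.route s = fst (ro.walk s 0) # map (\<lambda>n. fst (ro.walk s n)) [1..<Suc (ro.hops s)]"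
          unfolding ro.route_def by (simp add: upt_conv_Cons del: upt_Suc)
        moreover have "map (\<lambda>n. ?h (''pth'', s * W + n)) [1..<?h (''pl'', s)] = map (\<lambda>n. fst (ro.walk s n)) [1..<Suc (ro.hops s)]"
          using pl[of s] s pth_new[OF s] by (intro map_cong) auto
        ultimately show ?thesis unfolding path_of_def by simp
      qed
      have len_route: "length (ro.route s) = Suc (ro.hops s)" for s by (simp add: ro.route_def)
      have nth_route: "n \<le> ro.hops s \<Longrightarrow> ro.route s ! n = fst (ro.walk s n)" for n s
        unfolding ro.route_def by (subst nth_map) (auto simp del: upt_Suc)
      have last_route: "last (ro.route s) = ro.terminus s" for s
        unfolding ro.terminus_def ro.route_def by (simp add: last_map)
      have link: "linked (ro.route s)" if s: "s \<in> ro.sources" for s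
        unfolding linked_def
      proof (intro allI impI)
        fix n assume "Suc n < length (ro.route s)"
        then have n: "n < ro.hops s" by (simp add: len_route)
        let ?d = "ro.unit_dart (ro.walk s n)"
        have "?d < M" using ro.walk_dart(1)[OF s n] unfolding ro.carries_def by blast
        moreover have "ro.route s ! n = tail ?d" "ro.route s ! Suc n = head ?d"
          using ro.walk_dart(2,3)[OF s n] nth_route[of n s] nth_route[of "Suc n" s] n by linarith+
        ultimately show "\<exists>d<M. tail d = ro.route s ! n \<and> head d = ro.route s ! Suc n" by metis
      qed
      have used: "\<exists>n<ro.hops s. ro.unit_dart (ro.walk s n) = d" if s: "s \<in> ro.sources" and d: "d < M" "uses d (ro.route s)" for s d
      proof -
        from d(2) obtain n where n: "n < ro.hops s" "tail d = ro.route s ! n" "head d = ro.route s ! Suc n"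
          by (auto simp: uses_def len_route)
        let ?d = "ro.unit_dart (ro.walk s n)"
        have "?d < M" using ro.walk_dart(1)[OF s n(1)] unfolding ro.carries_def by blast
        moreover have "tail ?d = tail d" "head ?d = head d"
          using ro.walk_dart(2,3)[OF s n(1)] nth_route[of n s] nth_route[of "Suc n" s] n by linarith+
        ultimately have "?d = d" using simple d(1) by blast
        then show ?thesis using n(1) by blast
      qed
      have tmn: "ab (ro.terminus s) = 1" "ro.terminus s \<in> T - S" "fr (ro.terminus s) = 1" if "s \<in> ro.sources" for s
        using ro.terminus_absorbs(1)[OF that] ab1(2) hI(7) by blast+
      have cong: "card {v \<in> matched ?h. uses d (path_of ?h v)} \<le> card {v \<in> matched h. uses d (path_of h v)} + fs.fmax" if d: "d < M" for d
      proof -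
        have fm: "finite (matched h)" using finite_S by (simp add: matched_def)
        have fsr: "finite ro.sources" using ro.sources_verts finite_subset finite_sets(3) by blast
        have "{v \<in> matched ?h. uses d (path_of ?h v)} \<subseteq> {v \<in> matched h. uses d (path_of h v)} \<union> {s \<in> ro.sources. \<exists>n<ro.hops s. ro.unit_dart (ro.walk s n) = d}"
          using mat old new used[OF _ d] by auto
        then have "card {v \<in> matched ?h. uses d (path_of ?h v)} \<le> card ({v \<in> matched h. uses d (path_of h v)} \<union> {s \<in> ro.sources. \<exists>n<ro.hops s. ro.unit_dart (ro.walk s n) = d})"
          by (rule card_mono[rotated]) (use fm fsr in auto)
        also have "\<dots> \<le> card {v \<in> matched h. uses d (path_of h v)} + card {s \<in> ro.sources. \<exists>n<ro.hops s. ro.unit_dart (ro.walk s n) = d}"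
          by (rule card_Un_le)
        also have "\<dots> \<le> card {v \<in> matched h. uses d (path_of h v)} + fs.fmax"
          using ro.route_congestion[OF d] de(1)[OF d] by linarith
        finally show ?thesis .
      qed
      have div2: "K div 2 ^ Suc i = k div 2" unfolding k_def power_Suc2 by (rule div_mult2_eq)
      have "routes_ok ?h" unfolding routes_ok_def
      proof (intro conjI ballI allI impI)
        fix v assume v: "v \<in> matched ?h"
        consider "v \<in> matched h" "v \<notin> ro.sources" | "v \<in> ro.sources" using v mat disj by blast
        note cases = this
        show "1 \<le> ?h (''pl'', v)" using cases pl rk(1) by (cases; auto)
        show "?h (''pl'', v) \<le> W" using cases pl rk(1) tm.hops_H by (cases; auto simp: W_def)
        show "distinct (path_of ?h v)" using cases old new rk(1) ro.route_distinct by (cases; auto)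
        show "linked (path_of ?h v)" using cases old new rk(1) link by (cases; auto)
        show "last (path_of ?h v) \<in> T - S"
          using cases old new rk(1) last_route tmn by (cases) simp_all
        show "?h (''fr'', last (path_of ?h v)) = 0"
          using cases old new rk(1) last_route tmn frn by (cases) simp_all
      next
        show "inj_on (\<lambda>v. last (path_of ?h v)) (matched ?h)"
        proof (rule inj_onI)
          fix v w assume vw: "v \<in> matched ?h" "w \<in> matched ?h" "last (path_of ?h v) = last (path_of ?h w)"
          \<comment> \<open>\<open>fr\<close> refers to the beginning of the scale: sinks reached
            earlier were no longer free then, those reached now were. Old and new routes thus cannot
            end at the same sink.\<close>
          have lv: "u \<in> matched h \<Longrightarrow> fr (last (path_of ?h u)) = 0" "u \<in> ro.sources \<Longrightarrow> fr (last (path_of ?h u)) = 1" for u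
            using old new rk(1) last_route tmn by simp_all
          consider "v \<in> matched h" "w \<in> matched h" | "v \<in> ro.sources" "w \<in> ro.sources"
            using vw lv mat by (metis UnE zero_neq_one)
          then show "v = w"
          proof cases
            case 1
            then show ?thesis using vw(3) old rk(2) by (auto dest: inj_onD)
          next
            case 2
            then show ?thesis using vw(3) new last_route ro.terminus_inj by (auto dest: inj_onD)
          qed
        qed
      next
        fix t assume t: "t \<in> T - S" "?h (''fr'', t) = 0"
        show "t \<in> (\<lambda>v. last (path_of ?h v)) ` matched ?h"
        proof (cases "ab t = 1")
          case True
          then have "t \<in> ro.terminus ` ro.sources" using ro.terminus_image by blast
          then show ?thesis using mat new last_route by (auto intro!: image_eqI)
        next
          case False
          then have "fr t = 0" using t frn by simp
          with t rk(3) have "t \<in> (\<lambda>v. last (path_of h v)) ` matched h" by blast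
          then show ?thesis using mat old by (auto intro!: image_eqI)
        qed
      next
        fix v assume "v \<notin> matched ?h"
        then show "?h (''pl'', v) = (if v \<in> S \<inter> T then 1 else 0)" using mat pl rk(4) by auto
      qed
      moreover have "tables ?h"
        using tab5 from5[OF q6] other by (simp add: tables_def wired_def adjacent_def)
      moreover have "2 \<le> c d" "c d \<le> 2 * H" "lab (tail d) \<le> lab (head d) + c d" if d: "d < M" for d
        using fs.cost_ge[OF d] fs.cost_le[OF fe3 d] hI(2)[OF d] fe3 d unfolding c_def fs.feasible_def by blast+
      moreover have "?h (''p'', d) = 0" if "d < M" for d using p5[OF that] other from5[OF q6, of "''p''"] by simp
      moreover have "?h (''fr'', v) = 1 \<Longrightarrow> v \<in> T - S \<and> lab v = 0" for v
        using frn[of v] hI(7)[of v] qu3 ab1(1)[of v] by (cases "ab v") (auto simp: fs.quiet_def split: if_splits)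
      moreover have "?h (''un'', v) \<le> 1" "?h (''un'', v) = 1 \<Longrightarrow> v \<in> S - T" "?h (''fr'', v) \<le> 1" for v
        using un[of v] hI(4)[of v] hI(6)[of v] frn[of v] hI(5)[of v] by (auto split: if_splits)
      moreover have "?h (''x'', v) = 0" "?h (''sr'', v) = 0" "?h (''ab'', v) = 0" if "v \<notin> verts" for v
        using ro.outside[OF that] ro.srv[OF that] ab6 sr5 other from5[OF q6, of "''x''"] from5[OF q6, of "''sr''"]
        by (auto simp: x_def)
      \<comment> \<open>This scale spends at most half of the reserve
        \<open>2 * k * (g + 3)\<close>; the other half covers the reserve required for
        \<open>k div 2\<close>.\<close>
      moreover have "card {v \<in> matched ?h. uses d (path_of ?h v)} + 2 * (k div 2) * (g + 3) \<le> 2 * K * (g + 3)" if d: "d < M" for d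
      proof -
        have "2 * (k div 2) * (g + 3) \<le> k * (g + 3)" by (intro mult_le_mono1) simp
        then show ?thesis using cong[OF d] hI(10)[OF d] by (simp add: fs.fmax_def algebra_simps)
      qed
      moreover have "K * (\<Sum>d<M. ?h (''len'', d)) \<le> K * (2 * M) + Suc i * (2 * H * M)"
      proof -
        have "k * (\<Sum>d<M. c d) \<le> k * (\<Sum>d<M. len d) + 2 * H * (\<Sum>v\<in>verts. sr v)"
          unfolding c_def by (rule fs.total_cost[OF co3 fe3])
        \<comment> \<open>Multiplication by \<open>2 ^ i\<close> turns \<open>k\<close> into
          \<open>K\<close> and the number of sources into at most \<open>M\<close>, which makes the
          increment independent of the scale.\<close>
        then have "2 ^ i * (k * (\<Sum>d<M. c d)) \<le> 2 ^ i * (k * (\<Sum>d<M. len d) + 2 * H * (\<Sum>v\<in>verts. sr v))" by (rule mult_le_mono2)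
        then have "K * (\<Sum>d<M. c d) \<le> K * (\<Sum>d<M. len d) + 2 * H * (2 ^ i * (\<Sum>v\<in>verts. sr v))"
          unfolding Kk by (simp add: algebra_simps)
        moreover have "(\<Sum>v\<in>verts. sr v) = card {v \<in> verts. h (''un'', v) = 1 \<and> h (''lab'', v) < H}"
        proof -
          have "(\<Sum>v\<in>verts. sr v) = (\<Sum>v\<in>verts. if h (''un'', v) = 1 \<and> h (''lab'', v) < H then 1 else 0)"
          proof (rule sum.cong[OF refl])
            fix v assume "v \<in> verts"
            then show "sr v = (if h (''un'', v) = 1 \<and> h (''lab'', v) < H then 1 else 0)"
              using hI(4)[of v] by (cases "h (''un'', v)") (auto simp: sr_def)
          qed
          also have "\<dots> = card (verts \<inter> {v. h (''un'', v) = 1 \<and> h (''lab'', v) < H})" by (simp add: sum.If_cases)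
          also have "verts \<inter> {v. h (''un'', v) = 1 \<and> h (''lab'', v) < H} = {v \<in> verts. h (''un'', v) = 1 \<and> h (''lab'', v) < H}" by blast
          finally show ?thesis .
        qed
        then have "2 * H * (2 ^ i * (\<Sum>v\<in>verts. sr v)) \<le> 2 * H * M" using hI(12) by (intro mult_le_mono2) simp
        moreover have e: "(\<Sum>d<M. ?h (''len'', d)) = (\<Sum>d<M. c d)" using lenn by (intro sum.cong) auto
        ultimately show ?thesis using hI(11) unfolding mult_Suc e by linarith
      qed
      moreover have "2 ^ Suc i * card {v \<in> verts. ?h (''un'', v) = 1 \<and> lab v < H} \<le> M"
      proof -
        have "card {v \<in> verts. ?h (''un'', v) = 1 \<and> lab v < H} = (\<Sum>v\<in>{v \<in> verts. ?h (''un'', v) = 1 \<and> lab v < H}. 1)" by simp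
        also have "\<dots> \<le> (\<Sum>v\<in>{v \<in> verts. ?h (''un'', v) = 1 \<and> lab v < H}. if lab v < H then x v else 0)"
        proof (rule sum_mono)
          fix v assume v: "v \<in> {v \<in> verts. ?h (''un'', v) = 1 \<and> lab v < H}"
          then have "\<not> x v < sr v" "h (''un'', v) = 1" using un[of v] src[of v] by (auto split: if_splits)
          \<comment> \<open>Labels only rise, so a vertex that ends below \<open>H\<close> began
            below \<open>H\<close>. It was a source of this scale, and its unit has come back to it
            as excess.\<close>
          moreover have "h (''lab'', v) < H" using v mono3[of v] h2d(3)[of v] by (auto simp: lab_def)
          ultimately show "1 \<le> (if lab v < H then x v else 0)" using v by (auto simp: sr_def)
        qed
        also have "\<dots> \<le> fs.live x lab" unfolding fs.live_def by (intro sum_mono2) auto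
        also have "\<dots> \<le> N h3" using dr by (simp add: fs.draining_def)
        finally have "card {v \<in> verts. ?h (''un'', v) = 1 \<and> lab v < H} \<le> N h3" .
        moreover have "2 * 2 ^ i * N h3 \<le> M" unfolding N_def
          by (rule fs.live_after[OF _ Kk]) (use ri3 in \<open>simp add: POT_def R_def\<close>)
        ultimately show ?thesis unfolding power_Suc using mult_le_mono2 le_trans by blast
      qed
      ultimately have "state_inv (Suc i) ?h"
        unfolding state_inv_def div2 labn using lenn labH by simp
      moreover have "same scale_arrays h ?h"
        unfolding same_def using other g6 by simp
      moreover have "scale_params (Suc i) (l6(''k'' := k div 2))"
        using q6 l5 div2 unfolding scale_params_def Q6_def same_locals_def by simp
      moreover have "same_locals {''j'', ''r'', ''k''} l (l6(''k'' := k div 2))"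
        using q6 sl5 unfolding Q6_def same_locals_def by simp
      ultimately show ?thesis unfolding Post_def by blast
    qed
    show ?thesis
    proof (rule run_seq[OF r7], rule run_seq[OF r8], assumption, rule run_seq[OF r9], assumption, assumption)
      fix l6 h6 l7 h7' l8 h8' assume q6: "Q6 l6 h6" and "l7 = l6 \<and> h7' = h7 h6" "l8 = l7 \<and> h8' = h8 h6"
      then have e: "l8 = l6" "h8' = h8 h6" by auto
      have "l6 ''k'' = k" using q6 l5 by (simp add: Q6_def same_locals_def)
      moreover have "k div 2 \<le> Z" using sm.k_le by (meson div_le_dividend le_trans)
      ultimately show "run (Assign ''k'' (Var ''k'' \<oslash> Num 2)) l8 h8' 4 4 Post"
        using post[OF q6] by (intro run_wp) (auto simp: e)
    qed
  qed
  let ?c = "100 * (M + 1)"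
  let ?tR = "R * (5600 * (M + 1) + exp_cost (Var ''R'') + 7) + (exp_cost (Var ''R'') + 5)"
  let ?dR = "R * (5600 + exp_cost (Var ''R'') + 7) + (exp_cost (Var ''R'') + 5)"
  let ?tW = "W * (3600 * (M + 1) + exp_cost (Var ''W'') + 7) + (exp_cost (Var ''W'') + 5)"
  let ?dW = "W * (3600 + exp_cost (Var ''W'') + 7) + (exp_cost (Var ''W'') + 5)"
  let ?t6 = "4000 * (H + 1) * (M + 1) + (?c + (?c + 4))"
  let ?d6 = "4000 * (H + 1) + (100 + (100 + 4))"
  let ?r6 = "Seq trace (Seq (leaders commit_body) (Seq commit_len (Assign ''k'' (Var ''k'' \<oslash> Num 2))))"
  let ?r5 = "Seq (For ''r'' (Var ''W'') drain_round) ?r6"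
  let ?r4 = "Seq next_len ?r5"
  let ?r3 = "Seq (For ''r'' (Var ''R'') flow_round) ?r4"
  have s5: "run ?r5 l4 h' (?tW + ?t6) (?dW + ?d6) Post" if "Q3 R l3 h3" "l4 = l3 \<and> h' = h4 h3" for l3 h3 l4 h'
    by (rule run_seq[OF 5[OF that]], rule 6[OF that(1)])
  have s4: "run ?r4 l3 h3 (?c + (?tW + ?t6)) (100 + (?dW + ?d6)) Post" if "Q3 R l3 h3" for l3 h3
    by (rule run_seq[OF 4[OF that]], rule s5[OF that])
  have s3: "run ?r3 l h2 (?tR + (?c + (?tW + ?t6))) (?dR + (100 + (?dW + ?d6))) Post"
    by (rule run_seq[OF 3], rule s4)
  have s2: "run (Seq clear_flow ?r3) l h1 (?c + (?tR + (?c + (?tW + ?t6)))) (100 + (?dR + (100 + (?dW + ?d6)))) Post"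
    by (rule run_seq[OF 2]) (use s3 in simp)
  have s1: "run scale l h (?c + (?c + (?tR + (?c + (?tW + ?t6))))) (100 + (100 + (?dR + (100 + (?dW + ?d6))))) Post"
    unfolding scale_def by (rule run_seq[OF 1]) (use s2 in simp)
  show ?thesis unfolding Post_def[symmetric]
  proof (rule run_weaken[OF s1])
    have "100 * x + (100 * x + (r * (5600 * x + 1 + 7) + (1 + 5) + (100 * x + (w * (3600 * x + 1 + 7) + (1 + 5) +
        (4000 * w * x + (100 * x + (100 * x + 4))))))) \<le> 6000 * (r + 2 * w + 1) * x" if "1 \<le> x" for r w x :: nat
    proof -
      have "w * 1 \<le> w * x" "r * 1 \<le> r * x" using that by (intro mult_le_mono2; simp)+
      moreover have "r * (5600 * x + 1 + 7) = 5600 * (r * x) + 8 * r" "w * (3600 * x + 1 + 7) = 3600 * (w * x) + 8 * w"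
        "4000 * w * x = 4000 * (w * x)" "6000 * (r + 2 * w + 1) * x = 6000 * (r * x) + 12000 * (w * x) + 6000 * x"
        by (simp_all add: algebra_simps)
      ultimately show ?thesis using that by linarith
    qed
    from this[of "M + 1" R W, OF le_add2]
    show "?c + (?c + (?tR + (?c + (?tW + ?t6)))) \<le> 6000 * (R + 2 * W + 1) * (M + 1)"
      by (simp only: exp_cost.simps W_def)
    have "4000 * (H + 1) = 4000 * W" by (simp add: W_def)
    moreover have "6000 * (R + 2 * W + 1) = 6000 * R + 12000 * W + 6000" by simp
    moreover have "R * (5600 + 1 + 7) = 5608 * R" "W * (3600 + 1 + 7) = 3608 * W" by simp_all
    ultimately show "100 + (100 + (?dR + (100 + (?dW + ?d6)))) \<le> 6000 * (R + 2 * W + 1)"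
      unfolding exp_cost.simps by linarith
  qed
qed

end

section \<open>The input graph and the parameters\<close>

abbreviation ends :: "nat \<times> nat \<Rightarrow> nat set" where "ends \<equiv> \<lambda>(u, v). {u, v}"

locale problem_input =
  fixes n :: nat and es :: "(nat \<times> nat) list" and S T :: "nat set"
  assumes edge: "\<And>i. i < length es \<Longrightarrow> fst (es ! i) < n \<and> snd (es ! i) < n \<and> fst (es ! i) \<noteq> snd (es ! i)"
    and distinct_edges: "distinct (map ends es)"
    and degree: "\<And>v. v < n \<Longrightarrow> card {e \<in> ends ` set es. v \<in> e} \<le> 16"
    and S_sub: "S \<subseteq> {..<n}" and T_sub: "T \<subseteq> {..<n}"
begin

definition m :: nat where "m = length es"
definition M :: nat where "M = 2 * m"
text \<open>Dart \<open>i < m\<close> is edge \<open>i\<close> in the given orientation, dart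
  \<open>i + m\<close> its reversal.\<close>

definition tail :: "nat \<Rightarrow> nat" where
  "tail d = (if d < m then fst (es ! d) else if d < M then snd (es ! (d - m)) else 0)"
definition mate :: "nat \<Rightarrow> nat" where "mate d = (if d < m then d + m else if d < M then d - m else d)"
definition head :: "nat \<Rightarrow> nat" where "head d = tail (mate d)"
text \<open>Counting earlier darts with the same tail is the form that keyed prefix sums with unit
  weights compute.\<close>

definition rank :: "nat \<Rightarrow> nat" where "rank d = card {e. e < d \<and> tail e = tail d}"
definition index :: "nat \<Rightarrow> nat" where "index d = (if d < m then d else d - m)"

lemma mate_props: "d < M \<Longrightarrow> mate d < M" "d < M \<Longrightarrow> mate (mate d) = d"
  by (auto simp: mate_def M_def)

lemma tail_neq_head: "d < M \<Longrightarrow> tail d \<noteq> head d"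
  and tail_less: "d < M \<Longrightarrow> tail d < n"
  using edge[of d] edge[of "d - m"] by (auto simp: tail_def head_def mate_def M_def m_def)

lemma index_less: "d < M \<Longrightarrow> index d < m"
  by (auto simp: index_def M_def)

lemma ends_index: "d < M \<Longrightarrow> map ends es ! index d = {tail d, head d}"
  by (auto simp: index_def tail_def head_def mate_def M_def m_def case_prod_beta insert_commute)

lemma index_eq: "d < M \<Longrightarrow> e < M \<Longrightarrow> index d = index e \<Longrightarrow> e = d \<or> e = mate d"
  by (auto simp: index_def mate_def M_def split: if_splits)

lemma ends_inj:
  assumes "d < M" "e < M" "{tail d, head d} = {tail e, head e}"
  shows "e = d \<or> e = mate d"
proof -
  have "map ends es ! index d = map ends es ! index e" using assms ends_index by metis
  then have "index d = index e"
    using distinct_edges index_less assms(1,2) by (simp add: nth_eq_iff_index_eq m_def del: nth_map)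
  then show ?thesis using index_eq assms by blast
qed

lemma tail_ends_inj:
  assumes "d < M" "e < M" "tail d = tail e" "{tail d, head d} = {tail e, head e}"
  shows "d = e"
  using ends_inj[OF assms(1,2,4)] tail_neq_head[OF assms(1)] assms(3) by (auto simp: head_def)

lemma card_darts: "v < n \<Longrightarrow> card {d. d < M \<and> tail d = v} \<le> 16"
proof -
  assume v: "v < n"
  have "card {d. d < M \<and> tail d = v} \<le> card {e \<in> ends ` set es. v \<in> e}"
  proof (rule card_inj_on_le)
    show "inj_on (\<lambda>d. {tail d, head d}) {d. d < M \<and> tail d = v}"
      using tail_ends_inj by (auto intro!: inj_onI)
    have "{tail d, head d} \<in> ends ` set es" if "d < M" for d
    proof -
      have "map ends es ! index d \<in> set (map ends es)" using index_less[OF that] by (intro nth_mem) (simp add: m_def)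
      then show ?thesis using ends_index[OF that] by simp
    qed
    then show "(\<lambda>d. {tail d, head d}) ` {d. d < M \<and> tail d = v} \<subseteq> {e \<in> ends ` set es. v \<in> e}" by blast
  qed simp
  then show ?thesis using degree[OF v] by linarith
qed

sublocale network M tail head mate rank
proof
  fix d assume d: "d < M"
  then show "mate d < M \<and> mate (mate d) = d \<and> tail (mate d) = head d" using mate_props by (simp add: head_def)
  show "\<exists>e<M. tail e = tail d \<and> rank e = 0"
  proof -
    define e where "e = (LEAST e. tail e = tail d)"
    have "tail e = tail d" unfolding e_def by (rule LeastI) simp
    moreover have "e \<le> d" unfolding e_def by (rule Least_le) simp
    moreover have "{x. x < e \<and> tail x = tail e} = {}" using calculation not_less_Least unfolding e_def by auto
    then have "rank e = 0" by (simp add: rank_def)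
    ultimately show ?thesis using d by (intro exI[of _ e]) linarith
  qed
  have "{e. e < d \<and> tail e = tail d} \<subset> {e. e < M \<and> tail e = tail d}" using d by auto
  then have "rank d < card {e. e < M \<and> tail e = tail d}" unfolding rank_def by (intro psubset_card_mono) auto
  then show "rank d < 16" using card_darts[OF tail_less[OF d]] by linarith
next
  show "mate d = d" if "M \<le> d" for d using that by (auto simp: mate_def M_def)
next
  fix d e assume de: "d < M" "e < M" "tail d = tail e" "rank d = rank e"
  have less: "rank x < rank y" if "x < y" "tail x = tail y" for x y
    unfolding rank_def using that by (intro psubset_card_mono) auto
  show "d = e" using less[of d e] less[of e d] de by (cases d e rule: linorder_cases) auto
qed

lemma verts_less: "v \<in> verts \<Longrightarrow> v < n"
  using tail_less by (auto simp: verts_def)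

end

text \<open>The first alternative in \<open>g\<close> makes \<open>2 ^ g\<close> about
  \<open>1 / \<phi>\<close>. The second caps \<open>g\<close> by the logarithm of the graph size
  however small \<open>\<phi>\<close> is; once \<open>2 ^ g\<close> reaches \<open>4 * m\<close>, a
  single crossing edge is already more than an average level affords. Degree 5 of \<open>Z\<close>
  leaves room for the potential, which is of order \<open>M * K * H * g\<close>.\<close>

locale problem = problem_input n es S T + machine \<phi> B Z
  for n es S T \<phi> B Z +
  fixes g :: nat
  assumes phi: "0 < \<phi>" "\<phi> < 1"
    and g: "g = (LEAST j. 1 \<le> \<phi> * 2 ^ j \<or> 4 * length es \<le> 2 ^ j)"
    and Z_poly: "10 ^ 5 * (n + length es + 2 ^ g + 1) ^ 5 \<le> Z"
begin

lemma g_exit: "1 \<le> \<phi> * 2 ^ g \<or> 4 * m \<le> 2 ^ g"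
proof -
  have "4 * length es \<le> 2 ^ (4 * length es)" by (simp add: less_imp_le)
  then have "1 \<le> \<phi> * 2 ^ g \<or> 4 * length es \<le> 2 ^ g" unfolding g by (intro LeastI) blast
  then show ?thesis by (simp add: m_def)
qed

lemma g_below: "j < g \<Longrightarrow> \<phi> * 2 ^ j < 1 \<and> 2 ^ j < 4 * m"
  using not_less_Least[of j "\<lambda>j. 1 \<le> \<phi> * 2 ^ j \<or> 4 * length es \<le> 2 ^ j"] unfolding g m_def by force

text \<open>The inequality says that \<open>K = 2 ^ I\<close> exceeds the accumulated growth of
  lengths by a constant factor. Taking the least such exponent keeps \<open>K\<close> within a
  logarithmic factor of \<open>2 ^ g\<close>, as congestion and running time require.\<close>

definition I :: nat where "I = (LEAST j. 8 * (j + 1) * 2 ^ g \<le> (2::nat) ^ j)"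

text \<open>A crude exponent satisfying the inequality that defines \<open>I\<close>; it shows that
  \<open>I\<close> exists and is linear in \<open>g\<close>.\<close>

lemma I_bound: "8 * (2 * g + 7 + 1) * 2 ^ g \<le> (2::nat) ^ (2 * g + 7)"
proof -
  have "g + 4 \<le> 2 ^ (g + 3)"
    by (induction g) (auto simp: power_add)
  then have "(g + 4) * (16 * 2 ^ g) \<le> 2 ^ (g + 3) * (16 * 2 ^ g)" by (rule mult_le_mono1)
  also have "\<dots> = 2 ^ ((g + 3) + (g + 4))" unfolding power_add[of _ "g + 3"] power_add[of _ g 4] by simp
  also have "(g + 3) + (g + 4) = 2 * g + 7" by simp
  also have "(g + 4) * (16 * 2 ^ g) = 8 * (2 * g + 7 + 1) * (2::nat) ^ g" by simp
  finally show ?thesis .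
qed

lemma I_exit: "8 * (I + 1) * 2 ^ g \<le> (2::nat) ^ I" and I_le: "I \<le> 2 * g + 7"
  and I_below: "j < I \<Longrightarrow> (2::nat) ^ j < 8 * (j + 1) * 2 ^ g"
proof -
  show "8 * (I + 1) * 2 ^ g \<le> (2::nat) ^ I" unfolding I_def by (rule LeastI[where P = "\<lambda>j. 8 * (j + 1) * 2 ^ g \<le> (2::nat) ^ j", OF I_bound])
  show "I \<le> 2 * g + 7" unfolding I_def by (rule Least_le[where P = "\<lambda>j. 8 * (j + 1) * 2 ^ g \<le> (2::nat) ^ j", OF I_bound])
  show "(2::nat) ^ j < 8 * (j + 1) * 2 ^ g" if "j < I"
    using not_less_Least[of j "\<lambda>j. 8 * (j + 1) * 2 ^ g \<le> (2::nat) ^ j"] that unfolding I_def by (metis not_le)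
qed

lemma I_ge: "3 \<le> I"
proof (rule ccontr)
  assume "\<not> 3 \<le> I"
  then have "(2::nat) ^ I \<le> 2 ^ 2" by (intro power_increasing) auto
  moreover have "8 * 1 * 1 \<le> 8 * (I + 1) * (2::nat) ^ g" by (intro mult_le_mono) auto
  ultimately show False using I_exit by simp
qed

lemma two_I_le: "(2::nat) ^ I \<le> 16 * I * 2 ^ g"
proof -
  obtain j where j: "I = Suc j" using I_ge by (cases I) auto
  then show ?thesis using I_below[of j] by (simp add: algebra_simps)
qed

abbreviation q :: nat where "q \<equiv> 2 ^ g"
definition Y :: nat where "Y = n + m + q + 1"

lemma Z_Y: "10 ^ 5 * Y ^ 5 \<le> Z" and Y_ge: "2 \<le> Y" "n \<le> Y" "m \<le> Y" "q \<le> Y" "g + 1 \<le> q" "m + q + 1 \<le> Y" "n + q + 1 \<le> Y"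
proof -
  show "10 ^ 5 * Y ^ 5 \<le> Z" using Z_poly by (simp add: Y_def m_def)
  show "g + 1 \<le> q" using less_exp[of g] by linarith
  have "1 \<le> q" by simp
  then show "2 \<le> Y" "n \<le> Y" "m \<le> Y" "q \<le> Y" "m + q + 1 \<le> Y" "n + q + 1 \<le> Y" unfolding Y_def by linarith+
qed

lemma pow_Y: "c \<le> 10 ^ 5 \<Longrightarrow> k \<le> 5 \<Longrightarrow> c * Y ^ k \<le> Z"
proof -
  assume "c \<le> 10 ^ 5" "k \<le> 5"
  then have "c * Y ^ k \<le> 10 ^ 5 * Y ^ 5" using Y_ge by (intro mult_le_mono power_increasing) auto
  then show ?thesis using Z_Y by linarith
qed

text \<open>Logarithmic factors are simply replaced by \<open>q\<close>, because these estimates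
  only feed the bound on stored words and not the running time.\<close>

lemma KH_le: "2 ^ I * 2 ^ (g + 3) * (g + 7) \<le> 8064 * q ^ 4" "2 ^ I * (g + 3) \<le> 432 * q ^ 3"
proof -
  have "16 * I \<le> 144 * q" using I_le Y_ge(5) by linarith
  then have "16 * I * q \<le> 144 * q * q" by (rule mult_le_mono1)
  then have K: "2 ^ I \<le> 144 * q * q" using two_I_le by linarith
  have "2 ^ I * 2 ^ (g + 3) * (g + 7) \<le> (144 * q * q) * (8 * q) * (7 * q)"
    using K Y_ge(5) by (intro mult_le_mono) (auto simp: power_add)
  then show "2 ^ I * 2 ^ (g + 3) * (g + 7) \<le> 8064 * q ^ 4" by (simp add: power4_eq_xxxx mult.assoc)
  have "2 ^ I * (g + 3) \<le> (144 * q * q) * (3 * q)" using K Y_ge(5) by (intro mult_le_mono) auto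
  then show "2 ^ I * (g + 3) \<le> 432 * q ^ 3" by (simp add: power3_eq_cube mult.assoc)
qed

sublocale algorithm M tail head mate rank \<phi> B Z S T g I
proof
  have q4: "q ^ 4 \<le> Y ^ 4" "q ^ 3 \<le> Y ^ 3" "Y ^ 3 \<le> Y ^ 4" "Y \<le> Y ^ 5" "1 \<le> Y ^ 5" "Y ^ 4 \<le> Y ^ 5"
    using Y_ge(1,4) power_increasing[of 1 5 Y] by (auto intro!: power_mono power_increasing)
  have ZY: "100000 * Y ^ 5 \<le> Z" using Z_Y by simp
  have M: "M \<le> 2 * Y" using Y_ge(3) by (simp add: M_def)
  show "M \<le> Z" using pow_Y[of 2 1] M by simp
  show "finite S" using S_sub finite_subset by blast
  show "d = e" if "d < M" "e < M" "tail d = tail e" "head d = head e" for d e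
    using tail_ends_inj that by simp
  have "M * (2 ^ I * 2 ^ (g + 3) * (g + 7)) \<le> 2 * Y * (8064 * Y ^ 4)"
    by (rule mult_le_mono[OF M]) (use KH_le(1) q4(1) in linarith)
  moreover have "2 * M * (2 ^ I * (g + 3)) \<le> 4 * Y * (432 * Y ^ 4)"
    by (rule mult_le_mono) (use KH_le(2) q4(2,3) M in linarith)+
  moreover have "Y ^ 5 = Y * Y ^ 4" by (simp flip: power_Suc)
  then have "2 * Y * (8064 * Y ^ 4) = 16128 * Y ^ 5" "4 * Y * (432 * Y ^ 4) = 1728 * Y ^ 5" by simp_all
  ultimately have "M * (2 ^ I * 2 ^ (g + 3) * (g + 7)) + 2 * M * (2 ^ I * (g + 3)) \<le> 17856 * Y ^ 5" by linarith
  moreover have "2 * 2 ^ (g + 3) \<le> 16 * Y" using Y_ge(4) by (simp add: power_add)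
  ultimately show "M * (2 ^ I * 2 ^ (g + 3) * (g + 7)) + 2 * M * (2 ^ I * (g + 3)) + 2 * 2 ^ (g + 3) + 3 \<le> Z"
    using ZY q4 by linarith
  show "2 * 2 ^ I * 2 ^ (g + 3) * (g + 7) \<le> Z" using KH_le(1) q4 ZY by linarith
qed

end

section \<open>Programs for the parameters and the initial tables\<close>

definition constants :: com where
  "constants = Seq (Assign ''M'' (Var ''m'' \<oplus> Var ''m'')) (Seq (Assign ''one'' (Num 1))
     (Seq (Assign ''q'' (Num 1)) (Assign ''g'' (Num 0))))"

text \<open>\<open>Less\<close> on two truth values \<open>a\<close> and \<open>b\<close> computes
  "not \<open>a\<close>, and \<open>b\<close>": the loop runs while
  \<open>1 \<le> \<phi> * q\<close> fails and \<open>q < 4 * m\<close>.\<close>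

definition choose_q :: com where
  "choose_q = While (Op Less (LePhi (Num 1) (Var ''q'')) (Op Less (Var ''q'') (Num 4 \<otimes> Var ''m'')))
     (Seq (Assign ''q'' (Var ''q'' \<oplus> Var ''q'')) (Assign ''g'' (Var ''g'' \<oplus> Num 1)))"

definition more_constants :: com where
  "more_constants = Seq (Assign ''H'' (Num 8 \<otimes> Var ''q'')) (Seq (Assign ''W'' (Var ''H'' \<oplus> Num 1))
     (Seq (Assign ''I1'' (Num 1)) (Assign ''k'' (Num 1))))"

text \<open>With \<open>H = 8 * q\<close>, \<open>k = 2 ^ j\<close> and \<open>I1 = j + 1\<close>
  the guard is the negation of the inequality that defines \<open>I\<close>. The final value of
  \<open>I1\<close> is the number of scales.\<close>

definition choose_k :: com where
  "choose_k = While (Op Less (Var ''k'') (Var ''I1'' \<otimes> Var ''H''))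
     (Seq (Assign ''k'' (Var ''k'' \<oplus> Var ''k'')) (Assign ''I1'' (Var ''I1'' \<oplus> Num 1)))"

definition last_constants :: com where
  "last_constants = Seq (Assign ''R'' (Num 2 \<otimes> Var ''k'' \<otimes> Var ''H'' \<otimes> (Var ''g'' \<oplus> Num 7)))
     (Assign ''t'' (Num 1))"

definition power_table :: com where
  "power_table = For ''b'' (Var ''g'' \<oplus> Num 4)
     (Seq (Put ''pw'' (Var ''b'') (Var ''t'')) (Assign ''t'' (Var ''t'' \<oplus> Var ''t'')))"

definition parameters :: com where
  "parameters = Seq constants (Seq choose_q (Seq more_constants (Seq choose_k (Seq last_constants power_table))))"

definition wire :: com where
  "wire = ParFor ''d'' (Var ''m'') (Seq (Put ''tl'' vd (Get ''src'' vd)) (Seq (Put ''tl'' (vd \<oplus> Var ''m'') (Get ''dst'' vd))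
     (Seq (Put ''hd'' vd (Get ''dst'' vd)) (Seq (Put ''hd'' (vd \<oplus> Var ''m'') (Get ''src'' vd))
     (Seq (Put ''rv'' vd (vd \<oplus> Var ''m'')) (Put ''rv'' (vd \<oplus> Var ''m'') vd))))))"

definition vertex_init :: com where
  "vertex_init = ParFor ''v'' (Var ''n'') (Seq (Put ''pl'' vv (Get ''S'' vv \<otimes> Get ''T'' vv))
     (Seq (Put ''un'' vv (Get ''S'' vv \<ominus> Get ''T'' vv)) (Put ''fr'' vv (Get ''T'' vv \<ominus> Get ''S'' vv))))"

text \<open>Ranks are keyed prefix sums: the weights are 1 and the key of a dart is its tail. They
  are then inverted into the table \<open>adj\<close>, stored plus 1 so that the initial 0 means
  absence.\<close>

definition initialize :: com where
  "initialize = Seq wire (Seq (ParFor ''d'' (Var ''M'') (Put ''len'' vd (Num 2)))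
     (Seq (ParFor ''d'' (Var ''M'') (Put ''w1'' vd (Num 1))) (Seq vertex_init
     (Seq (prefix_sums ''rk'' ''c1'' ''w1'' ''tl'' ''M'' ''n'')
       (ParFor ''d'' (Var ''M'') (Put ''adj'' (Num 16 \<otimes> Get ''tl'' vd \<oplus> Get ''rk'' vd) (vd \<oplus> Num 1)))))))"

definition rounds :: com where
  "rounds = For ''sc'' (Var ''I1'') scale"

context problem
begin

definition input :: heap where "input = input_heap es S T"

definition ready_locals :: "locals \<Rightarrow> bool" where
  "ready_locals l \<longleftrightarrow> l ''n'' = n \<and> l ''m'' = m \<and> l ''M'' = M \<and> l ''one'' = 1 \<and> l ''H'' = H \<and> l ''W'' = W \<and> l ''R'' = R"

lemma values_le: "4 * m \<le> Z" "M \<le> Z" "H \<le> Z" "W \<le> Z" "R \<le> Z" "2 * H \<le> Z" "K \<le> Z" "I + 1 \<le> Z" "g + 4 \<le> Z" "n \<le> Z" "q \<le> Z" "2 * q \<le> Z" "1 \<le> Z"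
proof -
  show "M \<le> Z" by (rule M_le)
  show 1: "2 * H \<le> Z" and "H \<le> Z" "W \<le> Z" using Z_big(1) unfolding H_def W_def by linarith+
  show R: "R \<le> Z" using Z_big(2) unfolding R_def H_def K_def .
  have "K * 1 \<le> K * (2 * H * (g + 7))" by (intro mult_le_mono2) (simp add: H_def)
  then show K: "K \<le> Z" using R by (simp add: R_def algebra_simps)
  have "I + 1 \<le> K" unfolding K_def using less_exp[of I] by linarith
  then show "I + 1 \<le> Z" using K by linarith
  show "q \<le> Z" "2 * q \<le> Z" using 1 by (simp_all add: H_def power_add)
  show "4 * m \<le> Z" "n \<le> Z" using pow_Y[of 4 1] Y_ge by simp_all
  show "g + 4 \<le> Z" using pow_Y[of 4 1] Y_ge by simp
  show "1 \<le> Z" using Z_ge by linarith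
qed

lemma H_q: "H = 8 * q" by (simp add: H_def power_add)

lemma run_parameters:
  "run parameters (input_locals n es) input (100 * (g + I + 4)) (100 * (g + I + 4)) (\<lambda>l h.
    ready_locals l \<and> l ''k'' = K \<and> l ''I1'' = I + 1 \<and> same {''pw''} input h \<and> (\<forall>b\<le>g + 3. h (''pw'', b) = 2 ^ b))"
proof -
  define base where "base l h \<longleftrightarrow> l ''n'' = n \<and> l ''m'' = m \<and> l ''M'' = M \<and> l ''one'' = 1 \<and> h = input" for l :: locals and h :: heap
  note v = values_le
  have 1: "run constants (input_locals n es) input 12 12 (\<lambda>l h. base l h \<and> l ''q'' = 1 \<and> l ''g'' = 0)"
    by (rule run_wp) (use v in \<open>auto simp: constants_def base_def input_locals_def M_def m_def\<close>)
  have 2: "run choose_q l h (g * (8 + 9 + 1) + (9 + 1)) (g * (8 + 9 + 1) + (9 + 1)) (\<lambda>l h. base l h \<and> l ''q'' = 2 ^ g \<and> l ''g'' = g)"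
    if "base l h \<and> l ''q'' = 1 \<and> l ''g'' = 0" for l h
  proof -
    let ?e = "Op Less (LePhi (Num 1) (Var ''q'')) (Op Less (Var ''q'') (Num 4 \<otimes> Var ''m''))"
    have ec: "exp_cost ?e = 9" by simp
    show ?thesis unfolding choose_q_def ec[symmetric]
    proof (rule run_while[where Inv = "\<lambda>j l h. base l h \<and> l ''q'' = 2 ^ j \<and> l ''g'' = j"])
      show "base l h \<and> l ''q'' = 2 ^ 0 \<and> l ''g'' = 0" using that by simp
      show "exp_ok ?e" by simp
    next
      fix j l h assume j: "j < g" and I: "base l h \<and> l ''q'' = 2 ^ j \<and> l ''g'' = j"
      have "(2::nat) ^ Suc j \<le> q" using j by (intro power_increasing) auto
      then have "2 * 2 ^ j \<le> Z" "Suc j \<le> Z" using v(9,11) j unfolding power_Suc by linarith+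
      then show "val ?e l h \<noteq> 0 \<and> run (Seq (Assign ''q'' (Var ''q'' \<oplus> Var ''q'')) (Assign ''g'' (Var ''g'' \<oplus> Num 1))) l h 8 8 (\<lambda>l h. base l h \<and> l ''q'' = 2 ^ Suc j \<and> l ''g'' = Suc j)"
        using I g_below[OF j] by (intro conjI run_wp) (auto simp: base_def mult_2)
    next
      fix l h assume "base l h \<and> l ''q'' = 2 ^ g \<and> l ''g'' = g"
      then show "val ?e l h = 0" using g_exit by (auto simp: base_def)
    qed
  qed
  have 3: "run more_constants l h 12 12 (\<lambda>l h. base l h \<and> l ''g'' = g \<and> l ''H'' = H \<and> l ''W'' = W \<and> l ''k'' = 1 \<and> l ''I1'' = 1)"
    if "base l h \<and> l ''q'' = 2 ^ g \<and> l ''g'' = g" for l h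
    by (rule run_wp) (use v that in \<open>auto simp: more_constants_def base_def W_def H_q\<close>)
  have 4: "run choose_k l h (I * (8 + 5 + 1) + (5 + 1)) (I * (8 + 5 + 1) + (5 + 1)) (\<lambda>l h. base l h \<and> l ''g'' = g \<and> l ''H'' = H \<and> l ''W'' = W \<and> l ''k'' = 2 ^ I \<and> l ''I1'' = Suc I)"
    if "base l h \<and> l ''g'' = g \<and> l ''H'' = H \<and> l ''W'' = W \<and> l ''k'' = 1 \<and> l ''I1'' = 1" for l h
  proof -
    let ?e = "Op Less (Var ''k'') (Var ''I1'' \<otimes> Var ''H'')"
    have ec: "exp_cost ?e = 5" by simp
    show ?thesis unfolding choose_k_def ec[symmetric]
    proof (rule run_while[where Inv = "\<lambda>j l h. base l h \<and> l ''g'' = g \<and> l ''H'' = H \<and> l ''W'' = W \<and> l ''k'' = 2 ^ j \<and> l ''I1'' = Suc j"])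
      show "base l h \<and> l ''g'' = g \<and> l ''H'' = H \<and> l ''W'' = W \<and> l ''k'' = 2 ^ 0 \<and> l ''I1'' = Suc 0" using that by simp
      show "exp_ok ?e" by simp
    next
      fix j l h assume j: "j < I" and I: "base l h \<and> l ''g'' = g \<and> l ''H'' = H \<and> l ''W'' = W \<and> l ''k'' = 2 ^ j \<and> l ''I1'' = Suc j"
      have "(2::nat) ^ Suc j \<le> K" unfolding K_def using j by (intro power_increasing) auto
      then have "2 * 2 ^ j \<le> Z" "Suc (Suc j) \<le> Z" using v j by simp_all
      moreover have "2 ^ j < Suc j * H" using I_below[OF j] by (simp add: H_q algebra_simps)
      ultimately show "val ?e l h \<noteq> 0 \<and> run (Seq (Assign ''k'' (Var ''k'' \<oplus> Var ''k'')) (Assign ''I1'' (Var ''I1'' \<oplus> Num 1))) l h 8 8 (\<lambda>l h. base l h \<and> l ''g'' = g \<and> l ''H'' = H \<and> l ''W'' = W \<and> l ''k'' = 2 ^ Suc j \<and> l ''I1'' = Suc (Suc j))"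
        using I by (intro conjI run_wp) (auto simp: base_def mult_2)
    next
      fix l h assume "base l h \<and> l ''g'' = g \<and> l ''H'' = H \<and> l ''W'' = W \<and> l ''k'' = 2 ^ I \<and> l ''I1'' = Suc I"
      moreover have "Suc I * H \<le> 2 ^ I" using I_exit by (simp add: H_q algebra_simps)
      ultimately show "val ?e l h = 0" by (auto simp: base_def)
    qed
  qed
  have 5: "run last_constants l h 12 12 (\<lambda>l h. base l h \<and> l ''g'' = g \<and> l ''H'' = H \<and> l ''W'' = W \<and> l ''k'' = K \<and> l ''I1'' = I + 1 \<and> l ''R'' = R \<and> l ''t'' = 1)"
    if "base l h \<and> l ''g'' = g \<and> l ''H'' = H \<and> l ''W'' = W \<and> l ''k'' = 2 ^ I \<and> l ''I1'' = Suc I" for l h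
    by (rule run_wp) (use v that in \<open>auto simp: last_constants_def base_def R_def K_def\<close>)
  have 6: "run power_table l h ((g + 4) * (8 + 3 + 7) + (3 + 5)) ((g + 4) * (8 + 3 + 7) + (3 + 5)) (\<lambda>l h.
    ready_locals l \<and> l ''k'' = K \<and> l ''I1'' = I + 1 \<and> same {''pw''} input h \<and> (\<forall>b\<le>g + 3. h (''pw'', b) = 2 ^ b))"
    if b: "base l h \<and> l ''g'' = g \<and> l ''H'' = H \<and> l ''W'' = W \<and> l ''k'' = K \<and> l ''I1'' = I + 1 \<and> l ''R'' = R \<and> l ''t'' = 1" for l h
  proof -
    let ?e = "Var ''g'' \<oplus> Num 4"
    have ec: "exp_cost ?e = 3" by simp
    define Inv where "Inv j l h \<longleftrightarrow> ready_locals l \<and> l ''g'' = g \<and> l ''k'' = K \<and> l ''I1'' = I + 1 \<and> l ''t'' = 2 ^ j \<and> l ''b'' = j \<and>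
      same {''pw''} input h \<and> (\<forall>b<j. h (''pw'', b) = 2 ^ b)" for j l h
    have "run power_table l h ((g + 4) * (8 + exp_cost ?e + 7) + (exp_cost ?e + 5)) ((g + 4) * (8 + exp_cost ?e + 7) + (exp_cost ?e + 5)) (Inv (g + 4))"
      unfolding power_table_def
    proof (rule run_for)
      show "Inv 0 (l(''b'' := 0)) h" using b by (auto simp: Inv_def base_def ready_locals_def)
    next
      fix j l h assume j: "j < g + 4" and I: "Inv j l h"
      have "(2::nat) ^ Suc j \<le> 2 ^ (g + 4)" using j by (intro power_increasing) auto
      then have "2 * 2 ^ j \<le> Z" using v(6) by (simp add: H_def power_add)
      then show "run (Seq (Put ''pw'' (Var ''b'') (Var ''t'')) (Assign ''t'' (Var ''t'' \<oplus> Var ''t''))) l h 8 8 (\<lambda>l' h'. l' ''b'' = j \<and> Inv (Suc j) (l'(''b'' := Suc j)) h')"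
        using I by (intro run_wp) (auto simp: Inv_def ready_locals_def same_def mult_2 less_Suc_eq)
    qed (use v in \<open>auto simp: Inv_def\<close>)
    then show ?thesis unfolding ec
      by (rule run_weaken) (auto simp: Inv_def)
  qed
  show ?thesis unfolding parameters_def
    by (rule run_weaken[OF run_seq[OF 1 run_seq[OF 2 run_seq[OF 3 run_seq[OF 4 run_seq[OF 5 6]]]]]]) simp_all
qed

lemma input_simps [simp]:
  "i < m \<Longrightarrow> input (''src'', i) = fst (es ! i)" "i < m \<Longrightarrow> input (''dst'', i) = snd (es ! i)"
  "input (''S'', v) = of_bool (v \<in> S)" "input (''T'', v) = of_bool (v \<in> T)"
  "a \<notin> {''src'', ''dst'', ''S'', ''T''} \<Longrightarrow> input (a, i) = 0"
  by (simp_all add: input_def input_heap_def m_def)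

lemma input_le: "input p \<le> Z"
proof -
  have "fst (es ! i) \<le> Z" "snd (es ! i) \<le> Z" if "i < length es" for i
    using edge[OF that] values_le(10) by linarith+
  then show ?thesis using values_le(13) by (cases p) (auto simp: input_def input_heap_def)
qed

lemma small_input: "small (input_locals n es) input"
  using input_le values_le(1,10) by (auto simp: small_def input_locals_def m_def)

lemma run_wire:
  assumes l: "ready_locals l" and h: "\<And>i. i < m \<Longrightarrow> h (''src'', i) = fst (es ! i) \<and> h (''dst'', i) = snd (es ! i)"
  shows "run wire l h (100 * (m + 1)) 100 (\<lambda>l1 h1. l1 = l \<and>
    h1 = upd (upd (upd h ''tl'' (\<lambda>d. if d < M then tail d else h (''tl'', d))) ''hd'' (\<lambda>d. if d < M then head d else h (''hd'', d)))
      ''rv'' (\<lambda>d. if d < M then mate d else h (''rv'', d)))" (is "run _ _ _ _ _ (\<lambda>l1 h1. _ \<and> h1 = ?h)")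
  unfolding wire_def
proof (rule run_par[where N = m and RS = "\<lambda>d. {(b, q). b \<notin> {''tl'', ''hd'', ''rv''}}"
      and WS = "\<lambda>d. {(b, q). b \<in> {''tl'', ''hd'', ''rv''} \<and> (q = d \<or> q = d + m)}"])
  fix d assume d: "d < m"
  have e: "fst (es ! d) \<le> Z" "snd (es ! d) \<le> Z" using edge[of d] d values_le(10) by (auto simp: m_def)
  have md: "d + m \<le> Z" using d values_le(1) by linarith
  have lm: "l ''m'' = m" using l by (simp add: ready_locals_def)
  show "wp (Seq (Put ''tl'' vd (Get ''src'' vd)) (Seq (Put ''tl'' (vd \<oplus> Var ''m'') (Get ''dst'' vd))
     (Seq (Put ''hd'' vd (Get ''dst'' vd)) (Seq (Put ''hd'' (vd \<oplus> Var ''m'') (Get ''src'' vd))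
     (Seq (Put ''rv'' vd (vd \<oplus> Var ''m'')) (Put ''rv'' (vd \<oplus> Var ''m'') vd)))))) (l(''d'' := d)) h (\<lambda>l' h'' R Wr.
     R \<subseteq> {(b, q). b \<notin> {''tl'', ''hd'', ''rv''}} \<and> Wr \<subseteq> {(b, q). b \<in> {''tl'', ''hd'', ''rv''} \<and> (q = d \<or> q = d + m)} \<and>
     (\<forall>q\<in>{(b, q). b \<in> {''tl'', ''hd'', ''rv''} \<and> (q = d \<or> q = d + m)}. h'' q = ?h q))"
    using d md e h[OF d] lm by (auto simp: tail_def head_def mate_def M_def)
next
  fix q assume q: "\<And>i. i < m \<Longrightarrow> q \<notin> {(b, q). b \<in> {''tl'', ''hd'', ''rv''} \<and> (q = i \<or> q = i + m)}"
  obtain b y where qe: "q = (b, y)" by (cases q)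
  have "\<not> y < M" if b: "b \<in> {''tl'', ''hd'', ''rv''}"
  proof
    assume "y < M"
    then have "y < m \<or> y - m < m \<and> y = y - m + m" by (auto simp: M_def)
    then show False using q[of y] q[of "y - m"] b by (auto simp: qe)
  qed
  then show "?h q = h q" by (auto simp: qe)
qed (use l values_le(1) in \<open>auto simp: ready_locals_def\<close>)

lemma run_vertex_init:
  assumes l: "ready_locals l" and h: "\<And>v. h (''S'', v) = of_bool (v \<in> S) \<and> h (''T'', v) = of_bool (v \<in> T)"
  shows "run vertex_init l h (100 * (n + 1)) 100 (\<lambda>l1 h1. l1 = l \<and>
    h1 = upd (upd (upd h ''pl'' (\<lambda>v. if v < n then of_bool (v \<in> S \<inter> T) else h (''pl'', v)))
      ''un'' (\<lambda>v. if v < n then of_bool (v \<in> S - T) else h (''un'', v)))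
      ''fr'' (\<lambda>v. if v < n then of_bool (v \<in> T - S) else h (''fr'', v)))" (is "run _ _ _ _ _ (\<lambda>l1 h1. _ \<and> h1 = ?h)")
  unfolding vertex_init_def
proof (rule run_par[where N = n and RS = "\<lambda>d. {(b, q). b \<notin> {''pl'', ''un'', ''fr''}}"
      and WS = "\<lambda>d. {(b, q). b \<in> {''pl'', ''un'', ''fr''} \<and> q = d}"])
  fix v assume v: "v < n"
  show "wp (Seq (Put ''pl'' vv (Get ''S'' vv \<otimes> Get ''T'' vv))
     (Seq (Put ''un'' vv (Get ''S'' vv \<ominus> Get ''T'' vv)) (Put ''fr'' vv (Get ''T'' vv \<ominus> Get ''S'' vv)))) (l(''v'' := v)) h (\<lambda>l' h'' R Wr.
     R \<subseteq> {(b, q). b \<notin> {''pl'', ''un'', ''fr''}} \<and> Wr \<subseteq> {(b, q). b \<in> {''pl'', ''un'', ''fr''} \<and> q = v} \<and>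
     (\<forall>q\<in>{(b, q). b \<in> {''pl'', ''un'', ''fr''} \<and> q = v}. h'' q = ?h q))"
    using v values_le(13) h by (auto simp: of_bool_def)
next
  fix q assume q: "\<And>i. i < n \<Longrightarrow> q \<notin> {(b, q). b \<in> {''pl'', ''un'', ''fr''} \<and> q = i}"
  obtain b y where qe: "q = (b, y)" by (cases q)
  show "?h q = h q" using q[of y] by (auto simp: qe)
qed (use l values_le(10) in \<open>auto simp: ready_locals_def\<close>)

text \<open>Ranks are below 16, so tail and rank are quotient and remainder of the address.\<close>

lemma adj_inj:
  assumes "d < M" "e < M" "16 * tail d + rank d = 16 * tail e + rank e"
  shows "d = e"
proof -
  have "(16 * tail d + rank d) div 16 = tail d" "(16 * tail e + rank e) div 16 = tail e"
    using rank_less assms(1,2) by simp_all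
  then have "tail d = tail e" using assms(3) by simp
  then show ?thesis using assms by (auto intro: rank_inj[OF assms(1,2)])
qed

abbreviation "init_arrays \<equiv> {''pw'', ''tl'', ''hd'', ''rv'', ''len'', ''w1'', ''pl'', ''un'', ''fr'', ''rk'', ''c1'', ''adj''}"

lemma run_initialize:
  assumes l: "ready_locals l" and h: "same {''pw''} input h" and pw: "\<forall>b\<le>g + 3. h (''pw'', b) = 2 ^ b"
  shows "run initialize l h (500 * (M + 1) + 100 * (n + 1) + 300 * (M + 1) * (ceil_log2 M + 1)) (500 + 300 * (ceil_log2 M + 1))
    (\<lambda>l' h'. same_locals {''s''} l l' \<and> same init_arrays input h' \<and> state_inv 0 h')"
proof -
  define h1 where "h1 = upd (upd (upd h ''tl'' (\<lambda>d. if d < M then tail d else h (''tl'', d))) ''hd'' (\<lambda>d. if d < M then head d else h (''hd'', d)))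
      ''rv'' (\<lambda>d. if d < M then mate d else h (''rv'', d))"
  define h2 where "h2 = upd h1 ''len'' (\<lambda>d. if d < M then 2 else h1 (''len'', d))"
  define h3 where "h3 = upd h2 ''w1'' (\<lambda>d. if d < M then 1 else h2 (''w1'', d))"
  define h4 where "h4 = upd (upd (upd h3 ''pl'' (\<lambda>v. if v < n then of_bool (v \<in> S \<inter> T) else h3 (''pl'', v)))
      ''un'' (\<lambda>v. if v < n then of_bool (v \<in> S - T) else h3 (''un'', v)))
      ''fr'' (\<lambda>v. if v < n then of_bool (v \<in> T - S) else h3 (''fr'', v))"
  note defs = h1_def h2_def h3_def h4_def
  have hin: "a \<noteq> ''pw'' \<Longrightarrow> h (a, i) = input (a, i)" for a i using h by (simp add: same_def)
  have lM: "l ''M'' = M" "l ''n'' = n" using l by (auto simp: ready_locals_def)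
  have Z2: "2 \<le> Z" using Z_ge by linarith
  have 1: "run wire l h (100 * (m + 1)) 100 (\<lambda>l1 h'. l1 = l \<and> h' = h1)"
    unfolding h1_def by (rule run_wire[OF l]) (simp add: hin)
  have 2: "run (ParFor ''d'' (Var ''M'') (Put ''len'' vd (Num 2))) l h1 (100 * (M + 1)) 100 (\<lambda>l1 h'. l1 = l \<and> h' = h2)"
    unfolding h2_def by (rule run_flat) (use lM Z2 in auto)
  have 3: "run (ParFor ''d'' (Var ''M'') (Put ''w1'' vd (Num 1))) l h2 (100 * (M + 1)) 100 (\<lambda>l1 h'. l1 = l \<and> h' = h3)"
    unfolding h3_def by (rule run_flat) (use lM Z2 in auto)
  have 4: "run vertex_init l h3 (100 * (n + 1)) 100 (\<lambda>l1 h'. l1 = l \<and> h' = h4)"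
    unfolding h4_def by (rule run_vertex_init[OF l]) (simp add: defs hin)
  have tl4: "h4 (''tl'', d) = tail d" "h4 (''hd'', d) = head d" "h4 (''rv'', d) = mate d" "h4 (''w1'', d) = 1" "h4 (''len'', d) = 2" if "d < M" for d
    using that by (simp_all add: defs)
  have v4: "h4 (''pl'', v) = of_bool (v \<in> S \<inter> T)" "h4 (''un'', v) = of_bool (v \<in> S - T)" "h4 (''fr'', v) = of_bool (v \<in> T - S)" for v
    using S_sub T_sub by (auto simp: defs hin)
  have s4: "h4 (a, i) = input (a, i)" if "a \<notin> {''pw'', ''tl'', ''hd'', ''rv'', ''len'', ''w1'', ''pl'', ''un'', ''fr''}" for a i
    using that by (simp add: defs hin)
  have pw4: "h4 (''pw'', b) = h (''pw'', b)" for b by (simp add: defs)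
  define Q5 where "Q5 l' h' \<longleftrightarrow> l' = l(''s'' := 2 ^ ceil_log2 M) \<and> (\<forall>a q. a \<noteq> ''rk'' \<longrightarrow> a \<noteq> ''c1'' \<longrightarrow> h' (a, q) = h4 (a, q)) \<and>
      (\<forall>i<M. h' (''rk'', i) = rank i)" for l' h'
  have 5: "run (prefix_sums ''rk'' ''c1'' ''w1'' ''tl'' ''M'' ''n'') l h4 (300 * (M + 1) * (ceil_log2 M + 1)) (300 * (ceil_log2 M + 1)) Q5"
  proof (rule run_weaken[OF run_prefix_sums])
    show "keyed_sums.clean M n (\<lambda>i. h4 (''tl'', i)) (\<lambda>q. h4 (''c1'', q))"
    proof -
      have "keyed_sums M n (\<lambda>_. 1) (\<lambda>i. h4 (''tl'', i))" by unfold_locales (use tl4 tail_less in auto)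
      then show ?thesis by (simp add: keyed_sums.clean_def s4)
    qed
    show "2 * M \<le> Z" using values_le(1) by (simp add: M_def)
    have "(\<Sum>i<M. h4 (''w1'', i)) = (\<Sum>i<M. 1)" by (rule sum.cong) (simp_all add: tl4)
    then show "(\<Sum>i<M. h4 (''w1'', i)) \<le> Z" using M_le by simp
  next
    fix l' h' assume *: "l' = l(''s'' := 2 ^ ceil_log2 M) \<and> (\<forall>a q. a \<noteq> ''rk'' \<longrightarrow> a \<noteq> ''c1'' \<longrightarrow> h' (a, q) = h4 (a, q)) \<and>
      (\<forall>q. M \<le> q \<longrightarrow> h' (''rk'', q) = h4 (''rk'', q)) \<and>
      keyed_sums.clean M n (\<lambda>i. h4 (''tl'', i)) (\<lambda>q. h' (''c1'', q)) \<and>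
      (\<forall>i<M. h' (''rk'', i) = (\<Sum>i' | i' < i \<and> h4 (''tl'', i') = h4 (''tl'', i). h4 (''w1'', i')))"
    have "h' (''rk'', i) = rank i" if i: "i < M" for i
    proof -
      have "h' (''rk'', i) = (\<Sum>i' | i' < i \<and> h4 (''tl'', i') = h4 (''tl'', i). h4 (''w1'', i'))" using * i by blast
      also have "\<dots> = (\<Sum>i' | i' < i \<and> tail i' = tail i. 1)" using i by (intro sum.cong) (auto simp: tl4)
      finally show ?thesis by (simp add: rank_def)
    qed
    with * show "Q5 l' h'" unfolding Q5_def by blast
  qed (use tl4 tail_less lM in auto)
  have 6: "run (ParFor ''d'' (Var ''M'') (Put ''adj'' (Num 16 \<otimes> Get ''tl'' vd \<oplus> Get ''rk'' vd) (vd \<oplus> Num 1))) l5 h5 (100 * (M + 1)) 100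
    (\<lambda>l' h'. same_locals {''s''} l l' \<and> same init_arrays input h' \<and> state_inv 0 h')" if q5: "Q5 l5 h5" for l5 h5
  proof (rule run_weaken[OF run_par_ex[where N = M and RS = "\<lambda>d. {(b, q). b \<noteq> ''adj''}" and WS = "\<lambda>d. {(''adj'', 16 * tail d + rank d)}" and v = "\<lambda>d q. d + 1"]])
    have l5: "l5 = l(''s'' := 2 ^ ceil_log2 M)" and h5: "\<And>a q. a \<noteq> ''rk'' \<Longrightarrow> a \<noteq> ''c1'' \<Longrightarrow> h5 (a, q) = h4 (a, q)"
      and rk5: "\<And>i. i < M \<Longrightarrow> h5 (''rk'', i) = rank i" using q5 by (auto simp: Q5_def)
    show "wp (Put ''adj'' (Num 16 \<otimes> Get ''tl'' vd \<oplus> Get ''rk'' vd) (vd \<oplus> Num 1)) (l5(''d'' := d)) h5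
      (\<lambda>l' h'' R Wr. R \<subseteq> {(b, q). b \<noteq> ''adj''} \<and> Wr \<subseteq> {(''adj'', 16 * tail d + rank d)} \<and> (\<forall>q\<in>{(''adj'', 16 * tail d + rank d)}. h'' q = d + 1))"
      if "d < M" for d using that h5 rk5 tl4 M_le by simp
    show "val (Var ''M'') l5 h5 = M" using lM by (simp add: l5)
    show "q \<notin> {(b, q). b \<noteq> ''adj''} \<and> q \<notin> {(''adj'', 16 * tail e + rank e)}"
      if "d < M" "e < M" "d \<noteq> e" "q \<in> {(''adj'', 16 * tail d + rank d)}" for d e q
      using that adj_inj[of d e] by auto
    fix l' h' assume *: "l' = l5 \<and> (\<forall>i<M. \<forall>q\<in>{(''adj'', 16 * tail i + rank i)}. h' q = i + 1) \<and> (\<forall>q. (\<forall>i<M. q \<notin> {(''adj'', 16 * tail i + rank i)}) \<longrightarrow> h' q = h5 q)"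
    then have adj: "\<And>i. i < M \<Longrightarrow> h' (''adj'', 16 * tail i + rank i) = i + 1"
      and out: "\<And>q. (\<And>i. i < M \<Longrightarrow> q \<noteq> (''adj'', 16 * tail i + rank i)) \<Longrightarrow> h' q = h5 q" by auto
    have h': "h' (a, q) = h5 (a, q)" if "a \<noteq> ''adj''" for a q using out[of "(a, q)"] that by blast
    have z: "h' (a, q) = 0" if "a \<in> {''lab'', ''p'', ''x'', ''sr'', ''ab''}" for a q
      using that h' h5 s4 by auto
    have "adjacent h'" unfolding adjacent_def
    proof (intro conjI allI impI)
      fix v j :: nat assume j: "j < 16" "\<forall>d<M. tail d = v \<longrightarrow> rank d \<noteq> j"
      have "16 * v + j \<noteq> 16 * tail d + rank d" if d: "d < M" for d
      proof
        assume e: "16 * v + j = 16 * tail d + rank d"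
        have "(16 * v + j) div 16 = v" "(16 * tail d + rank d) div 16 = tail d" using j(1) rank_less[OF d] by simp_all
        then have "tail d = v" "rank d = j" using e by simp_all
        then show False using j(2) d by blast
      qed
      then have "h' (''adj'', 16 * v + j) = h5 (''adj'', 16 * v + j)" by (intro out) auto
      then show "h' (''adj'', 16 * v + j) = 0" using h5 s4 by simp
    qed (use adj in simp)
    moreover have "wired h'" using h' h5 rk5 tl4 by (simp add: wired_def)
    ultimately have tab: "tables h'" using pw pw4 h' h5 by (simp add: tables_def)
    have un: "h' (''un'', v) = of_bool (v \<in> S - T)" "h' (''fr'', v) = of_bool (v \<in> T - S)" "h' (''pl'', v) = of_bool (v \<in> S \<inter> T)" for v
      using h' h5 v4 by auto
    have mt: "matched h' = {}" by (auto simp: matched_def un)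
    have ro: "routes_ok h'" unfolding routes_ok_def mt by (auto simp: un)
    have len: "d < M \<Longrightarrow> h' (''len'', d) = 2" for d using h' h5 tl4 by simp
    \<comment> \<open>All lengths start at 2, the least admissible value, which gives the base
      \<open>2 * M\<close> of the length budget; the budget of live sources holds because there are
      at most \<open>M\<close> vertices with darts.\<close>
    have "(\<Sum>d<M. h' (''len'', d)) = 2 * M" using len by simp
    moreover have "card {v \<in> verts. h' (''un'', v) = 1 \<and> h' (''lab'', v) < H} \<le> card verts" by (intro card_mono) auto
    moreover have "card verts \<le> M" unfolding verts_def using card_image_le[of "{..<M}" tail] by simp
    moreover have "8 \<le> H" by (simp add: H_q)
    ultimately have "state_inv 0 h'"
      unfolding state_inv_def using tab ro un z len mt by (auto simp: of_bool_def)
    moreover have "same init_arrays input h'" using h' h5 s4 by (simp add: same_def)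
    ultimately show "same_locals {''s''} l l' \<and> same init_arrays input h' \<and> state_inv 0 h'"
      using * by (simp add: l5 same_locals_def)
  qed (use M_le in auto)
  show ?thesis unfolding initialize_def
  proof (rule run_weaken)
    show "run (Seq wire (Seq (ParFor ''d'' (Var ''M'') (Put ''len'' vd (Num 2)))
     (Seq (ParFor ''d'' (Var ''M'') (Put ''w1'' vd (Num 1))) (Seq vertex_init
     (Seq (prefix_sums ''rk'' ''c1'' ''w1'' ''tl'' ''M'' ''n'')
       (ParFor ''d'' (Var ''M'') (Put ''adj'' (Num 16 \<otimes> Get ''tl'' vd \<oplus> Get ''rk'' vd) (vd \<oplus> Num 1)))))))) l h
      (100 * (m + 1) + (100 * (M + 1) + (100 * (M + 1) + (100 * (n + 1) + (300 * (M + 1) * (ceil_log2 M + 1) + 100 * (M + 1))))))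
      (100 + (100 + (100 + (100 + (300 * (ceil_log2 M + 1) + 100)))))
      (\<lambda>l' h'. same_locals {''s''} l l' \<and> same init_arrays input h' \<and> state_inv 0 h')"
      by (rule run_seq[OF 1], clarify, rule run_seq[OF 2], clarify, rule run_seq[OF 3], clarify, rule run_seq[OF 4], clarify,
        rule run_seq[OF 5], rule 6)
  qed (use M_def in auto)
qed

lemma run_rounds:
  assumes l: "ready_locals l" "l ''k'' = K" "l ''I1'' = I + 1" and h: "state_inv 0 h"
  shows "run rounds l h ((I + 1) * (6000 * (R + 2 * W + 1) * (M + 1) + 8) + 6) ((I + 1) * (6000 * (R + 2 * W + 1) + 8) + 6)
    (\<lambda>l' h'. ready_locals l' \<and> same scale_arrays h h' \<and> state_inv (I + 1) h')"
proof -
  define Inv where "Inv j l' h' \<longleftrightarrow> ready_locals l' \<and> l' ''k'' = K div 2 ^ j \<and> l' ''I1'' = I + 1 \<and> l' ''sc'' = j \<and>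
    state_inv j h' \<and> same scale_arrays h h'" for j l' h'
  have "run rounds l h ((I + 1) * (6000 * (R + 2 * W + 1) * (M + 1) + exp_cost (Var ''I1'') + 7) + (exp_cost (Var ''I1'') + 5))
    ((I + 1) * (6000 * (R + 2 * W + 1) + exp_cost (Var ''I1'') + 7) + (exp_cost (Var ''I1'') + 5)) (Inv (I + 1))"
    unfolding rounds_def
  proof (rule run_for)
    show "Inv 0 (l(''sc'' := 0)) h" using l h by (simp add: Inv_def ready_locals_def)
  next
    fix j l' h' assume j: "j < I + 1" and inv: "Inv j l' h'"
    show "run scale l' h' (6000 * (R + 2 * W + 1) * (M + 1)) (6000 * (R + 2 * W + 1)) (\<lambda>l'' h''. l'' ''sc'' = j \<and> Inv (Suc j) (l''(''sc'' := Suc j)) h'')"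
    proof (rule run_weaken[OF run_scale[of j]])
      show "j \<le> I" "state_inv j h'" using j inv by (simp_all add: Inv_def)
      show "scale_params j l'" using inv by (simp add: Inv_def ready_locals_def scale_params_def)
      fix l'' h'' assume *: "same_locals {''j'', ''r'', ''k''} l' l'' \<and> scale_params (Suc j) l'' \<and> state_inv (Suc j) h'' \<and> same scale_arrays h' h''"
      moreover have "same scale_arrays h h''" using * inv same_trans unfolding Inv_def by blast
      ultimately show "l'' ''sc'' = j \<and> Inv (Suc j) (l''(''sc'' := Suc j)) h''"
        using inv by (simp add: Inv_def same_locals_def ready_locals_def scale_params_def)
    qed simp_all
  qed (use values_le in \<open>auto simp: Inv_def\<close>)
  then show ?thesis
    by (rule run_weaken) (auto simp: Inv_def)
qed

end

section \<open>Programs for the sparse level cut and for the output\<close>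

text \<open>The sum acts as a disjunction: unmatched sources belong to every candidate cut, whatever
  their label.\<close>

definition in_cut :: "string \<Rightarrow> exp \<Rightarrow> exp" where
  "in_cut x e = Op Less (Num 0) (Get ''un'' e \<oplus> Op Less (Var x) (Get ''lab'' e))"

text \<open>Prefix sums need positive weights, so crossing edges are counted in a higher digit: the
  total is \<open>m\<close> plus \<open>m + 1\<close> times their number, and division by
  \<open>m + 1\<close> recovers it. An extra item behind the last edge makes this total available as
  its prefix sum.\<close>

definition cut_weights :: com where
  "cut_weights = ParFor ''e'' (Var ''m'') (Put ''wt'' ve (Num 1 \<oplus> Var ''m1'' \<otimes>
     (Num 1 \<ominus> Op Equal (in_cut ''r'' (Get ''src'' ve)) (in_cut ''r'' (Get ''dst'' ve)))))"

definition cut_test :: com where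
  "cut_test = Cond (LePhi (Get ''ps'' (Var ''m'') \<oslash> Var ''m1'') (Var ''M'')) (Assign ''bt'' (Var ''r'')) Skip"

definition cut_round :: com where
  "cut_round = Seq cut_weights (Seq (Put ''wt'' (Var ''m'') (Num 1))
     (Seq (prefix_sums ''ps'' ''c2'' ''wt'' ''zz'' ''m1'' ''one'') cut_test))"

definition find_cut :: com where
  "find_cut = Seq (Seq (Assign ''m1'' (Var ''m'' \<oplus> Num 1)) (Assign ''bt'' (Num 0)))
     (Seq (For ''r'' (Var ''H'') cut_round) (ParFor ''v'' (Var ''n'') (Put ''C'' vv (in_cut ''bt'' vv))))"

text \<open>One prefix sum packs three numbers in base \<open>n + 1\<close>: the number of earlier
  vertices, of earlier paths, and the total length of the earlier paths. This reads the middle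
  digit; \<open>position\<close> reads what lies above it.\<close>

definition slot :: "exp \<Rightarrow> exp" where "slot e = Op Mod (Get ''os'' e \<oslash> Var ''n1'') (Var ''n1'')"
definition position :: "exp \<Rightarrow> exp" where "position e = Get ''os'' e \<oslash> Var ''n1'' \<oslash> Var ''n1''"

definition path_weights :: com where
  "path_weights = ParFor ''v'' (Var ''n'') (Put ''ow'' vv (Num 1 \<oplus> Var ''n1'' \<otimes>
     (Var ''n1'' \<otimes> Get ''pl'' vv \<oplus> Op Less (Num 0) (Get ''pl'' vv))))"

definition path_starts :: com where
  "path_starts = ParFor ''v'' (Var ''n'') (Cond (Get ''pl'' vv)
     (Seq (Put ''off'' (slot vv) (position vv)) (Put ''path'' (position vv) vv)) Skip)"

definition path_ends :: com where
  "path_ends = Seq (Put ''off'' (slot (Var ''n'')) (position (Var ''n''))) (Assign ''num_paths'' (slot (Var ''n'')))"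

text \<open>Indexed by darts and offsets, so that isolated vertices, whose paths have at most one
  vertex, add no factor \<open>W\<close> to the work. The first guard says that the rank is 0 and
  \<open>y\<close> is positive; it selects one dart per vertex and skips the start vertex, which
  \<open>path_starts\<close> has written.\<close>

definition path_bodies :: com where
  "path_bodies = ParFor ''a'' (Var ''M'' \<otimes> Var ''W'') (Seq (Assign ''d'' (Var ''a'' \<oslash> Var ''W''))
     (Seq (Assign ''y'' (Op Mod (Var ''a'') (Var ''W''))) (Seq (Assign ''v'' (Get ''tl'' vd))
     (Cond (Op Less (Get ''rk'' vd) (Op Less (Num 0) (Var ''y'')))
       (Cond (Op Less (Var ''y'') (Get ''pl'' vv))
         (Put ''path'' (position vv \<oplus> Var ''y'') (Get ''pth'' (vv \<otimes> Var ''W'' \<oplus> Var ''y''))) Skip) Skip))))"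

definition write_paths :: com where
  "write_paths = Seq (Assign ''n1'' (Var ''n'' \<oplus> Num 1)) (Seq path_weights (Seq (Put ''ow'' (Var ''n'') (Num 1))
     (Seq (prefix_sums ''os'' ''c3'' ''ow'' ''zz'' ''n1'' ''one'') (Seq path_starts (Seq path_ends path_bodies)))))"

lemma sum_lessThan_add: "(\<Sum>d<a + b. f d) = (\<Sum>d<(a::nat). f d) + (\<Sum>d<b. f (a + d) :: nat)"
  by (induction b) simp_all

lemma sum_card_swap:
  "(\<Sum>r<k. card {i. i < (j::nat) \<and> P i r}) = (\<Sum>i<j. card {r. r < (k::nat) \<and> P i r})"
proof -
  have "card {i. i < (j::nat) \<and> Q i} = (\<Sum>i<j. of_bool (Q i))" for j Q
  proof -
    have "{i. i < j \<and> Q i} = {..<j} \<inter> {i. Q i}" by auto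
    then show ?thesis by simp
  qed
  then show ?thesis by (simp add: sum.swap[of _ "{..<j}"] del: sum_of_bool_eq)
qed

context problem
begin

definition tidy :: "nat \<Rightarrow> string \<Rightarrow> heap \<Rightarrow> bool" where
  "tidy N c h \<longleftrightarrow> keyed_sums.clean N 1 (\<lambda>_. 0) (\<lambda>q. h (c, q))"

lemma tidy_zero: "(\<And>q. h (c, q) = 0) \<Longrightarrow> tidy N c h"
proof -
  assume z: "\<And>q. h (c, q) = 0"
  have "keyed_sums N 1 (\<lambda>_. 1) (\<lambda>_. 0)" by unfold_locales auto
  then show ?thesis using z by (simp add: tidy_def keyed_sums.clean_def)
qed

text \<open>Ordinary prefix sums are the case of a single key: the array \<open>zz\<close> of zeros
  serves as keys and the variable \<open>one\<close> as their number.\<close>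

lemma run_plain_sums:
  assumes names: "distinct [pre, cnt, wt, ''zz'']" "nv \<noteq> ''s''" "nv \<noteq> ''i''"
    and l: "l nv = N" "l ''one'' = 1" and zz: "\<And>i. h (''zz'', i) = 0" and w: "\<And>i. i < N \<Longrightarrow> 0 < h (wt, i)"
    and total: "(\<Sum>i<N. h (wt, i)) \<le> Z" and N: "2 * N \<le> Z" and clean: "tidy N cnt h"
  shows "run (prefix_sums pre cnt wt ''zz'' nv ''one'') l h (300 * (N + 1) * (ceil_log2 N + 1)) (300 * (ceil_log2 N + 1))
    (\<lambda>l' h'. l' = l(''s'' := 2 ^ ceil_log2 N) \<and> same {pre, cnt} h h' \<and> tidy N cnt h' \<and> (\<forall>i<N. h' (pre, i) = (\<Sum>j<i. h (wt, j))))"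
proof -
  have z: "(\<lambda>i. h (''zz'', i)) = (\<lambda>_. 0)" using zz by auto
  have s: "{i'. i' < i \<and> h (''zz'', i') = h (''zz'', i)} = {..<i}" for i using zz by auto
  show ?thesis
    by (rule run_weaken[OF run_prefix_sums[where N = N and kap = 1]])
      (use assms in \<open>auto simp: z s same_def tidy_def lessThan_def\<close>)
qed

definition inside :: "heap \<Rightarrow> nat \<Rightarrow> nat \<Rightarrow> bool" where
  "inside h r v \<longleftrightarrow> h (''un'', v) \<noteq> 0 \<or> r < h (''lab'', v)"

definition crossing :: "heap \<Rightarrow> nat \<Rightarrow> nat set" where
  "crossing h r = {i. i < m \<and> inside h r (fst (es ! i)) \<noteq> inside h r (snd (es ! i))}"

definition good :: "heap \<Rightarrow> nat \<Rightarrow> bool" where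
  "good h r \<longleftrightarrow> real (card (crossing h r)) \<le> \<phi> * real M"

lemma val_in_cut: "val (in_cut x e) l h = of_bool (inside h (l x) (val e l h))"
  by (auto simp: in_cut_def inside_def)

lemma reads_in_cut: "reads (in_cut x e) l h = reads e l h \<union> {(''un'', val e l h), (''lab'', val e l h)}"
  by (auto simp: in_cut_def)

lemma cost_in_cut [simp]: "exp_cost (in_cut x e) = 2 * exp_cost e + 7" "exp_ok (in_cut x e) = exp_ok e" "exp_deg (in_cut x e) = 1"
  by (auto simp: in_cut_def)

text \<open>Averaging over the levels. Apart from edges at unmatched vertices below
  \<open>H\<close>, an edge crosses only levels between the labels of its ends, and these are no
  more than the lengths of its two darts together. The exceptional vertices are few and have at most
  16 edges each. If all \<open>H\<close> levels were crossed too often, the budgets for lengths and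
  live sources would be exceeded.\<close>

lemma good_level:
  assumes inv: "state_inv (Suc I) h"
  shows "\<exists>r<H. good h r"
proof (rule ccontr)
  assume no: "\<not> (\<exists>r<H. good h r)"
  define lab where "lab v = h (''lab'', v)" for v
  define len where "len d = h (''len'', d)" for d
  define U where "U = {v \<in> verts. h (''un'', v) = 1 \<and> h (''lab'', v) < H}"
  define D where "D = (\<Sum>d<M. len d)"
  define touch where "touch = {i. i < m \<and> (tail i \<in> U \<or> head i \<in> U)}"
  have un: "\<And>v. h (''un'', v) \<le> 1" and lb: "\<And>d. d < M \<Longrightarrow> lab (tail d) \<le> lab (head d) + len d"
    and KD: "K * D \<le> K * (2 * M) + Suc I * (2 * H * M)" and KU: "2 ^ Suc I * card U \<le> M"
    using inv unfolding state_inv_def lab_def len_def U_def D_def by blast+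
  have iM: "i < M" "mate i < M" "mate i = m + i" "tail i = fst (es ! i)" "head i = snd (es ! i)" if "i < m" for i
    using that by (auto simp: M_def mate_def tail_def head_def)
  \<comment> \<open>An unmatched vertex at label \<open>H\<close> lies above every level anyway, so
    only unmatched vertices in \<open>U\<close> can make an edge cross without a difference of
    labels.\<close>
  have cr: "crossing h r \<subseteq> {i. i < m \<and> (r < lab (tail i)) \<noteq> (r < lab (head i))} \<union> touch" if "r < H" for r
  proof
    fix i assume "i \<in> crossing h r"
    then have i: "i < m" and c: "inside h r (tail i) \<noteq> inside h r (head i)" using iM(4,5) by (auto simp: crossing_def)
    have "tail i \<in> verts" "head i \<in> verts" using iM(1)[OF i] tail_verts head_verts by auto
    then have "v \<in> {tail i, head i} \<Longrightarrow> h (''un'', v) \<noteq> 0 \<Longrightarrow> r < lab v \<or> v \<in> U" for v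
      using un[of v] that by (auto simp: U_def lab_def)
    then show "i \<in> {i. i < m \<and> (r < lab (tail i)) \<noteq> (r < lab (head i))} \<union> touch"
      using i c unfolding inside_def touch_def lab_def by auto
  qed
  have touch: "card touch \<le> 16 * card U"
  proof -
    have "touch \<subseteq> index ` {d. d < M \<and> tail d \<in> U}"
    proof
      fix i assume i: "i \<in> touch"
      then have im: "i < m" by (simp add: touch_def)
      have "index i = i" "index (mate i) = i" using im by (auto simp: index_def iM(3))
      note ix = this
      have "i \<in> {d. d < M \<and> tail d \<in> U} \<or> mate i \<in> {d. d < M \<and> tail d \<in> U}"
        using i iM(1,2)[OF im] by (simp add: touch_def head_def)
      then show "i \<in> index ` {d. d < M \<and> tail d \<in> U}"
        by (rule disjE) (rule rev_image_eqI, assumption, simp add: ix)+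
    qed
    then have "card touch \<le> card {d. d < M \<and> tail d \<in> U}" by (intro surj_card_le) simp_all
    also have "{d. d < M \<and> tail d \<in> U} = (\<Union>v\<in>U. {d. d < M \<and> tail d = v})" by auto
    also have "card \<dots> \<le> (\<Sum>v\<in>U. card {d. d < M \<and> tail d = v})" by (rule card_UN_le) (simp add: U_def)
    also have "\<dots> \<le> (\<Sum>v\<in>U. 16)" by (rule sum_mono) (use card_darts verts_less in \<open>auto simp: U_def\<close>)
    finally show ?thesis by simp
  qed
  have levels: "(\<Sum>r<H. card {i. i < m \<and> (r < lab (tail i)) \<noteq> (r < lab (head i))}) \<le> D"
  proof -
    have "card {r. r < H \<and> (r < lab (tail i)) \<noteq> (r < lab (head i))} \<le> len i + len (m + i)" if i: "i < m" for i
    proof -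
      have "lab (tail i) \<le> lab (head i) + len i" using lb iM(1)[OF i] by blast
      moreover have "lab (head i) \<le> lab (tail i) + len (m + i)"
        using lb[OF iM(2)[OF i]] iM(3)[OF i] head_mate[OF iM(1)[OF i]] by (simp add: head_def)
      ultimately have "{r. r < H \<and> (r < lab (tail i)) \<noteq> (r < lab (head i))}
        \<subseteq> {lab (head i)..<lab (head i) + len i} \<union> {lab (tail i)..<lab (tail i) + len (m + i)}" by auto
      then have "card {r. r < H \<and> (r < lab (tail i)) \<noteq> (r < lab (head i))}
        \<le> card ({lab (head i)..<lab (head i) + len i} \<union> {lab (tail i)..<lab (tail i) + len (m + i)})" by (intro card_mono) auto
      also have "\<dots> \<le> len i + len (m + i)" by (rule order_trans[OF card_Un_le]) simp
      finally show ?thesis .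
    qed
    then have "(\<Sum>i<m. card {r. r < H \<and> (r < lab (tail i)) \<noteq> (r < lab (head i))}) \<le> (\<Sum>i<m. len i + len (m + i))" by (intro sum_mono) simp
    also have "\<dots> = D" unfolding D_def M_def mult_2 sum_lessThan_add by (rule sum.distrib)
    finally show ?thesis by (subst sum_card_swap)
  qed
  have "(\<Sum>r<H. card (crossing h r)) \<le> (\<Sum>r<H. card {i. i < m \<and> (r < lab (tail i)) \<noteq> (r < lab (head i))} + card touch)"
  proof (rule sum_mono)
    fix r assume "r \<in> {..<H}"
    then have "card (crossing h r) \<le> card ({i. i < m \<and> (r < lab (tail i)) \<noteq> (r < lab (head i))} \<union> touch)"
      using cr by (intro card_mono) (auto simp: touch_def)
    also have "\<dots> \<le> card {i. i < m \<and> (r < lab (tail i)) \<noteq> (r < lab (head i))} + card touch" by (rule card_Un_le)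
    finally show "card (crossing h r) \<le> card {i. i < m \<and> (r < lab (tail i)) \<noteq> (r < lab (head i))} + card touch" .
  qed
  also have "\<dots> = (\<Sum>r<H. card {i. i < m \<and> (r < lab (tail i)) \<noteq> (r < lab (head i))}) + H * card touch"
    unfolding sum.distrib by simp
  also have "\<dots> \<le> D + H * (16 * card U)" using levels touch by (intro add_mono mult_le_mono2)
  finally have total: "(\<Sum>r<H. card (crossing h r)) \<le> D + H * (16 * card U)" .
  \<comment> \<open>Both ways in which the choice of \<open>g\<close> can end lead here: either
    \<open>\<phi> * q\<close> is at least 1, or there are so few edges that one crossing edge
    suffices. The \<open>+ 1\<close> keeps the final contradiction strict even without
    edges.\<close>
  have big: "M + 1 \<le> q * card (crossing h r)" if r: "r < H" for r
  proof -
    let ?c = "card (crossing h r)"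
    have ng: "\<phi> * real M < real ?c" using no r unfolding good_def by force
    show ?thesis
    proof (cases "1 \<le> \<phi> * 2 ^ g")
      case True
      then have "real M * 1 \<le> real M * (\<phi> * 2 ^ g)" by (intro mult_left_mono) auto
      also have "\<dots> = (\<phi> * real M) * 2 ^ g" by simp
      also have "\<dots> < real ?c * 2 ^ g" using ng by (intro mult_strict_right_mono) auto
      also have "\<dots> = real (q * ?c)" by simp
      finally have "real M < real (q * ?c)" by simp
      then have "M < q * ?c" by (simp only: of_nat_less_iff)
      then show ?thesis by simp
    next
      case False
      then have "4 * m \<le> q" using g_exit by blast
      moreover have "0 \<le> \<phi> * real M" using phi by simp
      then have "0 < real ?c" using ng by linarith
      then have "q * 1 \<le> q * ?c" by (intro mult_le_mono2) simp
      moreover have "1 \<le> q" by simp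
      ultimately show ?thesis unfolding M_def by linarith
    qed
  qed
  have "H * (M + 1) = (\<Sum>r<H. M + 1)" by simp
  also have "\<dots> \<le> (\<Sum>r<H. q * card (crossing h r))" using big by (intro sum_mono) simp
  also have "\<dots> = q * (\<Sum>r<H. card (crossing h r))" by (simp add: sum_distrib_left)
  also have "\<dots> \<le> q * (D + H * (16 * card U))" using total by (rule mult_le_mono2)
  finally have "K * (H * (M + 1)) \<le> K * (q * (D + H * (16 * card U)))" by (rule mult_le_mono2)
  also have "\<dots> = q * (K * D) + 8 * (q * (H * (2 * K * card U)))" by (simp add: algebra_simps)
  also have "\<dots> \<le> q * (K * (2 * M) + Suc I * (2 * H * M)) + 8 * (q * (H * M))"
    using KD KU by (intro add_mono mult_le_mono2) (simp_all add: K_def)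
  \<comment> \<open>Each of the three terms on the right is at most a quarter of
    \<open>K * H * M\<close>: the first by \<open>H = 8 * q\<close>, the second by
    \<open>8 * (I + 1) * q \<le> K\<close>, the third by the same together with
    \<open>3 \<le> I\<close>.\<close>
  finally have main: "K * H * M + K * H \<le> 2 * (q * K * M) + 2 * (Suc I * q * (H * M)) + 8 * (q * (H * M))"
    by (simp add: algebra_simps)
  have "K * H * M = 8 * (q * K * M)" by (simp add: H_q)
  moreover have "8 * (Suc I * q) \<le> K" using I_exit by (simp add: K_def algebra_simps)
  then have "8 * (Suc I * q) * (H * M) \<le> K * (H * M)" by (rule mult_le_mono1)
  then have "8 * (Suc I * q * (H * M)) \<le> K * H * M" by (simp only: mult.assoc)
  moreover have "4 * (q * (H * M)) \<le> Suc I * (q * (H * M))" using I_ge by (intro mult_le_mono1) simp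
  then have "4 * (q * (H * M)) \<le> Suc I * q * (H * M)" by (simp only: mult.assoc)
  moreover have "0 < K * H" by (simp add: K_def H_def)
  ultimately show False using main by linarith
qed

lemma run_cut_round:
  assumes l: "ready_locals l" "l ''m1'' = m + 1" "l ''r'' = r" and zz: "\<And>i. h (''zz'', i) = 0" and t: "tidy (m + 1) ''c2'' h"
    and es: "\<And>i. i < m \<Longrightarrow> h (''src'', i) = fst (es ! i) \<and> h (''dst'', i) = snd (es ! i)"
  shows "run cut_round l h (500 * (m + 2) * (ceil_log2 (m + 1) + 1)) (500 * (ceil_log2 (m + 1) + 1)) (\<lambda>l' h'.
    l' = l(''s'' := 2 ^ ceil_log2 (m + 1), ''bt'' := if good h r then r else l ''bt'') \<and>
    same {''wt'', ''ps'', ''c2''} h h' \<and> tidy (m + 1) ''c2'' h')"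
proof -
  define w where "w i = 1 + (m + 1) * of_bool (i \<in> crossing h r)" for i
  define h1 where "h1 = upd h ''wt'' (\<lambda>i. if i < m then w i else h (''wt'', i))"
  define h2 where "h2 = h1((''wt'', m) := 1)"
  have lm: "l ''m'' = m" "l ''one'' = 1" "l ''M'' = M" using l by (auto simp: ready_locals_def)
  have m2: "m + 2 \<le> Z" using values_le(1) Z_ge by (cases "m = 0") simp_all
  have 1: "run cut_weights l h (100 * (m + 1)) 100 (\<lambda>l1 h'. l1 = l \<and> h' = h1)"
    unfolding cut_weights_def
  proof (rule run_par[where N = m and RS = "\<lambda>d. {(b, q). b \<noteq> ''wt''}" and WS = "\<lambda>d. {(''wt'', d)}"])
    fix i assume i: "i < m"
    let ?e = "Num 1 \<oplus> Var ''m1'' \<otimes> (Num 1 \<ominus> Op Equal (in_cut ''r'' (Get ''src'' ve)) (in_cut ''r'' (Get ''dst'' ve)))"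
    have "val ?e (l(''e'' := i)) h = w i"
      using l i es[OF i] by (simp add: val_in_cut w_def crossing_def)
    moreover have "w i \<le> Z" using m2 by (simp add: w_def)
    moreover have "reads ?e (l(''e'' := i)) h \<subseteq> {(b, q). b \<noteq> ''wt''}" by (auto simp: reads_in_cut)
    ultimately show "wp (Put ''wt'' ve ?e) (l(''e'' := i)) h (\<lambda>l' h'' R Wr.
      R \<subseteq> {(b, q). b \<noteq> ''wt''} \<and> Wr \<subseteq> {(''wt'', i)} \<and> (\<forall>q\<in>{(''wt'', i)}. h'' q = h1 q))"
      using i by (simp add: h1_def del: reads.simps(4) val.simps(4))
  next
    fix q assume q: "\<And>i. i < m \<Longrightarrow> q \<notin> {(''wt'', i)}"
    obtain b y where qe: "q = (b, y)" by (cases q)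
    show "h1 q = h q" using q[of y] by (auto simp: qe h1_def)
  qed (use lm values_le(1) in auto)
  have 2: "run (Put ''wt'' (Var ''m'') (Num 1)) l h1 3 3 (\<lambda>l1 h'. l1 = l \<and> h' = h2)"
    by (rule run_wp) (use lm values_le(13) in \<open>auto simp: h2_def\<close>)
  have sw: "(\<Sum>j<m. h2 (''wt'', j)) = m + (m + 1) * card (crossing h r)"
  proof -
    have "(\<Sum>j<m. h2 (''wt'', j)) = (\<Sum>j<m. w j)" by (intro sum.cong) (auto simp: h2_def h1_def)
    also have "\<dots> = m + (m + 1) * (\<Sum>j<m. of_bool (j \<in> crossing h r))" by (simp only: w_def sum.distrib sum_distrib_left) simp
    also have "(\<Sum>j<m. of_bool (j \<in> crossing h r)) = card (crossing h r)"
    proof -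
      have "{..<m} \<inter> {j. j \<in> crossing h r} = crossing h r" by (auto simp: crossing_def)
      then show ?thesis by simp
    qed
    finally show ?thesis .
  qed
  have "card (crossing h r) \<le> card {..<m}" by (intro card_mono) (auto simp: crossing_def)
  then have cm: "card (crossing h r) \<le> m" by simp
  define Q where "Q l' h' \<longleftrightarrow> l' = l(''s'' := 2 ^ ceil_log2 (m + 1)) \<and> same {''ps'', ''c2''} h2 h' \<and> tidy (m + 1) ''c2'' h' \<and>
    (\<forall>i<m + 1. h' (''ps'', i) = (\<Sum>j<i. h2 (''wt'', j)))" for l' h'
  have 3: "run (prefix_sums ''ps'' ''c2'' ''wt'' ''zz'' ''m1'' ''one'') l h2 (300 * (m + 1 + 1) * (ceil_log2 (m + 1) + 1))
    (300 * (ceil_log2 (m + 1) + 1)) Q"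
    unfolding Q_def
  proof (rule run_plain_sums)
    show "tidy (m + 1) ''c2'' h2" using t by (simp add: tidy_def h2_def h1_def)
    have "(m + 1) * card (crossing h r) \<le> Y * Y" using cm Y_ge by (intro mult_le_mono) linarith+
    then have "m + (m + 1) * card (crossing h r) + 1 \<le> 2 * Y + Y * Y" using Y_ge by linarith
    also have "\<dots> \<le> 2 * (Y * Y) + Y * Y" using Y_ge(1) by simp
    also have "\<dots> \<le> Z" using pow_Y[of 3 2] by (simp add: power2_eq_square)
    finally show "(\<Sum>i<m + 1. h2 (''wt'', i)) \<le> Z" using sw by (simp add: h2_def)
    show "2 * (m + 1) \<le> Z" using pow_Y[of 4 1] Y_ge by simp
  qed (use lm l zz in \<open>auto simp: h2_def h1_def w_def\<close>)
  have 4: "run cut_test l3 h3 20 20 (\<lambda>l' h'.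
    l' = l(''s'' := 2 ^ ceil_log2 (m + 1), ''bt'' := if good h r then r else l ''bt'') \<and>
    same {''wt'', ''ps'', ''c2''} h h' \<and> tidy (m + 1) ''c2'' h')" if Q: "Q l3 h3" for l3 h3
  proof (rule run_small)
    assume sm: "small l3 h3"
    have l3: "l3 = l(''s'' := 2 ^ ceil_log2 (m + 1))" and t3: "tidy (m + 1) ''c2'' h3" and s3: "same {''ps'', ''c2''} h2 h3"
      and p3: "h3 (''ps'', m) = m + (m + 1) * card (crossing h r)" using Q sw by (auto simp: Q_def)
    have r: "r \<le> Z" using smallD(1)[OF sm, of "''r''"] l by (simp add: l3)
    have "h3 (''ps'', m) div (m + 1) = card (crossing h r)" unfolding p3 by (subst div_mult_self2) simp_all
    moreover have "same {''wt'', ''ps'', ''c2''} h h3" using s3 by (simp add: same_def h2_def h1_def)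
    ultimately show ?thesis
      by (intro run_wp) (use t3 r lm l in \<open>auto simp: cut_test_def l3 good_def fun_eq_iff\<close>)
  qed
  show ?thesis unfolding cut_round_def
  proof (rule run_weaken)
    show "run (Seq cut_weights (Seq (Put ''wt'' (Var ''m'') (Num 1))
     (Seq (prefix_sums ''ps'' ''c2'' ''wt'' ''zz'' ''m1'' ''one'') cut_test))) l h
     (100 * (m + 1) + (3 + (300 * (m + 1 + 1) * (ceil_log2 (m + 1) + 1) + 20))) (100 + (3 + (300 * (ceil_log2 (m + 1) + 1) + 20)))
     (\<lambda>l' h'. l' = l(''s'' := 2 ^ ceil_log2 (m + 1), ''bt'' := if good h r then r else l ''bt'') \<and>
    same {''wt'', ''ps'', ''c2''} h h' \<and> tidy (m + 1) ''c2'' h')"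
      by (rule run_seq[OF 1], clarify, rule run_seq[OF 2], clarify, rule run_seq[OF 3], rule 4)
    have "100 * (m + 1) + 23 \<le> 200 * (m + 2) * 1" by simp
    also have "\<dots> \<le> 200 * (m + 2) * (ceil_log2 (m + 1) + 1)" by (intro mult_le_mono2) simp
    finally show "100 * (m + 1) + (3 + (300 * (m + 1 + 1) * (ceil_log2 (m + 1) + 1) + 20)) \<le> 500 * (m + 2) * (ceil_log2 (m + 1) + 1)"
      by (simp add: algebra_simps)
  qed simp_all
qed

lemma run_find_cut:
  assumes l: "ready_locals l" and zz: "\<And>i. h (''zz'', i) = 0" and t: "tidy (m + 1) ''c2'' h" and inv: "state_inv (Suc I) h"
    and es: "\<And>i. i < m \<Longrightarrow> h (''src'', i) = fst (es ! i) \<and> h (''dst'', i) = snd (es ! i)"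
  shows "run find_cut l h (H * (500 * (m + 2) * (ceil_log2 (m + 1) + 1) + 8) + 20 + 100 * (n + 1))
    (H * (500 * (ceil_log2 (m + 1) + 1) + 8) + 120) (\<lambda>l' h'. ready_locals l' \<and>
    same {''wt'', ''ps'', ''c2'', ''C''} h h' \<and> (\<exists>r. good h r \<and> (\<forall>v<n. h' (''C'', v) = of_bool (inside h r v))))"
proof -
  define base where "base l' \<longleftrightarrow> ready_locals l' \<and> l' ''m1'' = m + 1" for l'
  have m2: "m + 1 \<le> Z" using values_le(1) Z_ge by (cases "m = 0") simp_all
  have 1: "run (Seq (Assign ''m1'' (Var ''m'' \<oplus> Num 1)) (Assign ''bt'' (Num 0))) l h 6 6 (\<lambda>l1 h1. base l1 \<and> h1 = h)"
    by (rule run_wp) (use l m2 in \<open>auto simp: base_def ready_locals_def\<close>)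
  \<comment> \<open>\<open>bt\<close> holds the last good level met so far. The implication covers
    the time before the first one; at the end \<open>good_level\<close> supplies its
    premise.\<close>
  define Inv where "Inv j l' h' \<longleftrightarrow> base l' \<and> l' ''r'' = j \<and> same {''wt'', ''ps'', ''c2''} h h' \<and> tidy (m + 1) ''c2'' h' \<and>
    ((\<exists>r<j. good h r) \<longrightarrow> good h (l' ''bt''))" for j l' h'
  have 2: "run (For ''r'' (Var ''H'') cut_round) l1 h1 (H * (500 * (m + 2) * (ceil_log2 (m + 1) + 1) + exp_cost (Var ''H'') + 7) + (exp_cost (Var ''H'') + 5))
    (H * (500 * (ceil_log2 (m + 1) + 1) + exp_cost (Var ''H'') + 7) + (exp_cost (Var ''H'') + 5)) (Inv H)" if b: "base l1 \<and> h1 = h" for l1 h1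
  proof (rule run_for)
    show "Inv 0 (l1(''r'' := 0)) h1" using b t by (simp add: Inv_def base_def ready_locals_def)
  next
    fix j l' h' assume j: "j < H" and I: "Inv j l' h'"
    have sh: "same {''wt'', ''ps'', ''c2''} h h'" using I by (simp add: Inv_def)
    then have same: "inside h' = inside h" "good h' = good h"
      by (auto simp: fun_eq_iff inside_def good_def crossing_def same_def)
    show "run cut_round l' h' (500 * (m + 2) * (ceil_log2 (m + 1) + 1)) (500 * (ceil_log2 (m + 1) + 1)) (\<lambda>l'' h''. l'' ''r'' = j \<and> Inv (Suc j) (l''(''r'' := Suc j)) h'')"
    proof (rule run_weaken[OF run_cut_round[of _ j]])
      fix l'' h'' assume *: "l'' = l'(''s'' := 2 ^ ceil_log2 (m + 1), ''bt'' := if good h' j then j else l' ''bt'') \<and>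
        same {''wt'', ''ps'', ''c2''} h' h'' \<and> tidy (m + 1) ''c2'' h''"
      have "same {''wt'', ''ps'', ''c2''} h h''" using sh * same_trans by blast
      then show "l'' ''r'' = j \<and> Inv (Suc j) (l''(''r'' := Suc j)) h''"
        using * I by (auto simp: Inv_def same base_def ready_locals_def less_Suc_eq)
    qed (use I sh zz es in \<open>auto simp: Inv_def base_def same_def\<close>)
  qed (use values_le in \<open>auto simp: Inv_def base_def ready_locals_def\<close>)
  have 3: "run (ParFor ''v'' (Var ''n'') (Put ''C'' vv (in_cut ''bt'' vv))) l2 h2 (100 * (n + 1)) 100 (\<lambda>l' h'. ready_locals l' \<and>
    same {''wt'', ''ps'', ''c2'', ''C''} h h' \<and> (\<exists>r. good h r \<and> (\<forall>v<n. h' (''C'', v) = of_bool (inside h r v))))" if I: "Inv H l2 h2" for l2 h2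
  proof (rule run_weaken[OF run_par[where N = n and RS = "\<lambda>d. {(b, q). b \<noteq> ''C''}" and WS = "\<lambda>d. {(''C'', d)}"
      and h' = "upd h2 ''C'' (\<lambda>v. if v < n then of_bool (inside h2 (l2 ''bt'') v) else h2 (''C'', v))"]])
    let ?h = "upd h2 ''C'' (\<lambda>v. if v < n then of_bool (inside h2 (l2 ''bt'') v) else h2 (''C'', v))"
    show "wp (Put ''C'' vv (in_cut ''bt'' vv)) (l2(''v'' := v)) h2 (\<lambda>l' h'' R Wr.
      R \<subseteq> {(b, q). b \<noteq> ''C''} \<and> Wr \<subseteq> {(''C'', v)} \<and> (\<forall>q\<in>{(''C'', v)}. h'' q = ?h q))" if "v < n" for v
      using that values_le(13) by (auto simp: val_in_cut reads_in_cut of_bool_def)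
    show "?h q = h2 q" if q: "\<And>i. i < n \<Longrightarrow> q \<notin> {(''C'', i)}" for q
      using q[of "snd q"] by (cases q) auto
    fix l' h' assume *: "l' = l2 \<and> h' = ?h"
    have s2: "same {''wt'', ''ps'', ''c2''} h h2" using I by (simp add: Inv_def)
    then have in2: "inside h2 = inside h" by (auto simp: fun_eq_iff inside_def same_def)
    have "good h (l2 ''bt'')" using good_level[OF inv] I unfolding Inv_def by blast
    then show "ready_locals l' \<and> same {''wt'', ''ps'', ''c2'', ''C''} h h' \<and> (\<exists>r. good h r \<and> (\<forall>v<n. h' (''C'', v) = of_bool (inside h r v)))"
      using * I s2 by (auto simp: in2 Inv_def base_def same_def)
  qed (use I values_le(10) in \<open>auto simp: Inv_def base_def ready_locals_def\<close>)
  show ?thesis unfolding find_cut_def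
    by (rule run_weaken[OF run_seq[OF 1 run_seq[OF 2 3]]]) simp_all
qed

end

lemma digits:
  assumes "i < N" "c < (N::nat)"
  shows "(i + N * (N * s + c)) div N mod N = c" "(i + N * (N * s + c)) div N div N = s"
proof -
  have "(i + N * (N * s + c)) div N = N * s + c" using assms by simp
  then show "(i + N * (N * s + c)) div N mod N = c" "(i + N * (N * s + c)) div N div N = s" using assms by simp_all
qed

section \<open>Layout of the paths in the output array\<close>

context problem
begin

text \<open>A path with a second vertex begins with a dart, which puts its start into
  \<open>verts\<close>.\<close>

lemma pl_bounds:
  assumes "state_inv i h"
  shows "h (''pl'', v) \<le> W" and "v \<notin> verts \<Longrightarrow> h (''pl'', v) \<le> 1"
proof -
  have ro: "\<And>v. v \<in> matched h \<Longrightarrow> h (''pl'', v) \<le> W \<and> linked (path_of h v)"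
    "\<And>v. v \<notin> matched h \<Longrightarrow> h (''pl'', v) = (if v \<in> S \<inter> T then 1 else 0)"
    using assms unfolding state_inv_def routes_ok_def by blast+
  show "h (''pl'', v) \<le> W" using ro[of v] by (cases "v \<in> matched h") (auto simp: W_def)
  show "h (''pl'', v) \<le> 1" if v: "v \<notin> verts"
  proof (rule ccontr)
    assume n: "\<not> h (''pl'', v) \<le> 1"
    then have "v \<in> matched h" using ro(2)[of v] by (cases "v \<in> matched h") (auto split: if_splits)
    then have "linked (path_of h v)" using ro(1) by blast
    moreover have "Suc 0 < length (path_of h v)" "path_of h v ! 0 = v" using n by (simp_all add: path_of_def)
    ultimately obtain d where "d < M" "tail d = v" unfolding linked_def by metis
    then show False using tail_verts v by blast
  qed
qed

lemma run_write_paths: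
  assumes l: "ready_locals l" and inv: "state_inv (Suc I) h" and zz: "\<And>i. h (''zz'', i) = 0" and t: "tidy (n + 1) ''c3'' h"
  shows "run write_paths l h (400 * (n + 2) * (ceil_log2 (n + 1) + 1) + 200 * (n + 1) + 100 * (M * W + 1)) (300 * (ceil_log2 (n + 1) + 1) + 400)
    (\<lambda>l' h'. same {''ow'', ''os'', ''c3'', ''off'', ''path''} h h' \<and> output_paths l' h' = path_of h ` {v. v < n \<and> h (''pl'', v) \<noteq> 0})"
proof -
  define pl where "pl v = h (''pl'', v)" for v
  define sm where "sm v = (\<Sum>j<v. pl j)" for v
  define cn where "cn v = (\<Sum>j<v. if pl j = 0 then 0 else 1 :: nat)" for v
  define w where "w v = 1 + (n + 1) * ((n + 1) * pl v + (if pl v = 0 then 0 else 1))" for v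
  have plW: "pl v \<le> W" for v unfolding pl_def by (rule pl_bounds[OF inv])
  have step: "sm (Suc v) = sm v + pl v" "cn (Suc v) = cn v + (if pl v = 0 then 0 else 1)" for v by (simp_all add: sm_def cn_def)
  note sums = step
  have mono: "sm v \<le> sm v'" "cn v \<le> cn v'" if "v \<le> v'" for v v' unfolding sm_def cn_def using that by (auto intro!: sum_mono2)
  have strict: "sm v + pl v \<le> sm v'" "pl v \<noteq> 0 \<Longrightarrow> cn v < cn v'" if "v < v'" for v v'
    using mono[of "Suc v" v'] step[of v] that by (auto simp: Suc_le_eq)
  have block: "v = v'" if "y < pl v" "y' < pl v'" "sm v + y = sm v' + y'" for v v' y y'
    using strict(1)[of v v'] strict(1)[of v' v] that by (cases v v' rule: linorder_cases) linarith+
  have cn_le: "cn v \<le> v" for v by (induction v) (auto simp: step cn_def)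
  have sm_le: "sm v \<le> v * W" for v unfolding sm_def using sum_mono[of "{..<v}" pl "\<lambda>_. W"] plW by simp
  have osum: "(\<Sum>j<i. w j) = i + (n + 1) * ((n + 1) * sm i + cn i)" for i
    by (induction i) (simp_all add: step w_def sm_def cn_def algebra_simps)
  have WY: "W \<le> 8 * Y" using Y_ge by (simp add: W_def H_q)
  have n1: "n + 1 \<le> Y" using Y_ge(7) by simp
  have Ypow: "Y ^ 2 \<le> Y ^ 4" "Y \<le> Y ^ 4" "Y \<le> Y ^ 3" "1 \<le> Y ^ 3"
    using power_increasing[of 1 4 Y] power_increasing[of 1 3 Y] Y_ge(1) by (auto intro!: power_increasing)
  have tot: "(\<Sum>j<n. w j) + 1 \<le> Z"
  proof -
    have "n + 1 + (n + 1) * ((n + 1) * sm n + cn n) \<le> Y + Y * (Y * (Y * (8 * Y)) + Y)"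
      using n1 sm_le[of n] WY cn_le[of n] mult_le_mono[of n Y W "8 * Y"] by (intro add_mono mult_le_mono) linarith+
    also have "\<dots> = 8 * Y ^ 4 + Y ^ 2 + Y" by (simp add: power4_eq_xxxx power2_eq_square algebra_simps)
    also have "\<dots> \<le> 10 * Y ^ 4" using Ypow(1,2) by linarith
    also have "\<dots> \<le> Z" using pow_Y[of 10 4] by simp
    finally show ?thesis by (simp add: osum)
  qed
  have wZ: "w v \<le> Z" for v
  proof -
    have "w v \<le> 1 + Y * (Y * (8 * Y) + 1)"
      unfolding w_def using n1 plW[of v] WY by (intro add_mono mult_le_mono) auto
    also have "\<dots> = 8 * Y ^ 3 + Y + 1" by (simp add: power3_eq_cube algebra_simps)
    also have "\<dots> \<le> 10 * Y ^ 3" using Ypow(3,4) by linarith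
    also have "\<dots> \<le> Z" using pow_Y[of 10 3] by simp
    finally show ?thesis .
  qed
  define h1 where "h1 = upd h ''ow'' (\<lambda>v. if v < n then w v else h (''ow'', v))"
  define h2 where "h2 = h1((''ow'', n) := 1)"
  define ln where "ln = l(''n1'' := n + 1)"
  have nZ: "n + 1 \<le> Z" using pow_Y[of 1 1] n1 by simp
  have lr: "ln ''n'' = n" "ln ''n1'' = n + 1" "ln ''M'' = M" "ln ''W'' = W" "ln ''one'' = 1" "l ''n'' = n"
    using l by (auto simp: ready_locals_def ln_def)
  have 1: "run (Assign ''n1'' (Var ''n'' \<oplus> Num 1)) l h 4 4 (\<lambda>l1 h'. l1 = ln \<and> h' = h)"
    by (rule run_wp) (use lr nZ in \<open>auto simp: ln_def\<close>)
  have 2: "run path_weights ln h (100 * (n + 1)) 100 (\<lambda>l1 h'. l1 = ln \<and> h' = h1)"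
    unfolding path_weights_def
  proof (rule run_par[where N = n and RS = "\<lambda>d. {(b, q). b \<noteq> ''ow''}" and WS = "\<lambda>d. {(''ow'', d)}"])
    fix i assume i: "i < n"
    show "wp (Put ''ow'' vv (Num 1 \<oplus> Var ''n1'' \<otimes> (Var ''n1'' \<otimes> Get ''pl'' vv \<oplus> Op Less (Num 0) (Get ''pl'' vv)))) (ln(''v'' := i)) h
      (\<lambda>l' h'' R Wr. R \<subseteq> {(b, q). b \<noteq> ''ow''} \<and> Wr \<subseteq> {(''ow'', i)} \<and> (\<forall>q\<in>{(''ow'', i)}. h'' q = h1 q))"
      using i lr wZ[of i] by (auto simp: h1_def w_def pl_def)
  next
    fix q assume q: "\<And>i. i < n \<Longrightarrow> q \<notin> {(''ow'', i)}"
    obtain b y where qe: "q = (b, y)" by (cases q)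
    show "h1 q = h q" using q[of y] by (auto simp: qe h1_def)
  qed (use lr nZ in auto)
  have 3: "run (Put ''ow'' (Var ''n'') (Num 1)) ln h1 3 3 (\<lambda>l1 h'. l1 = ln \<and> h' = h2)"
    by (rule run_wp) (use lr values_le(13) in \<open>auto simp: h2_def\<close>)
  define l4 where "l4 = ln(''s'' := 2 ^ ceil_log2 (n + 1))"
  define Q where "Q h' \<longleftrightarrow> same {''ow'', ''os'', ''c3''} h h' \<and> (\<forall>i\<le>n. h' (''os'', i) = i + (n + 1) * ((n + 1) * sm i + cn i))" for h'
  have 4: "run (prefix_sums ''os'' ''c3'' ''ow'' ''zz'' ''n1'' ''one'') ln h2 (300 * (n + 1 + 1) * (ceil_log2 (n + 1) + 1))
    (300 * (ceil_log2 (n + 1) + 1)) (\<lambda>l' h'. l' = l4 \<and> Q h')"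
  proof (rule run_weaken[OF run_plain_sums[where N = "n + 1"]])
    show "tidy (n + 1) ''c3'' h2" using t by (simp add: tidy_def h2_def h1_def)
    have e: "(\<Sum>j<i. h2 (''ow'', j)) = (\<Sum>j<i. w j)" if "i \<le> n" for i
      using that by (intro sum.cong) (auto simp: h2_def h1_def)
    then show "(\<Sum>i<n + 1. h2 (''ow'', i)) \<le> Z" using tot by (simp add: h2_def)
    show "2 * (n + 1) \<le> Z" using pow_Y[of 4 1] n1 by simp
    fix l' h' assume *: "l' = ln(''s'' := 2 ^ ceil_log2 (n + 1)) \<and> same {''os'', ''c3''} h2 h' \<and> tidy (n + 1) ''c3'' h' \<and>
      (\<forall>i<n + 1. h' (''os'', i) = (\<Sum>j<i. h2 (''ow'', j)))"
    then have "\<forall>i\<le>n. h' (''os'', i) = i + (n + 1) * ((n + 1) * sm i + cn i)" using e osum by simp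
    moreover have "same {''ow'', ''os'', ''c3''} h h'" using * by (simp add: same_def h2_def h1_def)
    ultimately show "l' = l4 \<and> Q h'" using * by (simp add: Q_def l4_def)
  qed (use lr zz in \<open>auto simp: h2_def h1_def w_def\<close>)
  have l4: "l4 ''n'' = n" "l4 ''n1'' = n + 1" "l4 ''M'' = M" "l4 ''W'' = W" using lr by (auto simp: l4_def)
  have vals: "val (slot e) l' h' = cn (val e l' h')" "val (position e) l' h' = sm (val e l' h')"
    if "val e l' h' \<le> n" "l' ''n1'' = n + 1" "\<forall>i\<le>n. h' (''os'', i) = i + (n + 1) * ((n + 1) * sm i + cn i)" for e l' h'
    using that digits[of "val e l' h'" "n + 1" "cn (val e l' h')" "sm (val e l' h')"] cn_le[of "val e l' h'"]
    by (simp_all add: slot_def position_def)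
  have cost: "exp_cost (slot e) = 2 * 0 + exp_cost e + 5" "exp_cost (position e) = exp_cost e + 5" "exp_ok (slot e) = exp_ok e" "exp_ok (position e) = exp_ok e"
    "exp_deg (slot e) = 1" "exp_deg (position e) = 1" for e by (simp_all add: slot_def position_def)
  have rds: "reads (slot e) l' h' = reads e l' h' \<union> {(''os'', val e l' h')}" "reads (position e) l' h' = reads e l' h' \<union> {(''os'', val e l' h')}" for e l' h'
    by (auto simp: slot_def position_def)
  define P where "P h' \<longleftrightarrow> same {''ow'', ''os'', ''c3'', ''off'', ''path''} h h' \<and> (\<forall>i\<le>n. h' (''os'', i) = i + (n + 1) * ((n + 1) * sm i + cn i)) \<and>
    (\<forall>v<n. pl v \<noteq> 0 \<longrightarrow> h' (''off'', cn v) = sm v \<and> h' (''path'', sm v) = v)" for h'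
  have smZ: "sm v \<le> Z" if "v \<le> n" for v
  proof -
    have "sm v \<le> (\<Sum>j<n. w j)" using mono(1)[OF that] unfolding osum[of n] by (simp add: trans_le_add1 trans_le_add2)
    then show ?thesis using tot by linarith
  qed
  have 5: "run path_starts l4 h4 (100 * (n + 1)) 100 (\<lambda>l' h'. l' = l4 \<and> P h')" if q: "Q h4" for h4
    unfolding path_starts_def
  proof (rule run_weaken[OF run_par_ex[where N = n and RS = "\<lambda>v. {(b, q). b \<notin> {''off'', ''path''}}"
      and WS = "\<lambda>v. if pl v = 0 then {} else {(''off'', cn v), (''path'', sm v)}" and v = "\<lambda>v q. if fst q = ''off'' then sm v else v"]])
    have os4: "\<forall>i\<le>n. h4 (''os'', i) = i + (n + 1) * ((n + 1) * sm i + cn i)" and s4: "same {''ow'', ''os'', ''c3''} h h4" using q by (auto simp: Q_def)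
    have pl4: "h4 (''pl'', v) = pl v" for v using s4 by (simp add: same_def pl_def)
    show "wp (Cond (Get ''pl'' vv) (Seq (Put ''off'' (slot vv) (position vv)) (Put ''path'' (position vv) vv)) Skip) (l4(''v'' := v)) h4
      (\<lambda>l' h'' R Wr. R \<subseteq> {(b, q). b \<notin> {''off'', ''path''}} \<and> Wr \<subseteq> (if pl v = 0 then {} else {(''off'', cn v), (''path'', sm v)}) \<and>
       (\<forall>q\<in>(if pl v = 0 then {} else {(''off'', cn v), (''path'', sm v)}). h'' q = (if fst q = ''off'' then sm v else v)))" if v: "v < n" for v
      using v l4 os4 pl4 smZ[of v] nZ by (simp add: vals rds)
    show "q \<notin> {(b, q). b \<notin> {''off'', ''path''}} \<and> q \<notin> (if pl v' = 0 then {} else {(''off'', cn v'), (''path'', sm v')})"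
      if vv: "v < n" "v' < n" "v \<noteq> v'" "q \<in> (if pl v = 0 then {} else {(''off'', cn v), (''path'', sm v)})" for v v' q
    proof -
      have p: "pl v \<noteq> 0" "q = (''off'', cn v) \<or> q = (''path'', sm v)" using vv(4) by (auto split: if_splits)
      have "cn v \<noteq> cn v' \<and> sm v \<noteq> sm v'" if "pl v' \<noteq> 0"
        using strict[of v v'] strict[of v' v] p(1) that vv(3) by (cases v v' rule: linorder_cases) auto
      then show ?thesis using p(2) by auto
    qed
    fix l' h' assume *: "l' = l4 \<and> (\<forall>i<n. \<forall>q\<in>(if pl i = 0 then {} else {(''off'', cn i), (''path'', sm i)}). h' q = (if fst q = ''off'' then sm i else i)) \<and>
      (\<forall>q. (\<forall>i<n. q \<notin> (if pl i = 0 then {} else {(''off'', cn i), (''path'', sm i)})) \<longrightarrow> h' q = h4 q)"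
    have "h' (a, x) = h4 (a, x)" if "a \<notin> {''off'', ''path''}" for a x
    proof -
      have "\<forall>i<n. (a, x) \<notin> (if pl i = 0 then {} else {(''off'', cn i), (''path'', sm i)})" using that by auto
      then show ?thesis using * by blast
    qed
    then have "same {''ow'', ''os'', ''c3'', ''off'', ''path''} h h'" "\<forall>i\<le>n. h' (''os'', i) = i + (n + 1) * ((n + 1) * sm i + cn i)"
      using s4 os4 by (simp_all add: same_def)
    moreover have "h' (''off'', cn v) = sm v \<and> h' (''path'', sm v) = v" if "v < n" "pl v \<noteq> 0" for v
    proof -
      have "\<forall>q\<in>{(''off'', cn v), (''path'', sm v)}. h' q = (if fst q = ''off'' then sm v else v)" using * that by (metis (no_types))
      then show ?thesis by simp
    qed
    ultimately show "l' = l4 \<and> P h'" using * by (simp add: P_def)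
  qed (use l4 nZ in \<open>auto simp: cost\<close>)
  define l6 where "l6 = l4(''num_paths'' := cn n)"
  define P6 where "P6 h' \<longleftrightarrow> P h' \<and> h' (''off'', cn n) = sm n" for h'
  have 6: "run path_ends l4 h5 30 30 (\<lambda>l' h'. l' = l6 \<and> P6 h')" if p: "P h5" for h5
  proof -
    have os: "\<forall>i\<le>n. h5 (''os'', i) = i + (n + 1) * ((n + 1) * sm i + cn i)" using p by (simp add: P_def)
    define h6 where "h6 = h5((''off'', cn n) := sm n)"
    have os6: "\<forall>i\<le>n. h6 (''os'', i) = i + (n + 1) * ((n + 1) * sm i + cn i)" using os by (simp add: h6_def)
    have "h6 (''off'', cn v) = sm v \<and> h6 (''path'', sm v) = v" if v: "v < n" "pl v \<noteq> 0" for v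
    proof -
      have "cn v \<noteq> cn n" using strict(2)[OF v] by simp
      moreover have "h5 (''off'', cn v) = sm v \<and> h5 (''path'', sm v) = v" using p v unfolding P_def by blast
      ultimately show ?thesis by (simp add: h6_def)
    qed
    moreover have "same {''ow'', ''os'', ''c3'', ''off'', ''path''} h h6" using p by (simp add: P_def h6_def same_def)
    ultimately have "P h6" unfolding P_def using os6 by blast
    then have "P6 h6" by (simp add: P6_def h6_def)
    moreover have "cn n \<le> Z" using cn_le[of n] nZ by linarith
    moreover have "val (slot (Var ''n'')) l4 h5 = cn n" "val (position (Var ''n'')) l4 h5 = sm n" "val (slot (Var ''n'')) l4 h6 = cn n"
      using os os6 l4 by (simp_all add: vals)
    ultimately show ?thesis unfolding path_ends_def
      by (intro run_wp) (use smZ[of n] in \<open>simp_all add: cost l6_def h6_def[symmetric]\<close>)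
  qed
  define WS where "WS a = (if rank (a div W) = 0 \<and> 0 < a mod W \<and> a mod W < pl (tail (a div W))
    then {(''path'', sm (tail (a div W)) + a mod W)} else {})" for a
  have W0: "0 < W" by (simp add: W_def)
  have divM: "a div W < M" if "a < M * W" for a using that W0 by (simp add: less_mult_imp_div_less)
  have MWZ: "M * W \<le> Z"
  proof -
    have "M * W \<le> (2 * Y) * (8 * Y)" using WY Y_ge(3) by (intro mult_le_mono) (simp_all add: M_def)
    also have "\<dots> \<le> Z" using pow_Y[of 16 2] by (simp add: power2_eq_square)
    finally show ?thesis .
  qed
  have 7: "run path_bodies l6 h6 (100 * (M * W + 1)) 100
    (\<lambda>l' h'. same {''ow'', ''os'', ''c3'', ''off'', ''path''} h h' \<and> output_paths l' h' = path_of h ` {v. v < n \<and> h (''pl'', v) \<noteq> 0})" if p6: "P6 h6" for h6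
    unfolding path_bodies_def
  proof (rule run_weaken[OF run_par_ex[where N = "M * W" and RS = "\<lambda>v. {(b, q). b \<noteq> ''path''}" and WS = WS
      and v = "\<lambda>a q. h (''pth'', tail (a div W) * W + a mod W)"]])
    have os6: "\<forall>i\<le>n. h6 (''os'', i) = i + (n + 1) * ((n + 1) * sm i + cn i)" and s6: "same {''ow'', ''os'', ''c3'', ''off'', ''path''} h h6"
      using p6 by (auto simp: P_def P6_def)
    have wr: "d < M \<Longrightarrow> h (''tl'', d) = tail d \<and> h (''rk'', d) = rank d" for d
      using inv unfolding state_inv_def tables_def wired_def by blast
    have h6: "d < M \<Longrightarrow> h6 (''tl'', d) = tail d" "d < M \<Longrightarrow> h6 (''rk'', d) = rank d" "h6 (''pl'', v) = pl v" "h6 (''pth'', y) = h (''pth'', y)" for d v y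
      using s6 wr by (simp_all add: same_def pl_def)
    have l6: "l6 ''n1'' = n + 1" "l6 ''M'' = M" "l6 ''W'' = W" using l4 by (auto simp: l6_def)
    show "wp (Seq (Assign ''d'' (Var ''a'' \<oslash> Var ''W'')) (Seq (Assign ''y'' (Op Mod (Var ''a'') (Var ''W''))) (Seq (Assign ''v'' (Get ''tl'' vd))
     (Cond (Op Less (Get ''rk'' vd) (Op Less (Num 0) (Var ''y''))) (Cond (Op Less (Var ''y'') (Get ''pl'' vv))
         (Put ''path'' (position vv \<oplus> Var ''y'') (Get ''pth'' (vv \<otimes> Var ''W'' \<oplus> Var ''y''))) Skip) Skip)))) (l6(''a'' := a)) h6
      (\<lambda>l' h'' R Wr. R \<subseteq> {(b, q). b \<noteq> ''path''} \<and> Wr \<subseteq> WS a \<and> (\<forall>q\<in>WS a. h'' q = h (''pth'', tail (a div W) * W + a mod W)))"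
      if a: "a < M * W" and sm: "small l6 h6" for a
    proof -
      have d: "a div W < M" using divM[OF a] .
      have "a div W \<le> a" "a mod W \<le> a" by simp_all
      then have z: "a div W \<le> Z" "a mod W \<le> Z" using a MWZ by linarith+
      have tn: "tail (a div W) \<le> n" using tail_less[OF d] by simp
      have tz: "tail (a div W) \<le> Z" using tn nZ by linarith
      have pz: "h (''pth'', x) \<le> Z" for x using smallD(2)[OF sm, of "(''pth'', x)"] h6 by simp
      show ?thesis
        using z tz pz l6 tn os6 by (simp add: h6(1,2)[OF d] h6(3,4) vals rds WS_def)
    qed
    show "q \<notin> {(b, q). b \<noteq> ''path''} \<and> q \<notin> WS a'" if aa: "a < M * W" "a' < M * W" "a \<noteq> a'" "q \<in> WS a" for a a' q
    proof -
      have c: "rank (a div W) = 0" "a mod W < pl (tail (a div W))" "q = (''path'', sm (tail (a div W)) + a mod W)"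
        using aa(4) by (auto simp: WS_def split: if_splits)
      have "q \<notin> WS a'"
      proof
        assume "q \<in> WS a'"
        then have c': "rank (a' div W) = 0" "a' mod W < pl (tail (a' div W))" "q = (''path'', sm (tail (a' div W)) + a' mod W)"
          by (auto simp: WS_def split: if_splits)
        have e: "sm (tail (a div W)) + a mod W = sm (tail (a' div W)) + a' mod W" using c(3) c'(3) by simp
        have t: "tail (a div W) = tail (a' div W)" by (rule block[OF c(2) c'(2) e])
        then have "a mod W = a' mod W" using e by simp
        moreover have "a div W = a' div W"
          using rank_inj[OF divM[OF aa(1)] divM[OF aa(2)] t] c(1) c'(1) by simp
        ultimately show False using aa(3) by (metis div_mult_mod_eq)
      qed
      then show ?thesis using c(3) by simp
    qed
    fix l' h' assume *: "l' = l6 \<and> (\<forall>i<M * W. \<forall>q\<in>WS i. h' q = h (''pth'', tail (i div W) * W + i mod W)) \<and>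
      (\<forall>q. (\<forall>i<M * W. q \<notin> WS i) \<longrightarrow> h' q = h6 q)"
    have other: "h' (a, x) = h6 (a, x)" if "a \<noteq> ''path''" for a x
    proof -
      have "\<forall>i<M * W. (a, x) \<notin> WS i" using that by (auto simp: WS_def)
      then show ?thesis using * by blast
    qed
    \<comment> \<open>Downward induction: a vertex without a path has the same \<open>cn\<close> and
      \<open>sm\<close> as its successor, so the entry comes from the next vertex with a path or
      from the final entry written by \<open>path_ends\<close>.\<close>
    have off: "h' (''off'', cn i) = sm i" if "i \<le> n" for i
      using that
    proof (induction rule: inc_induct)
      case base
      then show ?case using p6 other by (simp add: P6_def)
    next
      case (step v)
      show ?case
      proof (cases "pl v = 0")
        case True
        have "cn (Suc v) = cn v" "sm (Suc v) = sm v" using True sums[of v] by simp_all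
        then show ?thesis using step.IH by simp
      next
        case False
        then show ?thesis using p6 step.hyps other by (simp add: P6_def P_def)
      qed
    qed
    have body: "h' (''path'', sm v + y) = path_of h v ! y" if v: "v < n" and y: "y < pl v" for v y
    proof (cases "y = 0")
      case True
      have "(''path'', sm v) \<notin> WS a" for a
      proof
        assume "(''path'', sm v) \<in> WS a"
        then have c: "0 < a mod W" "a mod W < pl (tail (a div W))" "sm v + 0 = sm (tail (a div W)) + a mod W"
          by (auto simp: WS_def split: if_splits)
        have "v = tail (a div W)" by (rule block[OF _ c(2,3)]) (use y in simp)
        then show False using c by simp
      qed
      then have "h' (''path'', sm v) = h6 (''path'', sm v)" using * by blast
      also have "\<dots> = v" using p6 v y by (simp add: P6_def P_def)
      finally show ?thesis using True by (simp add: path_of_def)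
    next
      case False
      then have "v \<in> verts" using pl_bounds(2)[OF inv, of v] y by (cases "v \<in> verts") (auto simp: pl_def)
      then obtain d where d: "d < M" "rank d = 0" "tail d = v" using verts_lead by blast
      have yW: "y < W" using y plW[of v] by linarith
      define a where "a = d * W + y"
      have "a < Suc d * W" using yW by (simp add: a_def)
      also have "\<dots> \<le> M * W" using d(1) by (intro mult_le_mono1) simp
      finally have "a < M * W" .
      moreover have ad: "a div W = d" "a mod W = y" using yW by (simp_all add: a_def)
      moreover have "(''path'', sm v + y) \<in> WS a" using d y False by (simp add: WS_def ad)
      ultimately have "h' (''path'', sm v + y) = h (''pth'', tail (a div W) * W + a mod W)" using * by blast
      moreover have "[1..<h (''pl'', v)] ! (y - 1) = y" using False y by (subst nth_upt) (simp_all add: pl_def)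
      ultimately show ?thesis using False y d by (simp add: ad path_of_def pl_def nth_Cons')
    qed
    have seg: "map (\<lambda>i. h' (''path'', i)) [h' (''off'', cn v)..<h' (''off'', Suc (cn v))] = path_of h v" if v: "v < n" "pl v \<noteq> 0" for v
    proof -
      have "cn (Suc v) = Suc (cn v)" "sm (Suc v) = sm v + pl v" using v step[of v] by simp_all
      then have o: "h' (''off'', cn v) = sm v" "h' (''off'', Suc (cn v)) = sm v + pl v" using off[of v] off[of "Suc v"] v by simp_all
      have len: "length (path_of h v) = pl v" using v by (simp add: path_of_def pl_def)
      show ?thesis unfolding o
        by (rule nth_equalityI) (use len body[OF v(1)] in auto)
    qed
    have onto: "\<exists>v<k. pl v \<noteq> 0 \<and> cn v = j" if "j < cn k" for j k
      using that
    proof (induction k)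
      case 0
      then show ?case by (simp add: cn_def)
    next
      case (Suc k)
      then show ?case using step[of k] by (cases "j < cn k") (auto simp: less_Suc_eq split: if_splits)
    qed
    have np: "l' ''num_paths'' = cn n" using * by (simp add: l6_def)
    have "output_paths l' h' = path_of h ` {v. v < n \<and> h (''pl'', v) \<noteq> 0}"
    proof (intro equalityI subsetI)
      fix p assume "p \<in> output_paths l' h'"
      then obtain j where j: "j < cn n" "p = map (\<lambda>i. h' (''path'', i)) [h' (''off'', j)..<h' (''off'', Suc j)]"
        by (auto simp: output_paths_def np)
      then obtain v where "v < n" "pl v \<noteq> 0" "cn v = j" using onto by blast
      then show "p \<in> path_of h ` {v. v < n \<and> h (''pl'', v) \<noteq> 0}" using j seg by (auto simp: pl_def)
    next
      fix p assume "p \<in> path_of h ` {v. v < n \<and> h (''pl'', v) \<noteq> 0}"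
      then obtain v where v: "v < n" "pl v \<noteq> 0" "p = path_of h v" by (auto simp: pl_def)
      then show "p \<in> output_paths l' h'"
        unfolding output_paths_def np using seg[OF v(1,2)] strict(2)[OF v(1,2)] by (auto intro!: image_eqI[of _ _ "cn v"])
    qed
    moreover have "same {''ow'', ''os'', ''c3'', ''off'', ''path''} h h'" using s6 other by (simp add: same_def)
    ultimately show "same {''ow'', ''os'', ''c3'', ''off'', ''path''} h h' \<and> output_paths l' h' = path_of h ` {v. v < n \<and> h (''pl'', v) \<noteq> 0}" by (rule conjI[rotated])
  qed (use l4 MWZ in \<open>auto simp: cost l6_def\<close>)
  show ?thesis unfolding write_paths_def
  proof (rule run_weaken)
    show "run (Seq (Assign ''n1'' (Var ''n'' \<oplus> Num 1)) (Seq path_weights (Seq (Put ''ow'' (Var ''n'') (Num 1))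
     (Seq (prefix_sums ''os'' ''c3'' ''ow'' ''zz'' ''n1'' ''one'') (Seq path_starts (Seq path_ends path_bodies)))))) l h
     (4 + (100 * (n + 1) + (3 + (300 * (n + 1 + 1) * (ceil_log2 (n + 1) + 1) + (100 * (n + 1) + (30 + 100 * (M * W + 1)))))))
     (4 + (100 + (3 + (300 * (ceil_log2 (n + 1) + 1) + (100 + (30 + 100))))))
     (\<lambda>l' h'. same {''ow'', ''os'', ''c3'', ''off'', ''path''} h h' \<and> output_paths l' h' = path_of h ` {v. v < n \<and> h (''pl'', v) \<noteq> 0})"
      by (rule run_seq[OF 1], clarify, rule run_seq[OF 2], clarify, rule run_seq[OF 3], clarify, rule run_seq[OF 4], clarify,
        rule run_seq[OF 5], assumption, clarify, rule run_seq[OF 6], assumption, clarify, rule 7)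
    have "37 \<le> 100 * (n + 2) * 1" by simp
    also have "\<dots> \<le> 100 * (n + 2) * (ceil_log2 (n + 1) + 1)" by (intro mult_le_mono2) simp
    finally show "4 + (100 * (n + 1) + (3 + (300 * (n + 1 + 1) * (ceil_log2 (n + 1) + 1) + (100 * (n + 1) + (30 + 100 * (M * W + 1))))))
      \<le> 400 * (n + 2) * (ceil_log2 (n + 1) + 1) + 200 * (n + 1) + 100 * (M * W + 1)" by (simp add: algebra_simps)
  qed simp_all
qed

end

section \<open>The complete program: cost and correctness\<close>

definition cut_matching :: com where
  "cut_matching = Seq parameters (Seq initialize (Seq rounds (Seq find_cut write_paths)))"

lemma ceil_log2_mono: "N \<le> N' \<Longrightarrow> ceil_log2 N \<le> ceil_log2 N'"
  unfolding ceil_log2_def[of N] by (rule Least_le) (use ceil_log2(1)[of N'] in linarith)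

lemma ceil_log2_le:
  assumes "0 < N"
  shows "real (ceil_log2 N) \<le> log 2 (real N) + 1"
proof (cases "ceil_log2 N")
  case 0
  then show ?thesis using assms by simp
next
  case (Suc j)
  then have "2 ^ j < N" by (intro ceil_log2(2)) simp
  then have "real (2 ^ j) < real N" by (simp only: of_nat_less_iff)
  then have "log 2 (2 ^ j) < log 2 (real N)" using assms by (subst log_less_cancel_iff) auto
  then show ?thesis using Suc by simp
qed

context problem
begin

lemma state_inv_same:
  assumes "same {''wt'', ''ps'', ''c2'', ''C''} h h'" "state_inv i h"
  shows "state_inv i h'"
proof -
  have e: "h' (a, x) = h (a, x)" if "a \<notin> {''wt'', ''ps'', ''c2'', ''C''}" for a x
    using assms(1) that unfolding same_def by blast
  have p: "path_of h' = path_of h" and mt: "matched h' = matched h"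
    by (simp_all add: fun_eq_iff path_of_def matched_def e)
  have "routes_ok h' = routes_ok h" unfolding routes_ok_def p mt by (simp add: e)
  moreover have "tables h' = tables h" unfolding tables_def wired_def adjacent_def by (simp add: e)
  ultimately show ?thesis using assms(2) unfolding state_inv_def p mt by (simp add: e)
qed

definition final :: "locals \<Rightarrow> heap \<Rightarrow> bool" where
  "final l' h' \<longleftrightarrow> (\<exists>h r. state_inv (Suc I) h \<and> good h r \<and> (\<forall>v<n. h' (''C'', v) = of_bool (inside h r v)) \<and>
     output_paths l' h' = path_of h ` {v. v < n \<and> h (''pl'', v) \<noteq> 0})"

text \<open>Up to constants, \<open>X\<close> counts the rounds of all scales and \<open>A\<close>
  is the logarithm from the prefix sums; \<open>X * A\<close> is the span.\<close>

definition X :: nat where "X = (I + 1) * (R + 2 * W + 1)"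
definition A :: nat where "A = ceil_log2 (2 * (n + m + 2)) + 1"

text \<open>Darts take part in every round, which gives the work term \<open>(M + 1) * X\<close>.
  Loops over all vertices, isolated ones included, occur a constant number of times, so
  \<open>n + 1\<close> is multiplied by the logarithm only.\<close>

lemma run_cut_matching:
  "run cut_matching (input_locals n es) input (10000 * (((M + 1) * X + (n + 1)) * A)) (10000 * (X * A)) final"
proof -
  define A2 where "A2 l h \<longleftrightarrow> ready_locals l \<and> l ''k'' = K \<and> l ''I1'' = I + 1 \<and> same init_arrays input h \<and> state_inv 0 h" for l h
  define A3 where "A3 l h \<longleftrightarrow> ready_locals l \<and> same (init_arrays \<union> scale_arrays) input h \<and> state_inv (Suc I) h" for l h
  define A4 where "A4 l h \<longleftrightarrow> ready_locals l \<and> same (init_arrays \<union> scale_arrays \<union> {''wt'', ''ps'', ''c2'', ''C''}) input h \<and> state_inv (Suc I) h \<and>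
    (\<exists>r. good h r \<and> (\<forall>v<n. h (''C'', v) = of_bool (inside h r v)))" for l h
  note 1 = run_parameters
  let ?t2 = "500 * (M + 1) + 100 * (n + 1) + 300 * (M + 1) * (ceil_log2 M + 1)" and ?d2 = "500 + 300 * (ceil_log2 M + 1)"
  have 2: "run initialize l h ?t2 ?d2 A2"
    if "ready_locals l \<and> l ''k'' = K \<and> l ''I1'' = I + 1 \<and> same {''pw''} input h \<and> (\<forall>b\<le>g + 3. h (''pw'', b) = 2 ^ b)" for l h
  proof (rule run_weaken[OF run_initialize])
    fix l' h' assume "same_locals {''s''} l l' \<and> same init_arrays input h' \<and> state_inv 0 h'"
    then show "A2 l' h'" using that by (simp add: A2_def ready_locals_def same_locals_def)
  qed ((rule order_refl | (insert that, blast))+)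
  let ?t3 = "(I + 1) * (6000 * (R + 2 * W + 1) * (M + 1) + 8) + 6" and ?d3 = "(I + 1) * (6000 * (R + 2 * W + 1) + 8) + 6"
  have 3: "run rounds l h ?t3 ?d3 A3" if a: "A2 l h" for l h
  proof (rule run_weaken[OF run_rounds])
    fix l' h' assume *: "ready_locals l' \<and> same scale_arrays h h' \<and> state_inv (I + 1) h'"
    have "same (init_arrays \<union> scale_arrays) input h'" using a * unfolding A2_def same_def by simp
    then show "A3 l' h'" using * by (simp add: A3_def)
  qed ((rule order_refl | (insert a, unfold A2_def, blast))+)
  let ?t4 = "H * (500 * (m + 2) * (ceil_log2 (m + 1) + 1) + 8) + 20 + 100 * (n + 1)" and ?d4 = "H * (500 * (ceil_log2 (m + 1) + 1) + 8) + 120"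
  have 4: "run find_cut l h ?t4 ?d4 A4" if a: "A3 l h" for l h
  proof -
    have hin: "h (a, x) = input (a, x)" if "a \<notin> init_arrays \<union> scale_arrays" for a x
    proof -
      have "same (init_arrays \<union> scale_arrays) input h" using a unfolding A3_def by (elim conjE)
      then show ?thesis unfolding same_def using that by (elim allE impE)
    qed
    show ?thesis
    proof (rule run_weaken[OF run_find_cut])
      show "tidy (m + 1) ''c2'' h" by (rule tidy_zero) (simp add: hin)
      show "h (''zz'', i) = 0" for i by (simp add: hin)
      show "h (''src'', i) = fst (es ! i) \<and> h (''dst'', i) = snd (es ! i)" if "i < m" for i using that by (simp add: hin)
      fix l' h' assume *: "ready_locals l' \<and> same {''wt'', ''ps'', ''c2'', ''C''} h h' \<and> (\<exists>r. good h r \<and> (\<forall>v<n. h' (''C'', v) = of_bool (inside h r v)))"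
      then have s: "same {''wt'', ''ps'', ''c2'', ''C''} h h'" by blast
      have "inside h' = inside h" "good h' = good h" using s by (auto simp: fun_eq_iff inside_def good_def crossing_def same_def)
      moreover have "state_inv (Suc I) h'" by (rule state_inv_same[OF s]) (use a in \<open>simp add: A3_def\<close>)
      moreover have "same (init_arrays \<union> scale_arrays \<union> {''wt'', ''ps'', ''c2'', ''C''}) input h'" using s hin unfolding same_def by simp
      ultimately show "A4 l' h'" using * by (simp add: A4_def)
    qed ((rule order_refl | (insert a, unfold A3_def, blast))+)
  qed
  let ?t5 = "400 * (n + 2) * (ceil_log2 (n + 1) + 1) + 200 * (n + 1) + 100 * (M * W + 1)" and ?d5 = "300 * (ceil_log2 (n + 1) + 1) + 400"
  have 5: "run write_paths l h ?t5 ?d5 final" if a: "A4 l h" for l h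
  proof -
    have hin: "h (a, x) = input (a, x)" if "a \<notin> init_arrays \<union> scale_arrays \<union> {''wt'', ''ps'', ''c2'', ''C''}" for a x
    proof -
      have "same (init_arrays \<union> scale_arrays \<union> {''wt'', ''ps'', ''c2'', ''C''}) input h" using a unfolding A4_def by (elim conjE)
      then show ?thesis unfolding same_def using that by (elim allE impE)
    qed
    show ?thesis
    proof (rule run_weaken[OF run_write_paths])
      show "tidy (n + 1) ''c3'' h" by (rule tidy_zero) (simp add: hin)
      show "h (''zz'', i) = 0" for i by (simp add: hin)
      fix l' h' assume *: "same {''ow'', ''os'', ''c3'', ''off'', ''path''} h h' \<and> output_paths l' h' = path_of h ` {v. v < n \<and> h (''pl'', v) \<noteq> 0}"
      then have "h' (''C'', v) = h (''C'', v)" for v by (simp add: same_def)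
      moreover obtain r where "good h r" "\<forall>v<n. h (''C'', v) = of_bool (inside h r v)" using a unfolding A4_def by blast
      moreover have "state_inv (Suc I) h" using a unfolding A4_def by blast
      ultimately show "final l' h'" unfolding final_def using * by (intro exI[of _ h] exI[of _ r]) simp
    qed ((rule order_refl | (insert a, unfold A4_def, blast))+)
  qed
  have A: "ceil_log2 M + 1 \<le> A" "ceil_log2 (m + 1) + 1 \<le> A" "ceil_log2 (n + 1) + 1 \<le> A" "1 \<le> A"
    unfolding A_def M_def by (auto intro!: ceil_log2_mono)
  have "g + 7 \<le> R"
  proof -
    have "1 * (g + 7) \<le> 2 * K * H * (g + 7)" by (intro mult_le_mono1) (simp add: K_def H_def Suc_le_eq)
    then show ?thesis by (simp add: R_def)
  qed
  moreover have "1 * (R + 2 * W + 1) \<le> X" unfolding X_def by (intro mult_le_mono1) simp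
  moreover have "(I + 1) * 1 \<le> X" unfolding X_def by (intro mult_le_mono2) simp
  ultimately have X: "g + 7 \<le> X" "W \<le> X" "H \<le> X" "I + 1 \<le> X" "1 \<le> X" by (simp_all add: W_def)
  define M1 where "M1 = M + 1"
  define B where "B = M1 * X * A"
  define D where "D = (n + 1) * A"
  have M1: "1 \<le> M1" "m + 2 \<le> 2 * M1" by (simp_all add: M1_def M_def)
  have B: "X \<le> B" "M1 * A \<le> B" "M1 \<le> B" "M1 * X \<le> B" "X * M1 * A \<le> B" "1 \<le> B"
  proof -
    have "1 * X * 1 \<le> B" "M1 * 1 * A \<le> B" "M1 * 1 * 1 \<le> B" "M1 * X * 1 \<le> B" "1 * 1 * 1 \<le> B"
      unfolding B_def using M1(1) X(5) A(4) by (intro mult_le_mono; simp)+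
    then show "X \<le> B" "M1 * A \<le> B" "M1 \<le> B" "M1 * X \<le> B" "1 \<le> B" by simp_all
    show "X * M1 * A \<le> B" by (simp add: B_def)
  qed
  have D: "n + 1 \<le> D" unfolding D_def using mult_le_mono2[OF A(4), of "n + 1"] by simp
  show ?thesis unfolding cut_matching_def
  proof (rule run_weaken[OF run_seq[OF 1 run_seq[OF 2 run_seq[OF 3 run_seq[OF 4 5]]]]])
    have f1: "300 * (M + 1) * (ceil_log2 M + 1) \<le> 300 * (M1 * A)" unfolding M1_def mult.assoc using A by (intro mult_le_mono2) simp
    have f2: "(I + 1) * (6000 * (R + 2 * W + 1) * (M + 1) + 8) = 6000 * (M1 * X) + 8 * (I + 1)"
      by (simp add: X_def M1_def algebra_simps)
    have f3: "H * (500 * (m + 2) * (ceil_log2 (m + 1) + 1) + 8) \<le> X * (500 * (2 * M1) * A + 8)"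
      using X(3) M1(2) A(2) by (intro mult_le_mono add_mono) auto
    have f4: "X * (500 * (2 * M1) * A + 8) = 1000 * (X * M1 * A) + 8 * X" by (simp add: algebra_simps)
    have f5: "400 * (n + 2) * (ceil_log2 (n + 1) + 1) \<le> 400 * (2 * (n + 1)) * A" using A(3) by (intro mult_le_mono) auto
    have f6: "400 * (2 * (n + 1)) * A = 800 * D" by (simp add: D_def algebra_simps)
    have f7: "M * W \<le> M1 * X" using X(2) by (intro mult_le_mono) (simp_all add: M1_def)
    have f8: "10000 * (((M + 1) * X + (n + 1)) * A) = 10000 * B + 10000 * D" by (simp add: B_def D_def M1_def algebra_simps)
    have f9: "M + 1 = M1" by (simp add: M1_def)
    have arith: "100 * (g' + i' + 4) + (500 * mm + 100 * nn + t1 + (t2 + 6 + (t3 + 20 + 100 * nn + (t4 + 200 * nn + 100 * (mw + 1))))) \<le> z"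
      if "t1 \<le> 300 * ma" "t2 = 6000 * mx + 8 * ii" "t3 \<le> t3'" "t3' = 1000 * b0 + 8 * x" "t4 \<le> t4'" "t4' = 800 * d" "mw \<le> mx"
        "z = 10000 * b + 10000 * d" "mm = m1" "x \<le> b" "ma \<le> b" "m1 \<le> b" "mx \<le> b" "b0 \<le> b" "1 \<le> b" "nn \<le> d" "g' + 7 \<le> x"
        "ii \<le> x" "i' + 1 = ii" for g' i' mm nn t1 t2 t3 t4 mw z ma mx ii t3' b0 x t4' d b m1 :: nat
    proof -
      have ts: "t1 \<le> 300 * b" "t2 \<le> 6008 * b" "t3 \<le> 1008 * b" "t4 \<le> 800 * d" "mw \<le> b" "mm \<le> b" using that by linarith+
      have gi: "g' + i' + 4 \<le> 2 * b" using that by linarith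
      have mw: "mw + 1 \<le> 2 * b" using ts(5) \<open>1 \<le> b\<close> by linarith
      have cs: "6 \<le> 6 * b" "20 \<le> 20 * b" using \<open>1 \<le> b\<close> by simp_all
      have "100 * (g' + i' + 4) + (500 * mm + 100 * nn + t1 + (t2 + 6 + (t3 + 20 + 100 * nn + (t4 + 200 * nn + 100 * (mw + 1)))))
        \<le> 100 * (2 * b) + (500 * b + 100 * d + 300 * b + (6008 * b + 6 * b + (1008 * b + 20 * b + 100 * d + (800 * d + 200 * d + 100 * (2 * b)))))"
        by (intro add_mono ts gi mw cs mult_le_mono2 \<open>nn \<le> d\<close>)
      also have "\<dots> = 8242 * b + 1200 * d" by simp
      also have "\<dots> \<le> 10000 * b + 10000 * d" by (intro add_mono mult_le_mono1) simp_all
      finally show ?thesis using that by simp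
    qed
    show "100 * (g + I + 4) + (?t2 + (?t3 + (?t4 + ?t5))) \<le> 10000 * (((M + 1) * X + (n + 1)) * A)"
      by (rule arith[OF f1 f2 f3 f4 f5 f6 f7 f8 f9 B(1-6) D X(1) X(4) refl])
    have h1: "(I + 1) * (6000 * (R + 2 * W + 1) + 8) = 6000 * X + 8 * (I + 1)" by (simp add: X_def algebra_simps)
    have h2: "H * (500 * (ceil_log2 (m + 1) + 1) + 8) \<le> X * (500 * A + 8)" using X(3) A(2) by (intro mult_le_mono add_mono) auto
    have h3: "X * (500 * A + 8) = 500 * (X * A) + 8 * X" by (simp add: algebra_simps)
    have h4: "X * 1 \<le> X * A" "1 * A \<le> X * A" using A(4) X(5) by (intro mult_le_mono; simp)+
    have h5: "X \<le> X * A" "ceil_log2 M + 1 \<le> X * A" "ceil_log2 (n + 1) + 1 \<le> X * A" "1 \<le> X * A"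
      using h4 X(5) A(4) order_trans[OF A(1)] order_trans[OF A(3)] by simp_all
    have arith: "100 * (g' + i' + 4) + (500 + 300 * a1 + (t2 + 6 + (t3 + 120 + (300 * a2 + 400)))) \<le> 10000 * b"
      if "g' + 7 \<le> x" "i' + 1 \<le> x" "t2 = 6000 * x + 8 * (i' + 1)" "t3 \<le> t3'" "t3' = 500 * b + 8 * x" "x \<le> b" "a1 \<le> b" "a2 \<le> b" "1 \<le> b"
      for g' i' a1 a2 t2 t3 t3' x b :: nat
    proof -
      have ib: "i' + 1 \<le> b" and gb: "g' + 7 \<le> b" using order_trans[OF that(2) \<open>x \<le> b\<close>] order_trans[OF that(1) \<open>x \<le> b\<close>] by simp_all
      have "t2 \<le> 6000 * b + 8 * b" unfolding that(3) by (intro add_mono mult_le_mono2 ib \<open>x \<le> b\<close>)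
      moreover have "t3' \<le> 500 * b + 8 * b" unfolding that(5) by (intro add_mono mult_le_mono2 order_refl \<open>x \<le> b\<close>)
      ultimately have ts: "t2 \<le> 6008 * b" "t3 \<le> 508 * b" using that(4) by simp_all
      have "(g' + 7) + (i' + 1) \<le> b + b" by (intro add_mono[OF gb ib])
      then have gi: "g' + i' + 4 \<le> 2 * b" by simp
      have cs: "500 \<le> 500 * b" "6 \<le> 6 * b" "120 \<le> 120 * b" "400 \<le> 400 * b" using \<open>1 \<le> b\<close> by simp_all
      have "100 * (g' + i' + 4) + (500 + 300 * a1 + (t2 + 6 + (t3 + 120 + (300 * a2 + 400))))
        \<le> 100 * (2 * b) + (500 * b + 300 * b + (6008 * b + 6 * b + (508 * b + 120 * b + (300 * b + 400 * b))))"
        by (intro add_mono ts gi cs mult_le_mono2 \<open>a1 \<le> b\<close> \<open>a2 \<le> b\<close>)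
      also have "\<dots> = 8342 * b" by simp
      also have "\<dots> \<le> 10000 * b" by (intro mult_le_mono1) simp
      finally show ?thesis .
    qed
    show "100 * (g + I + 4) + (?d2 + (?d3 + (?d4 + ?d5))) \<le> 10000 * (X * A)"
      by (rule arith[OF X(1) X(4) h1 h2 h3 h5])
  qed
qed

abbreviation V :: "nat set" where "V \<equiv> {..<n}"
abbreviation E :: "nat set set" where "E \<equiv> ends ` set es"

lemma edge_index: "e \<in> E \<Longrightarrow> \<exists>i<m. e = {tail i, head i} \<and> tail i = fst (es ! i) \<and> head i = snd (es ! i)"
proof -
  assume "e \<in> E"
  then obtain i where "i < m" "e = ends (es ! i)" by (auto simp: in_set_conv_nth m_def)
  then show ?thesis by (auto simp: tail_def head_def mate_def M_def case_prod_beta)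
qed

lemma dart_edge: "d < M \<Longrightarrow> {tail d, head d} \<in> E"
proof -
  assume d: "d < M"
  have "map ends es ! index d \<in> set (map ends es)" using index_less[OF d] by (intro nth_mem) (simp add: m_def)
  then show ?thesis using ends_index[OF d] by simp
qed

lemma card_E: "card E = m"
proof -
  have "card (set (map ends es)) = length (map ends es)" by (rule distinct_card[OF distinct_edges])
  then show ?thesis by (simp add: m_def)
qed

lemma cut_bound:
  assumes gd: "good h r" and C: "C = {v. v < n \<and> inside h r v}"
  shows "real (card (edges_between E C (V - C))) \<le> 2 * \<phi> * real m"
proof -
  have "edges_between E C (V - C) \<subseteq> (\<lambda>i. {tail i, head i}) ` crossing h r"
  proof
    fix e assume "e \<in> edges_between E C (V - C)"
    then have "e \<in> E \<and> (\<exists>x\<in>C. \<exists>y\<in>V - C. e = {x, y})" unfolding edges_between_def by (rule CollectD)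
    then obtain x y where e: "e \<in> E" "e = {x, y}" "x \<in> C" "y \<in> V - C" by (elim conjE bexE) (rule that)
    obtain i where i: "i < m" "e = {tail i, head i}" "tail i = fst (es ! i)" "head i = snd (es ! i)" using edge_index[OF e(1)] by blast
    have xy: "inside h r x" "\<not> inside h r y" using e(3,4) unfolding C by simp_all
    have "{x, y} = {tail i, head i}" using e(2) i(2) by simp
    then have "x = tail i \<and> y = head i \<or> x = head i \<and> y = tail i" unfolding doubleton_eq_iff .
    then have "inside h r (tail i) \<noteq> inside h r (head i)" using xy by (elim disjE conjE) simp_all
    then have "i \<in> crossing h r" using i(1,3,4) by (simp add: crossing_def)
    then show "e \<in> (\<lambda>i. {tail i, head i}) ` crossing h r" unfolding i(2) by (rule imageI)
  qed
  then have "card (edges_between E C (V - C)) \<le> card (crossing h r)" by (intro surj_card_le) (simp_all add: crossing_def)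
  then have "real (card (edges_between E C (V - C))) \<le> real (card (crossing h r))" by simp
  then show ?thesis using gd by (simp add: good_def M_def)
qed

lemma output_correct:
  assumes inv: "state_inv (Suc I) h" and C: "C = {v. v < n \<and> inside h r v}"
    and P: "P = path_of h ` {v. v < n \<and> h (''pl'', v) \<noteq> 0}"
  shows "\<forall>p\<in>P. path_between V E S T p"
    and "\<exists>Mt. matching_between S T Mt \<and> embeds P Mt"
    and "e \<in> E \<Longrightarrow> card {p \<in> P. e \<in> path_edges p} \<le> 4 * K * (g + 3)"
    and "S - hd ` P \<subseteq> C" and "C \<inter> (T - last ` P) = {}"
proof -
  define pth where "pth = path_of h"
  define Dm where "Dm = {v. v < n \<and> h (''pl'', v) \<noteq> 0}"
  have P': "P = pth ` Dm" by (simp add: P pth_def Dm_def)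
  have ro: "\<And>v. v \<in> matched h \<Longrightarrow> 1 \<le> h (''pl'', v) \<and> distinct (pth v) \<and> linked (pth v) \<and> last (pth v) \<in> T - S"
    "\<And>v. v \<notin> matched h \<Longrightarrow> h (''pl'', v) = (if v \<in> S \<inter> T then 1 else 0)"
    "inj_on (\<lambda>v. last (pth v)) (matched h)"
    "\<And>t. t \<in> T - S \<Longrightarrow> h (''fr'', t) = 0 \<Longrightarrow> t \<in> (\<lambda>v. last (pth v)) ` matched h"
    using inv unfolding state_inv_def routes_ok_def pth_def by blast+
  have st: "\<And>v. h (''un'', v) \<le> 1" "\<And>v. h (''un'', v) = 1 \<Longrightarrow> v \<in> S - T" "\<And>v. h (''fr'', v) \<le> 1" "\<And>v. h (''fr'', v) = 1 \<Longrightarrow> h (''lab'', v) = 0"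
    "\<And>d. d < M \<Longrightarrow> card {v \<in> matched h. uses d (pth v)} + 2 * (K div 2 ^ Suc I) * (g + 3) \<le> 2 * K * (g + 3)"
    using inv unfolding state_inv_def pth_def by blast+
  have hd: "hd (pth v) = v" for v by (simp add: pth_def path_of_def)
  have mn: "matched h \<subseteq> Dm"
  proof
    fix v assume v: "v \<in> matched h"
    then have "v < n" using S_sub by (auto simp: matched_def)
    then show "v \<in> Dm" using ro(1)[OF v] by (simp add: Dm_def)
  qed
  have Dm: "v \<in> matched h \<or> v \<in> S \<inter> T \<and> pth v = [v]" if "v \<in> Dm" for v
    using that ro(2)[of v] by (cases "v \<in> matched h") (auto simp: Dm_def pth_def path_of_def split: if_splits)
  have tr: "v \<in> S \<inter> T \<Longrightarrow> v \<in> Dm \<and> pth v = [v]" for v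
    using ro(2)[of v] S_sub by (auto simp: Dm_def matched_def pth_def path_of_def)
  have mST: "v \<in> matched h \<Longrightarrow> v \<in> S - T" for v by (simp add: matched_def)
  show "\<forall>p\<in>P. path_between V E S T p"
  proof
    fix p assume "p \<in> P"
    then obtain v where v: "v \<in> Dm" "p = pth v" by (auto simp: P')
    show "path_between V E S T p"
    proof (cases "v \<in> matched h")
      case True
      have lk: "linked p" "distinct p" "last p \<in> T" using ro(1)[OF True] v by auto
      have p0: "p \<noteq> []" "p ! 0 = v" unfolding v by (simp_all add: pth_def path_of_def)
      have "set p \<subseteq> V"
      proof
        fix x assume "x \<in> set p"
        then obtain i where i: "i < length p" "x = p ! i" by (auto simp: in_set_conv_nth)
        show "x \<in> V"
        proof (cases i)
          case 0
          then show ?thesis using i p0 v by (simp add: Dm_def)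
        next
          case (Suc j)
          then obtain d where "d < M" "head d = x" using lk(1) i unfolding linked_def by metis
          then show ?thesis using head_verts verts_less by blast
        qed
      qed
      moreover have "successively (\<lambda>u v. {u, v} \<in> E) p"
        unfolding successively_conv_nth
      proof (intro allI impI)
        fix i assume "Suc i < length p"
        then obtain d where "d < M" "tail d = p ! i" "head d = p ! Suc i" using lk(1) unfolding linked_def by metis
        then show "{p ! i, p ! Suc i} \<in> E" using dart_edge by metis
      qed
      ultimately show ?thesis using lk p0 mST[OF True] hd[of v] v by (simp add: path_between_def is_path_def)
    next
      case False
      then have "v \<in> S \<inter> T" "p = [v]" using Dm v by auto
      then show ?thesis using v by (simp add: path_between_def is_path_def Dm_def)
    qed
  qed
  have lastT: "last (pth v) \<in> T" if "v \<in> Dm" for v using Dm[OF that] ro(1)[of v] by auto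
  have vS: "v \<in> S" if "v \<in> Dm" for v using Dm[OF that] mST by auto
  \<comment> \<open>A start could coincide with the end of another path only at a vertex of both
    \<open>S\<close> and \<open>T\<close>; such vertices are paired with themselves, and all other
    routes lead from \<open>S - T\<close> to \<open>T - S\<close>.\<close>
  have cross: "v = w" if "v \<in> Dm" "w \<in> Dm" "v = last (pth w) \<or> last (pth v) = last (pth w)" for v w
    using Dm[OF that(1)] Dm[OF that(2)]
  proof (elim disjE)
    assume vw: "v \<in> matched h" "w \<in> matched h"
    then have "v \<in> S - T" "last (pth w) \<in> T" using mST ro(1) by auto
    then have "last (pth v) = last (pth w)" using that(3) by auto
    then show "v = w" using inj_onD[OF ro(3)] vw by blast
  next
    assume vw: "v \<in> matched h" "w \<in> S \<inter> T \<and> pth w = [w]"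
    then show "v = w" using mST[OF vw(1)] ro(1)[OF vw(1)] that(3) by auto
  next
    assume vw: "v \<in> S \<inter> T \<and> pth v = [v]" "w \<in> matched h"
    then show "v = w" using ro(1)[OF vw(2)] that(3) by auto
  qed (use that(3) in auto)
  define Mt where "Mt = (\<lambda>p. (hd p, last p)) ` P"
  have "matching_between S T Mt"
    unfolding matching_between_def
  proof
    show "Mt \<subseteq> S \<times> T" using lastT vS hd by (auto simp: Mt_def P')
    show "pairwise (\<lambda>x y. disjnt {fst x, snd x} {fst y, snd y}) Mt"
    proof (rule pairwiseI)
      fix x y assume "x \<in> Mt" "y \<in> Mt" and ne: "x \<noteq> y"
      then obtain v w where vw: "v \<in> Dm" "w \<in> Dm" "x = (v, last (pth v))" "y = (w, last (pth w))"
        using hd by (auto simp: Mt_def P')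
      then have "v \<noteq> w" using ne by auto
      then have "v \<noteq> last (pth w)" "w \<noteq> last (pth v)" "last (pth v) \<noteq> last (pth w)"
        using cross[OF vw(1,2)] cross[OF vw(2,1)] by auto
      with \<open>v \<noteq> w\<close> show "disjnt {fst x, snd x} {fst y, snd y}" by (auto simp: vw(3,4) disjnt_def)
    qed
  qed
  moreover have "embeds P Mt" unfolding embeds_def Mt_def
  proof (rule inj_on_imp_bij_betw, rule inj_onI)
    fix x y assume "x \<in> P" "y \<in> P" "(hd x, last x) = (hd y, last y)"
    then show "x = y" using hd by (auto simp: P')
  qed
  ultimately show "\<exists>Mt. matching_between S T Mt \<and> embeds P Mt" by blast
  show "card {p \<in> P. e \<in> path_edges p} \<le> 4 * K * (g + 3)" if "e \<in> E"
  proof -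
    obtain i where i: "i < m" "e = {tail i, head i}" using edge_index[OF \<open>e \<in> E\<close>] by blast
    have iM: "i < M" using i by (simp add: M_def)
    have mM: "mate i < M" "tail (mate i) = head i" "head (mate i) = tail i" using mate[OF iM] head_mate[OF iM] by auto
    \<comment> \<open>Paths of one vertex have no edges. Each orientation of \<open>e\<close> is
      used by at most \<open>2 * K * (g + 3)\<close> routes, hence the factor 4.\<close>
    let ?U = "{v \<in> matched h. uses i (pth v)} \<union> {v \<in> matched h. uses (mate i) (pth v)}"
    have fin: "finite ?U" using finite_S by (simp add: matched_def)
    have "{p \<in> P. e \<in> path_edges p} \<subseteq> pth ` ?U"
    proof
      fix p assume "p \<in> {p \<in> P. e \<in> path_edges p}"
      then obtain v j where v: "v \<in> Dm" "p = pth v" "e = {p ! j, p ! Suc j}" "Suc j < length p" by (auto simp: P' path_edges_def)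
      then have "v \<in> matched h" using Dm[OF v(1)] by auto
      moreover have "tail i = p ! j \<and> head i = p ! Suc j \<or> tail i = p ! Suc j \<and> head i = p ! j"
        using v(3) i(2) by (auto simp: doubleton_eq_iff)
      then have "uses i p \<or> uses (mate i) p" using v(4) mM unfolding uses_def by auto
      ultimately show "p \<in> pth ` ?U" using v(2) by blast
    qed
    then have "card {p \<in> P. e \<in> path_edges p} \<le> card ?U" by (rule surj_card_le[OF fin])
    also have "\<dots> \<le> card {v \<in> matched h. uses i (pth v)} + card {v \<in> matched h. uses (mate i) (pth v)}" by (rule card_Un_le)
    also have "\<dots> \<le> 2 * K * (g + 3) + 2 * K * (g + 3)" using st(5)[OF iM] st(5)[OF mM(1)] by linarith
    finally show ?thesis by simp
  qed
  show "S - hd ` P \<subseteq> C"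
  proof
    fix v assume v: "v \<in> S - hd ` P"
    have "v \<notin> Dm"
    proof
      assume "v \<in> Dm"
      then have "hd (pth v) \<in> hd ` P" unfolding P' by (intro imageI)
      then show False using v hd[of v] by simp
    qed
    then have "v \<notin> matched h" "v \<notin> T" using mn tr v by auto
    then have "h (''un'', v) \<noteq> 0" using v by (auto simp: matched_def)
    then show "v \<in> C" using v S_sub by (auto simp: C inside_def)
  qed
  show "C \<inter> (T - last ` P) = {}"
  proof (rule ccontr)
    assume "C \<inter> (T - last ` P) \<noteq> {}"
    then obtain v where v: "v \<in> C" "v \<in> T" "v \<notin> last ` P" by blast
    have lP: "w \<in> Dm \<Longrightarrow> last (pth w) \<in> last ` P" for w unfolding P' by (intro imageI)
    have nS: "v \<notin> S"
    proof
      assume "v \<in> S"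
      then have "v \<in> Dm" "pth v = [v]" using tr v(2) by auto
      then show False using v(3) lP[of v] by simp
    qed
    have "h (''fr'', v) \<noteq> 0"
    proof
      assume "h (''fr'', v) = 0"
      then have "v \<in> (\<lambda>v. last (pth v)) ` matched h" using ro(4) nS v(2) by blast
      then obtain w where "w \<in> matched h" "v = last (pth w)" by blast
      then show False using v(3) mn lP[of w] by blast
    qed
    then have "h (''fr'', v) = 1" using st(3)[of v] by linarith
    then have "h (''lab'', v) = 0" by (rule st(4))
    moreover have "h (''un'', v) = 0" using st(1)[of v] st(2)[of v] nS by (cases "h (''un'', v)") auto
    ultimately show False using v(1) by (simp add: C inside_def)
  qed
qed

section \<open>Estimates in terms of the graph size and the conductance parameter\<close>

definition L :: real where "L = log 2 (real (n + m) + 2)"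

lemma L_ge: "1 \<le> L"
proof -
  have "log 2 2 \<le> L" unfolding L_def by (subst log_le_cancel_iff) auto
  then show ?thesis by simp
qed

text \<open>By minimality of \<open>g\<close> the previous power of two fails the first alternative,
  so \<open>q\<close> exceeds \<open>1 / \<phi>\<close> by a factor of at most 2.\<close>

lemma q_le: "real q \<le> 2 / \<phi>"
proof (cases g)
  case 0
  then show ?thesis using phi by (simp add: field_simps)
next
  case (Suc j)
  then have "\<phi> * 2 ^ j < 1" using g_below[of j] by simp
  then show ?thesis using phi Suc by (simp add: field_simps)
qed

text \<open>The cap at \<open>4 * m\<close> enters here: minimality gives
  \<open>2 ^ (g - 1) < 4 * m\<close> for positive \<open>g\<close>, so \<open>g\<close> is
  logarithmic in the graph size and independent of \<open>\<phi>\<close>.\<close>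

lemma g_le: "real (g + 7) \<le> 11 * L"
proof (cases g)
  case 0
  then show ?thesis using L_ge by simp
next
  case (Suc j)
  then have "2 ^ j < 4 * m" using g_below[of j] by simp
  then have "real (2 ^ j) < real (4 * m)" by (simp only: of_nat_less_iff)
  also have "\<dots> \<le> 4 * (real (n + m) + 2)" by simp
  finally have "log 2 (2 ^ j) < log 2 (4 * (real (n + m) + 2))" by (subst log_less_cancel_iff) auto
  also have "\<dots> = log 2 (2 ^ 2) + L" unfolding L_def by (subst log_mult) auto
  also have "\<dots> = 2 + L" by (subst log_pow_cancel) auto
  finally have "real j < 2 + L" by simp
  then show ?thesis using Suc L_ge by simp
qed

lemma A_le: "real A \<le> 4 * L"
proof -
  have "real (ceil_log2 (2 * (n + m + 2))) \<le> log 2 (real (2 * (n + m + 2))) + 1" by (rule ceil_log2_le) simp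
  also have "real (2 * (n + m + 2)) = 2 * (real (n + m) + 2)" by simp
  also have "log 2 (2 * (real (n + m) + 2)) = 1 + L" unfolding L_def by (subst log_mult) auto
  finally show ?thesis using L_ge by (simp add: A_def)
qed

lemma K_le: "K \<le> 32 * (g + 7) * q"
proof -
  have "16 * I * q \<le> 32 * (g + 7) * q" using I_le by (intro mult_le_mono1) simp
  from order_trans[OF two_I_le this] show ?thesis by (simp only: K_def)
qed

text \<open>There are at most \<open>2 * (g + 7)\<close> scales, and \<open>R + 2 * W + 1\<close> is
  at most \<open>600 * (g + 7) ^ 2 * q ^ 2\<close>; the product is rounded up.\<close>

lemma X_le: "X \<le> 2000 * (q ^ 2 * (g + 7) ^ 3)"
proof -
  define G where "G = g + 7"
  define Q where "Q = G * G * (q * q)"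
  have "R \<le> 2 * (32 * G * q) * (8 * q) * G" unfolding R_def H_q G_def using K_le by (intro mult_le_mono) auto
  also have "\<dots> = 512 * Q" by (simp add: Q_def)
  finally have R: "R \<le> 512 * Q" .
  have "1 * 1 * (q * 1) \<le> Q" "1 * 1 * (1 * 1) \<le> Q" unfolding Q_def by (intro mult_le_mono; simp add: G_def)+
  then have "R + 2 * W + 1 \<le> 600 * Q" using R by (simp add: W_def H_q)
  moreover have "I + 1 \<le> 2 * G" using I_le by (simp add: G_def)
  ultimately have "X \<le> (2 * G) * (600 * Q)" unfolding X_def by (rule mult_le_mono[rotated])
  also have "\<dots> = 1200 * (q ^ 2 * G ^ 3)" by (simp add: Q_def power2_eq_square power3_eq_cube)
  finally show ?thesis by (simp add: G_def)
qed

text \<open>The constant is 2000 times 4 from the square of \<open>2 / \<phi>\<close> times 1331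
  from the cube of \<open>11 * L\<close>.\<close>

lemma X_real: "real X \<le> 10648000 * L ^ 3 * (1 / \<phi> ^ 2)"
proof -
  have "real X \<le> real (2000 * (q ^ 2 * (g + 7) ^ 3))" using X_le by (simp only: of_nat_le_iff)
  also have "\<dots> = 2000 * (real q ^ 2 * real (g + 7) ^ 3)" by (simp only: of_nat_mult of_nat_power of_nat_numeral)
  also have "\<dots> \<le> 2000 * ((2 / \<phi>) ^ 2 * (11 * L) ^ 3)"
    using q_le g_le L_ge phi by (intro mult_left_mono mult_mono power_mono) auto
  also have "\<dots> = 10648000 * L ^ 3 * (1 / \<phi> ^ 2)" by (simp add: power_mult_distrib power_divide)
  finally show ?thesis .
qed

text \<open>The estimate is of order \<open>1 / \<phi> ^ 2\<close> up to logarithms and is then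
  relaxed to the stated fourth power. One factor \<open>L\<close> comes from the prefix sums, three
  from \<open>X\<close>.\<close>

lemma span_bound: "real (10000 * (X * A)) \<le> 10 ^ 13 * L ^ 4 * (1 / \<phi> ^ 4)"
proof -
  have "real (10000 * (X * A)) = 10000 * (real X * real A)" by simp
  also have "\<dots> \<le> 10000 * ((10648000 * L ^ 3 * (1 / \<phi> ^ 2)) * (4 * L))"
    using X_real A_le L_ge phi by (intro mult_left_mono mult_mono) auto
  also have "\<dots> = 425920000000 * (L ^ 4 * (1 / \<phi> ^ 2))" by (simp add: power4_eq_xxxx power3_eq_cube)
  also have "\<dots> \<le> 10 ^ 13 * (L ^ 4 * (1 / \<phi> ^ 4))"
  proof (intro mult_mono)
    have "\<phi> ^ 4 \<le> \<phi> ^ 2" using phi by (intro power_decreasing) auto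
    then show "1 / \<phi> ^ 2 \<le> 1 / \<phi> ^ 4" using phi by (intro divide_left_mono) auto
  qed (use L_ge phi in auto)
  finally show ?thesis by simp
qed

lemma congestion_bound: "real (4 * K * (g + 3)) \<le> 10 ^ 13 * L ^ 4 * (1 / \<phi>)"
proof -
  have "4 * K * (g + 3) \<le> 4 * (32 * (g + 7) * q) * (g + 7)" using K_le by (intro mult_le_mono) auto
  then have "real (4 * K * (g + 3)) \<le> real (4 * (32 * (g + 7) * q) * (g + 7))" by (simp only: of_nat_le_iff)
  also have "\<dots> = 128 * (real q * real (g + 7) ^ 2)" by (simp add: power2_eq_square)
  also have "\<dots> \<le> 128 * ((2 / \<phi>) * (11 * L) ^ 2)"
    using q_le g_le L_ge phi by (intro mult_left_mono mult_mono power_mono) auto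
  also have "\<dots> = 30976 * (L ^ 2 * (1 / \<phi>))" by (simp add: power_mult_distrib)
  also have "\<dots> \<le> 10 ^ 13 * (L ^ 4 * (1 / \<phi>))"
    using L_ge phi by (intro mult_mono power_increasing) auto
  finally show ?thesis by simp
qed

text \<open>A vertex is isolated or the tail of one of the \<open>2 * m\<close> darts; this
  translates the linear work per vertex into the terms of \<open>work_bound\<close>.\<close>

lemma n_le: "n \<le> 2 * m + card (isolated V E)"
proof -
  have "V \<subseteq> verts \<union> isolated V E"
  proof
    fix v assume v: "v \<in> V"
    show "v \<in> verts \<union> isolated V E"
    proof (cases "deg E v = 0")
      case False
      then have "{e \<in> E. v \<in> e} \<noteq> {}" unfolding deg_def by (metis card.empty)
      then obtain e where e: "e \<in> E" "v \<in> e" by blast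
      obtain i where i: "i < m" "e = {tail i, head i}" using edge_index[OF e(1)] by blast
      have "i < M" using i by (simp add: M_def)
      then show ?thesis using e(2) i(2) tail_verts[of i] head_verts[of i] by auto
    qed (use v in \<open>simp add: isolated_def\<close>)
  qed
  then have "card V \<le> card (verts \<union> isolated V E)" by (intro card_mono) (auto simp: isolated_def)
  also have "\<dots> \<le> card verts + card (isolated V E)" by (rule card_Un_le)
  also have "card verts \<le> M" unfolding verts_def using card_image_le[of "{..<M}" tail] by simp
  finally show ?thesis by (simp add: M_def)
qed

lemma size_bound: "real ((M + 1) * X + (n + 1)) \<le> 40000000 * L ^ 3 * work_bound V E \<phi>"
proof -
  define iso where "iso = real (card (isolated V E))"
  define wb where "wb = work_bound V E \<phi>"
  have wb: "1 \<le> wb" "real m / \<phi>\<^sup>2 + iso \<le> wb" by (simp_all add: wb_def work_bound_def card_E iso_def)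
  have iso0: "0 \<le> iso" by (simp add: iso_def)
  have n: "real n \<le> 2 * real m + iso" using n_le unfolding iso_def by linarith
  have L3: "1 \<le> L ^ 3" using L_ge by (rule one_le_power)
  show ?thesis
  proof (cases "m = 0")
    case True
    \<comment> \<open>Without edges the second alternative holds at once, so \<open>g = 0\<close>,
      and \<open>X\<close> is bounded by the constant \<open>2000 * 7 ^ 3\<close>.\<close>
    have "g \<le> 0" unfolding g by (rule Least_le) (use True in \<open>simp add: m_def\<close>)
    then have "X \<le> 686000" using X_le by simp
    then have "real ((M + 1) * X + (n + 1)) \<le> 686001 + iso" using n True by (simp add: M_def)
    also have "\<dots> \<le> 40000000 * wb" using wb iso0 True by simp
    also have "\<dots> \<le> 40000000 * (L ^ 3 * wb)" using mult_right_mono[OF L3, of wb] wb(1) by simp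
    finally show ?thesis by (simp add: wb_def)
  next
    case False
    define y where "y = real m * (1 / \<phi>\<^sup>2)"
    have "\<phi>\<^sup>2 \<le> 1" using phi by (simp add: power_le_one)
    then have "1 \<le> 1 / \<phi>\<^sup>2" using phi by simp
    then have my: "real m \<le> y" unfolding y_def using mult_left_mono[of 1 "1 / \<phi>\<^sup>2" "real m"] by simp
    have m1: "1 \<le> real m" using False by simp
    have "real ((M + 1) * X) \<le> (3 * real m) * (10648000 * L ^ 3 * (1 / \<phi>\<^sup>2))"
      unfolding of_nat_mult using X_real m1 by (intro mult_mono) (auto simp: M_def)
    also have "\<dots> = 31944000 * (L ^ 3 * y)" by (simp add: y_def)
    finally have X: "real ((M + 1) * X) \<le> 31944000 * (L ^ 3 * y)" .
    have y: "y \<le> L ^ 3 * y" "iso \<le> L ^ 3 * iso"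
      using mult_right_mono[OF L3, of y] mult_right_mono[OF L3, of iso] my m1 iso0 by simp_all
    have "real ((M + 1) * X + (n + 1)) = real ((M + 1) * X) + real n + 1" by (simp only: of_nat_add of_nat_1)
    also have "\<dots> \<le> 40000000 * (L ^ 3 * y + L ^ 3 * iso)"
    proof -
      have "x + n' + 1 \<le> 40000000 * (a + b)" if "x \<le> 31944000 * a" "y' \<le> a" "i \<le> b" "n' \<le> 2 * m' + i" "m' \<le> y'" "1 \<le> m'" "0 \<le> i"
        for x n' a b y' i m' :: real
      proof -
        have "x + n' + 1 \<le> 31944003 * a + b" using that by linarith
        moreover have "0 \<le> a" "0 \<le> b" using that by linarith+
        ultimately show ?thesis by simp
      qed
      from this[OF X y n my m1 iso0] show ?thesis .
    qed
    also have "\<dots> = 40000000 * (L ^ 3 * (y + iso))" by (simp add: distrib_left)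
    also have "\<dots> \<le> 40000000 * (L ^ 3 * wb)" using wb(2) L_ge by (intro mult_left_mono) (auto simp: y_def)
    finally show ?thesis by (simp add: wb_def)
  qed
qed

lemma work_le: "real (10000 * (((M + 1) * X + (n + 1)) * A)) \<le> 10 ^ 13 * L ^ 4 * work_bound V E \<phi>"
proof -
  have wb: "0 \<le> work_bound V E \<phi>" by (simp add: work_bound_def)
  have "real (10000 * (((M + 1) * X + (n + 1)) * A)) = 10000 * (real ((M + 1) * X + (n + 1)) * real A)"
    by (simp only: of_nat_mult of_nat_numeral)
  also have "\<dots> \<le> 10000 * ((40000000 * L ^ 3 * work_bound V E \<phi>) * (4 * L))"
    using size_bound A_le L_ge wb by (intro mult_left_mono mult_mono) auto
  also have "\<dots> = 1600000000000 * (L ^ 4 * work_bound V E \<phi>)" by (simp add: power4_eq_xxxx power3_eq_cube)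
  also have "\<dots> \<le> 10 ^ 13 * (L ^ 4 * work_bound V E \<phi>)" using wb L_ge by (intro mult_right_mono) auto
  finally show ?thesis by simp
qed

lemma conclusion:
  "\<exists>l h reads writes work span C P Mt.
     exec \<phi> B cut_matching (input_locals n es, input_heap es S T) (l, h) reads writes work span \<and>
     real work \<le> polylog (10 ^ 13) 4 (n + m) * work_bound V E \<phi> \<and>
     real span \<le> polylog (10 ^ 13) 4 (n + m) * (1 / \<phi> ^ 4) \<and>
     C = output_cut n h \<and> P = output_paths l h \<and>
     (\<forall>p\<in>P. path_between V E S T p) \<and> matching_between S T Mt \<and> embeds P Mt \<and>
     (\<forall>e\<in>E. real (card {p \<in> P. e \<in> path_edges p}) \<le> polylog (10 ^ 13) 4 (n + m) * (1 / \<phi>)) \<and>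
     S - hd ` P \<subseteq> C \<and> C \<inter> (T - last ` P) = {} \<and>
     (C = {} \<or> real (card (edges_between E C (V - C))) \<le> \<phi> * real (deg_set E C) + 2 * \<phi> * real m)"
proof -
  have pl: "polylog (10 ^ 13) 4 (n + m) = 10 ^ 13 * L ^ 4" by (simp add: polylog_def L_def)
  obtain l' h' Rd Wr t d where ex: "exec \<phi> B cut_matching (input_locals n es, input) (l', h') Rd Wr t d"
    and t: "t \<le> 10000 * (((M + 1) * X + (n + 1)) * A)" and d: "d \<le> 10000 * (X * A)" and fin: "final l' h'"
    using run_cut_matching small_input unfolding run_def by blast
  obtain h r where inv: "state_inv (Suc I) h" and gd: "good h r" and Ch: "\<forall>v<n. h' (''C'', v) = of_bool (inside h r v)"
    and P: "output_paths l' h' = path_of h ` {v. v < n \<and> h (''pl'', v) \<noteq> 0}"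
    using fin unfolding final_def by blast
  have C: "output_cut n h' = {v. v < n \<and> inside h r v}" using Ch by (auto simp: output_cut_def)
  note correct = output_correct[OF inv C P]
  obtain Mt where Mt: "matching_between S T Mt" "embeds (output_paths l' h') Mt" using correct(2) by blast
  have "real t \<le> 10 ^ 13 * L ^ 4 * work_bound V E \<phi>" using t work_le by (meson of_nat_mono order_trans)
  moreover have "real d \<le> 10 ^ 13 * L ^ 4 * (1 / \<phi> ^ 4)" using d span_bound by (meson of_nat_mono order_trans)
  moreover have "\<forall>e\<in>E. real (card {p \<in> output_paths l' h'. e \<in> path_edges p}) \<le> 10 ^ 13 * L ^ 4 * (1 / \<phi>)"
    using correct(3) congestion_bound by (meson of_nat_mono order_trans)
  moreover have "real (card (edges_between E (output_cut n h') (V - output_cut n h'))) \<le> \<phi> * real (deg_set E (output_cut n h')) + 2 * \<phi> * real m"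
    using cut_bound[OF gd C] phi by (simp add: add_increasing)
  ultimately show ?thesis
    unfolding pl using ex Mt correct(1,4,5)
    by (intro exI[of _ l'] exI[of _ h'] exI[of _ Rd] exI[of _ Wr] exI[of _ t] exI[of _ d] exI[of _ "output_cut n h'"]
        exI[of _ "output_paths l' h'"] exI[of _ Mt] conjI disjI2) (simp_all only: input_def)
qed

end

section \<open>Word size and the conclusion\<close>

text \<open>The origin of 400. With \<open>c\<close> the rounded logarithm of
  \<open>n + m + 1 / \<phi>\<close>, the base is at most \<open>2 ^ (18 + 5 * (c + 2))\<close>. Its
  twelfth power has the exponent \<open>336 + 60 * c\<close>, at most \<open>400 * c\<close> because
  \<open>c\<close> is at least 1.\<close>

lemma word_bound_ge:
  assumes phi: "0 < \<phi>" "\<phi> < 1" and q: "real q \<le> 2 / \<phi>" "1 \<le> q"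
  shows "(10 ^ 5 * (n + m + q + 1) ^ 5 + 2) ^ 12 \<le> word_bound 400 n m \<phi>"
proof -
  define y where "y = real n + real m + 1 / \<phi>"
  define c where "c = nat \<lceil>log 2 y\<rceil>"
  define z where "z = n + m + q + 1"
  have "1 < 1 / \<phi>" using phi by simp
  then have y: "1 < y" "1 / \<phi> \<le> y" by (simp_all add: y_def)
  have "0 < log 2 y" using y(1) by simp
  then have "0 < \<lceil>log 2 y\<rceil>" by (simp only: zero_less_ceiling)
  then have c: "log 2 y \<le> real c" "1 \<le> c" unfolding c_def by (simp_all add: le_nat_iff)
  have "y = 2 powr log 2 y" using y(1) by simp
  also have "\<dots> \<le> 2 powr real c" using c(1) by simp
  finally have yc: "y \<le> 2 ^ c" by (simp add: powr_realpow)
  have "real z \<le> y + 2 * (1 / \<phi>) + 1" using q(1) phi by (simp add: z_def y_def)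
  also have "\<dots> \<le> 4 * 2 ^ c" using y yc by linarith
  finally have "real z \<le> real (4 * 2 ^ c)" by simp
  then have "z \<le> 4 * 2 ^ c" by (simp only: of_nat_le_iff)
  then have z: "z \<le> 2 ^ (c + 2)" by (simp add: power_add)
  have "1 \<le> z ^ 5" using one_le_power[of z 5] by (simp add: z_def)
  then have "10 ^ 5 * z ^ 5 + 2 \<le> 2 ^ 18 * z ^ 5" by simp
  also have "\<dots> \<le> 2 ^ 18 * (2 ^ (c + 2)) ^ 5" using z by (intro mult_le_mono2 power_mono) auto
  also have "\<dots> = 2 ^ (18 + (c + 2) * 5)" by (simp only: power_add power_mult)
  finally have "(10 ^ 5 * z ^ 5 + 2) ^ 12 \<le> (2 ^ (18 + (c + 2) * 5)) ^ 12" by (rule power_mono) simp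
  also have "\<dots> = 2 ^ ((18 + (c + 2) * 5) * 12)" by (simp only: power_mult)
  also have "\<dots> \<le> 2 ^ (400 * c)" using c(2) by (intro power_increasing) auto
  finally show ?thesis by (simp add: word_bound_def c_def y_def z_def)
qed

text \<open>The exponent 4 of the polylogarithm is the cube from the number of rounds times one
  logarithm from the prefix sums; \<open>10 ^ 13\<close> is a common upper bound for the constants
  of work, span and congestion.\<close>

theorem theoremA2:
  "\<exists>(alg :: com) (b :: nat) (K :: real) (k :: nat). b > 0 \<and> (
     \<forall>(n :: nat) (V :: nat set) (E :: nat set set) (es :: (nat \<times> nat) list)
       (S :: nat set) (T :: nat set) (m :: nat) (\<phi> :: real).
       V = {..<n} \<longrightarrow> ugraph V E \<longrightarrow> m = card E \<longrightarrow> edge_list E es \<longrightarrow>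
       (\<forall>v\<in>V. deg E v \<le> 16) \<longrightarrow> 0 < \<phi> \<longrightarrow> \<phi> < 1 \<longrightarrow>
       S \<subseteq> V \<longrightarrow> T \<subseteq> V \<longrightarrow> card S \<le> card T \<longrightarrow>
       (\<exists>l h reads writes work span C P M.
          exec \<phi> (word_bound b n m \<phi>) alg (input_locals n es, input_heap es S T) (l, h)
            reads writes work span \<and>
          real work \<le> polylog K k (n + m) * work_bound V E \<phi> \<and>
          real span \<le> polylog K k (n + m) * (1 / \<phi> ^ 4) \<and>
          C = output_cut n h \<and> P = output_paths l h \<and>
          (\<forall>p\<in>P. path_between V E S T p) \<and>
          matching_between S T M \<and> embeds P M \<and>
          (\<forall>e\<in>E. real (card {p \<in> P. e \<in> path_edges p}) \<le> polylog K k (n + m) * (1 / \<phi>)) \<and>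
          S - hd ` P \<subseteq> C \<and>
          C \<inter> (T - last ` P) = {} \<and>
          (C = {} \<or>
           real (card (edges_between E C (V - C))) \<le> \<phi> * real (deg_set E C) + 2 * \<phi> * real m)))"
proof (rule exI[of _ cut_matching], rule exI[of _ 400], rule exI[of _ "10 ^ 13"], rule exI[of _ 4], intro conjI allI impI)
  fix n :: nat and V E es and S T :: "nat set" and m :: nat and \<phi> :: real
  assume V: "V = {..<n}" and gr: "ugraph V E" and mE: "m = card E" and el: "edge_list E es"
    and dg: "\<forall>v\<in>V. deg E v \<le> 16" and phi: "0 < \<phi>" "\<phi> < 1" and ST: "S \<subseteq> V" "T \<subseteq> V"
  have E: "E = ends ` set es" and ds: "distinct (map ends es)" using el by (auto simp: edge_list_def)
  interpret pi: problem_input n es S T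
  proof
    fix i assume i: "i < length es"
    obtain a b where ab: "es ! i = (a, b)" by (cases "es ! i")
    have "ends (es ! i) \<in> E" unfolding E using i by (intro imageI nth_mem)
    then have "{a, b} \<in> E" by (simp add: ab)
    then obtain u v where "u \<in> V" "v \<in> V" "u \<noteq> v" "{a, b} = {u, v}" using gr unfolding ugraph_def by metis
    then have "a \<in> V" "b \<in> V" "a \<noteq> b" by (auto simp: doubleton_eq_iff)
    then show "fst (es ! i) < n \<and> snd (es ! i) < n \<and> fst (es ! i) \<noteq> snd (es ! i)" by (simp add: ab V)
  next
    show "card {e \<in> ends ` set es. v \<in> e} \<le> 16" if "v < n" for v
      using dg that unfolding V deg_def E by blast
  qed (use ds ST V in auto)
  define g where "g = (LEAST j. 1 \<le> \<phi> * 2 ^ j \<or> 4 * length es \<le> 2 ^ j)"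
  \<comment> \<open>\<open>Z\<close> is the least value that the locale admits; the words then only
    have to hold the twelfth power of \<open>Z + 2\<close>.\<close>
  define Z where "Z = 10 ^ 5 * (n + length es + 2 ^ g + 1) ^ 5"
  have me: "m = length es"
    unfolding mE E using distinct_card[OF ds] by simp
  have "real (2 ^ g) \<le> 2 / \<phi>"
  proof (cases g)
    case 0
    then show ?thesis using phi by (simp add: field_simps)
  next
    case (Suc j)
    then have "\<not> 1 \<le> \<phi> * 2 ^ j" using not_less_Least[of j "\<lambda>j. 1 \<le> \<phi> * 2 ^ j \<or> 4 * length es \<le> 2 ^ j"] unfolding g_def by auto
    then show ?thesis using phi Suc by (simp add: field_simps)
  qed
  then have wb: "(Z + 2) ^ 12 \<le> word_bound 400 n m \<phi>" unfolding Z_def me by (intro word_bound_ge phi) auto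
  have "1 \<le> (n + length es + 2 ^ g + 1) ^ 5" by (intro one_le_power) simp
  then have Z100: "100 \<le> Z" by (simp add: Z_def)
  interpret pr: problem n es S T \<phi> "word_bound 400 n m \<phi>" Z g
    by unfold_locales (fact Z100 wb phi g_def | simp only: Z_def order_refl)+
  have mm: "pi.m = m" by (simp add: pi.m_def me)
  show "\<exists>l h reads writes work span C P M.
          exec \<phi> (word_bound 400 n m \<phi>) cut_matching (input_locals n es, input_heap es S T) (l, h)
            reads writes work span \<and>
          real work \<le> polylog (10 ^ 13) 4 (n + m) * work_bound V E \<phi> \<and>
          real span \<le> polylog (10 ^ 13) 4 (n + m) * (1 / \<phi> ^ 4) \<and>
          C = output_cut n h \<and> P = output_paths l h \<and>
          (\<forall>p\<in>P. path_between V E S T p) \<and>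
          matching_between S T M \<and> embeds P M \<and>
          (\<forall>e\<in>E. real (card {p \<in> P. e \<in> path_edges p}) \<le> polylog (10 ^ 13) 4 (n + m) * (1 / \<phi>)) \<and>
          S - hd ` P \<subseteq> C \<and>
          C \<inter> (T - last ` P) = {} \<and>
          (C = {} \<or>
           real (card (edges_between E C (V - C))) \<le> \<phi> * real (deg_set E C) + 2 * \<phi> * real m)"
    unfolding V E by (rule pr.conclusion[unfolded mm])
qed simp

end
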